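(* Let $(M;\Omega_1,S)$ be an admissible triplet and $(N^M;\mathbb{P}^M,T^M)$ the associated noise. Its stable part is $$H^M_{\mathrm{stb}}=\{f\in\mathrm{L}^2(\mathbb{P}^M): f_K=0\text{ for all }K\in(2^{\mathbb{N}})_{\mathrm{fin}}\setminus\{\emptyset\}\}=\mathrm{L}^2\big(\mathbb{P}^M|_{\overline{\sigma}(W\circ\Theta^M)}\big)$$ (where $\overline{\sigma}$ indicates completion with respect to $\mathbb{P}^M$), and its first superchaos is $$H^M_{\mathrm{sens},1}=\{f\in\mathrm{L}^2(\mathbb{P}^M): f_K=0\text{ for all }K\in(2^{\mathbb{N}})_{\mathrm{fin}}\text{ of size}\ne1\}.$$
   Context: Wiener setting. $\Omega_0:=\{\omega:\mathbb{R}\to\mathbb{R}\text{ continuous},\ \omega(0)=0\}$, canonical process $B$, $\mathsf{W}$ the completed two-sided Wiener measure with domain $\mathcal{G}$; for extended-real $s<t$, $\mathcal{F}_{s,t}$ is generated by the increments of $B$ between $s$ and $t$ and all events of $\mathsf{W}$-probability $0$ or $1$; $\Delta_u(\omega)(t):=\omega(u+t)-\omega(u)$. $\mathbb{R}^\dagger:=\mathbb{R}\cup\{\dagger\}$, $\dagger\notin\mathbb{R}$; for a sequence $s$ in $\mathbb{R}^\dagger$, $[s]:=\{s_i:i\in\mathbb{N}\}\setminus\{\dagger\}$. For $\mathcal{A}\subset\mathcal{G}$, an $\mathcal{A}$-measurable enumeration of $M:\Omega_0\to2^{\mathbb{R}}$ is a sequence $S$ of $\mathcal{A}$-measurable $\mathbb{R}^\dagger$-valued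 random variables with $M=[S]$ $\mathsf{W}$-a.s. ("measurable" means $\mathcal{A}=\mathcal{G}$). $M$ is a random countable set if it has a measurable enumeration; it is dense if $\mathsf{W}$-a.s. dense in $\mathbb{R}$; local if each $M\cap(s,t)$, $s<t$ extended-real, has an $\mathcal{F}_{s,t}$-measurable enumeration; perfectly stationary if $M(\omega)=u+M(\Delta_u\omega)$ for all $u\in\mathbb{R}$, $\omega\in\Omega_0$. Admissible triplet $(M;\Omega_1,S)$: $M$ is a dense perfectly stationary local random countable set with $M(\omega)$ countable for every $\omega$; $\Omega_1\subset\Omega_0$ satisfies $\mathsf{W}(\Omega_1)=1$, $\Delta_v^{-1}(\Omega_1)=\Omega_1$ for all $v\in\mathbb{R}$, and $M(\omega)$ is dense for $\omega\in\Omega_1$; $S$ is a measurable enumeration of $M$ which on $\Omega_1$ is injective, $\mathbb{R}^{\mathbb{N}}$-valued and satisfies $M=[S]$. Noise of the triplet. $\mathbb{W}:=\mathsf{W}$ restricted to $\Omega_1$; $\Omega^M:=\{(\omega_1,\eta):\omega_1\in\Omega_1,\eta\in\{-1,1\}^{M(\omega_1)}\}$; $\Theta^M:\Omega^M\to\Omega_1\times\{-1,1\}^{\mathbb{N}}$ is the bijection $\Theta^M(\omega_1,\eta):=(\omega_1,(\eta(S_k(\omega_1)))_{k\in\mathbb{N}})$; $\mathbb{Q}:=\mathbb{W}\times(\frac12\delta_{-1}+\frac12\delta_1)^{\times\mathbb{N}}$; $\mathbb{P}^M$ (with domain $\mathcal{B}^M$) is the completion of the pull-back of $\mathbb{Q}$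 along $\Theta^M$. $(W,P)$ are the coordinate projections on $\Omega_1\times\{-1,1\}^{\mathbb{N}}$, so $W\circ\Theta^M(\omega_1,\eta)=\omega_1$ and $P_k\circ\Theta^M(\omega_1,\eta)=\eta(S_k(\omega_1))$. For extended-real $s<t$, $N^M_{s,t}$ is the $\mathbb{P}^M$-complete $\sigma$-field generated by the increments of $W\circ\Theta^M$ on $(s,t)$ and by the random variables $(\omega_1,\eta)\mapsto\eta(S_{s,t}(k)(\omega_1))$, $k\in\mathbb{N}$, where $S_{s,t}$ is an $\mathcal{F}_{s,t}$-measurable enumeration of $M\cap(s,t)$ that on $\Omega_1$ is injective, $(s,t)^{\mathbb{N}}$-valued and satisfies $M\cap(s,t)=[S_{s,t}]$ ($N^M_{s,t}$ does not depend on its choice). $T^M_h(\omega_1,\eta):=(\Delta_h(\omega_1),\eta(\cdot+h))$, $h\in\mathbb{R}$. Coefficients. $(2^{\mathbb{N}})_{\mathrm{fin}}$ is the set of finite subsets of $\mathbb{N}$. Each $f\in\mathrm{L}^2(\mathbb{P}^M)$ (complex) has a unique orthogonal expansion $f=\sum_{K\in(2^{\mathbb{N}})_{\mathrm{fin}}}f_K(W\circ\Theta^M)\prod_{k\in K}P_k\circ\Theta^M$ a.s. with $f_K\in\mathrm{L}^2(\mathsf{W})$, $\sum_K\mathsf{W}[|f_K|^2]<\infty$; this defines the $f_K$. Stable part and first superchaos. For a noise $(N;\mathbb{P},T)$ the first chaos is the set of $f\in\mathrm{L}^2(\mathbb{P})$ with $f=\mathbb{P}[f|N_{-\infty,t}]+\mathbb{P}[f|N_{t,\infty}]$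 for all $t\in\mathbb{R}$; the stable part $H_{\mathrm{stb}}$ is $\mathrm{L}^2$ of the completed $\sigma$-field $\sigma_{\mathrm{stb}}$ generated by the first chaos; the first superchaos $H_{\mathrm{sens},1}$ is the set of $f\in\mathrm{L}^2(\mathbb{P})$ with $f=\mathbb{P}[f|N_{-\infty,t}\vee\sigma_{\mathrm{stb}}]+\mathbb{P}[f|N_{t,\infty}\vee\sigma_{\mathrm{stb}}]$ for all $t\in\mathbb{R}$ (such $f$ are orthogonal to $H_{\mathrm{stb}}$). *)

theory Defs
  imports "HOL-Probability.Probability"
begin

subsection \<open>Completed \<open>\<sigma>\<close>-fields and complex \<open>L\<^sup>2\<close>\<close>

text \<open>A sub-\<open>\<sigma>\<close>-field is a \<open>measure\<close> of which only \<open>space\<close> and \<open>sets\<close> matter.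
  \<open>completed_sigma P C\<close> is generated by \<open>C\<close> and the \<open>P\<close>-trivial events; it is
  \<open>P\<close>-complete whenever \<open>P\<close> itself is complete.\<close>

definition completed_sigma :: "'a measure \<Rightarrow> 'a set set \<Rightarrow> 'a measure" where
  "completed_sigma P C =
     sigma (space P) (C \<union> {A \<in> sets P. measure P A = 0 \<or> measure P A = 1})"

definition join_sigma :: "'a measure \<Rightarrow> 'a measure \<Rightarrow> 'a measure" where
  "join_sigma F G = sigma (space F) (sets F \<union> sets G)"

definition events_of :: "'a measure \<Rightarrow> ('a \<Rightarrow> 'b::topological_space) \<Rightarrow> 'a set set" where
  "events_of P X = {X -` A \<inter> space P |A. A \<in> sets borel}"

text \<open>Elements of \<open>L\<^sup>2\<close> are represented by functions, not by equivalence classes. All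
  subsets of \<open>L2 P\<close> defined below are closed under modification on \<open>P\<close>-null sets if \<open>P\<close>
  is complete, so equality of such subsets is equality of the sets of classes.\<close>

definition L2 :: "'a measure \<Rightarrow> ('a \<Rightarrow> complex) set" where
  "L2 P = {f. f \<in> borel_measurable P \<and> integrable P (\<lambda>x. (cmod (f x))\<^sup>2)}"

definition complex_cond_exp ::
    "'a measure \<Rightarrow> 'a measure \<Rightarrow> ('a \<Rightarrow> complex) \<Rightarrow> 'a \<Rightarrow> complex" where
  "complex_cond_exp P F f x =
     Complex (real_cond_exp P F (\<lambda>y. Re (f y)) x) (real_cond_exp P F (\<lambda>y. Im (f y)) x)"


subsection \<open>Chaos and superchaos of a noise\<close>

record 'a noise =
  field_of :: "ereal \<Rightarrow> ereal \<Rightarrow> 'a measure"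
  law_of :: "'a measure"
  shift_of :: "real \<Rightarrow> 'a \<Rightarrow> 'a"

definition first_chaos :: "'a noise \<Rightarrow> ('a \<Rightarrow> complex) set" where
  "first_chaos N = {f \<in> L2 (law_of N). \<forall>t::real. AE x in law_of N.
     f x = complex_cond_exp (law_of N) (field_of N (-\<infinity>) (ereal t)) f x
         + complex_cond_exp (law_of N) (field_of N (ereal t) \<infinity>) f x}"

definition sigma_stb :: "'a noise \<Rightarrow> 'a measure" where
  "sigma_stb N = completed_sigma (law_of N) (\<Union>f\<in>first_chaos N. events_of (law_of N) f)"

definition H_stb :: "'a noise \<Rightarrow> ('a \<Rightarrow> complex) set" where
  "H_stb N = L2 (restr_to_subalg (law_of N) (sigma_stb N))"

definition first_superchaos :: "'a noise \<Rightarrow> ('a \<Rightarrow> complex) set" where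
  "first_superchaos N = {f \<in> L2 (law_of N). \<forall>t::real. AE x in law_of N.
     f x = complex_cond_exp (law_of N)
             (join_sigma (field_of N (-\<infinity>) (ereal t)) (sigma_stb N)) f x
         + complex_cond_exp (law_of N)
             (join_sigma (field_of N (ereal t) \<infinity>) (sigma_stb N)) f x}"


subsection \<open>The Wiener setting\<close>

type_synonym path = "real \<Rightarrow> real"

definition Omega0 :: "path set" where
  "Omega0 = {\<omega>. continuous_on UNIV \<omega> \<and> \<omega> 0 = 0}"

definition Delta :: "real \<Rightarrow> path \<Rightarrow> path" where
  "Delta u \<omega> = (\<lambda>t. \<omega> (u + t) - \<omega> u)"

text \<open>The two-sided Wiener measure, before and after completion. Since \<open>\<omega> 0 = 0\<close> on
  \<open>Omega0\<close>, the law of the increments determines the measure.\<close>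

definition raw_wiener_measure :: "path measure \<Rightarrow> bool" where
  "raw_wiener_measure W \<longleftrightarrow>
     prob_space W \<and>
     sets W = sets (restrict_space (\<Pi>\<^sub>M t\<in>UNIV. borel) Omega0) \<and>
     (\<forall>s t. s < t \<longrightarrow>
        distributed W lborel (\<lambda>\<omega>. \<omega> t - \<omega> s) (normal_density 0 (sqrt (t - s)))) \<and>
     (\<forall>t::nat \<Rightarrow> real. strict_mono t \<longrightarrow>
        prob_space.indep_vars W (\<lambda>_. borel) (\<lambda>i \<omega>. \<omega> (t (Suc i)) - \<omega> (t i)) UNIV)"

definition wiener_measure :: "path measure \<Rightarrow> bool" where
  "wiener_measure W \<longleftrightarrow> (\<exists>W0. raw_wiener_measure W0 \<and> W = completion W0)"

definition increment_events ::
    "'a measure \<Rightarrow> ('a \<Rightarrow> path) \<Rightarrow> ereal \<Rightarrow> ereal \<Rightarrow> 'a set set" where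
  "increment_events P X s t =
     (\<Union>(u, v) \<in> {(u, v). s \<le> ereal u \<and> u \<le> v \<and> ereal v \<le> t}.
        events_of P (\<lambda>x. X x v - X x u))"

definition Fld :: "path measure \<Rightarrow> ereal \<Rightarrow> ereal \<Rightarrow> path measure" where
  "Fld W s t = completed_sigma W (increment_events W (\<lambda>\<omega>. \<omega>) s t)"


subsection \<open>Random countable sets\<close>

text \<open>\<open>real option\<close> plays the role of the real line with an extra isolated point, \<open>None\<close>.\<close>

definition dagger_borel :: "real option measure" where
  "dagger_borel = sigma UNIV {A. Some -` A \<in> sets borel}"

definition values_of :: "(nat \<Rightarrow> real option) \<Rightarrow> real set" where
  "values_of s = {x. Some x \<in> range s}"

definition measurable_enumeration ::
    "path measure \<Rightarrow> path measure \<Rightarrow> (path \<Rightarrow> real set) \<Rightarrow> (nat \<Rightarrow> path \<Rightarrow> real option) \<Rightarrow> bool"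
  where
  "measurable_enumeration W A M S \<longleftrightarrow>
     (\<forall>i. S i \<in> A \<rightarrow>\<^sub>M dagger_borel) \<and> (AE \<omega> in W. M \<omega> = values_of (\<lambda>i. S i \<omega>))"

definition random_countable_set :: "path measure \<Rightarrow> (path \<Rightarrow> real set) \<Rightarrow> bool" where
  "random_countable_set W M \<longleftrightarrow> (\<exists>S. measurable_enumeration W W M S)"

definition dense_random_set :: "path measure \<Rightarrow> (path \<Rightarrow> real set) \<Rightarrow> bool" where
  "dense_random_set W M \<longleftrightarrow> (AE \<omega> in W. closure (M \<omega>) = UNIV)"

definition local_random_set :: "path measure \<Rightarrow> (path \<Rightarrow> real set) \<Rightarrow> bool" where
  "local_random_set W M \<longleftrightarrow>
     (\<forall>s t. s < t \<longrightarrow>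
        (\<exists>S. measurable_enumeration W (Fld W s t) (\<lambda>\<omega>. M \<omega> \<inter> einterval s t) S))"

definition perfectly_stationary :: "(path \<Rightarrow> real set) \<Rightarrow> bool" where
  "perfectly_stationary M \<longleftrightarrow> (\<forall>u. \<forall>\<omega>\<in>Omega0. M \<omega> = (\<lambda>x. u + x) ` M (Delta u \<omega>))"

text \<open>An enumeration that on \<open>\<Omega>1\<close> is everywhere injective, free of \<open>None\<close> and onto \<open>M\<close>
  (hence with values in \<open>M\<close>).\<close>

definition proper_enumeration ::
    "path measure \<Rightarrow> path measure \<Rightarrow> (path \<Rightarrow> real set) \<Rightarrow> path set \<Rightarrow>
     (nat \<Rightarrow> path \<Rightarrow> real option) \<Rightarrow> bool" where
  "proper_enumeration W A M \<Omega>1 S \<longleftrightarrow>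
     measurable_enumeration W A M S \<and>
     (\<forall>\<omega>\<in>\<Omega>1. inj (\<lambda>k. S k \<omega>) \<and> (\<forall>k. S k \<omega> \<noteq> None) \<and> M \<omega> = values_of (\<lambda>k. S k \<omega>))"

definition admissible_triplet ::
    "path measure \<Rightarrow> (path \<Rightarrow> real set) \<Rightarrow> path set \<Rightarrow> (nat \<Rightarrow> path \<Rightarrow> real option) \<Rightarrow> bool"
  where
  "admissible_triplet W M \<Omega>1 S \<longleftrightarrow>
     random_countable_set W M \<and> dense_random_set W M \<and> local_random_set W M \<and>
     perfectly_stationary M \<and> (\<forall>\<omega>\<in>Omega0. countable (M \<omega>)) \<and>
     \<Omega>1 \<subseteq> Omega0 \<and> \<Omega>1 \<in> sets W \<and> emeasure W \<Omega>1 = 1 \<and>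
     (\<forall>v. Delta v -` \<Omega>1 \<inter> Omega0 = \<Omega>1) \<and>
     (\<forall>\<omega>\<in>\<Omega>1. closure (M \<omega>) = UNIV) \<and>
     proper_enumeration W W M \<Omega>1 S"


subsection \<open>The noise of an admissible triplet\<close>

type_synonym signed_path = "path \<times> (real \<Rightarrow> real)"

text \<open>Functions on \<open>M \<omega>\<close> are extensional functions on the reals.\<close>

definition OmegaM :: "(path \<Rightarrow> real set) \<Rightarrow> path set \<Rightarrow> signed_path set" where
  "OmegaM M \<Omega>1 = {(\<omega>, \<eta>). \<omega> \<in> \<Omega>1 \<and> \<eta> \<in> M \<omega> \<rightarrow>\<^sub>E {-1, 1}}"

definition ThetaM ::
    "(nat \<Rightarrow> path \<Rightarrow> real option) \<Rightarrow> signed_path \<Rightarrow> path \<times> (nat \<Rightarrow> real)" where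
  "ThetaM S = (\<lambda>(\<omega>, \<eta>). (\<omega>, \<lambda>k. \<eta> (the (S k \<omega>))))"

definition QQ :: "path measure \<Rightarrow> path set \<Rightarrow> (path \<times> (nat \<Rightarrow> real)) measure" where
  "QQ W \<Omega>1 = restrict_space W \<Omega>1 \<Otimes>\<^sub>M (\<Pi>\<^sub>M k\<in>UNIV. uniform_count_measure {-1, 1})"

text \<open>The pull-back along the bijection \<open>ThetaM S\<close> is the image under its inverse.\<close>

definition PPM ::
    "path measure \<Rightarrow> (path \<Rightarrow> real set) \<Rightarrow> path set \<Rightarrow> (nat \<Rightarrow> path \<Rightarrow> real option) \<Rightarrow>
     signed_path measure" where
  "PPM W M \<Omega>1 S =
     completion (distr (QQ W \<Omega>1) (vimage_algebra (OmegaM M \<Omega>1) (ThetaM S) (QQ W \<Omega>1))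
       (inv_into (OmegaM M \<Omega>1) (ThetaM S)))"

text \<open>The resulting \<open>\<sigma>\<close>-field does not depend on the chosen enumeration.\<close>

definition local_enumeration ::
    "path measure \<Rightarrow> (path \<Rightarrow> real set) \<Rightarrow> path set \<Rightarrow> ereal \<Rightarrow> ereal \<Rightarrow>
     (nat \<Rightarrow> path \<Rightarrow> real option)" where
  "local_enumeration W M \<Omega>1 s t =
     (SOME R. proper_enumeration W (Fld W s t) (\<lambda>\<omega>. M \<omega> \<inter> einterval s t) \<Omega>1 R)"

definition NNM ::
    "path measure \<Rightarrow> (path \<Rightarrow> real set) \<Rightarrow> path set \<Rightarrow> (nat \<Rightarrow> path \<Rightarrow> real option) \<Rightarrow>
     ereal \<Rightarrow> ereal \<Rightarrow> signed_path measure" where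
  "NNM W M \<Omega>1 S s t =
     completed_sigma (PPM W M \<Omega>1 S)
       (increment_events (PPM W M \<Omega>1 S) (\<lambda>x. fst (ThetaM S x)) s t \<union>
        (\<Union>k. events_of (PPM W M \<Omega>1 S)
                (\<lambda>(\<omega>, \<eta>). \<eta> (the (local_enumeration W M \<Omega>1 s t k \<omega>)))))"

definition TTM :: "real \<Rightarrow> signed_path \<Rightarrow> signed_path" where
  "TTM h = (\<lambda>(\<omega>, \<eta>). (Delta h \<omega>, \<lambda>x. \<eta> (x + h)))"

definition noise_of_triplet ::
    "path measure \<Rightarrow> (path \<Rightarrow> real set) \<Rightarrow> path set \<Rightarrow> (nat \<Rightarrow> path \<Rightarrow> real option) \<Rightarrow>
     signed_path noise" where
  "noise_of_triplet W M \<Omega>1 S =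
     \<lparr>field_of = NNM W M \<Omega>1 S, law_of = PPM W M \<Omega>1 S, shift_of = TTM\<rparr>"

definition sigma_W ::
    "path measure \<Rightarrow> (path \<Rightarrow> real set) \<Rightarrow> path set \<Rightarrow> (nat \<Rightarrow> path \<Rightarrow> real option) \<Rightarrow>
     signed_path measure" where
  "sigma_W W M \<Omega>1 S =
     completed_sigma (PPM W M \<Omega>1 S)
       {(\<lambda>x. fst (ThetaM S x)) -` A \<inter> OmegaM M \<Omega>1 |A. A \<in> sets (restrict_space W \<Omega>1)}"


subsection \<open>Coefficients\<close>

text \<open>The sum over the finite \<open>K\<close> converges unconditionally in \<open>L\<^sup>2\<close>. Only the values
  \<open>c K\<close> at finite \<open>K\<close> are relevant, and these are unique up to \<open>W\<close>-null sets.\<close>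

definition orthogonal_expansion ::
    "path measure \<Rightarrow> (path \<Rightarrow> real set) \<Rightarrow> path set \<Rightarrow> (nat \<Rightarrow> path \<Rightarrow> real option) \<Rightarrow>
     (signed_path \<Rightarrow> complex) \<Rightarrow> (nat set \<Rightarrow> path \<Rightarrow> complex) \<Rightarrow> bool" where
  "orthogonal_expansion W M \<Omega>1 S f c \<longleftrightarrow>
     (\<forall>K. finite K \<longrightarrow> c K \<in> L2 W) \<and>
     (\<lambda>K. \<integral>\<omega>. (cmod (c K \<omega>))\<^sup>2 \<partial>W) summable_on {K. finite K} \<and>
     ((\<lambda>\<K>. \<integral>x. (cmod (f x - (\<Sum>K\<in>\<K>. c K (fst (ThetaM S x)) *
           (\<Prod>k\<in>K. complex_of_real (snd (ThetaM S x) k)))))\<^sup>2 \<partial>PPM W M \<Omega>1 S)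
        \<longlongrightarrow> 0) (finite_subsets_at_top {K. finite K})"

definition coefficient ::
    "path measure \<Rightarrow> (path \<Rightarrow> real set) \<Rightarrow> path set \<Rightarrow> (nat \<Rightarrow> path \<Rightarrow> real option) \<Rightarrow>
     (signed_path \<Rightarrow> complex) \<Rightarrow> nat set \<Rightarrow> path \<Rightarrow> complex" where
  "coefficient W M \<Omega>1 S f = (SOME c. orthogonal_expansion W M \<Omega>1 S f c)"

end

theory Submission
  imports Defs
begin

text \<open>
  A point \<open>pt k\<close> outside \<open>(s,t)\<close> has a sign independent of \<open>N\<^sub>s\<^sub>,\<^sub>t\<close> and \<open>W\<close>. Hence if
  \<open>f\<close> is a sum of a past and a future part at time \<open>t\<close>, then \<open>f\<^sub>K\<close> vanishes on the event that
  two points with indices in \<open>K\<close> are separated by \<open>t\<close>; letting \<open>t\<close> run through the rationals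
  gives \<open>f\<^sub>K = 0\<close> for \<open>card K \<ge> 2\<close>. Given \<open>W\<close>, a single sign is either past or future, so the
  terms with \<open>card K = 1\<close> do belong to the superchaos.

  In the first chaos those terms vanish as well. The conditional variance given \<open>W\<close> of the past part
  at time \<open>t\<close> is the sum of \<open>\<bar>f\<^sub>{\<^sub>k\<^sub>}\<bar>\<^sup>2\<close> over the points before \<open>t\<close>. As a function of \<open>t\<close> it is
  nondecreasing with \<open>F\<^sub>s\<^sub>,\<^sub>t\<close>-measurable increments, and such a functional of the Wiener process
  is deterministic: compare its correlations with \<open>exp (i l (\<omega> t - \<omega> s))\<close> along fine partitions. Its
  atoms would therefore be fixed times, which the points of a stationary countable set avoid almost
  surely. What remains is the chaos of \<open>W\<close> itself, which generates \<open>\<sigma>(W)\<close>.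
\<close>

text \<open>The indices \<open>k\<close> are global, whereas \<open>NN s t\<close> knows only the
  points of \<open>(s,t)\<close>, in an order of its own; its generating signs are therefore coins
  whose index depends on the path. This shapes the proof: everything rests on an abstract space of
  coins that are fair and independent conditionally on the whole path. Coins picked by an injective
  path-dependent rule then behave in the same way, and averaging an \<open>NN s t\<close>-measurable
  variable over the coins leaves a function measurable for \<open>Fld W s t\<close>. Otherwise the
  conditional variance would merely be a function of the whole path and no additive functional.
  Coefficients are tested by integrals of \<open>f x * wal K x\<close> over events of W, which makes
  it possible to argue on events that fix the position of the points relative to \<open>t\<close>,
  and to glue countably many of them. Correlations with \<open>wave l s t\<close> suffice because
  weighting W with the normalised increment of the functional keeps the characteristic function of
  \<open>\<omega> t - \<omega> s\<close>, hence by Levy its law; induction over partitions then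
  reaches all boxes of increments, which generate the Wiener sigma-field.\<close>

lemma Doob_Dynkin_real:
  fixes u :: "'b \<Rightarrow> real"
  assumes X: "X \<in> space_P \<rightarrow> space W"
    and u: "u \<in> borel_measurable (vimage_algebra space_P X W)"
  obtains v where "v \<in> borel_measurable W" "\<And>x. x \<in> space_P \<Longrightarrow> u x = v (X x)"
proof -
  have "\<exists>B\<in>sets W. {x \<in> space_P. u x > q} = X -` B \<inter> space_P" for q :: real
  proof -
    have "{x \<in> space (vimage_algebra space_P X W). u x > q} \<in> sets (vimage_algebra space_P X W)"
      using u by measurable
    then show ?thesis
      using X by (auto simp: sets_vimage_algebra2)
  qed
  then obtain B where B: "\<And>q. B q \<in> sets W" "\<And>q. {x \<in> space_P. u x > q} = X -` B q \<inter> space_P"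
    by metis
  \<comment> \<open>A real number is the supremum of the rationals below it, and \<open>B q\<close>
    decides whether \<open>q\<close> lies below. Outside the range of \<open>X\<close> the supremum
    may be infinite, hence the detour through extended reals.\<close>
  define v where "v \<omega> = (SUP q\<in>\<rat>. if \<omega> \<in> B q then ereal q else -\<infinity>)" for \<omega>
  have [measurable]: "v \<in> borel_measurable W"
    unfolding v_def using B(1) countable_rat by (intro borel_measurable_SUP) (auto)
  have *: "ereal (u x) = v (X x)" if x: "x \<in> space_P" for x
  proof -
    have eq: "X x \<in> B q \<longleftrightarrow> u x > q" for q
      using B(2)[of q] x by blast
    show ?thesis
    proof (rule antisym)
      show "v (X x) \<le> ereal (u x)"
        unfolding v_def by (rule SUP_least) (auto simp: eq)
      show "ereal (u x) \<le> v (X x)"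
      proof (rule ccontr)
        assume "\<not> ?thesis"
        then have lt: "v (X x) < ereal (u x)" by simp
        obtain y where y: "v (X x) < ereal y" "y < u x"
          using ereal_dense2[OF lt] by auto
        obtain q where q: "q \<in> \<rat>" "y < q" "q < u x"
          using Rats_dense_in_real[OF y(2)] by auto
        have "ereal q \<le> v (X x)"
          unfolding v_def by (rule SUP_upper2[OF q(1)]) (simp add: eq q)
        with y q show False
          by (metis less_ereal.simps(1) not_less order.strict_trans2 order_less_imp_not_less)
      qed
    qed
  qed
  show ?thesis
  proof
    show "(\<lambda>\<omega>. real_of_ereal (v \<omega>)) \<in> borel_measurable W" by measurable
    show "u x = real_of_ereal (v (X x))" if "x \<in> space_P" for x
      using *[OF that] by (metis real_of_ereal.simps(1))
  qed
qed

section \<open>Real square-integrable functions\<close>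

definition rL2 :: "'a measure \<Rightarrow> ('a \<Rightarrow> real) set" where
  "rL2 P = {f. f \<in> borel_measurable P \<and> integrable P (\<lambda>x. (f x)\<^sup>2)}"

lemma rL2_measurable: "f \<in> rL2 P \<Longrightarrow> f \<in> borel_measurable P"
  by (simp add: rL2_def)

lemma rL2_square: "f \<in> rL2 P \<Longrightarrow> integrable P (\<lambda>x. (f x)\<^sup>2)"
  by (simp add: rL2_def)

lemma rL2_mult_integrable:
  assumes "f \<in> rL2 P" "g \<in> rL2 P"
  shows "integrable P (\<lambda>x. f x * g x)"
proof (rule Bochner_Integration.integrable_bound)
  show "integrable P (\<lambda>x. (f x)\<^sup>2 + (g x)\<^sup>2)"
    using assms by (auto simp: rL2_def)
  show "(\<lambda>x. f x * g x) \<in> borel_measurable P"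
    using assms by (auto simp: rL2_def)
  have "\<bar>a * b\<bar> \<le> a\<^sup>2 + b\<^sup>2" for a b :: real
  proof -
    have "2 * \<bar>a\<bar> * \<bar>b\<bar> \<le> \<bar>a\<bar>\<^sup>2 + \<bar>b\<bar>\<^sup>2" by (rule sum_squares_bound)
    moreover have "0 \<le> \<bar>a\<bar> * \<bar>b\<bar>" by simp
    ultimately show ?thesis
      unfolding abs_mult power2_abs by linarith
  qed
  then show "AE x in P. norm (f x * g x) \<le> norm ((f x)\<^sup>2 + (g x)\<^sup>2)"
    by simp
qed

lemma rL2_add: "f \<in> rL2 P \<Longrightarrow> g \<in> rL2 P \<Longrightarrow> (\<lambda>x. f x + g x) \<in> rL2 P"
  using integrable_mult_right[OF rL2_mult_integrable[of f P g], of 2]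
  by (auto simp: rL2_def power2_sum mult.assoc)

lemma rL2_cmult: "f \<in> rL2 P \<Longrightarrow> (\<lambda>x. c * f x) \<in> rL2 P"
  by (auto simp: rL2_def power_mult_distrib)

lemma rL2_diff: "f \<in> rL2 P \<Longrightarrow> g \<in> rL2 P \<Longrightarrow> (\<lambda>x. f x - g x) \<in> rL2 P"
  using rL2_add[of f P "\<lambda>x. -1 * g x"] rL2_cmult[of g P "-1"] by simp

lemma rL2_sum: "(\<And>i. i \<in> I \<Longrightarrow> f i \<in> rL2 P) \<Longrightarrow> (\<lambda>x. \<Sum>i\<in>I. f i x) \<in> rL2 P"
proof (induction I rule: infinite_finite_induct)
  case (insert i I)
  then show ?case by (simp add: rL2_add)
qed (simp_all add: rL2_def)

text \<open>The bound 1 fits all factors that occur: signs, Walsh functions and indicators.\<close>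

lemma rL2_bounded_mult:
  assumes f: "f \<in> rL2 P" and [measurable]: "g \<in> borel_measurable P"
    and b: "\<And>x. x \<in> space P \<Longrightarrow> \<bar>g x\<bar> \<le> 1"
  shows "(\<lambda>x. f x * g x) \<in> rL2 P"
proof -
  note [measurable] = rL2_measurable[OF f]
  have "integrable P (\<lambda>x. (f x * g x)\<^sup>2)"
  proof (rule Bochner_Integration.integrable_bound[OF rL2_square[OF f]])
    have "(f x * g x)\<^sup>2 \<le> (f x)\<^sup>2" if "x \<in> space P" for x
    proof -
      have "(g x)\<^sup>2 \<le> 1" using b[OF that] abs_square_le_1 by blast
      then show ?thesis by (simp add: power_mult_distrib mult_left_le)
    qed
    then show "AE x in P. norm ((f x * g x)\<^sup>2) \<le> norm ((f x)\<^sup>2)"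
      by (intro AE_I2) simp
  qed measurable
  then show ?thesis by (simp add: rL2_def)
qed

context prob_space
begin

lemma rL2_const: "(\<lambda>x. c) \<in> rL2 M"
  by (simp add: rL2_def)

lemma rL2_indicator: "A \<in> sets M \<Longrightarrow> indicator A \<in> rL2 M"
  using rL2_bounded_mult[OF rL2_const[of 1], of "indicator A"] by simp

lemma rL2_integrable: "f \<in> rL2 M \<Longrightarrow> integrable M f"
  using rL2_mult_integrable[OF _ rL2_const[of 1], of f] by simp

text \<open>Nonnegativity of the variance. It serves to bound a single pairing by an L2
  error.\<close>

lemma rL2_abs_integral_le:
  assumes "f \<in> rL2 M" shows "(\<integral>x. f x \<partial>M)\<^sup>2 \<le> (\<integral>x. (f x)\<^sup>2 \<partial>M)"
proof -
  have "0 \<le> variance f" by simp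
  then show ?thesis
    using variance_eq[OF rL2_integrable[OF assms] rL2_square[OF assms]] by simp
qed

end

lemma subalgebra_sigma_finite:
  assumes "prob_space P" "subalgebra P F"
  shows "sigma_finite_subalgebra P F"
  by (rule finite_measure_subalgebra_is_sigma_finite)
     (use assms in \<open>auto simp: finite_measure_subalgebra_def finite_measure_subalgebra_axioms_def prob_space_def\<close>)

text \<open>Conditional Jensen inequality for the square.\<close>

lemma real_cond_exp_square:
  assumes P: "prob_space P" and F: "subalgebra P F" and f: "f \<in> rL2 P"
  shows "real_cond_exp P F f \<in> rL2 P"
proof -
  interpret sigma_finite_subalgebra P F by (rule subalgebra_sigma_finite[OF P F])
  interpret finite_measure_subalgebra P F
    using P F by (auto simp: finite_measure_subalgebra_def finite_measure_subalgebra_axioms_def prob_space_def)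
  have c: "convex_on UNIV (\<lambda>x::real. x\<^sup>2)"
    using convex_power2 by (simp add: convex_on_def)
  have "integrable P (\<lambda>x. (real_cond_exp P F f x)\<^sup>2)"
    by (rule integrable_convex_cond_exp[where I=UNIV and q="\<lambda>x. x\<^sup>2"])
       (use prob_space.rL2_integrable[OF P f] rL2_square[OF f] c in auto)
  then show ?thesis
    unfolding rL2_def using F by auto
qed

subsection \<open>Fair coins over a base space\<close>

text \<open>Abstract form of the space of signed paths, with \<open>X\<close> the path and
  \<open>p\<close> the signs. Only the value 1 is tested: a coin has two values, and the sets in
  \<open>law\<close> form an Int-stable family that settles the joint law. The field is generated up
  to null sets only, so that \<open>P\<close> may be complete.\<close>

locale coin_space = P: prob_space P + W: prob_space W
  for P :: "'b measure" and W :: "'a measure" +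
  fixes X :: "'b \<Rightarrow> 'a" and p :: "nat \<Rightarrow> 'b \<Rightarrow> real"
  assumes X_measurable [measurable]: "X \<in> P \<rightarrow>\<^sub>M W"
    and p_measurable [measurable]: "p k \<in> borel_measurable P"
    and p_values: "x \<in> space P \<Longrightarrow> p k x \<in> {-1, 1}"
    and law: "A \<in> sets W \<Longrightarrow> finite J \<Longrightarrow>
      P.prob {x \<in> space P. X x \<in> A \<and> (\<forall>j\<in>J. p j x = 1)} = W.prob A / 2 ^ card J"
    and generated: "C \<in> sets P \<Longrightarrow>
      \<exists>D \<in> sigma_sets (space P)
        {{x \<in> space P. X x \<in> A \<and> (\<forall>j\<in>J. p j x = 1)} |A J. A \<in> sets W \<and> finite J}.
        AE x in P. x \<in> C \<longleftrightarrow> x \<in> D"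
begin

definition cyl :: "'a set \<Rightarrow> nat set \<Rightarrow> 'b set" where
  "cyl A J = {x \<in> space P. X x \<in> A \<and> (\<forall>j\<in>J. p j x = 1)}"

text \<open>What is known when all but the \<open>k\<close>-th coin are revealed. Every
  orthogonality below goes back to the independence of \<open>p k\<close> from this field.\<close>

definition others :: "nat \<Rightarrow> 'b measure" where
  "others k = sigma (space P) {cyl A J |A J. A \<in> sets W \<and> finite J \<and> k \<notin> J}"

lemma cyl_sets [measurable]:
  assumes [measurable]: "A \<in> sets W" and J: "finite J"
  shows "cyl A J \<in> sets P"
  unfolding cyl_def using J
  by (intro sets.sets_Collect sets.sets_Collect_finite_All) measurable

lemma cyl_Int: "cyl A J \<inter> cyl B K = cyl (A \<inter> B) (J \<union> K)"
  unfolding cyl_def by auto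

lemma cyl_subset: "cyl A J \<subseteq> space P"
  unfolding cyl_def by auto

lemma prob_cyl: "A \<in> sets W \<Longrightarrow> finite J \<Longrightarrow> P.prob (cyl A J) = W.prob A / 2 ^ card J"
  unfolding cyl_def by (rule law)

lemma Int_stable_cyl: "Int_stable {cyl A J |A J. A \<in> sets W \<and> finite J}"
  unfolding Int_stable_def by (force simp: cyl_Int)

lemma sets_others: "sets (others k) = sigma_sets (space P) {cyl A J |A J. A \<in> sets W \<and> finite J \<and> k \<notin> J}"
  unfolding others_def by (rule sets_measure_of) (auto simp: cyl_def)

lemma space_others [simp]: "space (others k) = space P"
  unfolding others_def by (rule space_measure_of) (auto simp: cyl_def)

lemma subalgebra_others: "subalgebra P (others k)"
  unfolding subalgebra_def sets_others space_others
  by (intro conjI refl sets.sigma_sets_subset) (use cyl_sets in blast)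

lemma X_others [measurable]: "X \<in> others k \<rightarrow>\<^sub>M W"
proof (rule measurableI)
  fix A assume "A \<in> sets W"
  then have "cyl A {} \<in> sets (others k)"
    unfolding sets_others by (intro sigma_sets.Basic) blast
  then show "X -` A \<inter> space (others k) \<in> sets (others k)"
    by (simp add: cyl_def vimage_def Int_def conj_commute)
qed (use measurable_space[OF X_measurable] in simp)

lemma p_eq_indicator: "x \<in> space P \<Longrightarrow> p k x = 2 * indicator {x \<in> space P. p k x = 1} x - 1"
  using p_values[of x k] by (auto simp: indicator_def)

lemma p_others: assumes "l \<noteq> k" shows "p l \<in> borel_measurable (others k)"
proof -
  have "cyl (space W) {l} \<in> sets (others k)"
    unfolding sets_others using assms by (intro sigma_sets.Basic) blast
  then have "{x \<in> space P. p l x = 1} \<in> sets (others k)"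
    by (rule back_subst[where P="\<lambda>D. D \<in> sets (others k)"])
       (use measurable_space[OF X_measurable] in \<open>auto simp: cyl_def\<close>)
  then have "(\<lambda>x. 2 * indicator {x \<in> space P. p l x = 1} x - 1 :: real) \<in> borel_measurable (others k)"
    by measurable
  then show ?thesis
    by (rule measurable_cong[THEN iffD2, rotated]) (simp add: p_eq_indicator[symmetric])
qed

text \<open>Independence of the \<open>k\<close>-th coin from the rest: the cylinders are
  Int-stable, and the sets that the coin halves form a Dynkin system.\<close>

lemma half_others:
  assumes "C \<in> sets (others k)"
  shows "P.prob (C \<inter> {x \<in> space P. p k x = 1}) = P.prob C / 2"
proof -
  let ?G = "{cyl A J |A J. A \<in> sets W \<and> finite J \<and> k \<notin> J}"
  have st: "Int_stable ?G" unfolding Int_stable_def by (force simp: cyl_Int)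
  have sub: "?G \<subseteq> Pow (space P)" using cyl_subset by blast
  have inP: "D \<in> sets P" if "D \<in> sigma_sets (space P) ?G" for D
    using that subalgebra_others sets_others unfolding subalgebra_def by blast
  have [measurable]: "{x \<in> space P. p k x = 1} \<in> sets P" by measurable
  have k: "P.prob {x \<in> space P. p k x = 1} = 1 / 2"
  proof -
    have "{x \<in> space P. p k x = 1} = cyl (space W) {k}"
      using measurable_space[OF X_measurable] by (auto simp: cyl_def)
    then show ?thesis using prob_cyl[of "space W" "{k}"] W.prob_space by simp
  qed
  from st sub assms[unfolded sets_others] show ?thesis
  proof (induction rule: sigma_sets_induct_disjoint)
    case (basic A)
    then obtain B J where A: "A = cyl B J" "B \<in> sets W" "finite J" "k \<notin> J" by auto
    have "A \<inter> {x \<in> space P. p k x = 1} = cyl B (insert k J)"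
      unfolding A(1) by (auto simp: cyl_def)
    then show ?case using A by (simp add: prob_cyl)
  next
    case empty
    then show ?case by simp
  next
    case (compl A)
    note [measurable] = inP[OF compl(1)]
    have "(space P - A) \<inter> {x \<in> space P. p k x = 1} = {x \<in> space P. p k x = 1} - A \<inter> {x \<in> space P. p k x = 1}"
      by auto
    then have "P.prob ((space P - A) \<inter> {x \<in> space P. p k x = 1}) = 1/2 - P.prob A / 2"
      using P.finite_measure_Diff[of "{x \<in> space P. p k x = 1}" "A \<inter> {x \<in> space P. p k x = 1}"]
      by (simp add: k compl.IH)
    then show ?case by (simp add: P.prob_compl)
  next
    case (union A)
    have Ai [measurable]: "A i \<in> sets P" for i using inP union(2) by blast
    have "(\<Union>i. A i) \<inter> {x \<in> space P. p k x = 1} = (\<Union>i. A i \<inter> {x \<in> space P. p k x = 1})" by auto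
    moreover have "(\<lambda>i. P.prob (A i \<inter> {x \<in> space P. p k x = 1})) sums P.prob (\<Union>i. A i \<inter> {x \<in> space P. p k x = 1})"
      using union(1) by (intro P.finite_measure_UNION) (auto simp: disjoint_family_on_def)
    moreover have "(\<lambda>i. P.prob (A i) / 2) sums (P.prob (\<Union>i. A i) / 2)"
      using union(1) by (intro sums_divide P.finite_measure_UNION) auto
    moreover have "(\<lambda>i. P.prob (A i \<inter> {x \<in> space P. p k x = 1})) = (\<lambda>i. P.prob (A i) / 2)"
      by (rule ext) (rule union.IH)
    ultimately show ?case by (metis (no_types, lifting) sums_unique2)
  qed
qed

lemma p_bounded: "x \<in> space P \<Longrightarrow> \<bar>p k x\<bar> \<le> 1"
  using p_values[of x k] by auto

lemma p_integrable: "integrable P (p k)"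
  using P.rL2_integrable[OF rL2_bounded_mult[OF P.rL2_const[of 1], of "p k"]] p_bounded by simp

lemma cond_exp_p: "AE x in P. real_cond_exp P (others k) (p k) x = 0"
proof -
  interpret S: sigma_finite_subalgebra P "others k"
    by (rule subalgebra_sigma_finite[OF P.prob_space_axioms subalgebra_others])
  show ?thesis
  proof (rule S.real_cond_exp_charact)
    fix C assume C: "C \<in> sets (others k)"
    then have [measurable]: "C \<in> sets P" using subalgebra_others unfolding subalgebra_def by blast
    have "set_lebesgue_integral P C (p k) =
        (\<integral>x. 2 * indicator (C \<inter> {x \<in> space P. p k x = 1}) x - indicator C x \<partial>P)"
      unfolding set_lebesgue_integral_def
    proof (rule Bochner_Integration.integral_cong[OF refl])
      fix x assume "x \<in> space P"
      then show "indicator C x *\<^sub>R p k x = 2 * indicator (C \<inter> {x \<in> space P. p k x = 1}) x - indicator C x"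
        using p_values[of x k] by (auto simp: indicator_def)
    qed
    also have "\<dots> = 2 * P.prob (C \<inter> {x \<in> space P. p k x = 1}) - P.prob C"
      by (subst Bochner_Integration.integral_diff) (auto simp: P.emeasure_eq_measure)
    also have "\<dots> = 0" using half_others[OF C] by simp
    finally show "set_lebesgue_integral P C (p k) = (\<integral>x\<in>C. 0 \<partial>P)" by simp
  qed (use p_integrable in auto)
qed

text \<open>The form in which fairness is used from here on: a factor \<open>p k\<close> annihilates
  every integrand that does not look at the \<open>k\<close>-th coin.\<close>

lemma integral_mult_p:
  assumes h: "h \<in> borel_measurable (others k)" and int: "integrable P h"
  shows "(\<integral>x. h x * p k x \<partial>P) = 0"
proof -
  interpret S: sigma_finite_subalgebra P "others k"
    by (rule subalgebra_sigma_finite[OF P.prob_space_axioms subalgebra_others])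
  have [measurable]: "h \<in> borel_measurable P"
    using int by auto
  have "integrable P (\<lambda>x. h x * p k x)"
    by (rule Bochner_Integration.integrable_bound[OF int])
       (auto intro!: AE_I2 simp: abs_mult mult_left_le p_bounded)
  from S.real_cond_exp_intg(2)[OF this h] have
    "(\<integral>x. h x * p k x \<partial>P) = (\<integral>x. h x * real_cond_exp P (others k) (p k) x \<partial>P)" by simp
  also have "\<dots> = (\<integral>x. 0 \<partial>P)"
    using cond_exp_p[of k] by (intro integral_cong_AE) (auto elim: eventually_mono)
  finally show ?thesis by simp
qed

lemma distr_X: "distr P W X = W"
proof (rule measure_eqI)
  fix A assume "A \<in> sets (distr P W X)"
  then have A: "A \<in> sets W" by simp
  then have "emeasure (distr P W X) A = emeasure P (cyl A {})"
    by (simp add: emeasure_distr cyl_def vimage_def Int_def conj_commute)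
  also have "\<dots> = emeasure W A"
    using A by (simp add: P.emeasure_eq_measure W.emeasure_eq_measure prob_cyl)
  finally show "emeasure (distr P W X) A = emeasure W A" .
qed simp

lemma integrable_X_iff:
  fixes g :: "'a \<Rightarrow> 'c::{banach,second_countable_topology}"
  shows "g \<in> borel_measurable W \<Longrightarrow> integrable P (\<lambda>x. g (X x)) \<longleftrightarrow> integrable W g"
  using integrable_distr_eq[of X P W g] by (simp add: distr_X)

lemma integral_X:
  fixes g :: "'a \<Rightarrow> 'c::{banach,second_countable_topology}"
  shows "g \<in> borel_measurable W \<Longrightarrow> (\<integral>x. g (X x) \<partial>P) = (\<integral>\<omega>. g \<omega> \<partial>W)"
  using integral_distr[of X P W g] by (simp add: distr_X)

lemma AE_X: "AE \<omega> in W. Q \<omega> \<Longrightarrow> AE x in P. Q (X x)"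
  using AE_distrD[of X P W Q, unfolded distr_X] by simp

lemma rL2_X: "g \<in> rL2 W \<Longrightarrow> (\<lambda>x. g (X x)) \<in> rL2 P"
  using integrable_X_iff[of "\<lambda>\<omega>. (g \<omega>)\<^sup>2"] by (auto simp: rL2_def)

section \<open>Walsh functions of the coins\<close>

definition wal :: "nat set \<Rightarrow> 'b \<Rightarrow> real" where
  "wal K x = (\<Prod>k\<in>K. p k x)"

lemma wal_measurable [measurable]: "wal K \<in> borel_measurable P"
  unfolding wal_def by measurable

lemma wal_values: "x \<in> space P \<Longrightarrow> wal K x \<in> {-1, 1}"
  unfolding wal_def
proof (induction K rule: infinite_finite_induct)
  case (insert k K)
  then show ?case using p_values[of x k] by auto
qed auto

lemma wal_bounded: "x \<in> space P \<Longrightarrow> \<bar>wal K x\<bar> \<le> 1"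
  using wal_values[of x K] by auto

lemma wal_square: "x \<in> space P \<Longrightarrow> wal K x * wal K x = 1"
  using wal_values[of x K] by auto

lemma wal_empty [simp]: "wal {} x = 1"
  by (simp add: wal_def)

lemma wal_remove: "finite K \<Longrightarrow> k \<in> K \<Longrightarrow> wal K x = p k x * wal (K - {k}) x"
  unfolding wal_def by (rule prod.remove)

lemma wal_others: "k \<notin> K \<Longrightarrow> wal K \<in> borel_measurable (others k)"
  unfolding wal_def by (intro borel_measurable_prod p_others) auto

text \<open>Coins square to 1, so common indices cancel and the symmetric difference
  remains.\<close>

lemma wal_mult:
  assumes "finite K" "finite L" "x \<in> space P"
  shows "wal K x * wal L x = wal ((K - L) \<union> (L - K)) x"
proof -
  have "wal K x = wal (K - L) x * wal (K \<inter> L) x"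
    unfolding wal_def using assms
    by (subst prod.union_disjoint[symmetric]) (auto intro!: prod.cong)
  moreover have "wal L x = wal (L - K) x * wal (K \<inter> L) x"
    unfolding wal_def using assms
    by (subst prod.union_disjoint[symmetric]) (auto intro!: prod.cong)
  moreover have "wal (K - L) x * wal (L - K) x = wal ((K - L) \<union> (L - K)) x"
    unfolding wal_def using assms by (subst prod.union_disjoint) auto
  moreover have "wal (K \<inter> L) x * wal (K \<inter> L) x = 1"
    by (rule wal_square[OF assms(3)])
  moreover have "(a * d) * (e * d) = (a * e) * (d * d)" for a d e :: real
    by (simp add: mult_ac)
  ultimately show ?thesis by (simp only: mult_1_right)
qed

text \<open>One coin of \<open>K\<close> is pulled out; the remaining integrand is measurable for
  the others.\<close>

lemma integral_wal:
  assumes K: "finite K" "K \<noteq> {}" and b: "integrable W b"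
  shows "(\<integral>x. b (X x) * wal K x \<partial>P) = 0"
proof -
  obtain k where k: "k \<in> K" using K by auto
  have [measurable]: "b \<in> borel_measurable W" using b by auto
  have w [measurable]: "wal (K - {k}) \<in> borel_measurable (others k)"
    by (rule wal_others) simp
  have h: "(\<lambda>x. b (X x) * wal (K - {k}) x) \<in> borel_measurable (others k)"
    by measurable
  have "integrable P (\<lambda>x. b (X x))" using b by (simp add: integrable_X_iff)
  then have "integrable P (\<lambda>x. b (X x) * wal (K - {k}) x)"
    by (rule Bochner_Integration.integrable_bound)
       (auto intro!: AE_I2 simp: abs_mult mult_left_le wal_bounded)
  from integral_mult_p[OF h this] show ?thesis
    using wal_remove[OF K(1) k] by (simp add: mult_ac)
qed

lemma integral_wal_wal:
  assumes "finite K" "finite L" "integrable W b"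
  shows "(\<integral>x. b (X x) * (wal K x * wal L x) \<partial>P) = (if K = L then (\<integral>\<omega>. b \<omega> \<partial>W) else 0)"
proof -
  have "(\<integral>x. b (X x) * (wal K x * wal L x) \<partial>P) = (\<integral>x. b (X x) * wal ((K - L) \<union> (L - K)) x \<partial>P)"
    using assms by (intro Bochner_Integration.integral_cong) (auto simp: wal_mult)
  also have "\<dots> = (if K = L then (\<integral>\<omega>. b \<omega> \<partial>W) else 0)"
  proof (cases "K = L")
    case True
    then show ?thesis using assms integral_X[of b] by auto
  next
    case False
    then have "(K - L) \<union> (L - K) \<noteq> {}" by auto
    then show ?thesis using assms False integral_wal[of "(K - L) \<union> (L - K)" b] by auto
  qed
  finally show ?thesis .
qed

subsection \<open>Coefficients\<close>

text \<open>The conditional expectation of \<open>f * wal K\<close> given \<open>X\<close>, written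
  as a function on the base and characterised by test functions. As \<open>wal K\<close> squares to
  1 and distinct Walsh functions are orthogonal given \<open>X\<close>, this is the coefficient of
  \<open>wal K\<close> in \<open>f\<close>.\<close>

definition is_coef :: "('b \<Rightarrow> real) \<Rightarrow> nat set \<Rightarrow> ('a \<Rightarrow> real) \<Rightarrow> bool" where
  "is_coef f K c \<longleftrightarrow> c \<in> rL2 W \<and>
     (\<forall>b\<in>rL2 W. (\<integral>x. f x * wal K x * b (X x) \<partial>P) = (\<integral>\<omega>. c \<omega> * b \<omega> \<partial>W))"

text \<open>Conditional expectation with respect to the field generated by \<open>X\<close>, pushed
  down to the base by \<open>Doob_Dynkin_real\<close>; it is square integrable by Jensen.\<close>

lemma projection_exists:
  assumes h: "h \<in> rL2 P"
  shows "\<exists>c\<in>rL2 W. \<forall>b\<in>rL2 W. (\<integral>x. h x * b (X x) \<partial>P) = (\<integral>\<omega>. c \<omega> * b \<omega> \<partial>W)"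
proof -
  define F where "F = vimage_algebra (space P) X W"
  have X: "X \<in> space P \<rightarrow> space W" using measurable_space[OF X_measurable] by auto
  have F: "subalgebra P F"
    unfolding subalgebra_def F_def by (auto simp: sets_vimage_algebra2[OF X])
  interpret S: sigma_finite_subalgebra P F
    by (rule subalgebra_sigma_finite[OF P.prob_space_axioms F])
  have E: "real_cond_exp P F h \<in> rL2 P"
    by (rule real_cond_exp_square[OF P.prob_space_axioms F h])
  obtain v where v [measurable]: "v \<in> borel_measurable W" and
    vX: "\<And>x. x \<in> space P \<Longrightarrow> real_cond_exp P F h x = v (X x)"
    using Doob_Dynkin_real[OF X, of "real_cond_exp P F h"] unfolding F_def by auto
  have "integrable P (\<lambda>x. (v (X x))\<^sup>2)"
    using rL2_square[OF E] by (rule Bochner_Integration.integrable_cong[THEN iffD1, rotated 2]) (simp_all add: vX)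
  then have "v \<in> rL2 W"
    using integrable_X_iff[of "\<lambda>\<omega>. (v \<omega>)\<^sup>2"] by (simp add: rL2_def)
  moreover have "(\<integral>x. h x * b (X x) \<partial>P) = (\<integral>\<omega>. v \<omega> * b \<omega> \<partial>W)" if b: "b \<in> rL2 W" for b
  proof -
    note [measurable] = rL2_measurable[OF b]
    have "X \<in> F \<rightarrow>\<^sub>M W" unfolding F_def by (rule measurable_vimage_algebra1[OF X])
    then have m: "(\<lambda>x. b (X x)) \<in> borel_measurable F" by measurable
    have "integrable P (\<lambda>x. b (X x) * h x)"
      using rL2_mult_integrable[OF rL2_X[OF b] h] .
    from S.real_cond_exp_intg(2)[OF this m]
    have "(\<integral>x. b (X x) * h x \<partial>P) = (\<integral>x. b (X x) * real_cond_exp P F h x \<partial>P)"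
      using rL2_measurable[OF h] by simp
    also have "\<dots> = (\<integral>x. v (X x) * b (X x) \<partial>P)"
      by (intro Bochner_Integration.integral_cong) (auto simp: vX)
    also have "\<dots> = (\<integral>\<omega>. v \<omega> * b \<omega> \<partial>W)" by (rule integral_X) measurable
    finally show ?thesis by (simp add: mult.commute)
  qed
  ultimately show ?thesis by blast
qed

lemma is_coef_exists:
  assumes "f \<in> rL2 P" shows "\<exists>c. is_coef f K c"
  using projection_exists[of "\<lambda>x. f x * wal K x"] rL2_bounded_mult[OF assms wal_measurable wal_bounded]
  unfolding is_coef_def by blast

definition coef :: "('b \<Rightarrow> real) \<Rightarrow> nat set \<Rightarrow> 'a \<Rightarrow> real" where
  "coef f K = (SOME c. is_coef f K c)"

lemma is_coef_coef: "f \<in> rL2 P \<Longrightarrow> is_coef f K (coef f K)"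
  unfolding coef_def using is_coef_exists by (rule someI_ex)

lemma coef_rL2: "f \<in> rL2 P \<Longrightarrow> coef f K \<in> rL2 W"
  using is_coef_coef unfolding is_coef_def by blast

lemma coef_measurable: "f \<in> rL2 P \<Longrightarrow> coef f K \<in> borel_measurable W"
  using coef_rL2 rL2_measurable by blast

lemma integral_coef:
  "f \<in> rL2 P \<Longrightarrow> b \<in> rL2 W \<Longrightarrow> (\<integral>x. f x * wal K x * b (X x) \<partial>P) = (\<integral>\<omega>. coef f K \<omega> * b \<omega> \<partial>W)"
  using is_coef_coef unfolding is_coef_def by blast

end

subsection \<open>Walsh expansion\<close>

text \<open>A triangle inequality without square roots, from
  \<open>0 \<le> ((a - b) - (b - c))\<^sup>2\<close>. The price is the factor 2, which accounts for
  the quarters of \<open>e\<close> below.\<close>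

lemma square_integral_triangle:
  assumes "f \<in> rL2 P" "g \<in> rL2 P" "h \<in> rL2 P"
  shows "(\<integral>x. (f x - h x)\<^sup>2 \<partial>P) \<le> 2 * (\<integral>x. (f x - g x)\<^sup>2 \<partial>P) + 2 * (\<integral>x. (g x - h x)\<^sup>2 \<partial>P)"
proof -
  have i: "integrable P (\<lambda>x. (f x - h x)\<^sup>2)" "integrable P (\<lambda>x. (f x - g x)\<^sup>2)"
    "integrable P (\<lambda>x. (g x - h x)\<^sup>2)"
    using rL2_square[OF rL2_diff] assms by blast+
  have le: "(a - c)\<^sup>2 \<le> 2 * (a - b)\<^sup>2 + 2 * (b - c)\<^sup>2" for a b c :: real
  proof -
    have "0 \<le> ((a - b) - (b - c))\<^sup>2" by simp
    then show ?thesis by (simp add: power2_eq_square algebra_simps)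
  qed
  have "(\<integral>x. (f x - h x)\<^sup>2 \<partial>P) \<le> (\<integral>x. 2 * (f x - g x)\<^sup>2 + 2 * (g x - h x)\<^sup>2 \<partial>P)"
    by (rule integral_mono) (use i le in auto)
  also have "\<dots> = 2 * (\<integral>x. (f x - g x)\<^sup>2 \<partial>P) + 2 * (\<integral>x. (g x - h x)\<^sup>2 \<partial>P)"
    using i by simp
  finally show ?thesis .
qed

context coin_space
begin

text \<open>Finite Walsh sums with coefficients depending on the base. The inductive form gives
  closure under sums and under multiplication by a coin without bookkeeping of index sets;
  \<open>wpoly_repr\<close> restores the index set once it is needed.\<close>

inductive wpoly :: "('b \<Rightarrow> real) \<Rightarrow> bool" where
  monomial: "finite K \<Longrightarrow> a \<in> rL2 W \<Longrightarrow> wpoly (\<lambda>x. a (X x) * wal K x)"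
| add: "wpoly g \<Longrightarrow> wpoly h \<Longrightarrow> wpoly (\<lambda>x. g x + h x)"

lemma monomial_rL2: "a \<in> rL2 W \<Longrightarrow> (\<lambda>x. a (X x) * wal K x) \<in> rL2 P"
  by (rule rL2_bounded_mult[OF rL2_X wal_measurable wal_bounded])

lemma wpoly_rL2: "wpoly h \<Longrightarrow> h \<in> rL2 P"
  by (induction rule: wpoly.induct) (auto intro: monomial_rL2 rL2_add)

lemma wpoly_repr:
  assumes "wpoly h"
  obtains \<K> a where "finite \<K>" "\<And>K. K \<in> \<K> \<Longrightarrow> finite K" "\<And>K. a K \<in> rL2 W"
    "\<And>x. h x = (\<Sum>K\<in>\<K>. a K (X x) * wal K x)"
proof -
  have "\<exists>\<K> a. finite \<K> \<and> (\<forall>K\<in>\<K>. finite K) \<and> (\<forall>K. a K \<in> rL2 W) \<and>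
     (\<forall>x. h x = (\<Sum>K\<in>\<K>. a K (X x) * wal K x))"
    using assms
  proof (induction rule: wpoly.induct)
    case (monomial K a)
    then show ?case by (intro exI[of _ "{K}"] exI[of _ "\<lambda>_. a"]) simp
  next
    case (add g h)
    then obtain \<K> a \<L> b where 1: "finite \<K>" "\<forall>K\<in>\<K>. finite K" "\<forall>K. a K \<in> rL2 W"
      "\<forall>x. g x = (\<Sum>K\<in>\<K>. a K (X x) * wal K x)"
      and 2: "finite \<L>" "\<forall>K\<in>\<L>. finite K" "\<forall>K. b K \<in> rL2 W"
      "\<forall>x. h x = (\<Sum>K\<in>\<L>. b K (X x) * wal K x)" by blast
    have zero: "(\<lambda>_. 0) \<in> rL2 W" by (rule W.rL2_const)
    \<comment> \<open>Both families are extended by zero, so that the two sums can run over the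
      union of the index sets.\<close>
    define a' where "a' K \<omega> = (if K \<in> \<K> then a K \<omega> else 0)" for K \<omega>
    define b' where "b' K \<omega> = (if K \<in> \<L> then b K \<omega> else 0)" for K \<omega>
    have a': "a' K \<in> rL2 W" for K using 1(3) zero unfolding a'_def by (cases "K \<in> \<K>") auto
    have b': "b' K \<in> rL2 W" for K using 2(3) zero unfolding b'_def by (cases "K \<in> \<L>") auto
    have "g x + h x = (\<Sum>K\<in>\<K> \<union> \<L>. (a' K (X x) + b' K (X x)) * wal K x)" for x
    proof -
      have "g x = (\<Sum>K\<in>\<K> \<union> \<L>. a' K (X x) * wal K x)"
        using 1 2 by (auto simp: a'_def intro!: sum.mono_neutral_cong_left)
      moreover have "h x = (\<Sum>K\<in>\<K> \<union> \<L>. b' K (X x) * wal K x)"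
        using 1 2 by (auto simp: b'_def intro!: sum.mono_neutral_cong_left)
      ultimately show ?thesis by (simp add: sum.distrib distrib_right)
    qed
    then show ?case using 1 2 a' b'
      by (intro exI[of _ "\<K> \<union> \<L>"] exI[of _ "\<lambda>K \<omega>. a' K \<omega> + b' K \<omega>"]) (auto intro: rL2_add)
  qed
  then show ?thesis using that by blast
qed

lemma wpoly_cmult: "wpoly h \<Longrightarrow> wpoly (\<lambda>x. c * h x)"
proof (induction rule: wpoly.induct)
  case (monomial K a)
  then show ?case using wpoly.monomial[OF _ rL2_cmult[of a W c], of K] by (simp add: mult.assoc)
next
  case (add g h)
  then show ?case using wpoly.add by (simp add: distrib_left)
qed

text \<open>Multiplication by \<open>p k\<close> toggles the membership of \<open>k\<close> in
  \<open>K\<close>. Equality is claimed on the space only, because that is where the coins are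
  signs.\<close>

lemma wpoly_mult_p: "wpoly h \<Longrightarrow> \<exists>g. wpoly g \<and> (\<forall>x\<in>space P. g x = h x * p k x)"
proof (induction rule: wpoly.induct)
  case (monomial K a)
  have "a (X x) * wal ((K - {k}) \<union> ({k} - K)) x = a (X x) * wal K x * p k x" if "x \<in> space P" for x
    using wal_mult[OF monomial(1) _ that, of "{k}"] by (simp add: wal_def)
  then show ?case using wpoly.monomial[OF _ monomial(2), of "(K - {k}) \<union> ({k} - K)"] monomial(1)
    by (intro exI[of _ "\<lambda>x. a (X x) * wal ((K - {k}) \<union> ({k} - K)) x"]) auto
next
  case (add g h)
  then obtain g' h' where "wpoly g'" "\<forall>x\<in>space P. g' x = g x * p k x"
    "wpoly h'" "\<forall>x\<in>space P. h' x = h x * p k x" by blast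
  then show ?case by (intro exI[of _ "\<lambda>x. g' x + h' x"]) (auto intro: wpoly.add simp: distrib_right)
qed

lemma wpoly_cyl:
  assumes A: "A \<in> sets W" and J: "finite J"
  shows "\<exists>h. wpoly h \<and> (\<forall>x\<in>space P. h x = indicator (cyl A J) x)"
  using J
proof (induction J)
  case empty
  show ?case using wpoly.monomial[OF finite.emptyI W.rL2_indicator[OF A]]
    by (intro exI[of _ "\<lambda>x. indicator A (X x) * wal {} x"]) (auto simp: cyl_def indicator_def)
next
  case (insert k J)
  then obtain h where h: "wpoly h" "\<forall>x\<in>space P. h x = indicator (cyl A J) x" by blast
  obtain g where g: "wpoly g" "\<forall>x\<in>space P. g x = h x * p k x" using wpoly_mult_p[OF h(1)] by blast
  \<comment> \<open>\<open>(1 + p k x) / 2\<close> is the indicator of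
    \<open>p k x = 1\<close>.\<close>
  have "wpoly (\<lambda>x. (1/2) * (h x + g x))" by (intro wpoly_cmult wpoly.add h g)
  moreover have "(1/2) * (h x + g x) = indicator (cyl A (insert k J)) x" if "x \<in> space P" for x
    using h g that p_values[OF that, of k] by (auto simp: cyl_def indicator_def)
  ultimately show ?case by (intro exI[of _ "\<lambda>x. (1/2) * (h x + g x)"]) auto
qed

definition approximable :: "('b \<Rightarrow> real) \<Rightarrow> bool" where
  "approximable f \<longleftrightarrow> f \<in> rL2 P \<and> (\<forall>e>0. \<exists>h. wpoly h \<and> (\<integral>x. (f x - h x)\<^sup>2 \<partial>P) < e)"

lemma approximable_limit:
  assumes f: "f \<in> rL2 P" and lim: "\<And>e. e > 0 \<Longrightarrow> \<exists>g. approximable g \<and> (\<integral>x. (f x - g x)\<^sup>2 \<partial>P) < e"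
  shows "approximable f"
  unfolding approximable_def
proof (intro conjI f allI impI)
  fix e :: real assume e: "e > 0"
  \<comment> \<open>A quarter for each distance, since \<open>square_integral_triangle\<close>
    doubles both.\<close>
  then obtain g where g: "approximable g" "(\<integral>x. (f x - g x)\<^sup>2 \<partial>P) < e / 4" using lim[of "e/4"] by auto
  then obtain h where h: "wpoly h" "(\<integral>x. (g x - h x)\<^sup>2 \<partial>P) < e / 4"
    unfolding approximable_def using e by (meson zero_less_divide_iff zero_less_numeral)
  show "\<exists>h. wpoly h \<and> (\<integral>x. (f x - h x)\<^sup>2 \<partial>P) < e"
    using square_integral_triangle[OF f, of g h] g h wpoly_rL2[OF h(1)] unfolding approximable_def
    by (intro exI[of _ h]) auto
qed

lemma approximable_add:
  assumes f: "approximable f" and g: "approximable g"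
  shows "approximable (\<lambda>x. f x + g x)"
  unfolding approximable_def
proof (intro conjI allI impI)
  have fg: "f \<in> rL2 P" "g \<in> rL2 P" using assms by (auto simp: approximable_def)
  show "(\<lambda>x. f x + g x) \<in> rL2 P" using fg by (rule rL2_add)
  fix e :: real assume e: "e > 0"
  obtain h where h: "wpoly h" "(\<integral>x. (f x - h x)\<^sup>2 \<partial>P) < e / 4"
    using f e unfolding approximable_def by (meson zero_less_divide_iff zero_less_numeral)
  obtain k where k: "wpoly k" "(\<integral>x. (g x - k x)\<^sup>2 \<partial>P) < e / 4"
    using g e unfolding approximable_def by (meson zero_less_divide_iff zero_less_numeral)
  note hk = wpoly_rL2[OF h(1)] wpoly_rL2[OF k(1)]
  have "(\<integral>x. ((f x + g x) - (h x + k x))\<^sup>2 \<partial>P) \<le>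
      2 * (\<integral>x. ((f x + g x) - (h x + g x))\<^sup>2 \<partial>P) + 2 * (\<integral>x. ((h x + g x) - (h x + k x))\<^sup>2 \<partial>P)"
    by (rule square_integral_triangle) (intro rL2_add fg hk)+
  also have "\<dots> < e" using h k by simp
  finally show "\<exists>h. wpoly h \<and> (\<integral>x. (f x + g x - h x)\<^sup>2 \<partial>P) < e"
    using wpoly.add[OF h(1) k(1)] by blast
qed

lemma approximable_wpoly: "wpoly h \<Longrightarrow> approximable h"
  unfolding approximable_def using wpoly_rL2 by (auto intro!: exI[of _ h])

lemma approximable_cong_AE:
  assumes f: "approximable f" and g: "g \<in> borel_measurable P" and eq: "AE x in P. f x = g x"
  shows "approximable g"
proof (rule approximable_limit)
  have m: "f \<in> borel_measurable P" and fi: "f \<in> rL2 P"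
    using f by (auto simp: approximable_def rL2_def)
  have "integrable P (\<lambda>x. (g x)\<^sup>2)"
    using rL2_square[OF fi] by (rule integrable_cong_AE_imp) (use g eq in \<open>auto elim: eventually_mono\<close>)
  then show "g \<in> rL2 P" using g by (simp add: rL2_def)
  fix e :: real assume "e > 0"
  moreover have "(\<integral>x. (g x - f x)\<^sup>2 \<partial>P) = (\<integral>x. 0 \<partial>P)"
    by (rule integral_cong_AE) (use g m eq in \<open>auto elim: eventually_mono\<close>)
  ultimately show "\<exists>f. approximable f \<and> (\<integral>x. (g x - f x)\<^sup>2 \<partial>P) < e" using f by auto
qed

lemma approximable_cmult:
  assumes f: "approximable f" shows "approximable (\<lambda>x. c * f x)"
proof (cases "c = 0")
  case True
  have "(\<integral>x. (0::real) \<partial>P) = 0" by simp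
  moreover have "wpoly (\<lambda>x. 0)"
    using wpoly.monomial[OF finite.emptyI W.rL2_const[of 0]] by simp
  ultimately show ?thesis using True approximable_wpoly by simp
next
  case False
  show ?thesis unfolding approximable_def
  proof (intro conjI allI impI)
    show "(\<lambda>x. c * f x) \<in> rL2 P" using f by (auto simp: approximable_def rL2_cmult)
    fix e :: real assume e: "e > 0"
    then have "e / c\<^sup>2 > 0" using False by simp
    then obtain h where h: "wpoly h" "(\<integral>x. (f x - h x)\<^sup>2 \<partial>P) < e / c\<^sup>2"
      using f unfolding approximable_def by blast
    have "(\<integral>x. (c * f x - c * h x)\<^sup>2 \<partial>P) = c\<^sup>2 * (\<integral>x. (f x - h x)\<^sup>2 \<partial>P)"
      by (simp add: right_diff_distrib[symmetric] power_mult_distrib)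
    also have "\<dots> < e" using h(2) False by (simp add: field_simps)
    finally show "\<exists>h. wpoly h \<and> (\<integral>x. (c * f x - h x)\<^sup>2 \<partial>P) < e"
      using wpoly_cmult[OF h(1)] by blast
  qed
qed

lemma approximable_sum:
  "finite I \<Longrightarrow> (\<And>i. i \<in> I \<Longrightarrow> approximable (f i)) \<Longrightarrow> approximable (\<lambda>x. \<Sum>i\<in>I. f i x)"
proof (induction I rule: finite_induct)
  case empty
  have "wpoly (\<lambda>x. 0)"
    using wpoly.monomial[OF finite.emptyI W.rL2_const[of 0]] by simp
  then show ?case using approximable_wpoly by simp
qed (auto intro: approximable_add)

text \<open>Density of Walsh sums by a Dynkin argument: cylinders are themselves Walsh sums, and
  approximability passes to complements and to countable disjoint unions.\<close>

lemma approximable_indicator_generated: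
  assumes "D \<in> sigma_sets (space P) {cyl A J |A J. A \<in> sets W \<and> finite J}"
  shows "approximable (indicator D)"
proof -
  let ?G = "{cyl A J |A J. A \<in> sets W \<and> finite J}"
  have sub: "?G \<subseteq> Pow (space P)" using cyl_subset by blast
  have inP: "D \<in> sets P" if "D \<in> sigma_sets (space P) ?G" for D
  proof -
    have "sigma_sets (space P) ?G \<subseteq> sets P"
      by (rule sets.sigma_sets_subset) (use cyl_sets in blast)
    then show ?thesis using that by blast
  qed
  have one: "approximable (\<lambda>_. 1)"
    using approximable_wpoly[OF wpoly.monomial[OF finite.emptyI W.rL2_const[of 1]]] by simp
  from Int_stable_cyl sub assms show ?thesis
  proof (induction rule: sigma_sets_induct_disjoint)
    case (basic A)
    then obtain B J where A: "A = cyl B J" "B \<in> sets W" "finite J" by auto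
    from wpoly_cyl[OF A(2,3)] obtain h where h: "wpoly h" "\<forall>x\<in>space P. h x = indicator (cyl B J) x" by blast
    show ?case unfolding A(1)
      by (rule approximable_cong_AE[OF approximable_wpoly[OF h(1)]]) (use h(2) A in auto)
  next
    case empty
    show ?case using approximable_cmult[OF one, of 0] by (simp add: indicator_def)
  next
    case (compl A)
    have "approximable (\<lambda>x. 1 + (-1) * indicator A x)"
      by (intro approximable_add approximable_cmult one compl)
    moreover have "(indicator (space P - A) :: 'b \<Rightarrow> real) \<in> borel_measurable P"
      using inP[OF compl(1)] by (intro borel_measurable_indicator) blast
    moreover have "AE x in P. 1 + (-1) * indicator A x = (indicator (space P - A) x :: real)"
      by (rule AE_I2) (auto simp: indicator_def)
    ultimately show ?case by (rule approximable_cong_AE)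
  next
    case (union A)
    have Ai [measurable]: "A i \<in> sets P" for i using inP union(2) by blast
    show ?case
    proof (rule approximable_limit)
      show "indicator (\<Union>i. A i) \<in> rL2 P" by (rule P.rL2_indicator) measurable
      fix e :: real assume e: "e > 0"
      have "(\<lambda>i. P.prob (A i)) sums P.prob (\<Union>i. A i)"
        using union(1) by (intro P.finite_measure_UNION) auto
      then have "(\<lambda>n. \<Sum>i<n. P.prob (A i)) \<longlonglongrightarrow> P.prob (\<Union>i. A i)" by (simp add: sums_def)
      then obtain n where "dist (\<Sum>i<n. P.prob (A i)) (P.prob (\<Union>i. A i)) < e"
        using e unfolding lim_sequentially by blast
      then have n: "P.prob (\<Union>i. A i) - (\<Sum>i<n. P.prob (A i)) < e" by (simp add: dist_real_def)
      have dis: "disjoint_family_on A {..<n}" using union(1) by (auto simp: disjoint_family_on_def)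
      have ind: "(\<Sum>i<n. indicator (A i) x) = (indicator (\<Union>i<n. A i) x :: real)" for x
        using dis by (simp add: indicator_UN_disjoint)
      \<comment> \<open>The difference of nested indicators is an indicator and equals its square,
        so the squared distance is a difference of probabilities.\<close>
      have "(\<integral>x. (indicat_real (\<Union>i. A i) x - (\<Sum>i<n. indicat_real (A i) x))\<^sup>2 \<partial>P) =
         (\<integral>x. indicat_real (\<Union>i. A i) x - indicat_real (\<Union>i<n. A i) x \<partial>P)"
        by (intro Bochner_Integration.integral_cong refl, subst ind) (auto simp: indicator_def power2_eq_square)
      also have "\<dots> = P.prob (\<Union>i. A i) - P.prob (\<Union>i<n. A i)"
        by (subst Bochner_Integration.integral_diff) (auto simp: P.emeasure_eq_measure)
      also have "P.prob (\<Union>i<n. A i) = (\<Sum>i<n. P.prob (A i))"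
        by (rule P.finite_measure_finite_Union) (use dis in auto)
      finally have "(\<integral>x. (indicat_real (\<Union>i. A i) x - (\<Sum>i<n. indicat_real (A i) x))\<^sup>2 \<partial>P) < e"
        using n by simp
      moreover have "approximable (\<lambda>x. \<Sum>i<n. indicat_real (A i) x)"
        using union.IH by (intro approximable_sum) auto
      ultimately show "\<exists>g. approximable g \<and> (\<integral>x. (indicator (\<Union> (range A)) x - g x)\<^sup>2 \<partial>P) < e"
        by auto
    qed
  qed
qed

lemma approximable_indicator:
  assumes "C \<in> sets P"
  shows "approximable (indicator C)"
proof -
  obtain D where D: "D \<in> sigma_sets (space P) {cyl A J |A J. A \<in> sets W \<and> finite J}"
    "AE x in P. x \<in> C \<longleftrightarrow> x \<in> D"
    using generated[OF assms] unfolding cyl_def by blast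
  show ?thesis
    by (rule approximable_cong_AE[OF approximable_indicator_generated[OF D(1)]])
       (use D(2) assms in \<open>auto elim!: eventually_mono simp: indicator_def\<close>)
qed

lemma approximable_rL2:
  assumes f: "f \<in> rL2 P"
  shows "approximable f"
proof (rule approximable_limit[OF f])
  fix e :: real assume e: "e > 0"
  note [measurable] = rL2_measurable[OF f]
  obtain s where s: "\<And>i. simple_function P (s i)" "\<And>x. x \<in> space P \<Longrightarrow> (\<lambda>i. s i x) \<longlonglongrightarrow> f x"
      "\<And>i x. x \<in> space P \<Longrightarrow> dist (s i x) 0 \<le> 2 * dist (f x) 0"
    using borel_measurable_implies_sequence_metric[OF rL2_measurable[OF f], of 0] by blast
  have [measurable]: "s i \<in> borel_measurable P" for i using s(1) by (rule borel_measurable_simple_function)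
  have "(\<lambda>i. \<integral>x. (f x - s i x)\<^sup>2 \<partial>P) \<longlonglongrightarrow> (\<integral>x. 0 \<partial>P)"
  proof (rule integral_dominated_convergence)
    \<comment> \<open>\<open>9 = (1 + 2)\<^sup>2\<close>: the simple functions are bounded by twice
      \<open>f\<close>.\<close>
    show "integrable P (\<lambda>x. 9 * (f x)\<^sup>2)" using rL2_square[OF f] by simp
    show "AE x in P. (\<lambda>i. (f x - s i x)\<^sup>2) \<longlonglongrightarrow> 0"
    proof (rule AE_I2)
      fix x assume "x \<in> space P"
      then have "(\<lambda>i. (f x - s i x)\<^sup>2) \<longlonglongrightarrow> (f x - f x)\<^sup>2" by (intro tendsto_intros s)
      then show "(\<lambda>i. (f x - s i x)\<^sup>2) \<longlonglongrightarrow> 0" by simp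
    qed
    show "AE x in P. norm ((f x - s i x)\<^sup>2) \<le> 9 * (f x)\<^sup>2" for i
    proof (rule AE_I2)
      fix x assume "x \<in> space P"
      then have "\<bar>s i x\<bar> \<le> 2 * \<bar>f x\<bar>" using s(3)[of x i] by simp
      then have "\<bar>f x - s i x\<bar> \<le> 3 * \<bar>f x\<bar>" by linarith
      then have "\<bar>f x - s i x\<bar>\<^sup>2 \<le> (3 * \<bar>f x\<bar>)\<^sup>2" by (intro power_mono) auto
      then show "norm ((f x - s i x)\<^sup>2) \<le> 9 * (f x)\<^sup>2" by (simp add: power_mult_distrib)
    qed
  qed measurable
  then have "(\<lambda>i. \<integral>x. (f x - s i x)\<^sup>2 \<partial>P) \<longlonglongrightarrow> 0" by simp
  then obtain i where "norm ((\<integral>x. (f x - s i x)\<^sup>2 \<partial>P) - 0) < e"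
    using e LIMSEQ_D by blast
  then have i: "(\<integral>x. (f x - s i x)\<^sup>2 \<partial>P) < e" by simp
  have fin: "finite (s i ` space P)" using s(1) by (simp add: simple_function_def)
  have "approximable (\<lambda>x. \<Sum>y\<in>s i ` space P. y * indicator (s i -` {y} \<inter> space P) x)"
    using fin s(1) by (intro approximable_sum approximable_cmult approximable_indicator)
      (auto simp: simple_function_def)
  moreover have "(\<Sum>y\<in>s i ` space P. y * indicator (s i -` {y} \<inter> space P) x) = s i x" if "x \<in> space P" for x
  proof -
    have "(\<Sum>y\<in>s i ` space P. y * indicator (s i -` {y} \<inter> space P) x) =
        (\<Sum>y\<in>s i ` space P. if s i x = y then y else 0)"
      using that by (intro sum.cong) (auto simp: indicator_def)
    also have "\<dots> = s i x" using that by (subst sum.delta'[OF fin]) simp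
    finally show ?thesis .
  qed
  ultimately have "approximable (s i)"
    by (elim approximable_cong_AE) (auto intro!: AE_I2)
  then show "\<exists>g. approximable g \<and> (\<integral>x. (f x - g x)\<^sup>2 \<partial>P) < e" using i by blast
qed

definition partial :: "('b \<Rightarrow> real) \<Rightarrow> nat set set \<Rightarrow> 'b \<Rightarrow> real" where
  "partial f \<K> x = (\<Sum>K\<in>\<K>. coef f K (X x) * wal K x)"

lemma partial_rL2: "f \<in> rL2 P \<Longrightarrow> partial f \<K> \<in> rL2 P"
  using rL2_sum[of \<K> "\<lambda>K x. coef f K (X x) * wal K x" P] monomial_rL2 coef_rL2
  unfolding partial_def[abs_def] by blast

lemma integral_square_walsh_sum:
  assumes \<K>: "finite \<K>" "\<And>K. K \<in> \<K> \<Longrightarrow> finite K" and a: "\<And>K. a K \<in> rL2 W"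
  shows "(\<integral>x. (\<Sum>K\<in>\<K>. a K (X x) * wal K x)\<^sup>2 \<partial>P) = (\<Sum>K\<in>\<K>. \<integral>\<omega>. (a K \<omega>)\<^sup>2 \<partial>W)"
proof -
  have int: "integrable P (\<lambda>x. (a K (X x) * a L (X x)) * (wal K x * wal L x))" for K L
    using rL2_mult_integrable[OF monomial_rL2[OF a[of K], of K] monomial_rL2[OF a[of L], of L]]
    by (simp add: mult_ac)
  have "(\<integral>x. (\<Sum>K\<in>\<K>. a K (X x) * wal K x)\<^sup>2 \<partial>P) =
      (\<integral>x. (\<Sum>K\<in>\<K>. \<Sum>L\<in>\<K>. (a K (X x) * a L (X x)) * (wal K x * wal L x)) \<partial>P)"
    by (simp add: power2_eq_square sum_product mult_ac)
  also have "\<dots> = (\<Sum>K\<in>\<K>. \<Sum>L\<in>\<K>. \<integral>x. (a K (X x) * a L (X x)) * (wal K x * wal L x) \<partial>P)"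
    using int by simp
  also have "\<dots> = (\<Sum>K\<in>\<K>. \<Sum>L\<in>\<K>. if K = L then (\<integral>\<omega>. (a K \<omega>)\<^sup>2 \<partial>W) else 0)"
  proof (intro sum.cong refl)
    fix K L assume "K \<in> \<K>" "L \<in> \<K>"
    then show "(\<integral>x. (a K (X x) * a L (X x)) * (wal K x * wal L x) \<partial>P) =
        (if K = L then (\<integral>\<omega>. (a K \<omega>)\<^sup>2 \<partial>W) else 0)"
      using integral_wal_wal[OF \<K>(2) \<K>(2) rL2_mult_integrable[OF a a], of K L K L]
      by (auto simp: power2_eq_square)
  qed
  also have "\<dots> = (\<Sum>K\<in>\<K>. \<integral>\<omega>. (a K \<omega>)\<^sup>2 \<partial>W)"
    using \<K>(1) by simp
  finally show ?thesis .
qed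

lemma integral_mult_walsh_sum:
  assumes \<K>: "finite \<K>" and a: "\<And>K. a K \<in> rL2 W" and f: "f \<in> rL2 P"
  shows "(\<integral>x. f x * (\<Sum>K\<in>\<K>. a K (X x) * wal K x) \<partial>P) = (\<Sum>K\<in>\<K>. \<integral>\<omega>. coef f K \<omega> * a K \<omega> \<partial>W)"
proof -
  have int: "integrable P (\<lambda>x. f x * (a K (X x) * wal K x))" for K
    by (rule rL2_mult_integrable[OF f monomial_rL2[OF a]])
  have "(\<integral>x. f x * (\<Sum>K\<in>\<K>. a K (X x) * wal K x) \<partial>P) = (\<Sum>K\<in>\<K>. \<integral>x. f x * (a K (X x) * wal K x) \<partial>P)"
    using int by (simp add: sum_distrib_left)
  also have "\<dots> = (\<Sum>K\<in>\<K>. \<integral>x. f x * wal K x * a K (X x) \<partial>P)"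
    by (simp add: mult_ac)
  also have "\<dots> = (\<Sum>K\<in>\<K>. \<integral>\<omega>. coef f K \<omega> * a K \<omega> \<partial>W)"
    by (simp add: integral_coef[OF f a])
  finally show ?thesis .
qed

lemma square_distance_walsh_sum:
  assumes \<K>: "finite \<K>" "\<And>K. K \<in> \<K> \<Longrightarrow> finite K" and a: "\<And>K. a K \<in> rL2 W" and f: "f \<in> rL2 P"
  shows "(\<integral>x. (f x - (\<Sum>K\<in>\<K>. a K (X x) * wal K x))\<^sup>2 \<partial>P) =
    (\<integral>x. (f x)\<^sup>2 \<partial>P) - 2 * (\<Sum>K\<in>\<K>. \<integral>\<omega>. coef f K \<omega> * a K \<omega> \<partial>W) + (\<Sum>K\<in>\<K>. \<integral>\<omega>. (a K \<omega>)\<^sup>2 \<partial>W)"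
proof -
  define g where "g x = (\<Sum>K\<in>\<K>. a K (X x) * wal K x)" for x
  have g: "g \<in> rL2 P" unfolding g_def[abs_def] by (intro rL2_sum monomial_rL2 a)
  have i: "integrable P (\<lambda>x. f x * g x)" by (rule rL2_mult_integrable[OF f g])
  have "(\<integral>x. (f x - g x)\<^sup>2 \<partial>P) = (\<integral>x. (f x)\<^sup>2 - 2 * (f x * g x) + (g x)\<^sup>2 \<partial>P)"
    by (simp add: power2_diff algebra_simps)
  also have "\<dots> = (\<integral>x. (f x)\<^sup>2 \<partial>P) - 2 * (\<integral>x. f x * g x \<partial>P) + (\<integral>x. (g x)\<^sup>2 \<partial>P)"
    using rL2_square[OF f] rL2_square[OF g] i by simp
  finally show ?thesis
    using integral_square_walsh_sum[OF \<K> a] integral_mult_walsh_sum[OF \<K>(1) a f] unfolding g_def by simp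
qed

lemma square_distance_partial:
  assumes \<K>: "finite \<K>" "\<And>K. K \<in> \<K> \<Longrightarrow> finite K" and f: "f \<in> rL2 P"
  shows "(\<integral>x. (f x - partial f \<K> x)\<^sup>2 \<partial>P) =
    (\<integral>x. (f x)\<^sup>2 \<partial>P) - (\<Sum>K\<in>\<K>. \<integral>\<omega>. (coef f K \<omega>)\<^sup>2 \<partial>W)"
  using square_distance_walsh_sum[OF \<K> coef_rL2[OF f] f]
  unfolding partial_def by (simp add: power2_eq_square)

text \<open>Completing the square: the excess of any other choice is the sum of the squared L2
  distances of its coefficients from those of \<open>f\<close>.\<close>

lemma partial_best:
  assumes \<K>: "finite \<K>" "\<And>K. K \<in> \<K> \<Longrightarrow> finite K" and a: "\<And>K. a K \<in> rL2 W" and f: "f \<in> rL2 P"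
  shows "(\<integral>x. (f x - partial f \<K> x)\<^sup>2 \<partial>P) \<le> (\<integral>x. (f x - (\<Sum>K\<in>\<K>. a K (X x) * wal K x))\<^sup>2 \<partial>P)"
proof -
  have "(\<integral>x. (f x - (\<Sum>K\<in>\<K>. a K (X x) * wal K x))\<^sup>2 \<partial>P) - (\<integral>x. (f x - partial f \<K> x)\<^sup>2 \<partial>P) =
     (\<Sum>K\<in>\<K>. (\<integral>\<omega>. (coef f K \<omega>)\<^sup>2 \<partial>W) - 2 * (\<integral>\<omega>. coef f K \<omega> * a K \<omega> \<partial>W) + (\<integral>\<omega>. (a K \<omega>)\<^sup>2 \<partial>W))"
    using square_distance_partial[OF \<K> f] square_distance_walsh_sum[OF \<K> a f]
    by (simp add: sum.distrib sum_subtractf sum_distrib_left)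
  also have "\<dots> = (\<Sum>K\<in>\<K>. \<integral>\<omega>. (coef f K \<omega> - a K \<omega>)\<^sup>2 \<partial>W)"
  proof (intro sum.cong refl)
    fix K
    have "(\<integral>\<omega>. (coef f K \<omega> - a K \<omega>)\<^sup>2 \<partial>W) = (\<integral>\<omega>. (coef f K \<omega>)\<^sup>2 - 2 * (coef f K \<omega> * a K \<omega>) + (a K \<omega>)\<^sup>2 \<partial>W)"
      by (simp add: power2_diff algebra_simps)
    then show "(\<integral>\<omega>. (coef f K \<omega>)\<^sup>2 \<partial>W) - 2 * (\<integral>\<omega>. coef f K \<omega> * a K \<omega> \<partial>W) + (\<integral>\<omega>. (a K \<omega>)\<^sup>2 \<partial>W) =
      (\<integral>\<omega>. (coef f K \<omega> - a K \<omega>)\<^sup>2 \<partial>W)"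
      using rL2_square[OF coef_rL2[OF f]] rL2_square[OF a] rL2_mult_integrable[OF coef_rL2[OF f] a] by simp
  qed
  also have "\<dots> \<ge> 0" by (intro sum_nonneg) simp
  finally show ?thesis by simp
qed

text \<open>Density supplies one good Walsh sum. Padded with zeros it competes over every larger
  index set, where by \<open>partial_best\<close> the partial sum of \<open>f\<close> is at least as
  good.\<close>

lemma partial_tendsto:
  assumes f: "f \<in> rL2 P"
  shows "((\<lambda>\<K>. \<integral>x. (f x - partial f \<K> x)\<^sup>2 \<partial>P) \<longlongrightarrow> 0) (finite_subsets_at_top {K. finite K})"
proof (rule tendstoI)
  fix e :: real assume "e > 0"
  then obtain h where h: "wpoly h" "(\<integral>x. (f x - h x)\<^sup>2 \<partial>P) < e"
    using approximable_rL2[OF f] unfolding approximable_def by blast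
  obtain \<K> a where \<K>: "finite \<K>" "\<And>K. K \<in> \<K> \<Longrightarrow> finite K" and a: "\<And>K. a K \<in> rL2 W"
    and heq: "\<And>x. h x = (\<Sum>K\<in>\<K>. a K (X x) * wal K x)" using wpoly_repr[OF h(1)] by metis
  show "eventually (\<lambda>\<K>. dist (\<integral>x. (f x - partial f \<K> x)\<^sup>2 \<partial>P) 0 < e) (finite_subsets_at_top {K. finite K})"
    unfolding eventually_finite_subsets_at_top
  proof (intro exI[of _ \<K>] conjI allI impI)
    show "finite \<K>" "\<K> \<subseteq> {K. finite K}" using \<K> by auto
    fix \<L> assume L: "finite \<L> \<and> \<K> \<subseteq> \<L> \<and> \<L> \<subseteq> {K. finite K}"
    define b where "b K = (if K \<in> \<K> then a K else (\<lambda>_. 0))" for K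
    have b: "b K \<in> rL2 W" for K using a W.rL2_const[of 0] by (simp add: b_def)
    have "h x = (\<Sum>K\<in>\<L>. b K (X x) * wal K x)" for x
      unfolding heq using L by (auto simp: b_def intro!: sum.mono_neutral_cong_left)
    then have "(\<integral>x. (f x - partial f \<L> x)\<^sup>2 \<partial>P) \<le> (\<integral>x. (f x - h x)\<^sup>2 \<partial>P)"
      using partial_best[of \<L> b f] L b f by auto
    then show "dist (\<integral>x. (f x - partial f \<L> x)\<^sup>2 \<partial>P) 0 < e"
      using h(2) by simp
  qed
qed

text \<open>The defect in Bessel's inequality is the squared distance from the partial sum, which
  tends to zero.\<close>

lemma Parseval:
  assumes f: "f \<in> rL2 P"
  shows "((\<lambda>K. \<integral>\<omega>. (coef f K \<omega>)\<^sup>2 \<partial>W) has_sum (\<integral>x. (f x)\<^sup>2 \<partial>P)) {K. finite K}"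
  unfolding has_sum_def
proof -
  have "((\<lambda>\<K>. (\<integral>x. (f x)\<^sup>2 \<partial>P) - (\<integral>x. (f x - partial f \<K> x)\<^sup>2 \<partial>P)) \<longlongrightarrow> (\<integral>x. (f x)\<^sup>2 \<partial>P) - 0)
    (finite_subsets_at_top {K. finite K})"
    by (intro tendsto_intros partial_tendsto[OF f])
  then show "(sum (\<lambda>K. \<integral>\<omega>. (coef f K \<omega>)\<^sup>2 \<partial>W) \<longlongrightarrow> (\<integral>x. (f x)\<^sup>2 \<partial>P)) (finite_subsets_at_top {K. finite K})"
    unfolding diff_zero
    by (rule Lim_transform_eventually)
      (auto intro!: eventually_finite_subsets_at_top_weakI simp: square_distance_partial[OF _ _ f] subset_iff)
qed

text \<open>The coefficient of \<open>wal K\<close> is zero on \<open>B\<close>. The formulation by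
  integrals involves no chosen version of the coefficient, restricts to smaller \<open>B\<close>,
  and can be checked directly for sums and conditional expectations.\<close>

definition vanishes :: "('b \<Rightarrow> real) \<Rightarrow> nat set \<Rightarrow> 'a set \<Rightarrow> bool" where
  "vanishes f K B \<longleftrightarrow> (\<forall>A\<in>sets W. A \<subseteq> B \<longrightarrow> (\<integral>x. f x * wal K x * indicator A (X x) \<partial>P) = 0)"

lemma (in -) AE_zero_on:
  fixes c :: "'d \<Rightarrow> real"
  assumes c: "integrable W c" and B: "B \<in> sets W"
    and 0: "\<And>A. A \<in> sets W \<Longrightarrow> A \<subseteq> B \<Longrightarrow> (\<integral>\<omega>. c \<omega> * indicator A \<omega> \<partial>W) = 0"
  shows "AE \<omega> in W. \<omega> \<in> B \<longrightarrow> c \<omega> = 0"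
proof -
  have [measurable]: "c \<in> borel_measurable W" using c by auto
  note [measurable] = B
  let ?A = "B \<inter> {\<omega> \<in> space W. c \<omega> > 0}" and ?A' = "B \<inter> {\<omega> \<in> space W. c \<omega> < 0}"
  have 1: "?A \<in> sets W" "?A' \<in> sets W" by measurable
  have int: "integrable W (\<lambda>\<omega>. c \<omega> * indicator A \<omega>)" if "A \<in> sets W" for A
    using integrable_mult_indicator[OF that c] by (simp add: mult.commute)
  have "AE \<omega> in W. c \<omega> * indicator ?A \<omega> = 0"
    using 0[OF 1(1)] integral_nonneg_eq_0_iff_AE[OF int[OF 1(1)]] by (auto simp: indicator_def)
  moreover have "AE \<omega> in W. - (c \<omega> * indicator ?A' \<omega>) = 0"
  proof -
    have "(\<integral>\<omega>. - (c \<omega> * indicator ?A' \<omega>) \<partial>W) = 0" using 0[OF 1(2)] by simp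
    then show ?thesis
      using integral_nonneg_eq_0_iff_AE[OF Bochner_Integration.integrable_minus[OF int[OF 1(2)]]]
      by (auto simp: indicator_def)
  qed
  ultimately show ?thesis
  proof (rule AE_mp[OF AE_conjI], intro AE_I2 impI)
    fix \<omega> assume "\<omega> \<in> space W" "c \<omega> * indicator ?A \<omega> = 0 \<and> - (c \<omega> * indicator ?A' \<omega>) = 0" "\<omega> \<in> B"
    then show "c \<omega> = 0" by (cases "c \<omega>" "0 :: real" rule: linorder_cases) (auto simp: indicator_def)
  qed
qed

lemma vanishes_iff:
  assumes f: "f \<in> rL2 P" and B: "B \<in> sets W"
  shows "vanishes f K B \<longleftrightarrow> (AE \<omega> in W. \<omega> \<in> B \<longrightarrow> coef f K \<omega> = 0)"
proof
  note ic = integral_coef[OF f W.rL2_indicator, of _ K]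
  {
    assume v: "vanishes f K B"
    show "AE \<omega> in W. \<omega> \<in> B \<longrightarrow> coef f K \<omega> = 0"
      by (rule AE_zero_on[OF W.rL2_integrable[OF coef_rL2[OF f]] B])
         (use v in \<open>simp add: vanishes_def ic\<close>)
  }
  assume ae: "AE \<omega> in W. \<omega> \<in> B \<longrightarrow> coef f K \<omega> = 0"
  show "vanishes f K B" unfolding vanishes_def
  proof (intro ballI impI)
    fix A assume A: "A \<in> sets W" "A \<subseteq> B"
    have "(\<integral>\<omega>. coef f K \<omega> * indicator A \<omega> \<partial>W) = (\<integral>\<omega>. 0 \<partial>W)"
      using ae A coef_measurable[OF f, of K]
      by (intro integral_cong_AE) (auto elim!: eventually_mono simp: indicator_def)
    then show "(\<integral>x. f x * wal K x * indicator A (X x) \<partial>P) = 0" using ic[OF A(1)] by simp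
  qed
qed

lemma vanishes_space_iff:
  assumes f: "f \<in> rL2 P"
  shows "vanishes f K (space W) \<longleftrightarrow> (AE \<omega> in W. coef f K \<omega> = 0)"
  unfolding vanishes_iff[OF f sets.top] by (intro AE_cong) simp

lemma zero_if_all_vanish:
  assumes f: "f \<in> rL2 P" and v: "\<And>K. finite K \<Longrightarrow> vanishes f K (space W)"
  shows "AE x in P. f x = 0"
proof -
  have "(\<integral>\<omega>. (coef f K \<omega>)\<^sup>2 \<partial>W) = 0" if "finite K" for K
  proof -
    have "(\<integral>\<omega>. (coef f K \<omega>)\<^sup>2 \<partial>W) = (\<integral>\<omega>. 0 \<partial>W)"
      using v[OF that] coef_measurable[OF f] unfolding vanishes_space_iff[OF f]
      by (intro integral_cong_AE) (auto elim!: eventually_mono)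
    then show ?thesis by simp
  qed
  then have "((\<lambda>K. \<integral>\<omega>. (coef f K \<omega>)\<^sup>2 \<partial>W) has_sum 0) {K. finite K}"
    by (intro has_sum_0) auto
  then have "(\<integral>x. (f x)\<^sup>2 \<partial>P) = 0" using Parseval[OF f] has_sum_unique by blast
  then have "AE x in P. (f x)\<^sup>2 = 0"
    using integral_nonneg_eq_0_iff_AE[OF rL2_square[OF f]] by simp
  then show ?thesis by simp
qed

lemma vanishes_add:
  assumes "f \<in> rL2 P" "g \<in> rL2 P" "vanishes f K B" "vanishes g K B"
  shows "vanishes (\<lambda>x. f x + g x) K B" "vanishes (\<lambda>x. f x - g x) K B"
proof -
  have i: "integrable P (\<lambda>x. h x * wal K x * indicator A (X x))" if "h \<in> rL2 P" "A \<in> sets W" for h A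
    using rL2_mult_integrable[OF rL2_bounded_mult[OF that(1) wal_measurable wal_bounded]
       rL2_X[OF W.rL2_indicator[OF that(2)]]] .
  show "vanishes (\<lambda>x. f x + g x) K B" "vanishes (\<lambda>x. f x - g x) K B"
    using assms i unfolding vanishes_def by (auto simp: distrib_right left_diff_distrib)
qed

lemma eq_if_differences_vanish:
  assumes f: "f \<in> rL2 P" and g: "g \<in> rL2 P"
    and v: "\<And>K. finite K \<Longrightarrow> vanishes (\<lambda>x. f x - g x) K (space W)"
  shows "AE x in P. f x = g x"
  using zero_if_all_vanish[OF rL2_diff[OF f g] v] by simp

lemma vanishes_X:
  assumes b: "b \<in> rL2 W" and K: "finite K" "K \<noteq> {}"
  shows "vanishes (\<lambda>x. b (X x)) K B"
  unfolding vanishes_def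
proof (intro ballI impI)
  fix A assume A: "A \<in> sets W"
  have "integrable W (\<lambda>\<omega>. b \<omega> * indicator A \<omega>)"
    by (rule rL2_mult_integrable[OF b W.rL2_indicator[OF A]])
  from integral_wal[OF K this] show "(\<integral>x. b (X x) * wal K x * indicator A (X x) \<partial>P) = 0"
    by (simp add: mult_ac)
qed

text \<open>Subtracting \<open>coef f {} (X x)\<close> removes the one coefficient that may be left
  and by \<open>vanishes_X\<close> creates no other.\<close>

lemma eq_coef_empty:
  assumes f: "f \<in> rL2 P" and v: "\<And>K. finite K \<Longrightarrow> K \<noteq> {} \<Longrightarrow> vanishes f K (space W)"
  shows "AE x in P. f x = coef f {} (X x)"
proof (rule eq_if_differences_vanish[OF f rL2_X[OF coef_rL2[OF f]]])
  fix K :: "nat set" assume K: "finite K"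
  show "vanishes (\<lambda>x. f x - coef f {} (X x)) K (space W)"
  proof (cases "K = {}")
    case False
    then show ?thesis
      using vanishes_add(2)[OF f rL2_X[OF coef_rL2[OF f]] v[OF K False] vanishes_X[OF coef_rL2[OF f] K False]] by blast
  next
    case True
    show ?thesis unfolding vanishes_def
    proof (intro ballI impI)
      fix A assume A: "A \<in> sets W"
      have m: "coef f {} \<in> borel_measurable W" by (rule coef_measurable[OF f])
      have "(\<integral>x. coef f {} (X x) * indicator A (X x) \<partial>P) = (\<integral>\<omega>. coef f {} \<omega> * indicator A \<omega> \<partial>W)"
        using A m by (intro integral_X) simp
      moreover have "(\<integral>x. f x * indicator A (X x) \<partial>P) = (\<integral>\<omega>. coef f {} \<omega> * indicator A \<omega> \<partial>W)"
        using integral_coef[OF f W.rL2_indicator[OF A], of "{}"] by simp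
      ultimately show "(\<integral>x. (f x - coef f {} (X x)) * wal K x * indicator A (X x) \<partial>P) = 0"
        using rL2_mult_integrable[OF f rL2_X[OF W.rL2_indicator[OF A]]]
          rL2_mult_integrable[OF rL2_X[OF coef_rL2[OF f, of "{}"]] rL2_X[OF W.rL2_indicator[OF A]]]
        by (simp add: True left_diff_distrib)
    qed
  qed
qed

text \<open>Multiplying \<open>f\<close> by the indicator of \<open>X x \<in> A\<close> multiplies
  every coefficient by \<open>indicator A\<close>, so this is Parseval for the product. For varying
  \<open>A\<close> it is the conditional form: given \<open>X\<close>, the second moment of
  \<open>f\<close> is the sum of the squared coefficients.\<close>

lemma Parseval_on:
  assumes f: "f \<in> rL2 P" and A: "A \<in> sets W"
  shows "((\<lambda>K. \<integral>\<omega>. (coef f K \<omega>)\<^sup>2 * indicator A \<omega> \<partial>W) has_sum (\<integral>x. (f x)\<^sup>2 * indicator A (X x) \<partial>P)) {K. finite K}"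
proof -
  define g where "g x = f x * indicator A (X x)" for x
  note [measurable] = A rL2_measurable[OF f] coef_measurable[OF f]
  have g: "g \<in> rL2 P" unfolding g_def[abs_def]
    by (rule rL2_bounded_mult[OF f]) (auto simp: indicator_def)
  note [measurable] = coef_measurable[OF g]
  have ae: "AE \<omega> in W. coef g K \<omega> - coef f K \<omega> * indicator A \<omega> = 0" if "finite K" for K
  proof -
    have c: "(\<lambda>\<omega>. coef f K \<omega> * indicator A \<omega>) \<in> rL2 W"
      by (rule rL2_bounded_mult[OF coef_rL2[OF f]]) (auto simp: indicator_def)
    have "AE \<omega> in W. \<omega> \<in> space W \<longrightarrow> coef g K \<omega> - coef f K \<omega> * indicator A \<omega> = 0"
    proof (rule AE_zero_on[OF W.rL2_integrable[OF rL2_diff[OF coef_rL2[OF g] c]]])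
      fix B assume B: "B \<in> sets W"
      have "(\<integral>\<omega>. coef g K \<omega> * indicator B \<omega> \<partial>W) = (\<integral>x. g x * wal K x * indicator B (X x) \<partial>P)"
        by (rule integral_coef[OF g W.rL2_indicator[OF B], symmetric])
      also have "\<dots> = (\<integral>x. f x * wal K x * indicator (A \<inter> B) (X x) \<partial>P)"
        by (intro Bochner_Integration.integral_cong) (auto simp: g_def indicator_def)
      also have "\<dots> = (\<integral>\<omega>. coef f K \<omega> * indicator (A \<inter> B) \<omega> \<partial>W)"
        by (rule integral_coef[OF f W.rL2_indicator]) (use A B in auto)
      also have "\<dots> = (\<integral>\<omega>. (coef f K \<omega> * indicator A \<omega>) * indicator B \<omega> \<partial>W)"
        by (intro Bochner_Integration.integral_cong) (auto simp: indicator_def)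
      finally show "(\<integral>\<omega>. (coef g K \<omega> - coef f K \<omega> * indicator A \<omega>) * indicator B \<omega> \<partial>W) = 0"
        using rL2_mult_integrable[OF coef_rL2[OF g, of K] W.rL2_indicator[OF B]]
          rL2_mult_integrable[OF c W.rL2_indicator[OF B]]
        by (simp add: left_diff_distrib)
    qed auto
    then show ?thesis by (auto elim!: AE_mp intro!: AE_I2)
  qed
  have geq: "(\<integral>\<omega>. (coef g K \<omega>)\<^sup>2 \<partial>W) = (\<integral>\<omega>. (coef f K \<omega>)\<^sup>2 * indicator A \<omega> \<partial>W)" if "finite K" for K
  proof (rule integral_cong_AE)
    show "AE \<omega> in W. (coef g K \<omega>)\<^sup>2 = (coef f K \<omega>)\<^sup>2 * indicator A \<omega>"
      using ae[OF that]
      by (rule eventually_mono) (auto simp: indicator_def)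
  qed measurable
  moreover have "(\<integral>x. (g x)\<^sup>2 \<partial>P) = (\<integral>x. (f x)\<^sup>2 * indicator A (X x) \<partial>P)"
    unfolding g_def by (intro Bochner_Integration.integral_cong) (auto simp: indicator_def)
  moreover have "((\<lambda>K. \<integral>\<omega>. (coef f K \<omega>)\<^sup>2 * indicator A \<omega> \<partial>W) has_sum (\<integral>x. (g x)\<^sup>2 \<partial>P)) {K. finite K}"
    using Parseval[OF g] by (rule has_sum_cong[THEN iffD1, rotated]) (simp add: geq)
  ultimately show ?thesis by simp
qed

end

text \<open>The bridge to real functions: \<open>complex_cond_exp\<close> acts on the real and
  imaginary part separately, so all further analysis is real.\<close>

lemma L2_iff: "f \<in> L2 P \<longleftrightarrow> (\<lambda>x. Re (f x)) \<in> rL2 P \<and> (\<lambda>x. Im (f x)) \<in> rL2 P"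
proof
  assume f: "f \<in> L2 P"
  then have [measurable]: "f \<in> borel_measurable P" and i: "integrable P (\<lambda>x. (cmod (f x))\<^sup>2)"
    by (auto simp: L2_def)
  have "integrable P (\<lambda>x. (Re (f x))\<^sup>2)" "integrable P (\<lambda>x. (Im (f x))\<^sup>2)"
    by (rule Bochner_Integration.integrable_bound[OF i]; simp add: cmod_power2)+
  then show "(\<lambda>x. Re (f x)) \<in> rL2 P \<and> (\<lambda>x. Im (f x)) \<in> rL2 P"
    by (simp add: rL2_def)
next
  assume f: "(\<lambda>x. Re (f x)) \<in> rL2 P \<and> (\<lambda>x. Im (f x)) \<in> rL2 P"
  then have "f \<in> borel_measurable P" by (simp add: rL2_def borel_measurable_complex_iff)
  then show "f \<in> L2 P" using f by (simp add: L2_def rL2_def cmod_power2)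
qed

context coin_space
begin

text \<open>\<open>orthogonal_expansion\<close> transcribed to an arbitrary coin space.\<close>

definition expansion :: "('b \<Rightarrow> complex) \<Rightarrow> (nat set \<Rightarrow> 'a \<Rightarrow> complex) \<Rightarrow> bool" where
  "expansion f c \<longleftrightarrow> (\<forall>K. finite K \<longrightarrow> c K \<in> L2 W) \<and>
     (\<lambda>K. \<integral>\<omega>. (cmod (c K \<omega>))\<^sup>2 \<partial>W) summable_on {K. finite K} \<and>
     ((\<lambda>\<K>. \<integral>x. (cmod (f x - (\<Sum>K\<in>\<K>. c K (X x) * (\<Prod>k\<in>K. complex_of_real (p k x)))))\<^sup>2 \<partial>P)
        \<longlongrightarrow> 0) (finite_subsets_at_top {K. finite K})"

lemma cmod_square_remainder:
  "(cmod (f x - (\<Sum>K\<in>\<K>. c K (X x) * (\<Prod>k\<in>K. complex_of_real (p k x)))))\<^sup>2 =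
    (Re (f x) - (\<Sum>K\<in>\<K>. Re (c K (X x)) * wal K x))\<^sup>2 + (Im (f x) - (\<Sum>K\<in>\<K>. Im (c K (X x)) * wal K x))\<^sup>2"
  by (simp add: cmod_power2 wal_def flip: of_real_prod)

lemma expansion_exists:
  assumes f: "f \<in> L2 P"
  shows "\<exists>c. expansion f c"
proof -
  let ?r = "\<lambda>x. Re (f x)" and ?i = "\<lambda>x. Im (f x)"
  have r: "?r \<in> rL2 P" and i: "?i \<in> rL2 P" using f by (auto simp: L2_iff)
  define c where "c K \<omega> = Complex (coef ?r K \<omega>) (coef ?i K \<omega>)" for K \<omega>
  have sq: "(\<integral>\<omega>. (cmod (c K \<omega>))\<^sup>2 \<partial>W) = (\<integral>\<omega>. (coef ?r K \<omega>)\<^sup>2 \<partial>W) + (\<integral>\<omega>. (coef ?i K \<omega>)\<^sup>2 \<partial>W)" for K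
    using rL2_square[OF coef_rL2[OF r]] rL2_square[OF coef_rL2[OF i]]
    by (simp add: cmod_power2 c_def)
  have "expansion f c"
    unfolding expansion_def
  proof (intro conjI allI impI)
    show "c K \<in> L2 W" for K unfolding L2_iff using coef_rL2[OF r] coef_rL2[OF i] by (simp add: c_def)
    show "(\<lambda>K. \<integral>\<omega>. (cmod (c K \<omega>))\<^sup>2 \<partial>W) summable_on {K. finite K}"
      unfolding sq using Parseval[OF r] Parseval[OF i]
      by (intro summable_on_add) (auto simp: summable_on_def)
    have "((\<lambda>\<K>. (\<integral>x. (?r x - partial ?r \<K> x)\<^sup>2 \<partial>P) + (\<integral>x. (?i x - partial ?i \<K> x)\<^sup>2 \<partial>P)) \<longlongrightarrow> 0 + 0)
       (finite_subsets_at_top {K. finite K})"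
      by (intro tendsto_intros partial_tendsto r i)
    moreover have "(\<integral>x. (cmod (f x - (\<Sum>K\<in>\<K>. c K (X x) * (\<Prod>k\<in>K. complex_of_real (p k x)))))\<^sup>2 \<partial>P) =
       (\<integral>x. (?r x - partial ?r \<K> x)\<^sup>2 \<partial>P) + (\<integral>x. (?i x - partial ?i \<K> x)\<^sup>2 \<partial>P)" for \<K>
      unfolding cmod_square_remainder
      using rL2_square[OF rL2_diff[OF r partial_rL2[OF r]], of \<K>] rL2_square[OF rL2_diff[OF i partial_rL2[OF i]], of \<K>]
      by (simp add: partial_def c_def)
    ultimately show "((\<lambda>\<K>. \<integral>x. (cmod (f x - (\<Sum>K\<in>\<K>. c K (X x) * (\<Prod>k\<in>K. complex_of_real (p k x)))))\<^sup>2 \<partial>P)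
        \<longlongrightarrow> 0) (finite_subsets_at_top {K. finite K})"
      by simp
  qed
  then show ?thesis by blast
qed

text \<open>Pairing with \<open>wal K x * indicator A (X x)\<close> is continuous in L2, and on a
  finite Walsh sum that contains \<open>K\<close> it returns the integral of \<open>c K\<close> over
  \<open>A\<close>. The error is only assumed to lie below \<open>E\<close>, so that the one complex
  error can serve the real and the imaginary part.\<close>

lemma real_expansion_unique:
  assumes f: "f \<in> rL2 P" and c: "\<And>K. finite K \<Longrightarrow> c K \<in> rL2 W" and K: "finite K"
    and E: "(E \<longlongrightarrow> 0) (finite_subsets_at_top {K. finite K})"
    and le: "\<And>\<K>. finite \<K> \<Longrightarrow> \<K> \<subseteq> {K. finite K} \<Longrightarrow>
      (\<integral>x. (f x - (\<Sum>K\<in>\<K>. c K (X x) * wal K x))\<^sup>2 \<partial>P) \<le> E \<K>"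
  shows "(AE \<omega> in W. c K \<omega> = 0) \<longleftrightarrow> vanishes f K (space W)"
proof -
  have eq: "(\<integral>x. f x * wal K x * indicator A (X x) \<partial>P) = (\<integral>\<omega>. c K \<omega> * indicator A \<omega> \<partial>W)"
    if A: "A \<in> sets W" for A
  proof -
    note [measurable] = A
    define D where "D = (\<integral>x. f x * wal K x * indicator A (X x) \<partial>P) - (\<integral>\<omega>. c K \<omega> * indicator A \<omega> \<partial>W)"
    have D: "D\<^sup>2 \<le> E \<K>" if \<K>: "finite \<K>" "\<K> \<subseteq> {K. finite K}" "K \<in> \<K>" for \<K>
    proof -
      define s where "s x = (\<Sum>K\<in>\<K>. c K (X x) * wal K x)" for x
      have s: "s \<in> rL2 P" unfolding s_def[abs_def] using \<K>(2) by (intro rL2_sum monomial_rL2 c) auto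
      define u where "u x = wal K x * indicator A (X x)" for x
      have um: "u \<in> borel_measurable P" unfolding u_def by measurable
      have u1: "\<bar>u x\<bar> \<le> 1" if "x \<in> space P" for x
        using wal_bounded[OF that, of K] by (auto simp: u_def indicator_def)
      have u: "u \<in> rL2 P" using rL2_bounded_mult[OF P.rL2_const[of 1] um u1] by simp
      have "(\<integral>x. s x * u x \<partial>P) = (\<Sum>L\<in>\<K>. \<integral>x. c L (X x) * wal L x * u x \<partial>P)"
        unfolding s_def sum_distrib_right using \<K>(2)
        by (intro Bochner_Integration.integral_sum rL2_mult_integrable[OF monomial_rL2 u] c) auto
      also have "\<dots> = (\<Sum>L\<in>\<K>. if L = K then (\<integral>\<omega>. c K \<omega> * indicator A \<omega> \<partial>W) else 0)"
      proof (intro sum.cong refl)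
        fix L assume "L \<in> \<K>"
        then have L: "finite L" using \<K>(2) by auto
        have i: "integrable W (\<lambda>\<omega>. c L \<omega> * indicator A \<omega>)"
          by (rule rL2_mult_integrable[OF c[OF L] W.rL2_indicator[OF A]])
        show "(\<integral>x. c L (X x) * wal L x * u x \<partial>P) = (if L = K then (\<integral>\<omega>. c K \<omega> * indicator A \<omega> \<partial>W) else 0)"
          using integral_wal_wal[OF L K i] by (auto simp: u_def mult_ac)
      qed
      also have "\<dots> = (\<integral>\<omega>. c K \<omega> * indicator A \<omega> \<partial>W)" using \<K> by simp
      finally have "(\<integral>x. s x * u x \<partial>P) = (\<integral>\<omega>. c K \<omega> * indicator A \<omega> \<partial>W)" .
      moreover have "(\<integral>x. (f x - s x) * u x \<partial>P) = (\<integral>x. f x * u x \<partial>P) - (\<integral>x. s x * u x \<partial>P)"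
        using rL2_mult_integrable[OF f u] rL2_mult_integrable[OF s u]
        by (simp add: left_diff_distrib)
      moreover have "(\<integral>x. f x * u x \<partial>P) = (\<integral>x. f x * wal K x * indicator A (X x) \<partial>P)"
        by (simp add: u_def mult.assoc)
      ultimately have "D = (\<integral>x. (f x - s x) * u x \<partial>P)"
        by (simp add: D_def)
      then have "D\<^sup>2 \<le> (\<integral>x. ((f x - s x) * u x)\<^sup>2 \<partial>P)"
        using P.rL2_abs_integral_le[OF rL2_bounded_mult[OF rL2_diff[OF f s] um u1]] by simp
      also have "\<dots> \<le> (\<integral>x. (f x - s x)\<^sup>2 \<partial>P)"
      proof (rule integral_mono_AE)
        show "AE x in P. ((f x - s x) * u x)\<^sup>2 \<le> (f x - s x)\<^sup>2"
        proof (rule AE_I2)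
          fix x assume "x \<in> space P"
          then have "(u x)\<^sup>2 \<le> 1" using u1 abs_square_le_1 by blast
          then show "((f x - s x) * u x)\<^sup>2 \<le> (f x - s x)\<^sup>2"
            using mult_left_le[of "(u x)\<^sup>2" "(f x - s x)\<^sup>2"] by (simp only: power_mult_distrib zero_le_power2)
        qed
      qed (intro rL2_square rL2_bounded_mult[OF _ um u1] rL2_diff f s; assumption)+
      also have "\<dots> \<le> E \<K>" using le[OF \<K>(1,2)] by (simp add: s_def)
      finally show ?thesis .
    qed
    \<comment> \<open>The defect \<open>D\<close> does not depend on the finite sum, and the sums
      that contain \<open>K\<close> are cofinal.\<close>
    have "eventually (\<lambda>\<K>. D\<^sup>2 \<le> E \<K>) (finite_subsets_at_top {K. finite K})"
      unfolding eventually_finite_subsets_at_top using K D by (intro exI[of _ "{K}"]) auto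
    then have "D\<^sup>2 \<le> 0"
      by (intro tendsto_lowerbound[OF E]) simp_all
    then show ?thesis by (simp add: D_def)
  qed
  show ?thesis
  proof
    assume "AE \<omega> in W. c K \<omega> = 0"
    then have "(\<integral>\<omega>. c K \<omega> * indicator A \<omega> \<partial>W) = (\<integral>\<omega>. 0 \<partial>W)" if "A \<in> sets W" for A
      using rL2_measurable[OF c[OF K]] that by (intro integral_cong_AE) (auto elim!: eventually_mono)
    then show "vanishes f K (space W)" unfolding vanishes_def using eq by simp
  next
    assume "vanishes f K (space W)"
    then have "AE \<omega> in W. \<omega> \<in> space W \<longrightarrow> c K \<omega> = 0"
      unfolding vanishes_def using eq
      by (intro AE_zero_on[OF W.rL2_integrable[OF c[OF K]]]) auto
    then show "AE \<omega> in W. c K \<omega> = 0" by (rule AE_mp) simp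
  qed
qed

lemma expansion_zero_iff:
  assumes f: "f \<in> L2 P" and c: "expansion f c" and K: "finite K"
  shows "(AE \<omega> in W. c K \<omega> = 0) \<longleftrightarrow>
    vanishes (\<lambda>x. Re (f x)) K (space W) \<and> vanishes (\<lambda>x. Im (f x)) K (space W)"
proof -
  let ?E = "\<lambda>\<K>. \<integral>x. (cmod (f x - (\<Sum>K\<in>\<K>. c K (X x) * (\<Prod>k\<in>K. complex_of_real (p k x)))))\<^sup>2 \<partial>P"
  have r: "(\<lambda>x. Re (f x)) \<in> rL2 P" and i: "(\<lambda>x. Im (f x)) \<in> rL2 P" using f by (auto simp: L2_iff)
  have cr: "(\<lambda>\<omega>. Re (c K \<omega>)) \<in> rL2 W" and ci: "(\<lambda>\<omega>. Im (c K \<omega>)) \<in> rL2 W" if "finite K" for K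
    using c that unfolding expansion_def by (auto simp: L2_iff)
  have E: "(?E \<longlongrightarrow> 0) (finite_subsets_at_top {K. finite K})"
    using c unfolding expansion_def by blast
  \<comment> \<open>The complex error is the sum of two nonnegative real ones and therefore bounds
    each of them.\<close>
  have split: "(\<integral>x. (Re (f x) - (\<Sum>K\<in>\<K>. Re (c K (X x)) * wal K x))\<^sup>2 \<partial>P) +
      (\<integral>x. (Im (f x) - (\<Sum>K\<in>\<K>. Im (c K (X x)) * wal K x))\<^sup>2 \<partial>P) = ?E \<K>"
    if "\<K> \<subseteq> {K. finite K}" for \<K>
    unfolding cmod_square_remainder
    by (rule Bochner_Integration.integral_add[symmetric];
        rule rL2_square[OF rL2_diff[OF _ rL2_sum]]; (rule r i)?; (rule monomial_rL2)?; (rule cr ci)?; use that in auto)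
  have "(AE \<omega> in W. Re (c K \<omega>) = 0) \<longleftrightarrow> vanishes (\<lambda>x. Re (f x)) K (space W)"
  proof (rule real_expansion_unique[OF r cr K E])
    fix \<K> :: "nat set set" assume "\<K> \<subseteq> {K. finite K}"
    moreover have "0 \<le> (\<integral>x. (Im (f x) - (\<Sum>K\<in>\<K>. Im (c K (X x)) * wal K x))\<^sup>2 \<partial>P)" by simp
    ultimately show "(\<integral>x. (Re (f x) - (\<Sum>K\<in>\<K>. Re (c K (X x)) * wal K x))\<^sup>2 \<partial>P) \<le> ?E \<K>"
      using split[of \<K>] by linarith
  qed
  moreover have "(AE \<omega> in W. Im (c K \<omega>) = 0) \<longleftrightarrow> vanishes (\<lambda>x. Im (f x)) K (space W)"
  proof (rule real_expansion_unique[OF i ci K E])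
    fix \<K> :: "nat set set" assume "\<K> \<subseteq> {K. finite K}"
    moreover have "0 \<le> (\<integral>x. (Re (f x) - (\<Sum>K\<in>\<K>. Re (c K (X x)) * wal K x))\<^sup>2 \<partial>P)" by simp
    ultimately show "(\<integral>x. (Im (f x) - (\<Sum>K\<in>\<K>. Im (c K (X x)) * wal K x))\<^sup>2 \<partial>P) \<le> ?E \<K>"
      using split[of \<K>] by linarith
  qed
  moreover have "(AE \<omega> in W. c K \<omega> = 0) \<longleftrightarrow> (AE \<omega> in W. Re (c K \<omega>) = 0) \<and> (AE \<omega> in W. Im (c K \<omega>) = 0)"
    by (simp add: complex_eq_iff)
  ultimately show ?thesis by simp
qed

text \<open>The sets that agree with a member of \<open>S\<close> almost surely where
  \<open>Q\<close> holds form a sigma-field, so it is enough to test generators. The predicate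
  \<open>Q\<close> makes it possible to compare two fields on one event only.\<close>

lemma (in -) sigma_sets_AE_class:
  assumes "C \<in> sigma_sets (space P) G" and "space S = space P"
    and "\<And>C. C \<in> G \<Longrightarrow> \<exists>D\<in>sets S. AE x in P. Q x \<longrightarrow> (x \<in> C \<longleftrightarrow> x \<in> D)"
  shows "\<exists>D\<in>sets S. AE x in P. Q x \<longrightarrow> (x \<in> C \<longleftrightarrow> x \<in> D)"
  using assms(1)
proof (induction rule: sigma_sets.induct)
  case (Basic C)
  then show ?case by (rule assms(3))
next
  case Empty
  then show ?case by (intro bexI[of _ "{}"]) auto
next
  case (Compl C)
  then obtain D where "D \<in> sets S" "AE x in P. Q x \<longrightarrow> (x \<in> C \<longleftrightarrow> x \<in> D)" by blast
  then show ?case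
    by (intro bexI[of _ "space S - D"] sets.compl_sets) (auto simp: assms(2) elim!: AE_mp intro!: AE_I2)
next
  case (Union C)
  then have "\<forall>i. \<exists>D. D \<in> sets S \<and> (AE x in P. Q x \<longrightarrow> (x \<in> C i \<longleftrightarrow> x \<in> D))" by blast
  from choice[OF this] obtain D
    where D: "\<And>i. D i \<in> sets S" "\<And>i. AE x in P. Q x \<longrightarrow> (x \<in> C i \<longleftrightarrow> x \<in> D i)" by blast
  then have "AE x in P. \<forall>i. Q x \<longrightarrow> (x \<in> C i \<longleftrightarrow> x \<in> D i)" unfolding AE_all_countable by blast
  then have "AE x in P. Q x \<longrightarrow> (x \<in> (\<Union>i. C i) \<longleftrightarrow> x \<in> (\<Union>i. D i))"
    by (rule eventually_mono) blast
  moreover have "(\<Union>i. D i) \<in> sets S" using D(1) by auto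
  ultimately show ?case by blast
qed

text \<open>On the event \<open>X x \<in> A\<close> the field \<open>N\<close> cannot distinguish
  its events from ones that ignore the \<open>k\<close>-th coin. Hence \<open>wal K\<close>, cut off
  to a part of that event, has conditional expectation zero given \<open>N\<close>, because it
  contains the factor \<open>p k\<close>.\<close>

lemma orthogonal_on:
  assumes N: "subalgebra P N" "sets N = sigma_sets (space P) G"
    and A: "A \<in> sets W" and k: "finite K" "k \<in> K"
    and G: "\<And>C. C \<in> G \<Longrightarrow> \<exists>D\<in>sets (others k). AE x in P. X x \<in> A \<longrightarrow> (x \<in> C \<longleftrightarrow> x \<in> D)"
    and Y: "Y \<in> rL2 P" "Y \<in> borel_measurable N"
  shows "vanishes Y K A"
  unfolding vanishes_def
proof (intro ballI impI)
  fix B assume B: "B \<in> sets W" "B \<subseteq> A"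
  note [measurable] = B(1)
  define u where "u x = wal K x * indicator B (X x)" for x
  have um [measurable]: "u \<in> borel_measurable P" unfolding u_def by measurable
  have u1: "\<bar>u x\<bar> \<le> 1" if "x \<in> space P" for x
    using wal_bounded[OF that, of K] by (auto simp: u_def indicator_def)
  have u: "u \<in> rL2 P" using rL2_bounded_mult[OF P.rL2_const[of 1] um u1] by simp
  interpret S: sigma_finite_subalgebra P N
    by (rule subalgebra_sigma_finite[OF P.prob_space_axioms N(1)])
  have "AE x in P. real_cond_exp P N u x = 0"
  proof (rule S.real_cond_exp_charact)
    fix C assume C: "C \<in> sets N"
    then have [measurable]: "C \<in> sets P" using N(1) by (auto simp: subalgebra_def)
    from C have C': "C \<in> sigma_sets (space P) G" using N(2) by simp
    obtain D where D [measurable]: "D \<in> sets (others k)" and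
      ae: "AE x in P. X x \<in> A \<longrightarrow> (x \<in> C \<longleftrightarrow> x \<in> D)"
      using sigma_sets_AE_class[OF C' space_others G] by blast
    have [measurable]: "D \<in> sets P" using D subalgebra_others[of k] unfolding subalgebra_def by blast
    have [measurable]: "wal (K - {k}) \<in> borel_measurable (others k)" by (rule wal_others) simp
    define h where "h x = indicator D x * wal (K - {k}) x * indicator B (X x)" for x
    have h: "h \<in> borel_measurable (others k)" unfolding h_def by measurable
    have "integrable P h"
    proof (rule P.integrable_const_bound[of _ 1])
      show "AE x in P. norm (h x) \<le> 1"
        using wal_bounded by (intro AE_I2) (auto simp: h_def indicator_def)
      show "h \<in> borel_measurable P" unfolding h_def by measurable
    qed
    from integral_mult_p[OF h this] have 0: "(\<integral>x. h x * p k x \<partial>P) = 0" .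
    \<comment> \<open>\<open>C\<close> may be exchanged for \<open>D\<close>: the two agree where
      \<open>X x \<in> A\<close>, and \<open>u\<close> vanishes elsewhere.\<close>
    have "set_lebesgue_integral P C u = (\<integral>x. h x * p k x \<partial>P)"
      unfolding set_lebesgue_integral_def
    proof (rule integral_cong_AE)
      show "(\<lambda>x. h x * p k x) \<in> borel_measurable P" unfolding h_def by measurable
      show "AE x in P. indicator C x *\<^sub>R u x = h x * p k x"
        using ae by (rule AE_mp) (use B(2) wal_remove[OF k] in \<open>auto intro!: AE_I2 simp: h_def u_def indicator_def\<close>)
    qed measurable
    then show "set_lebesgue_integral P C u = (\<integral>x\<in>C. 0 \<partial>P)" using 0 by simp
  qed (use P.rL2_integrable[OF u] in auto)
  moreover have "(\<integral>x. Y x * u x \<partial>P) = (\<integral>x. Y x * real_cond_exp P N u x \<partial>P)"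
    using S.real_cond_exp_intg(2)[OF rL2_mult_integrable[OF Y(1) u] Y(2) um] by simp
  moreover have "\<dots> = (\<integral>x. 0 \<partial>P)" if "AE x in P. real_cond_exp P N u x = 0"
    using that rL2_measurable[OF Y(1)] by (intro integral_cong_AE) (auto elim!: eventually_mono)
  ultimately show "(\<integral>x. Y x * wal K x * indicator B (X x) \<partial>P) = 0"
    by (simp add: u_def mult_ac)
qed

end

subsection \<open>Randomly selected coins\<close>

text \<open>\<open>\<kappa> j\<close> is the index, chosen by looking at the base, of the coin used
  in place \<open>j\<close>. Injectivity forbids using a coin twice; together with the conditional
  independence of the coins it makes the selected ones fair and independent given
  \<open>X\<close>.\<close>

locale coin_selection = coin_space +
  fixes \<kappa> :: "nat \<Rightarrow> 'b \<Rightarrow> nat"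
  assumes \<kappa>_measurable [measurable]: "\<kappa> j \<in> W \<rightarrow>\<^sub>M count_space UNIV"
    and \<kappa>_inj: "\<omega> \<in> space W \<Longrightarrow> inj (\<lambda>j. \<kappa> j \<omega>)"
begin

definition q :: "nat \<Rightarrow> 'a \<Rightarrow> real" where
  "q j x = p (\<kappa> j (X x)) x"

definition qcyl :: "'b set \<Rightarrow> nat set \<Rightarrow> 'a set" where
  "qcyl A J = {x \<in> space P. X x \<in> A \<and> (\<forall>j\<in>J. q j x = 1)}"

lemma X_space: "x \<in> space P \<Longrightarrow> X x \<in> space W"
  using measurable_space[OF X_measurable] .

lemma q_measurable [measurable]: "q j \<in> borel_measurable P"
  unfolding q_def by (rule measurable_compose_countable[where f=p and g="\<lambda>x. \<kappa> j (X x)"]) measurable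

lemma q_values: "x \<in> space P \<Longrightarrow> q j x \<in> {-1, 1}"
  unfolding q_def by (rule p_values)

lemma q_bounded: "x \<in> space P \<Longrightarrow> \<bar>q j x\<bar> \<le> 1"
  using q_values[of x j] by auto

lemma qcyl_sets [measurable]: "A \<in> sets W \<Longrightarrow> finite J \<Longrightarrow> qcyl A J \<in> sets P"
proof -
  assume [measurable]: "A \<in> sets W" and J: "finite J"
  show ?thesis unfolding qcyl_def using J
    by (intro sets.sets_Collect sets.sets_Collect_finite_All) measurable
qed

lemma qcyl_subset: "qcyl A J \<subseteq> space P"
  unfolding qcyl_def by auto

lemma qcyl_Int: "qcyl A J \<inter> qcyl B K = qcyl (A \<inter> B) (J \<union> K)"
  unfolding qcyl_def by auto

text \<open>A substitute for the event \<open>q j x = 1\<close> that never looks at the coin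
  \<open>k\<close>. It is correct whenever the \<open>j\<close>-th selection is some other
  coin.\<close>

definition q_avoiding :: "nat \<Rightarrow> nat \<Rightarrow> 'a set" where
  "q_avoiding k j = (\<Union>n\<in>-{k}. {x \<in> space P. \<kappa> j (X x) = n \<and> p n x = 1})"

lemma q_avoiding_sets: "q_avoiding k j \<in> sets (others k)"
proof -
  have "{x \<in> space P. \<kappa> j (X x) = n \<and> p n x = 1} \<in> sets (others k)" if "n \<noteq> k" for n
  proof -
    note [measurable] = p_others[OF that]
    have "{x \<in> space (others k). \<kappa> j (X x) = n \<and> p n x = 1} \<in> sets (others k)" by measurable
    then show ?thesis by simp
  qed
  then show ?thesis unfolding q_avoiding_def by (intro sets.countable_UN') auto
qed

lemma q_avoiding_iff:
  "x \<in> space P \<Longrightarrow> \<kappa> j (X x) \<noteq> k \<Longrightarrow> x \<in> q_avoiding k j \<longleftrightarrow> q j x = 1"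
  unfolding q_avoiding_def q_def by auto

text \<open>Split according to the value \<open>n\<close> of the \<open>j\<close>-th selection. By
  injectivity no selection in \<open>J\<close> equals \<open>n\<close> then, so on this piece the
  cylinder is an event of \<open>others n\<close> and the factor \<open>p n\<close> makes the
  integral zero.\<close>

lemma integral_qcyl_q:
  assumes A: "A \<in> sets W" and J: "finite J" "j \<notin> J" and g: "integrable W g"
  shows "(\<integral>x. g (X x) * indicator (qcyl A J) x * q j x \<partial>P) = 0"
proof -
  note [measurable] = A
  have [measurable]: "g \<in> borel_measurable W" using g by auto
  have [measurable]: "qcyl A J \<in> sets P" using A J by simp
  have gi: "integrable P (\<lambda>x. g (X x))" using g by (simp add: integrable_X_iff)
  have zero: "(\<integral>x. g (X x) * indicator (qcyl A J) x * indicator {x \<in> space P. \<kappa> j (X x) = n} x * p n x \<partial>P) = 0" for n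
  proof -
    define D where "D = {x \<in> space P. X x \<in> A \<and> \<kappa> j (X x) = n} \<inter> {x \<in> space P. \<forall>i\<in>J. x \<in> q_avoiding n i}"
    have "{x \<in> space (others n). X x \<in> A \<and> \<kappa> j (X x) = n} \<in> sets (others n)" by measurable
    moreover have "{x \<in> space (others n). \<forall>i\<in>J. x \<in> q_avoiding n i} \<in> sets (others n)"
    proof (rule sets.sets_Collect_finite_All[OF _ J(1)])
      fix i
      have "{x \<in> space (others n). x \<in> q_avoiding n i} = q_avoiding n i" by (auto simp: q_avoiding_def)
      then show "{x \<in> space (others n). x \<in> q_avoiding n i} \<in> sets (others n)" using q_avoiding_sets by simp
    qed
    ultimately have D [measurable]: "D \<in> sets (others n)" unfolding D_def by simp
    have "x \<in> D \<longleftrightarrow> x \<in> qcyl A J \<and> \<kappa> j (X x) = n" if x: "x \<in> space P" for x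
    proof (cases "\<kappa> j (X x) = n")
      case True
      have "\<kappa> i (X x) \<noteq> n" if "i \<in> J" for i
        using \<kappa>_inj[OF X_space[OF x]] True J(2) that by (auto dest: injD)
      then show ?thesis using True x q_avoiding_iff[OF x] by (auto simp: D_def qcyl_def)
    qed (simp add: D_def)
    then have "(\<integral>x. g (X x) * indicator (qcyl A J) x * indicator {x \<in> space P. \<kappa> j (X x) = n} x * p n x \<partial>P) =
        (\<integral>x. g (X x) * indicator D x * p n x \<partial>P)"
      by (intro Bochner_Integration.integral_cong) (auto simp: indicator_def)
    also have "\<dots> = 0"
    proof (rule integral_mult_p)
      show "(\<lambda>x. g (X x) * indicator D x) \<in> borel_measurable (others n)" by measurable
      have "D \<in> sets P" using D subalgebra_others[of n] unfolding subalgebra_def by blast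
      then show "integrable P (\<lambda>x. g (X x) * indicator D x)"
        using integrable_mult_indicator[OF _ gi] by (simp add: mult.commute)
    qed
    finally show ?thesis .
  qed
  define F where "F x = g (X x) * indicator (qcyl A J) x * q j x" for x
  \<comment> \<open>At each point at most one term is nonzero, the one with
    \<open>n = \<kappa> j (X x)\<close>. The partial sums are thus eventually equal to
    \<open>F\<close> and dominated by \<open>\<bar>g (X x)\<bar>\<close>.\<close>
  define s where "s N x = (\<Sum>n<N. g (X x) * indicator (qcyl A J) x * indicator {x \<in> space P. \<kappa> j (X x) = n} x * p n x)" for N :: nat and x
  have s: "s N x = (if \<kappa> j (X x) < N then F x else 0)" if "x \<in> space P" for N x
  proof -
    have "s N x = (\<Sum>n<N. if \<kappa> j (X x) = n then F x else 0)"
      unfolding s_def using that by (intro sum.cong) (auto simp: F_def q_def)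
    then show ?thesis by simp
  qed
  have [measurable]: "F \<in> borel_measurable P" "s N \<in> borel_measurable P" for N
    unfolding F_def s_def by measurable
  have "(\<lambda>N. \<integral>x. s N x \<partial>P) \<longlonglongrightarrow> (\<integral>x. F x \<partial>P)"
  proof (rule integral_dominated_convergence[where w="\<lambda>x. \<bar>g (X x)\<bar>"])
    show "integrable P (\<lambda>x. \<bar>g (X x)\<bar>)" using gi by simp
    show "AE x in P. (\<lambda>N. s N x) \<longlonglongrightarrow> F x"
    proof (rule AE_I2)
      fix x assume x: "x \<in> space P"
      show "(\<lambda>N. s N x) \<longlonglongrightarrow> F x"
        by (rule tendsto_eventually, rule eventually_sequentiallyI[of "Suc (\<kappa> j (X x))"]) (simp add: s[OF x])
    qed
    show "AE x in P. norm (s N x) \<le> \<bar>g (X x)\<bar>" for N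
      using q_bounded[of _ j]
      by (intro AE_I2) (auto simp: s F_def indicator_def abs_mult mult_left_le)
  qed measurable
  moreover have "(\<integral>x. s N x \<partial>P) = 0" for N
  proof -
    have "integrable P (\<lambda>x. g (X x) * indicator (qcyl A J) x * indicator {x \<in> space P. \<kappa> j (X x) = n} x * p n x)" for n
      by (rule Bochner_Integration.integrable_bound[OF gi])
        (auto intro!: AE_I2 simp: indicator_def abs_mult mult_left_le p_bounded)
    then show ?thesis unfolding s_def using zero by (subst Bochner_Integration.integral_sum) auto
  qed
  ultimately have "(\<lambda>N. 0) \<longlonglongrightarrow> (\<integral>x. F x \<partial>P)" by simp
  then have "(\<integral>x. F x \<partial>P) = 0" by (simp add: LIMSEQ_const_iff)
  then show ?thesis unfolding F_def .
qed

text \<open>Each further coin contributes the factor \<open>(1 + q j x) / 2\<close>, whose second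
  summand integrates to zero by \<open>integral_qcyl_q\<close>.\<close>

lemma integral_qcyl:
  fixes g :: "'b \<Rightarrow> real"
  assumes A: "A \<in> sets W" and J: "finite J" and g: "integrable W g"
  shows "(\<integral>x. g (X x) * indicator (qcyl A J) x \<partial>P) = (\<integral>\<omega>. g \<omega> * indicator A \<omega> \<partial>W) / 2 ^ card J"
  using J
proof (induction J)
  case empty
  have "(\<integral>x. g (X x) * indicator (qcyl A {}) x \<partial>P) = (\<integral>x. g (X x) * indicator A (X x) \<partial>P)"
    by (rule Bochner_Integration.integral_cong[OF refl]) (simp add: qcyl_def indicator_def)
  also have "\<dots> = (\<integral>\<omega>. g \<omega> * indicator A \<omega> \<partial>W)"
    using integral_X[of "\<lambda>\<omega>. g \<omega> * indicator A \<omega>"] g A by simp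
  finally show ?case by simp
next
  case (insert j J)
  have [measurable]: "g \<in> borel_measurable W" using g by auto
  have [measurable]: "qcyl A J \<in> sets P" using A insert(1) by simp
  have gi: "integrable P (\<lambda>x. g (X x))" using g by (simp add: integrable_X_iff)
  have i1: "integrable P (\<lambda>x. g (X x) * indicator (qcyl A J) x)"
    using integrable_mult_indicator[OF _ gi, of "qcyl A J"] by (simp add: mult.commute)
  have i2: "integrable P (\<lambda>x. g (X x) * indicator (qcyl A J) x * q j x)"
    by (rule Bochner_Integration.integrable_bound[OF i1])
      (auto intro!: AE_I2 simp: abs_mult mult_left_le q_bounded)
  have "(\<integral>x. g (X x) * indicator (qcyl A (insert j J)) x \<partial>P) =
      (\<integral>x. (g (X x) * indicator (qcyl A J) x + g (X x) * indicator (qcyl A J) x * q j x) / 2 \<partial>P)"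
  proof (intro Bochner_Integration.integral_cong refl)
    fix x assume "x \<in> space P"
    then show "g (X x) * indicator (qcyl A (insert j J)) x =
       (g (X x) * indicator (qcyl A J) x + g (X x) * indicator (qcyl A J) x * q j x) / 2"
      using q_values[of x j] by (auto simp: qcyl_def indicator_def)
  qed
  also have "\<dots> = (\<integral>x. g (X x) * indicator (qcyl A J) x \<partial>P) / 2"
    using i1 i2 integral_qcyl_q[OF A insert(1,2) g] by simp
  finally show ?case using insert by simp
qed

text \<open>The selected coins carry no information about \<open>X\<close>, so predicting a function
  of \<open>X\<close> from \<open>N\<close> is no better than predicting it from \<open>F\<close>.
  On the Int-stable cylinders both candidates have the same integral, with the common factor
  \<open>1 / 2 ^ card J\<close>; the Dynkin argument does the rest.\<close>

lemma cond_exp_X: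
  assumes F: "subalgebra W F" and N: "subalgebra P N" and XN: "X \<in> N \<rightarrow>\<^sub>M F"
    and gen: "\<And>C. C \<in> sets N \<Longrightarrow>
      \<exists>D\<in>sigma_sets (space P) {qcyl A J |A J. A \<in> sets F \<and> finite J}. AE x in P. x \<in> C \<longleftrightarrow> x \<in> D"
    and g: "integrable W g"
  shows "AE x in P. real_cond_exp P N (\<lambda>x. g (X x)) x = real_cond_exp W F g (X x)"
proof -
  interpret F: sigma_finite_subalgebra W F
    by (rule subalgebra_sigma_finite[OF W.prob_space_axioms F])
  interpret N: sigma_finite_subalgebra P N
    by (rule subalgebra_sigma_finite[OF P.prob_space_axioms N])
  define h where "h = real_cond_exp W F g"
  have h: "integrable W h" "h \<in> borel_measurable F" unfolding h_def using F.real_cond_exp_int(1)[OF g] by auto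
  have gm [measurable]: "g \<in> borel_measurable W" "h \<in> borel_measurable W" using g h by auto
  have gi: "integrable P (\<lambda>x. g (X x))" "integrable P (\<lambda>x. h (X x))" using g h(1) by (simp_all add: integrable_X_iff)
  let ?G = "{qcyl A J |A J. A \<in> sets F \<and> finite J}"
  have st: "Int_stable ?G" unfolding Int_stable_def by (force simp: qcyl_Int)
  have sub: "?G \<subseteq> Pow (space P)" using qcyl_subset by blast
  have GP: "sigma_sets (space P) ?G \<subseteq> sets P"
    by (rule sets.sigma_sets_subset) (use F in \<open>auto simp: subalgebra_def\<close>)
  have spF: "space W \<in> sets F" using F by (metis sets.top subalgebra_def)
  have on_cyl: "set_lebesgue_integral P (qcyl A J) (\<lambda>x. g (X x)) = set_lebesgue_integral P (qcyl A J) (\<lambda>x. h (X x))"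
    if A: "A \<in> sets F" and J: "finite J" for A J
  proof -
    have AW: "A \<in> sets W" using A F by (auto simp: subalgebra_def)
    have "(\<integral>\<omega>. g \<omega> * indicator A \<omega> \<partial>W) = (\<integral>\<omega>. h \<omega> * indicator A \<omega> \<partial>W)"
      using F.real_cond_exp_intA[OF g A] unfolding h_def set_lebesgue_integral_def by (simp add: mult.commute)
    then show ?thesis
      using integral_qcyl[OF AW J g] integral_qcyl[OF AW J h(1)]
      unfolding set_lebesgue_integral_def by (simp add: mult.commute)
  qed
  have "qcyl (space W) {} = space P" using X_space by (auto simp: qcyl_def)
  then have whole: "(\<integral>x. g (X x) \<partial>P) = (\<integral>x. h (X x) \<partial>P)"
    using on_cyl[OF spF, of "{}"] by (simp add: set_integral_space gi)
  have main: "set_lebesgue_integral P D (\<lambda>x. g (X x)) = set_lebesgue_integral P D (\<lambda>x. h (X x))"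
    if "D \<in> sigma_sets (space P) ?G" for D
    using st sub that
  proof (induction rule: sigma_sets_induct_disjoint)
    case (basic A)
    then obtain B J where "A = qcyl B J" "B \<in> sets F" "finite J" by auto
    then show ?case using on_cyl by simp
  next
    case empty
    then show ?case by (simp add: set_lebesgue_integral_def)
  next
    case (compl A)
    then have A: "A \<in> sets P" using GP by blast
    have "set_lebesgue_integral P (space P - A) f = (\<integral>x. f x \<partial>P) - set_lebesgue_integral P A f"
      if f: "integrable P f" for f :: "'a \<Rightarrow> real"
    proof -
      have "set_lebesgue_integral P (space P - A) f = (\<integral>x. f x - indicator A x *\<^sub>R f x \<partial>P)"
        unfolding set_lebesgue_integral_def
        by (intro Bochner_Integration.integral_cong) (auto simp: indicator_def)
      then show ?thesis using f integrable_mult_indicator[OF A f] by (simp add: set_lebesgue_integral_def)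
    qed
    then show ?case using gi whole compl.IH by simp
  next
    case (union A)
    have A: "A i \<in> sets P" for i using union(2) GP by blast
    have "set_lebesgue_integral P (\<Union>i. A i) f = (\<Sum>i. set_lebesgue_integral P (A i) f)"
      if f: "integrable P f" for f :: "'a \<Rightarrow> real"
    proof (rule lebesgue_integral_countable_add[OF A])
      show "i \<noteq> j \<Longrightarrow> A i \<inter> A j = {}" for i j using union(1) by (auto simp: disjoint_family_on_def)
      show "set_integrable P (\<Union> (range A)) f"
        unfolding set_integrable_def using A by (intro integrable_mult_indicator[OF _ f]) auto
    qed
    then show ?case using gi union.IH by simp
  qed
  show ?thesis unfolding h_def[symmetric]
  proof (rule N.real_cond_exp_charact)
    fix C assume C: "C \<in> sets N"
    obtain D where D: "D \<in> sigma_sets (space P) ?G" and ae: "AE x in P. x \<in> C \<longleftrightarrow> x \<in> D" using gen[OF C] by blast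
    have CD: "C \<in> sets P" "D \<in> sets P" using C N D GP by (auto simp: subalgebra_def)
    have "set_lebesgue_integral P C f = set_lebesgue_integral P D f" if "f \<in> borel_measurable P" for f :: "'a \<Rightarrow> real"
      unfolding set_lebesgue_integral_def
    proof (rule integral_cong_AE)
      show "AE x in P. indicator C x *\<^sub>R f x = indicator D x *\<^sub>R f x"
        using ae by (rule eventually_mono) (simp add: indicator_def)
    qed (use CD that in measurable)
    then show "set_lebesgue_integral P C (\<lambda>x. g (X x)) = set_lebesgue_integral P C (\<lambda>x. h (X x))"
      using main[OF D] by simp
  next
    show "(\<lambda>x. h (X x)) \<in> borel_measurable N" using h(2) XN by measurable
  qed (use gi in auto)
qed

text \<open>Averaging over the coins given all of \<open>X\<close> leaves only what \<open>F\<close>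
  knows. By duality: in the integral of \<open>Y\<close> against \<open>indicator A (X x)\<close>
  the indicator may be replaced by its conditional expectation given \<open>N\<close>, which by
  \<open>cond_exp_X\<close> is that given \<open>F\<close>; self-adjointness of the latter moves it
  onto the average of \<open>Y\<close>.\<close>

lemma local_projection:
  fixes Y :: "'a \<Rightarrow> real"
  assumes F: "subalgebra W F" and N: "subalgebra P N" and XN: "X \<in> N \<rightarrow>\<^sub>M F"
    and gen: "\<And>C. C \<in> sets N \<Longrightarrow>
      \<exists>D\<in>sigma_sets (space P) {qcyl A J |A J. A \<in> sets F \<and> finite J}. AE x in P. x \<in> C \<longleftrightarrow> x \<in> D"
    and Y: "integrable P Y" "Y \<in> borel_measurable N"
  shows "\<exists>y. integrable W y \<and> y \<in> borel_measurable F \<and>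
    (\<forall>A\<in>sets W. (\<integral>x. Y x * indicator A (X x) \<partial>P) = (\<integral>\<omega>. y \<omega> * indicator A \<omega> \<partial>W))"
proof -
  interpret F: sigma_finite_subalgebra W F
    by (rule subalgebra_sigma_finite[OF W.prob_space_axioms F])
  interpret N: sigma_finite_subalgebra P N
    by (rule subalgebra_sigma_finite[OF P.prob_space_axioms N])
  have Xsp: "X \<in> space P \<rightarrow> space W" using X_space by auto
  define V where "V = vimage_algebra (space P) X W"
  have V: "subalgebra P V" unfolding subalgebra_def V_def by (auto simp: sets_vimage_algebra2[OF Xsp])
  interpret V: sigma_finite_subalgebra P V
    by (rule subalgebra_sigma_finite[OF P.prob_space_axioms V])
  have Ym [measurable]: "Y \<in> borel_measurable P" using Y by auto
  obtain v where v [measurable]: "v \<in> borel_measurable W" and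
    vX: "\<And>x. x \<in> space P \<Longrightarrow> real_cond_exp P V Y x = v (X x)"
    using Doob_Dynkin_real[OF Xsp, of "real_cond_exp P V Y"] unfolding V_def by auto
  have "integrable P (real_cond_exp P V Y) \<longleftrightarrow> integrable P (\<lambda>x. v (X x))"
    by (rule Bochner_Integration.integrable_cong) (simp_all add: vX)
  then have "integrable P (\<lambda>x. v (X x))"
    using V.real_cond_exp_int(1)[OF Y(1)] by simp
  then have vi: "integrable W v" by (simp add: integrable_X_iff)
  have bd: "integrable W (\<lambda>\<omega>. f \<omega> * b \<omega>)"
    if "integrable W f" "b \<in> borel_measurable W" "AE \<omega> in W. \<bar>b \<omega>\<bar> \<le> 1" for f b :: "'b \<Rightarrow> real"
  proof (rule Bochner_Integration.integrable_bound[OF that(1)])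
    show "(\<lambda>\<omega>. f \<omega> * b \<omega>) \<in> borel_measurable W" using that by measurable
    show "AE \<omega> in W. norm (f \<omega> * b \<omega>) \<le> norm (f \<omega>)"
      using that(3) by (rule eventually_mono) (simp add: abs_mult mult_left_le)
  qed
  have bdP: "integrable P (\<lambda>x. Y x * b (X x))"
    if "b \<in> borel_measurable W" "AE \<omega> in W. \<bar>b \<omega>\<bar> \<le> 1" for b :: "'b \<Rightarrow> real"
  proof (rule Bochner_Integration.integrable_bound[OF Y(1)])
    show "(\<lambda>x. Y x * b (X x)) \<in> borel_measurable P" using that(1) by measurable
    show "AE x in P. norm (Y x * b (X x)) \<le> norm (Y x)"
      using AE_X[OF that(2)] by (rule eventually_mono) (simp add: abs_mult mult_left_le)
  qed
  have proj: "(\<integral>x. Y x * b (X x) \<partial>P) = (\<integral>\<omega>. v \<omega> * b \<omega> \<partial>W)"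
    if b [measurable]: "b \<in> borel_measurable W" and b1: "AE \<omega> in W. \<bar>b \<omega>\<bar> \<le> 1" for b :: "'b \<Rightarrow> real"
  proof -
    have "X \<in> V \<rightarrow>\<^sub>M W" unfolding V_def by (rule measurable_vimage_algebra1[OF Xsp])
    then have m: "(\<lambda>x. b (X x)) \<in> borel_measurable V" by measurable
    have "integrable P (\<lambda>x. b (X x) * Y x)" using bdP[OF b b1] by (simp add: mult.commute)
    from V.real_cond_exp_intg(2)[OF this m Ym]
    have "(\<integral>x. b (X x) * Y x \<partial>P) = (\<integral>x. b (X x) * real_cond_exp P V Y x \<partial>P)" by simp
    also have "\<dots> = (\<integral>x. v (X x) * b (X x) \<partial>P)"
      by (intro Bochner_Integration.integral_cong) (auto simp: vX)
    also have "\<dots> = (\<integral>\<omega>. v \<omega> * b \<omega> \<partial>W)" by (rule integral_X) measurable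
    finally show ?thesis by (simp add: mult.commute)
  qed
  \<comment> \<open>\<open>v\<close> is the average of \<open>Y\<close> given \<open>X\<close>. The
    chain below shows that its projection to \<open>F\<close> has the same integrals over all events
    of W.\<close>
  define y where "y = real_cond_exp W F v"
  have y: "integrable W y" "y \<in> borel_measurable F" unfolding y_def using F.real_cond_exp_int(1)[OF vi] by auto
  have "(\<integral>x. Y x * indicator A (X x) \<partial>P) = (\<integral>\<omega>. y \<omega> * indicator A \<omega> \<partial>W)" if A [measurable]: "A \<in> sets W" for A
  proof -
    define a :: "'b \<Rightarrow> real" where "a = indicator A"
    have a [measurable]: "a \<in> borel_measurable W" and ai: "integrable W a" and a1: "AE \<omega> in W. \<bar>a \<omega>\<bar> \<le> 1"
      unfolding a_def by (auto simp: W.emeasure_eq_measure)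
    define h where "h = real_cond_exp W F a"
    have h: "h \<in> borel_measurable F" "h \<in> borel_measurable W" unfolding h_def by auto
    have h1: "AE \<omega> in W. \<bar>h \<omega>\<bar> \<le> 1"
    proof -
      have "AE \<omega> in W. 0 \<le> h \<omega>" unfolding h_def by (rule F.real_cond_exp_ge_c[OF ai]) (simp add: a_def)
      moreover have "AE \<omega> in W. h \<omega> \<le> 1" unfolding h_def by (rule F.real_cond_exp_le_c[OF ai]) (simp add: a_def)
      ultimately show ?thesis by eventually_elim simp
    qed
    have "(\<integral>x. Y x * a (X x) \<partial>P) = (\<integral>x. Y x * real_cond_exp P N (\<lambda>x. a (X x)) x \<partial>P)"
      using N.real_cond_exp_intg(2)[OF bdP[OF a a1] Y(2)] by simp
    also have "\<dots> = (\<integral>x. Y x * h (X x) \<partial>P)"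
    proof (rule integral_cong_AE)
      show "AE x in P. Y x * real_cond_exp P N (\<lambda>x. a (X x)) x = Y x * h (X x)"
        using cond_exp_X[OF F N XN gen ai] unfolding h_def by (auto elim!: eventually_mono)
    qed (use h in measurable)
    also have "\<dots> = (\<integral>\<omega>. v \<omega> * h \<omega> \<partial>W)" by (rule proj[OF h(2) h1])
    also have "\<dots> = (\<integral>\<omega>. h \<omega> * v \<omega> \<partial>W)" by (simp add: mult.commute)
    also have "\<dots> = (\<integral>\<omega>. h \<omega> * y \<omega> \<partial>W)"
      unfolding y_def using F.real_cond_exp_intg(2)[of h v] bd[OF vi h(2) h1] h v by (simp add: mult.commute)
    also have "\<dots> = (\<integral>\<omega>. y \<omega> * h \<omega> \<partial>W)" by (simp add: mult.commute)
    also have "\<dots> = (\<integral>\<omega>. y \<omega> * a \<omega> \<partial>W)"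
      unfolding h_def using F.real_cond_exp_intg(2)[of y a] bd[OF y(1) a a1] y a by simp
    finally show ?thesis unfolding a_def .
  qed
  then show ?thesis using y by blast
qed

end

subsection \<open>Wiener measure and its increments\<close>

lemma finite_as_strict_mono_range:
  fixes T :: "real set"
  assumes "finite T"
  obtains \<tau> :: "nat \<Rightarrow> real" and n where "strict_mono \<tau>" "T = \<tau> ` {..<n}"
proof (cases "T = {}")
  case True
  have "strict_mono (\<lambda>n. real n)" by (simp add: strict_mono_def)
  then show ?thesis using that[of real 0] True by simp
next
  case False
  define xs where "xs = sorted_list_of_set T"
  have xs: "set xs = T" "sorted_wrt (<) xs" "xs \<noteq> []"
    using assms False unfolding xs_def by (auto simp: strict_sorted_list_of_set)
  define n where "n = length xs"
  \<comment> \<open>\<open>raw_wiener_measure\<close> speaks of infinite strictly increasing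
    sequences, so beyond the last element the list is continued in steps of length one.\<close>
  define \<tau> where "\<tau> i = (if i < n then xs ! i else xs ! (n - 1) + real (i - n + 1))" for i
  have n: "n > 0" using xs(3) by (simp add: n_def)
  have lt: "xs ! i < xs ! j" if "i < j" "j < n" for i j
    using xs(2) that unfolding n_def by (simp add: sorted_wrt_iff_nth_less)
  have "\<tau> i < \<tau> (Suc i)" for i
  proof -
    consider "Suc i < n" | "Suc i = n" | "n \<le> i" by linarith
    then show ?thesis
      by cases (use lt n in \<open>auto simp: \<tau>_def\<close>)
  qed
  then have "strict_mono \<tau>" by (simp add: strict_mono_Suc_iff)
  moreover have "T = \<tau> ` {..<n}"
    unfolding xs(1)[symmetric] set_conv_nth by (auto simp: \<tau>_def n_def)
  ultimately show ?thesis using that by blast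
qed

locale wiener =
  fixes W0 W :: "path measure"
  assumes raw: "raw_wiener_measure W0" and W_def: "W = completion W0"

sublocale wiener \<subseteq> W0: prob_space W0
  using raw unfolding raw_wiener_measure_def by blast

context wiener
begin

lemma sets_W0: "sets W0 = sets (restrict_space (\<Pi>\<^sub>M t\<in>UNIV. borel) Omega0)"
  using raw unfolding raw_wiener_measure_def by blast

lemma space_W0: "space W0 = Omega0"
  using sets_eq_imp_space_eq[OF sets_W0] by (simp add: space_restrict_space space_PiM)

lemma eval_measurable [measurable]: "(\<lambda>\<omega>. \<omega> t) \<in> borel_measurable W0"
  unfolding measurable_cong_sets[OF sets_W0 refl]
  by (intro measurable_restrict_space1) measurable

lemma measurable_into_W0:
  assumes "\<And>x. x \<in> space N \<Longrightarrow> f x \<in> Omega0" and "\<And>t. (\<lambda>x. f x t) \<in> borel_measurable N"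
  shows "f \<in> N \<rightarrow>\<^sub>M W0"
  unfolding measurable_cong_sets[OF refl sets_W0]
  by (rule measurable_restrict_space2) (use assms in \<open>auto intro!: measurable_PiM_single'\<close>)

lemma increment_distributed: "s < t \<Longrightarrow>
    distributed W0 lborel (\<lambda>\<omega>. \<omega> t - \<omega> s) (normal_density 0 (sqrt (t - s)))"
  using raw unfolding raw_wiener_measure_def by blast

lemma increments_indep: "strict_mono \<tau> \<Longrightarrow>
    W0.indep_vars (\<lambda>_. borel) (\<lambda>i \<omega>. \<omega> (\<tau> (Suc i)) - \<omega> (\<tau> i)) UNIV"
  for \<tau> :: "nat \<Rightarrow> real"
  using raw unfolding raw_wiener_measure_def by blast

definition cylinders :: "path set set" where
  "cylinders = {{\<omega> \<in> Omega0. \<forall>t\<in>J. \<omega> t \<in> A t} |J A. finite J \<and> (\<forall>t. A t \<in> sets (borel :: real measure))}"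

lemma Int_stable_cylinders: "Int_stable cylinders"
  unfolding Int_stable_def cylinders_def
proof (intro ballI; clarify)
  fix J :: "real set" and A :: "real \<Rightarrow> real set" and K :: "real set" and B :: "real \<Rightarrow> real set"
  assume J: "finite J" and A: "\<forall>t. A t \<in> sets borel" and K: "finite K" and B: "\<forall>t. B t \<in> sets borel"
  define C where "C t = (if t \<in> J then A t else UNIV) \<inter> (if t \<in> K then B t else UNIV)" for t
  have "{\<omega> \<in> Omega0. \<forall>t\<in>J. \<omega> t \<in> A t} \<inter> {\<omega> \<in> Omega0. \<forall>t\<in>K. \<omega> t \<in> B t} = {\<omega> \<in> Omega0. \<forall>t\<in>J \<union> K. \<omega> t \<in> C t}"
    by (auto simp: C_def)
  moreover have "\<forall>t. C t \<in> sets borel" using A B by (auto simp: C_def)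
  ultimately show "\<exists>J' A'. {\<omega> \<in> Omega0. \<forall>t\<in>J. \<omega> t \<in> A t} \<inter> {\<omega> \<in> Omega0. \<forall>t\<in>K. \<omega> t \<in> B t} =
      {\<omega> \<in> Omega0. \<forall>t\<in>J'. \<omega> t \<in> A' t} \<and> finite J' \<and> (\<forall>t. A' t \<in> sets borel)"
    using J K by (intro exI[of _ "J \<union> K"] exI[of _ C]) auto
qed

lemma sets_W0_cylinders: "sets W0 = sigma_sets Omega0 cylinders"
proof
  define S where "S = sigma Omega0 cylinders"
  have sub: "cylinders \<subseteq> Pow Omega0" by (auto simp: cylinders_def)
  have S: "sets S = sigma_sets Omega0 cylinders" "space S = Omega0" unfolding S_def using sub by auto
  have "(\<lambda>\<omega>. \<omega>) \<in> S \<rightarrow>\<^sub>M W0"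
  proof (rule measurable_into_W0)
    fix t show "(\<lambda>\<omega>. \<omega> t) \<in> borel_measurable S"
    proof (rule measurableI)
      fix A :: "real set" assume "A \<in> sets borel"
      then have "{\<omega> \<in> Omega0. \<forall>s\<in>{t}. \<omega> s \<in> A} \<in> cylinders"
        unfolding cylinders_def by (intro CollectI exI[of _ "{t}"] exI[of _ "\<lambda>_. A"]) simp
      then have "{\<omega> \<in> Omega0. \<omega> t \<in> A} \<in> sets S" unfolding S by (intro sigma_sets.Basic) simp
      then show "(\<lambda>\<omega>. \<omega> t) -` A \<inter> space S \<in> sets S" by (simp add: S vimage_def Int_def conj_commute)
    qed simp
  qed (simp add: S)
  then have "(\<lambda>\<omega>. \<omega>) -` A \<inter> space S \<in> sets S" if "A \<in> sets W0" for A
    using that by (rule measurable_sets)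
  then show "sets W0 \<subseteq> sigma_sets Omega0 cylinders"
    using sets.sets_into_space[of _ W0] by (auto simp: S space_W0 Int_absorb2)
  have "cylinders \<subseteq> sets W0"
  proof
    fix C assume "C \<in> cylinders"
    then obtain J A where C: "C = {\<omega> \<in> space W0. \<forall>t\<in>J. \<omega> t \<in> A t}" and J: "finite J"
      and [measurable]: "\<And>t. A t \<in> sets borel" by (auto simp: cylinders_def space_W0)
    show "C \<in> sets W0" unfolding C using J by (intro sets.sets_Collect_finite_All) measurable
  qed
  then show "sigma_sets Omega0 cylinders \<subseteq> sets W0"
    using sets.sigma_sets_subset[of cylinders W0] by (simp add: space_W0)
qed

definition incs :: "(nat \<Rightarrow> real) \<Rightarrow> nat \<Rightarrow> path \<Rightarrow> real" where
  "incs \<tau> i \<omega> = \<omega> (\<tau> (Suc i)) - \<omega> (\<tau> i)"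

lemma incs_measurable [measurable]: "incs \<tau> i \<in> borel_measurable W0"
  unfolding incs_def by measurable

lemma sum_incs: "m \<le> n \<Longrightarrow> (\<Sum>i=m..<n. incs \<tau> i \<omega>) = \<omega> (\<tau> n) - \<omega> (\<tau> m)"
  unfolding incs_def by (rule sum_Suc_diff')

text \<open>Because paths vanish at \<open>0\<close>, increments along a partition containing \<open>0\<close> recover the values.\<close>

lemma W0_measure_eqI:
  assumes \<mu>: "finite_measure \<mu>" "sets \<mu> = sets W0" and \<nu>: "sets \<nu> = sets W0"
    and eq: "\<And>\<tau> n U. strict_mono \<tau> \<Longrightarrow> (\<And>i. U i \<in> sets borel) \<Longrightarrow>
      emeasure \<mu> {\<omega> \<in> Omega0. \<forall>i<n. incs \<tau> i \<omega> \<in> U i} = emeasure \<nu> {\<omega> \<in> Omega0. \<forall>i<n. incs \<tau> i \<omega> \<in> U i}"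
  shows "\<mu> = \<nu>"
proof -
  interpret \<mu>: finite_measure \<mu> by fact
  have sp: "space \<mu> = Omega0" "space \<nu> = Omega0"
    using sets_eq_imp_space_eq[OF \<mu>(2)] sets_eq_imp_space_eq[OF \<nu>] by (simp_all add: space_W0)
  show ?thesis
  proof (rule measure_eqI_generator_eq[OF Int_stable_cylinders, where \<Omega>=Omega0 and A="\<lambda>_. Omega0"])
    show "cylinders \<subseteq> Pow Omega0" by (auto simp: cylinders_def)
    show "sets \<mu> = sigma_sets Omega0 cylinders" "sets \<nu> = sigma_sets Omega0 cylinders"
      using \<mu>(2) \<nu> sets_W0_cylinders by auto
    have "Omega0 \<in> cylinders"
      unfolding cylinders_def by (intro CollectI exI[of _ "{}"] exI[of _ "\<lambda>_. {}"]) simp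
    then show "range (\<lambda>_::nat. Omega0) \<subseteq> cylinders" "(\<Union>_::nat. Omega0) = Omega0" by auto
    show "emeasure \<mu> Omega0 \<noteq> \<infinity>" by simp
    fix C assume "C \<in> cylinders"
    then obtain J A where C: "C = {\<omega> \<in> Omega0. \<forall>t\<in>J. \<omega> t \<in> A t}" and J: "finite J"
      and A [measurable]: "\<And>t. A t \<in> sets borel" by (auto simp: cylinders_def)
    obtain \<tau> :: "nat \<Rightarrow> real" and n where \<tau>: "strict_mono \<tau>" and T: "insert 0 J = \<tau> ` {..<n}"
      by (rule finite_as_strict_mono_range[OF finite.insertI[OF J, of 0]])
    have all: "\<exists>i<n. \<tau> i = t" if "t \<in> insert 0 J" for t using that unfolding T by auto
    obtain i0 where i0: "i0 < n" "\<tau> i0 = 0" using all[of 0] by auto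
    have "\<forall>t\<in>J. \<exists>i. i < n \<and> \<tau> i = t" using all by auto
    from bchoice[OF this] obtain idx where idx: "\<And>t. t \<in> J \<Longrightarrow> idx t < n" "\<And>t. t \<in> J \<Longrightarrow> \<tau> (idx t) = t" by blast
    let ?G = "\<lambda>\<omega>. \<lambda>i\<in>{..<n}. incs \<tau> i \<omega>"
    let ?R = "\<Pi>\<^sub>M i\<in>{..<n}. (borel :: real measure)"
    have inc: "incs \<tau> i \<in> borel_measurable \<mu>" "incs \<tau> i \<in> borel_measurable \<nu>" for i
      using incs_measurable[of \<tau> i] by (simp_all only: measurable_cong_sets[OF \<mu>(2) refl] measurable_cong_sets[OF \<nu> refl])
    have G\<mu>: "?G \<in> \<mu> \<rightarrow>\<^sub>M ?R" and G\<nu>: "?G \<in> \<nu> \<rightarrow>\<^sub>M ?R"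
      by (rule measurable_restrict, rule inc)+
    have box: "?G -` (\<Pi>\<^sub>E i\<in>{..<n}. U i) \<inter> Omega0 = {\<omega> \<in> Omega0. \<forall>i<n. incs \<tau> i \<omega> \<in> U i}" for U
      unfolding vimage_def Int_def mem_Collect_eq restrict_PiE_iff by auto
    have "distr \<mu> ?R ?G = distr \<nu> ?R ?G"
    proof (rule measure_eqI_PiM_finite[where I="{..<n}" and M="\<lambda>_. borel" and A="\<lambda>_. \<Pi>\<^sub>E i\<in>{..<n}. UNIV"])
      fix U :: "nat \<Rightarrow> real set" assume U: "\<And>i. i \<in> {..<n} \<Longrightarrow> U i \<in> sets borel"
      define V where "V i = (if i < n then U i else {})" for i
      have UV: "Pi\<^sub>E {..<n} U = Pi\<^sub>E {..<n} V" by (intro PiE_cong) (simp add: V_def)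
      have V: "V i \<in> sets borel" for i using U by (simp add: V_def)
      have m: "Pi\<^sub>E {..<n} V \<in> sets ?R" using V by (intro sets_PiM_I_finite) auto
      show "emeasure (distr \<mu> ?R ?G) (Pi\<^sub>E {..<n} U) = emeasure (distr \<nu> ?R ?G) (Pi\<^sub>E {..<n} U)"
        unfolding UV emeasure_distr[OF G\<mu> m] emeasure_distr[OF G\<nu> m] sp box by (rule eq[OF \<tau> V])
    next
      show "range (\<lambda>_::nat. \<Pi>\<^sub>E i\<in>{..<n}. UNIV) \<subseteq> prod_algebra {..<n} (\<lambda>_. borel :: real measure)"
        by (auto intro!: prod_algebraI_finite[where M="\<lambda>_. borel", simplified])
      show "emeasure (distr \<mu> ?R ?G) (\<Pi>\<^sub>E i\<in>{..<n}. UNIV) \<noteq> \<infinity>"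
        using finite_measure.emeasure_finite[OF \<mu>.finite_measure_distr[OF G\<mu>]] by simp
    qed (auto simp: space_PiM)
    note this
    define E where "E = {x \<in> space ?R. \<forall>t\<in>J. (\<Sum>i=0..<idx t. x i) - (\<Sum>i=0..<i0. x i) \<in> A t}"
    have "{x \<in> space ?R. (\<Sum>i=0..<idx t. x i) - (\<Sum>i=0..<i0. x i) \<in> A t} \<in> sets ?R" if "t \<in> J" for t
    proof -
      have "(\<lambda>x. (\<Sum>i=0..<idx t. x i) - (\<Sum>i=0..<i0. x i)) \<in> borel_measurable ?R"
        using idx(1)[OF that] i0 by (intro borel_measurable_diff borel_measurable_sum measurable_component_singleton) auto
      then show ?thesis by measurable
    qed
    then have E: "E \<in> sets ?R" unfolding E_def using J by (intro sets.sets_Collect_finite_All) auto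
    have "?G -` E \<inter> Omega0 = C"
    proof -
      have "(\<Sum>i=0..<idx t. ?G \<omega> i) - (\<Sum>i=0..<i0. ?G \<omega> i) = \<omega> t" if "t \<in> J" "\<omega> \<in> Omega0" for t \<omega>
      proof -
        have "(\<Sum>i=0..<idx t. ?G \<omega> i) = (\<Sum>i=0..<idx t. incs \<tau> i \<omega>)"
          using idx(1)[OF that(1)] by (intro sum.cong) auto
        moreover have "(\<Sum>i=0..<i0. ?G \<omega> i) = (\<Sum>i=0..<i0. incs \<tau> i \<omega>)"
          using i0 by (intro sum.cong) auto
        ultimately show ?thesis using that i0 idx(2)[OF that(1)] by (simp add: sum_incs Omega0_def)
      qed
      then show ?thesis unfolding E_def C by (auto simp: space_PiM)
    qed
    then show "emeasure \<mu> C = emeasure \<nu> C"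
      using \<open>distr \<mu> ?R ?G = distr \<nu> ?R ?G\<close> emeasure_distr[OF G\<mu> E] emeasure_distr[OF G\<nu> E] by (simp add: sp)
  qed
qed

section \<open>Shift invariance of the Wiener measure\<close>

lemma Delta_Omega0: "\<omega> \<in> Omega0 \<Longrightarrow> Delta v \<omega> \<in> Omega0"
  unfolding Omega0_def Delta_def
  by (auto intro!: continuous_intros continuous_on_compose2[of UNIV \<omega>])

lemma Delta_measurable [measurable]: "Delta v \<in> W0 \<rightarrow>\<^sub>M W0"
proof (rule measurable_into_W0)
  show "Delta v \<omega> \<in> Omega0" if "\<omega> \<in> space W0" for \<omega> using that Delta_Omega0 by (simp add: space_W0)
  show "(\<lambda>\<omega>. Delta v \<omega> t) \<in> borel_measurable W0" for t unfolding Delta_def by measurable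
qed

lemma prob_box:
  assumes \<tau>: "strict_mono \<tau>" and U: "\<And>i. U i \<in> sets borel"
  shows "W0.prob {\<omega> \<in> Omega0. \<forall>i<n. incs \<tau> i \<omega> \<in> U i} =
    (\<Prod>i<n. measure (density lborel (normal_density 0 (sqrt (\<tau> (Suc i) - \<tau> i)))) (U i))"
proof (cases "n = 0")
  case True
  then show ?thesis using W0.prob_space by (simp add: space_W0)
next
  case False
  have "W0.prob (\<Inter>i\<in>{..<n}. incs \<tau> i -` U i \<inter> space W0) = (\<Prod>i<n. W0.prob (incs \<tau> i -` U i \<inter> space W0))"
    using W0.indep_varsD[OF increments_indep[OF \<tau>], of "{..<n}" U] U False unfolding incs_def by auto
  moreover have "(\<Inter>i\<in>{..<n}. incs \<tau> i -` U i \<inter> space W0) = {\<omega> \<in> Omega0. \<forall>i<n. incs \<tau> i \<omega> \<in> U i}"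
    using False by (auto simp: space_W0)
  moreover have "W0.prob (incs \<tau> i -` U i \<inter> space W0) =
      measure (density lborel (normal_density 0 (sqrt (\<tau> (Suc i) - \<tau> i)))) (U i)" for i
  proof -
    have "\<tau> i < \<tau> (Suc i)" using \<tau> by (simp add: strict_mono_Suc_iff)
    note d = increment_distributed[OF this]
    have "measure (density lborel (normal_density 0 (sqrt (\<tau> (Suc i) - \<tau> i)))) (U i) =
        measure (distr W0 lborel (incs \<tau> i)) (U i)"
      using distributed_distr_eq_density[OF d] by (simp add: incs_def[abs_def])
    also have "\<dots> = W0.prob (incs \<tau> i -` U i \<inter> space W0)"
      using U by (intro measure_distr) auto
    finally show ?thesis by simp
  qed
  ultimately show ?thesis by simp
qed

text \<open>The probability of a box of increments depends on the partition only through its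
  spacings, and these are unchanged by a shift.\<close>

lemma distr_Delta: "distr W0 W0 (Delta v) = W0"
proof (rule W0_measure_eqI)
  show "finite_measure (distr W0 W0 (Delta v))"
    by (rule W0.finite_measure_distr[OF Delta_measurable])
  fix \<tau> :: "nat \<Rightarrow> real" and n and U :: "nat \<Rightarrow> real set"
  assume \<tau>: "strict_mono \<tau>" and U: "\<And>i. U i \<in> sets borel"
  define \<sigma> where "\<sigma> i = v + \<tau> i" for i
  have \<sigma>: "strict_mono \<sigma>" using \<tau> by (simp add: \<sigma>_def strict_mono_def)
  have m: "{\<omega> \<in> Omega0. \<forall>i<n. incs \<tau> i \<omega> \<in> U i} \<in> sets W0"
  proof -
    have "{\<omega> \<in> space W0. \<forall>i\<in>{..<n}. incs \<tau> i \<omega> \<in> U i} \<in> sets W0"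
    proof (rule sets.sets_Collect_finite_All)
      fix i
      have "incs \<tau> i -` U i \<inter> space W0 \<in> sets W0" by (rule measurable_sets[OF incs_measurable U])
      then show "{\<omega> \<in> space W0. incs \<tau> i \<omega> \<in> U i} \<in> sets W0" by (simp add: vimage_def Int_def conj_commute)
    qed (rule finite_lessThan)
    then show ?thesis unfolding space_W0 Ball_def lessThan_iff .
  qed
  have "Delta v -` {\<omega> \<in> Omega0. \<forall>i<n. incs \<tau> i \<omega> \<in> U i} \<inter> space W0 = {\<omega> \<in> Omega0. \<forall>i<n. incs \<sigma> i \<omega> \<in> U i}"
    using Delta_Omega0 by (auto simp: space_W0 incs_def Delta_def \<sigma>_def)
  then have "emeasure (distr W0 W0 (Delta v)) {\<omega> \<in> Omega0. \<forall>i<n. incs \<tau> i \<omega> \<in> U i} =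
      emeasure W0 {\<omega> \<in> Omega0. \<forall>i<n. incs \<sigma> i \<omega> \<in> U i}"
    by (simp only: emeasure_distr[OF Delta_measurable m])
  also have "\<dots> = emeasure W0 {\<omega> \<in> Omega0. \<forall>i<n. incs \<tau> i \<omega> \<in> U i}"
    unfolding W0.emeasure_eq_measure prob_box[OF \<sigma> U] prob_box[OF \<tau> U] \<sigma>_def add_diff_cancel_left ..
  finally show "emeasure (distr W0 W0 (Delta v)) {\<omega> \<in> Omega0. \<forall>i<n. incs \<tau> i \<omega> \<in> U i} =
      emeasure W0 {\<omega> \<in> Omega0. \<forall>i<n. incs \<tau> i \<omega> \<in> U i}" .
qed simp_all

lemma space_W: "space W = Omega0"
  by (simp add: W_def space_W0)

lemma prob_space_W: "prob_space W"
  unfolding W_def by (rule prob_spaceI) (use W0.emeasure_space_1 in simp)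

lemma sets_W0_W: "A \<in> sets W0 \<Longrightarrow> A \<in> sets W"
  unfolding W_def by (rule sets_completionI_sets)

lemma measurable_W0_W: "f \<in> W0 \<rightarrow>\<^sub>M N \<Longrightarrow> f \<in> W \<rightarrow>\<^sub>M N"
  unfolding W_def by (rule measurable_completion)

lemma emeasure_W0_W: "A \<in> sets W0 \<Longrightarrow> emeasure W A = emeasure W0 A"
  unfolding W_def by simp

lemma complete_W: "A \<in> null_sets W \<Longrightarrow> B \<subseteq> A \<Longrightarrow> B \<in> sets W"
  unfolding W_def by (rule completion.complete)

text \<open>An event of the completion is an event of \<open>W0\<close> together with a part of a
  null set. The shift preserves \<open>W0\<close>, so the preimage of the covering null set is null
  again.\<close>

lemma Delta_invariant:
  assumes "A \<in> sets W"
  shows "Delta v -` A \<inter> Omega0 \<in> sets W" "emeasure W (Delta v -` A \<inter> Omega0) = emeasure W A"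
proof -
  from assms[unfolded W_def] obtain S N N' where A: "A = S \<union> N" "N \<subseteq> N'" "N' \<in> null_sets W0" "S \<in> sets W0"
    by (rule sets_completionE)
  have S: "Delta v -` S \<inter> Omega0 \<in> sets W0" "emeasure W0 (Delta v -` S \<inter> Omega0) = emeasure W0 S"
    using measurable_sets[OF Delta_measurable A(4)] emeasure_distr[OF Delta_measurable A(4)]
    by (auto simp: space_W0 distr_Delta)
  have N: "Delta v -` N' \<inter> Omega0 \<in> null_sets W0"
    using measurable_sets[OF Delta_measurable, of N'] emeasure_distr[OF Delta_measurable, of N'] A(3)
    by (auto simp: space_W0 distr_Delta null_sets_def)
  have e: "Delta v -` A \<inter> Omega0 = (Delta v -` S \<inter> Omega0) \<union> (Delta v -` N \<inter> Omega0)" using A(1) by blast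
  have NN: "Delta v -` N \<inter> Omega0 \<in> null_sets W"
    unfolding W_def using N A(2) by (intro null_sets_completion_subset[OF _ null_sets_completionI[OF N]]) blast
  have N0: "N \<in> null_sets W"
    unfolding W_def using A by (intro null_sets_completion_subset[OF _ null_sets_completionI[OF A(3)]])
  show "Delta v -` A \<inter> Omega0 \<in> sets W" unfolding e using sets_W0_W[OF S(1)] NN by auto
  show "emeasure W (Delta v -` A \<inter> Omega0) = emeasure W A"
  proof -
    have "emeasure W (Delta v -` A \<inter> Omega0) = emeasure W (Delta v -` S \<inter> Omega0)"
      unfolding e by (rule emeasure_Un_null_set[OF sets_W0_W[OF S(1)] NN])
    moreover have "emeasure W A = emeasure W S"
      unfolding A(1) by (rule emeasure_Un_null_set[OF sets_W0_W[OF A(4)] N0])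
    ultimately show ?thesis using S emeasure_W0_W A(4) by simp
  qed
qed

end

section \<open>Completed sigma-fields\<close>

lemma space_completed_sigma: "C \<subseteq> sets P \<Longrightarrow> space (completed_sigma P C) = space P"
  unfolding completed_sigma_def by (rule space_measure_of) (auto dest: sets.sets_into_space)

lemma sets_completed_sigma: "C \<subseteq> sets P \<Longrightarrow> sets (completed_sigma P C) =
    sigma_sets (space P) (C \<union> {A \<in> sets P. measure P A = 0 \<or> measure P A = 1})"
  unfolding completed_sigma_def by (rule sets_measure_of) (auto dest: sets.sets_into_space)

lemma subalgebra_completed_sigma: "C \<subseteq> sets P \<Longrightarrow> subalgebra P (completed_sigma P C)"
  unfolding subalgebra_def
  by (simp add: space_completed_sigma sets_completed_sigma) (rule sets.sigma_sets_subset; auto)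

lemma completed_sigma_basic: "C \<subseteq> sets P \<Longrightarrow> A \<in> C \<Longrightarrow> A \<in> sets (completed_sigma P C)"
  by (simp add: sets_completed_sigma)

lemma completed_sigma_null: "C \<subseteq> sets P \<Longrightarrow> A \<in> null_sets P \<Longrightarrow> A \<in> sets (completed_sigma P C)"
  by (auto simp: sets_completed_sigma measure_def null_sets_def)

text \<open>The symmetric difference is null, and all null sets of \<open>P\<close> belong to the
  field.\<close>

lemma completed_sigma_AE_cong:
  assumes C: "C \<subseteq> sets P" and D: "D \<in> sets (completed_sigma P C)" and E: "E \<in> sets P"
    and ae: "AE x in P. x \<in> D \<longleftrightarrow> x \<in> E"
  shows "E \<in> sets (completed_sigma P C)"
proof -
  have D': "D \<in> sets P" using D subalgebra_completed_sigma[OF C] by (auto simp: subalgebra_def)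
  define N where "N = (D - E) \<union> (E - D)"
  have N: "N \<in> sets P" using D' E by (auto simp: N_def)
  have "AE x in P. x \<notin> N" using ae by (rule eventually_mono) (simp add: N_def)
  then have N0: "N \<in> null_sets P" using N by (simp add: AE_iff_null_sets)
  then have EN: "E \<inter> N \<in> null_sets P" using E by (rule null_set_Int1)
  have "E = (D - N) \<union> (E \<inter> N)" by (auto simp: N_def)
  then show ?thesis
    using D completed_sigma_null[OF C N0] completed_sigma_null[OF C EN] by (metis sets.Diff sets.Un)
qed

lemma completed_sigma_measurable_AE_cong:
  fixes f g :: "'a \<Rightarrow> 'c::topological_space"
  assumes C: "C \<subseteq> sets P" and f: "f \<in> borel_measurable (completed_sigma P C)" and g: "g \<in> borel_measurable P"
    and ae: "AE x in P. f x = g x"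
  shows "g \<in> borel_measurable (completed_sigma P C)"
proof (rule measurableI)
  fix B :: "'c set" assume B: "B \<in> sets borel"
  show "g -` B \<inter> space (completed_sigma P C) \<in> sets (completed_sigma P C)"
    unfolding space_completed_sigma[OF C]
  proof (rule completed_sigma_AE_cong[OF C])
    show "f -` B \<inter> space P \<in> sets (completed_sigma P C)"
      using measurable_sets[OF f B] by (simp add: space_completed_sigma[OF C])
    show "g -` B \<inter> space P \<in> sets P" by (rule measurable_sets[OF g B])
    show "AE x in P. x \<in> f -` B \<inter> space P \<longleftrightarrow> x \<in> g -` B \<inter> space P"
      using ae by (rule eventually_mono) simp
  qed
qed simp

text \<open>The trivial events agree almost surely with the empty set or the whole space, so only
  the generators in \<open>C\<close> have to be tested.\<close>

lemma completed_sigma_AE_class: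
  assumes P: "prob_space P" and C: "C \<subseteq> sets P" and S: "space S = space P"
    and A: "A \<in> sets (completed_sigma P C)"
    and basic: "\<And>A. A \<in> C \<Longrightarrow> \<exists>D\<in>sets S. AE x in P. Q x \<longrightarrow> (x \<in> A \<longleftrightarrow> x \<in> D)"
  shows "\<exists>D\<in>sets S. AE x in P. Q x \<longrightarrow> (x \<in> A \<longleftrightarrow> x \<in> D)"
proof (rule sigma_sets_AE_class[OF A[unfolded sets_completed_sigma[OF C]] S])
  interpret P: prob_space P by fact
  fix A assume "A \<in> C \<union> {A \<in> sets P. measure P A = 0 \<or> measure P A = 1}"
  then consider "A \<in> C" | "A \<in> sets P" "measure P A = 0" | "A \<in> sets P" "measure P A = 1" by blast
  then show "\<exists>D\<in>sets S. AE x in P. Q x \<longrightarrow> (x \<in> A \<longleftrightarrow> x \<in> D)"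
  proof cases
    case 1
    then show ?thesis by (rule basic)
  next
    case 2
    then have "A \<in> null_sets P" by (simp add: null_sets_def P.emeasure_eq_measure)
    then have "AE x in P. x \<notin> A" by (rule AE_not_in)
    then have "AE x in P. Q x \<longrightarrow> (x \<in> A \<longleftrightarrow> x \<in> {})" by (rule eventually_mono) simp
    then show ?thesis by blast
  next
    case 3
    then have "AE x in P. x \<in> A" using P.prob_eq_1 by blast
    then have "AE x in P. Q x \<longrightarrow> (x \<in> A \<longleftrightarrow> x \<in> space S)" using AE_space by eventually_elim (simp add: S)
    then show ?thesis by blast
  qed
qed

sublocale wiener \<subseteq> W: prob_space W
  by (rule prob_space_W)

section \<open>Independence of past and future\<close>

context wiener
begin

text \<open>Positions are measured from the value at \<open>t\<close>, which makes the family
  Int-stable and, for times on one side of \<open>t\<close>, a function of the increments on that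
  side.\<close>

definition rel_cylinders :: "real set \<Rightarrow> real \<Rightarrow> path set set" where
  "rel_cylinders I t = {{\<omega> \<in> Omega0. \<forall>u\<in>J. \<omega> u - \<omega> t \<in> A u} |J A.
     finite J \<and> J \<subseteq> I \<and> (\<forall>u. A u \<in> sets (borel :: real measure))}"

lemma Int_stable_rel_cylinders: "Int_stable (rel_cylinders I t)"
  unfolding Int_stable_def rel_cylinders_def
proof (intro ballI; clarify)
  fix J :: "real set" and A :: "real \<Rightarrow> real set" and K :: "real set" and B :: "real \<Rightarrow> real set"
  assume J: "finite J" "J \<subseteq> I" and A: "\<forall>u. A u \<in> sets borel" and K: "finite K" "K \<subseteq> I" and B: "\<forall>u. B u \<in> sets borel"
  define C where "C u = (if u \<in> J then A u else UNIV) \<inter> (if u \<in> K then B u else UNIV)" for u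
  have "{\<omega> \<in> Omega0. \<forall>u\<in>J. \<omega> u - \<omega> t \<in> A u} \<inter> {\<omega> \<in> Omega0. \<forall>u\<in>K. \<omega> u - \<omega> t \<in> B u} =
      {\<omega> \<in> Omega0. \<forall>u\<in>J \<union> K. \<omega> u - \<omega> t \<in> C u}"
    by (auto simp: C_def)
  moreover have "\<forall>u. C u \<in> sets borel" using A B by (auto simp: C_def)
  ultimately show "\<exists>J' A'. {\<omega> \<in> Omega0. \<forall>u\<in>J. \<omega> u - \<omega> t \<in> A u} \<inter> {\<omega> \<in> Omega0. \<forall>u\<in>K. \<omega> u - \<omega> t \<in> B u} =
      {\<omega> \<in> Omega0. \<forall>u\<in>J'. \<omega> u - \<omega> t \<in> A' u} \<and> finite J' \<and> J' \<subseteq> I \<and> (\<forall>u. A' u \<in> sets borel)"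
    using J K by (intro exI[of _ "J \<union> K"] exI[of _ C]) auto
qed

lemma rel_cylinders_events: "rel_cylinders I t \<subseteq> sets W0"
proof
  fix C assume "C \<in> rel_cylinders I t"
  then obtain J A where C: "C = {\<omega> \<in> space W0. \<forall>u\<in>J. \<omega> u - \<omega> t \<in> A u}" and J: "finite J"
    and A: "\<And>u. A u \<in> sets borel" by (auto simp: rel_cylinders_def space_W0)
  show "C \<in> sets W0" unfolding C
  proof (rule sets.sets_Collect_finite_All[OF _ J])
    fix u
    have "(\<lambda>\<omega>. \<omega> u - \<omega> t) -` A u \<inter> space W0 \<in> sets W0"
      by (rule measurable_sets[OF _ A]) measurable
    then show "{\<omega> \<in> space W0. \<omega> u - \<omega> t \<in> A u} \<in> sets W0" by (simp add: vimage_def Int_def conj_commute)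
  qed
qed

text \<open>A single partition through \<open>t\<close> and all times of both cylinders: the
  increments with index below \<open>m\<close> determine the one cylinder, those from
  \<open>m\<close> on the other, and disjoint blocks of independent variables are
  independent.\<close>

lemma indep_rel_cylinders: "W0.indep_set (rel_cylinders {..t} t) (rel_cylinders {t..} t)"
proof (rule W0.indep_setI[OF rel_cylinders_events rel_cylinders_events])
  fix a b assume a: "a \<in> rel_cylinders {..t} t" and b: "b \<in> rel_cylinders {t..} t"
  obtain J A where aeq: "a = {\<omega> \<in> Omega0. \<forall>u\<in>J. \<omega> u - \<omega> t \<in> A u}" and J: "finite J" "J \<subseteq> {..t}"
    and A: "\<And>u. A u \<in> sets borel" using a by (auto simp: rel_cylinders_def)
  obtain K B where beq: "b = {\<omega> \<in> Omega0. \<forall>u\<in>K. \<omega> u - \<omega> t \<in> B u}" and K: "finite K" "K \<subseteq> {t..}"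
    and B: "\<And>u. B u \<in> sets borel" using b by (auto simp: rel_cylinders_def)
  have fin: "finite (insert t (J \<union> K))" using J K by simp
  obtain \<tau> :: "nat \<Rightarrow> real" and n where \<tau>: "strict_mono \<tau>" and T: "insert t (J \<union> K) = \<tau> ` {..<n}"
    by (rule finite_as_strict_mono_range[OF fin])
  have "\<exists>i. \<tau> i = u" if "u \<in> insert t (J \<union> K)" for u using that unfolding T by auto
  then obtain idx where idx: "\<And>u. u \<in> insert t (J \<union> K) \<Longrightarrow> \<tau> (idx u) = u" by metis
  define m where "m = idx t"
  have m: "\<tau> m = t" using idx by (simp add: m_def)
  have idxJ: "idx u \<le> m" "\<tau> (idx u) = u" if "u \<in> J" for u
  proof -
    show e: "\<tau> (idx u) = u" using idx that by simp
    have "\<tau> (idx u) \<le> \<tau> m" using J(2) that e m by auto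
    then show "idx u \<le> m" using strict_mono_less_eq[OF \<tau>] by simp
  qed
  have idxK: "m \<le> idx u" "\<tau> (idx u) = u" if "u \<in> K" for u
  proof -
    show e: "\<tau> (idx u) = u" using idx that by simp
    have "\<tau> m \<le> \<tau> (idx u)" using K(2) that e m by auto
    then show "m \<le> idx u" using strict_mono_less_eq[OF \<tau>] by simp
  qed
  let ?Rb = "\<Pi>\<^sub>M i\<in>{..<m}. (borel :: real measure)" and ?Ra = "\<Pi>\<^sub>M i\<in>{m..}. (borel :: real measure)"
  let ?X = "\<lambda>\<omega>. restrict (\<lambda>i. incs \<tau> i \<omega>) {..<m}" and ?Y = "\<lambda>\<omega>. restrict (\<lambda>i. incs \<tau> i \<omega>) {m..}"
  have ind: "W0.indep_var ?Rb ?X ?Ra ?Y"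
    using increments_indep[OF \<tau>] unfolding incs_def by (rule W0.indep_var_restrict) auto
  \<comment> \<open>The minus sign appears because \<open>u\<close> precedes \<open>t\<close>: the
    increments from \<open>u\<close> to \<open>t\<close> add up to
    \<open>\<omega> t - \<omega> u\<close>.\<close>
  define E where "E = {x \<in> space ?Rb. \<forall>u\<in>J. - (\<Sum>i=idx u..<m. x i) \<in> A u}"
  have E: "E \<in> sets ?Rb" unfolding E_def
  proof (rule sets.sets_Collect_finite_All[OF _ J(1)])
    fix u
    have "(\<lambda>x. - (\<Sum>i=idx u..<m. x i)) \<in> borel_measurable ?Rb"
      by (intro borel_measurable_uminus borel_measurable_sum measurable_component_singleton) auto
    from measurable_sets[OF this A] show "{x \<in> space ?Rb. - (\<Sum>i=idx u..<m. x i) \<in> A u} \<in> sets ?Rb"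
      by (simp add: vimage_def Int_def conj_commute)
  qed
  define F where "F = {x \<in> space ?Ra. \<forall>u\<in>K. (\<Sum>i=m..<idx u. x i) \<in> B u}"
  have F: "F \<in> sets ?Ra" unfolding F_def
  proof (rule sets.sets_Collect_finite_All[OF _ K(1)])
    fix u
    have "(\<lambda>x. \<Sum>i=m..<idx u. x i) \<in> borel_measurable ?Ra"
      by (intro borel_measurable_sum measurable_component_singleton) auto
    from measurable_sets[OF this B] show "{x \<in> space ?Ra. (\<Sum>i=m..<idx u. x i) \<in> B u} \<in> sets ?Ra"
      by (simp add: vimage_def Int_def conj_commute)
  qed
  have aE: "?X -` E \<inter> space W0 = a"
  proof -
    have "- (\<Sum>i=idx u..<m. ?X \<omega> i) = \<omega> u - \<omega> t" if "u \<in> J" for u \<omega>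
    proof -
      have "(\<Sum>i=idx u..<m. ?X \<omega> i) = (\<Sum>i=idx u..<m. incs \<tau> i \<omega>)" by (intro sum.cong) auto
      then show ?thesis using sum_incs[OF idxJ(1)[OF that]] idxJ(2)[OF that] m by simp
    qed
    then have "?X \<omega> \<in> E \<longleftrightarrow> (\<forall>u\<in>J. \<omega> u - \<omega> t \<in> A u)" for \<omega>
      unfolding E_def by (simp add: space_PiM del: restrict_apply)
    then show ?thesis unfolding aeq space_W0 by blast
  qed
  have bF: "?Y -` F \<inter> space W0 = b"
  proof -
    have "(\<Sum>i=m..<idx u. ?Y \<omega> i) = \<omega> u - \<omega> t" if "u \<in> K" for u \<omega>
    proof -
      have "(\<Sum>i=m..<idx u. ?Y \<omega> i) = (\<Sum>i=m..<idx u. incs \<tau> i \<omega>)" by (intro sum.cong) auto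
      then show ?thesis using sum_incs[OF idxK(1)[OF that]] idxK(2)[OF that] m by simp
    qed
    then have "?Y \<omega> \<in> F \<longleftrightarrow> (\<forall>u\<in>K. \<omega> u - \<omega> t \<in> B u)" for \<omega>
      unfolding F_def by (simp add: space_PiM del: restrict_apply)
    then show ?thesis unfolding beq space_W0 by blast
  qed
  have "(\<lambda>\<omega>. (?X \<omega>, ?Y \<omega>)) -` (E \<times> F) \<inter> space W0 = a \<inter> b"
    unfolding aE[symmetric] bF[symmetric] by blast
  then show "W0.prob (a \<inter> b) = W0.prob a * W0.prob b"
    using W0.indep_varD[OF ind E F] unfolding aE bF by simp
qed

definition rel_field :: "real set \<Rightarrow> real \<Rightarrow> path measure" where
  "rel_field I t = sigma Omega0 (rel_cylinders I t)"

lemma space_rel_field: "space (rel_field I t) = Omega0"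
  unfolding rel_field_def by (rule space_measure_of) (auto simp: rel_cylinders_def)

lemma sets_rel_field: "sets (rel_field I t) = sigma_sets Omega0 (rel_cylinders I t)"
  unfolding rel_field_def by (rule sets_measure_of) (auto simp: rel_cylinders_def)

lemma rel_field_W0: "sets (rel_field I t) \<subseteq> sets W0"
  unfolding sets_rel_field using sets.sigma_sets_subset[OF rel_cylinders_events] by (simp add: space_W0)

lemma indep_rel_field:
  assumes "C \<in> sets (rel_field {..t} t)" "D \<in> sets (rel_field {t..} t)"
  shows "W0.prob (C \<inter> D) = W0.prob C * W0.prob D"
  using W0.indep_setD[OF W0.indep_set_sigma_sets[OF indep_rel_cylinders Int_stable_rel_cylinders Int_stable_rel_cylinders]]
  assms unfolding sets_rel_field space_W0 by blast

lemma rel_field_increment: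
  assumes u: "u \<in> I" shows "(\<lambda>\<omega>. \<omega> u - \<omega> t) \<in> borel_measurable (rel_field I t)"
proof (rule measurableI)
  fix A :: "real set" assume "A \<in> sets borel"
  then have "{\<omega> \<in> Omega0. \<forall>s\<in>{u}. \<omega> s - \<omega> t \<in> A} \<in> rel_cylinders I t"
    using u unfolding rel_cylinders_def by (intro CollectI exI[of _ "{u}"] exI[of _ "\<lambda>_. A"]) simp
  then have "{\<omega> \<in> Omega0. \<omega> u - \<omega> t \<in> A} \<in> sets (rel_field I t)"
    unfolding sets_rel_field by (intro sigma_sets.Basic) simp
  then show "(\<lambda>\<omega>. \<omega> u - \<omega> t) -` A \<inter> space (rel_field I t) \<in> sets (rel_field I t)"
    by (simp add: space_rel_field vimage_def Int_def conj_commute)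
qed simp

lemma increment_measurable_W: "(\<lambda>\<omega>. \<omega> v - \<omega> u) \<in> borel_measurable W"
  by (rule measurable_W0_W) measurable

lemma increment_events_W: "increment_events W (\<lambda>\<omega>. \<omega>) s t \<subseteq> sets W"
  using measurable_sets[OF increment_measurable_W] unfolding increment_events_def events_of_def by auto

lemma subalgebra_Fld: "subalgebra W (Fld W s t)"
  unfolding Fld_def by (rule subalgebra_completed_sigma[OF increment_events_W])

lemma space_Fld: "space (Fld W s t) = Omega0"
  using subalgebra_Fld by (simp add: subalgebra_def space_W)

text \<open>The reference time \<open>r\<close> is arbitrary, since it cancels from every
  increment.\<close>

lemma Fld_AE_rel_field:
  assumes C: "C \<in> sets (Fld W s t)" and I: "I = {u. s \<le> ereal u \<and> ereal u \<le> t}"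
  shows "\<exists>D\<in>sets (rel_field I r). AE \<omega> in W. \<omega> \<in> C \<longleftrightarrow> \<omega> \<in> D"
proof -
  have "\<exists>D\<in>sets (rel_field I r). AE \<omega> in W. True \<longrightarrow> (\<omega> \<in> C \<longleftrightarrow> \<omega> \<in> D)"
  proof (rule completed_sigma_AE_class[OF prob_space_W increment_events_W _ C[unfolded Fld_def]])
    show "space (rel_field I r) = space W" by (simp add: space_rel_field space_W)
    fix A assume "A \<in> increment_events W (\<lambda>\<omega>. \<omega>) s t"
    then obtain u v B where uv: "s \<le> ereal u" "u \<le> v" "ereal v \<le> t" and B: "B \<in> sets borel" and
      A: "A = (\<lambda>\<omega>. \<omega> v - \<omega> u) -` B \<inter> space W"
      unfolding increment_events_def events_of_def by auto
    have "ereal u \<le> ereal v" using uv(2) by simp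
    then have "u \<in> I" "v \<in> I"
      using uv order_trans[of s "ereal u" "ereal v"] order_trans[of "ereal u" "ereal v" t] unfolding I by blast+
    then have "(\<lambda>\<omega>. (\<omega> v - \<omega> r) - (\<omega> u - \<omega> r)) \<in> borel_measurable (rel_field I r)"
      using borel_measurable_diff[OF rel_field_increment[of v I r] rel_field_increment[of u I r]] by blast
    then have "(\<lambda>\<omega>. \<omega> v - \<omega> u) \<in> borel_measurable (rel_field I r)" by simp
    from measurable_sets[OF this B] have "A \<in> sets (rel_field I r)" by (simp add: A space_W space_rel_field)
    then show "\<exists>D\<in>sets (rel_field I r). AE x in W. True \<longrightarrow> (x \<in> A \<longleftrightarrow> x \<in> D)" by blast
  qed
  then show ?thesis by simp
qed

text \<open>Both events are replaced, up to null sets, by events of the uncompleted fields with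
  common reference time \<open>t\<close>.\<close>

lemma indep_Fld:
  assumes C: "C \<in> sets (Fld W (-\<infinity>) (ereal t))" and D: "D \<in> sets (Fld W (ereal t) \<infinity>)"
  shows "W.prob (C \<inter> D) = W.prob C * W.prob D"
proof -
  have "{..t} = {u. -\<infinity> \<le> ereal u \<and> ereal u \<le> ereal t}" "{t..} = {u. ereal t \<le> ereal u \<and> ereal u \<le> \<infinity>}" by auto
  note I = this
  obtain C0 where C0: "C0 \<in> sets (rel_field {..t} t)" "AE \<omega> in W. \<omega> \<in> C \<longleftrightarrow> \<omega> \<in> C0"
    using Fld_AE_rel_field[OF C I(1)] by blast
  obtain D0 where D0: "D0 \<in> sets (rel_field {t..} t)" "AE \<omega> in W. \<omega> \<in> D \<longleftrightarrow> \<omega> \<in> D0"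
    using Fld_AE_rel_field[OF D I(2)] by blast
  have W0: "C0 \<in> sets W0" "D0 \<in> sets W0"
    using C0(1) D0(1) rel_field_W0[of "{..t}" t] rel_field_W0[of "{t..}" t] by blast+
  have CD: "C \<in> sets W" "D \<in> sets W"
    using C D subalgebra_Fld[of "-\<infinity>" "ereal t"] subalgebra_Fld[of "ereal t" "\<infinity>"] unfolding subalgebra_def by blast+
  have W: "W.prob E = W0.prob E" if "E \<in> sets W0" for E
    using emeasure_W0_W[OF that] by (simp add: measure_def)
  have "W.prob (C \<inter> D) = W.prob (C0 \<inter> D0)"
    by (rule W.finite_measure_eq_AE) (use C0(2) D0(2) W0 CD sets_W0_W in \<open>auto\<close>)
  moreover have "W.prob C = W.prob C0"
    by (rule W.finite_measure_eq_AE) (use C0(2) W0 CD sets_W0_W in \<open>auto\<close>)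
  moreover have "W.prob D = W.prob D0"
    by (rule W.finite_measure_eq_AE) (use D0(2) W0 CD sets_W0_W in \<open>auto\<close>)
  ultimately show ?thesis
    using indep_rel_field[OF C0(1) D0(1)] W W0 by simp
qed

text \<open>Stated over a general field because real functionals and complex waves are both
  integrated below.\<close>

lemma
  fixes f g :: "path \<Rightarrow> 'c::{real_normed_field, banach, second_countable_topology}"
  assumes f: "f \<in> borel_measurable (Fld W (-\<infinity>) (ereal t))" "integrable W f"
    and g: "g \<in> borel_measurable (Fld W (ereal t) \<infinity>)" "integrable W g"
  shows integral_past_future: "(\<integral>\<omega>. f \<omega> * g \<omega> \<partial>W) = (\<integral>\<omega>. f \<omega> \<partial>W) * (\<integral>\<omega>. g \<omega> \<partial>W)"
    and integrable_past_future: "integrable W (\<lambda>\<omega>. f \<omega> * g \<omega>)"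
proof -
  have "W.indep_var borel f borel g"
    unfolding W.indep_var_eq
  proof (intro conjI W.indep_setI)
    have sub: "sigma_sets (space W) {h -` A \<inter> space W |A. A \<in> sets borel} \<subseteq> sets (Fld W s u)"
      if "h \<in> borel_measurable (Fld W s u)" for h :: "path \<Rightarrow> 'c" and s u
    proof -
      have "{h -` A \<inter> space W |A. A \<in> sets borel} \<subseteq> sets (Fld W s u)"
        using measurable_sets[OF that] by (auto simp: space_Fld space_W)
      then show ?thesis using sets.sigma_sets_subset[of _ "Fld W s u"] by (simp add: space_Fld space_W)
    qed
    show "sigma_sets (space W) {f -` A \<inter> space W |A. A \<in> sets borel} \<subseteq> W.events"
      "sigma_sets (space W) {g -` A \<inter> space W |A. A \<in> sets borel} \<subseteq> W.events"
      using sub[OF f(1)] sub[OF g(1)] subalgebra_Fld unfolding subalgebra_def by blast+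
    show "W.prob (a \<inter> b) = W.prob a * W.prob b"
      if "a \<in> sigma_sets (space W) {f -` A \<inter> space W |A. A \<in> sets borel}"
        "b \<in> sigma_sets (space W) {g -` A \<inter> space W |A. A \<in> sets borel}" for a b
      using that sub[OF f(1)] sub[OF g(1)] by (intro indep_Fld) auto
  qed (use f(2) g(2) in auto)
  then show "(\<integral>\<omega>. f \<omega> * g \<omega> \<partial>W) = (\<integral>\<omega>. f \<omega> \<partial>W) * (\<integral>\<omega>. g \<omega> \<partial>W)" "integrable W (\<lambda>\<omega>. f \<omega> * g \<omega>)"
    using W.indep_var_lebesgue_integral W.indep_var_integrable f(2) g(2) by blast+
qed

lemma Fld_mono: "s' \<le> s \<Longrightarrow> t \<le> t' \<Longrightarrow> sets (Fld W s t) \<subseteq> sets (Fld W s' t')"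
  unfolding Fld_def sets_completed_sigma[OF increment_events_W]
  by (rule sigma_sets_mono') (auto simp: increment_events_def intro: order_trans)

lemma Fld_measurable_mono:
  assumes f: "f \<in> Fld W s t \<rightarrow>\<^sub>M N" and "s' \<le> s" "t \<le> t'"
  shows "f \<in> Fld W s' t' \<rightarrow>\<^sub>M N"
proof (rule measurable_from_subalg[OF _ f])
  show "subalgebra (Fld W s' t') (Fld W s t)"
    unfolding subalgebra_def space_Fld using Fld_mono[OF assms(2,3)] by simp
qed

lemma Fld_increment:
  assumes "s \<le> ereal u" "u \<le> v" "ereal v \<le> t"
  shows "(\<lambda>\<omega>. \<omega> v - \<omega> u) \<in> borel_measurable (Fld W s t)"
proof (rule measurableI)
  fix B :: "real set" assume B: "B \<in> sets borel"
  have "(\<lambda>\<omega>. \<omega> v - \<omega> u) -` B \<inter> space W \<in> increment_events W (\<lambda>\<omega>. \<omega>) s t"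
    unfolding increment_events_def events_of_def using assms B by auto
  then have "(\<lambda>\<omega>. \<omega> v - \<omega> u) -` B \<inter> space W \<in> sets (Fld W s t)"
    unfolding Fld_def by (rule completed_sigma_basic[OF increment_events_W])
  then show "(\<lambda>\<omega>. \<omega> v - \<omega> u) -` B \<inter> space (Fld W s t) \<in> sets (Fld W s t)"
    by (simp add: space_Fld space_W)
qed simp

lemma Fld_AE_cong:
  fixes f g :: "path \<Rightarrow> 'c::topological_space"
  shows "f \<in> borel_measurable (Fld W s t) \<Longrightarrow> g \<in> borel_measurable W \<Longrightarrow> AE \<omega> in W. f \<omega> = g \<omega> \<Longrightarrow>
    g \<in> borel_measurable (Fld W s t)"
  unfolding Fld_def by (rule completed_sigma_measurable_AE_cong[OF increment_events_W])

end

subsection \<open>Monotone additive functionals of the increments\<close>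

lemma norm_iexp_minus_1: "cmod (iexp x - 1) \<le> \<bar>x\<bar>"
  using iexp_approx1[of x 0] by simp

context wiener
begin

text \<open>Characters of an increment. They are multiplicative over adjacent intervals, and their
  means are the nonzero values of a Gaussian characteristic function.\<close>

definition wave :: "real \<Rightarrow> real \<Rightarrow> real \<Rightarrow> path \<Rightarrow> complex" where
  "wave l s t \<omega> = iexp (l * (\<omega> t - \<omega> s))"

lemma norm_wave [simp]: "cmod (wave l s t \<omega>) = 1"
  unfolding wave_def by simp

lemma wave_mult: "wave l s t \<omega> * wave l t u \<omega> = wave l s u \<omega>"
  unfolding wave_def by (simp add: algebra_simps flip: exp_add)

lemma wave_Fld:
  assumes "s \<le> ereal u" "u \<le> v" "ereal v \<le> t"
  shows "wave l u v \<in> borel_measurable (Fld W s t)"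
proof -
  have "(\<lambda>x::real. iexp (l * x)) \<in> borel_measurable borel" by measurable
  from measurable_compose[OF Fld_increment[OF assms] this] show ?thesis
    unfolding wave_def[abs_def] .
qed

lemma wave_measurable [measurable]: "wave l u v \<in> borel_measurable W"
  unfolding wave_def[abs_def] using increment_measurable_W[of v u] by measurable

lemma wave_integrable: "integrable W (wave l u v)"
  by (rule W.integrable_const_bound[of _ 1]) auto

lemma integral_wave:
  assumes st: "s < t"
  shows "(\<integral>\<omega>. wave l s t \<omega> \<partial>W) = of_real (exp (- (l\<^sup>2 * (t - s)) / 2))"
proof -
  define \<sigma> where "\<sigma> = sqrt (t - s)"
  have \<sigma>: "\<sigma> > 0" "\<sigma>\<^sup>2 = t - s" using st by (auto simp: \<sigma>_def)
  have d: "distributed W0 lborel (\<lambda>\<omega>. (\<omega> t - \<omega> s - 0) / \<sigma>) std_normal_density"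
    using increment_distributed[OF st] W0.normal_standard_normal_convert[OF \<sigma>(1), of "\<lambda>\<omega>. \<omega> t - \<omega> s" 0]
    unfolding \<sigma>_def by simp
  have "(\<integral>\<omega>. wave l s t \<omega> \<partial>W) = (\<integral>\<omega>. wave l s t \<omega> \<partial>W0)"
    unfolding W_def by (rule integral_completion) (simp add: wave_def[abs_def])
  also have "\<dots> = (\<integral>\<omega>. iexp ((l * \<sigma>) * ((\<omega> t - \<omega> s - 0) / \<sigma>)) \<partial>W0)"
    using \<sigma>(1) by (simp add: wave_def)
  also have "\<dots> = (\<integral>x. iexp ((l * \<sigma>) * x) \<partial>(distr W0 lborel (\<lambda>\<omega>. (\<omega> t - \<omega> s - 0) / \<sigma>)))"
    by (subst integral_distr) auto
  also have "\<dots> = char std_normal_distribution (l * \<sigma>)"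
    unfolding char_def distributed_distr_eq_density[OF d] ..
  also have "\<dots> = of_real (exp (- (l\<^sup>2 * (t - s)) / 2))"
    by (simp add: char_std_normal_distribution power_mult_distrib \<sigma>(2))
  finally show ?thesis .
qed

end

text \<open>\<open>A t\<close> plays the role of the energy located before \<open>t\<close> and
  \<open>Ainf\<close> that of the total energy. The two measurability conditions make an increment
  of \<open>A\<close> over \<open>(s,t)\<close> measurable both for the past of \<open>t\<close> and
  for the future of \<open>s\<close>, so it is independent of the past of \<open>s\<close> and of
  the future of \<open>t\<close>.\<close>

locale additive_functional = wiener +
  fixes A :: "real \<Rightarrow> path \<Rightarrow> real" and Ainf :: "path \<Rightarrow> real"
  assumes past: "A t \<in> borel_measurable (Fld W (-\<infinity>) (ereal t))"
    and future: "(\<lambda>\<omega>. Ainf \<omega> - A t \<omega>) \<in> borel_measurable (Fld W (ereal t) \<infinity>)"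
    and A_integrable: "integrable W (A t)" and Ainf_integrable: "integrable W Ainf"
    and A_nonneg: "AE \<omega> in W. 0 \<le> A t \<omega>" and A_mono: "s \<le> t \<Longrightarrow> AE \<omega> in W. A s \<omega> \<le> A t \<omega>"
    and A_le: "AE \<omega> in W. A t \<omega> \<le> Ainf \<omega>"
begin

lemma A_measurable [measurable]: "A t \<in> borel_measurable W"
  using A_integrable by auto

lemma past_inc: assumes "s \<le> t" shows "(\<lambda>\<omega>. A t \<omega> - A s \<omega>) \<in> borel_measurable (Fld W (-\<infinity>) (ereal t))"
  by (rule borel_measurable_diff[OF past Fld_measurable_mono[OF past[of s]]]) (use assms in auto)

lemma future_inc: assumes "s \<le> t" shows "(\<lambda>\<omega>. A t \<omega> - A s \<omega>) \<in> borel_measurable (Fld W (ereal s) \<infinity>)"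
proof -
  have "(\<lambda>\<omega>. (Ainf \<omega> - A s \<omega>) - (Ainf \<omega> - A t \<omega>)) \<in> borel_measurable (Fld W (ereal s) \<infinity>)"
    by (rule borel_measurable_diff[OF future Fld_measurable_mono[OF future[of t]]]) (use assms in auto)
  then show ?thesis by simp
qed

definition psi :: "real \<Rightarrow> real \<Rightarrow> real \<Rightarrow> complex" where
  "psi l s t = (\<integral>\<omega>. of_real (A t \<omega> - A s \<omega>) * wave l s t \<omega> \<partial>W)"

text \<open>Dividing by the mean of the wave turns the product rule \<open>psi_add\<close> into
  plain additivity in the interval.\<close>

definition phi :: "real \<Rightarrow> real \<Rightarrow> real \<Rightarrow> complex" where
  "phi l s t = psi l s t / (\<integral>\<omega>. wave l s t \<omega> \<partial>W)"

lemma inc_wave_integrable: "integrable W (\<lambda>\<omega>. complex_of_real (A t \<omega> - A s \<omega>) * wave l u v \<omega>)"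
  by (rule Bochner_Integration.integrable_bound[of _ "\<lambda>\<omega>. A t \<omega> - A s \<omega>"])
    (auto intro!: A_integrable simp: norm_mult simp del: of_real_diff)

text \<open>A Leibniz rule: the increment splits into a sum, the wave into a product, and in each
  resulting term the factors before and after \<open>t\<close> are independent.\<close>

lemma psi_add:
  assumes "s \<le> t" "t \<le> u"
  shows "psi l s u = psi l s t * (\<integral>\<omega>. wave l t u \<omega> \<partial>W) + (\<integral>\<omega>. wave l s t \<omega> \<partial>W) * psi l t u"
proof -
  have 1: "(\<lambda>\<omega>. complex_of_real (A t \<omega> - A s \<omega>) * wave l s t \<omega>) \<in> borel_measurable (Fld W (-\<infinity>) (ereal t))"
    by (rule borel_measurable_times[OF measurable_compose[OF past_inc[OF assms(1)] borel_measurable_of_real] wave_Fld])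
      (use assms in auto)
  have 2: "wave l t u \<in> borel_measurable (Fld W (ereal t) \<infinity>)" using assms by (intro wave_Fld) auto
  have 3: "wave l s t \<in> borel_measurable (Fld W (-\<infinity>) (ereal t))" using assms by (intro wave_Fld) auto
  have 4: "(\<lambda>\<omega>. complex_of_real (A u \<omega> - A t \<omega>) * wave l t u \<omega>) \<in> borel_measurable (Fld W (ereal t) \<infinity>)"
    by (rule borel_measurable_times[OF measurable_compose[OF future_inc[OF assms(2)] borel_measurable_of_real] wave_Fld])
      (use assms in auto)
  note i1 = integral_past_future[OF 1 inc_wave_integrable 2 wave_integrable]
    and j1 = integrable_past_future[OF 1 inc_wave_integrable 2 wave_integrable]
    and i2 = integral_past_future[OF 3 wave_integrable 4 inc_wave_integrable]
    and j2 = integrable_past_future[OF 3 wave_integrable 4 inc_wave_integrable]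
  have eq: "complex_of_real (A u \<omega> - A s \<omega>) * wave l s u \<omega> =
      (complex_of_real (A t \<omega> - A s \<omega>) * wave l s t \<omega>) * wave l t u \<omega> +
      wave l s t \<omega> * (complex_of_real (A u \<omega> - A t \<omega>) * wave l t u \<omega>)" for \<omega>
    unfolding wave_mult[of l s t \<omega> u, symmetric] by (simp add: algebra_simps)
  show ?thesis
    unfolding psi_def eq Bochner_Integration.integral_add[OF j1 j2] i1 i2 ..
qed

lemma phi_add:
  assumes "s < t" "t < u"
  shows "phi l s u = phi l s t + phi l t u"
proof -
  have "(\<integral>\<omega>. wave l s u \<omega> \<partial>W) = (\<integral>\<omega>. wave l s t \<omega> \<partial>W) * (\<integral>\<omega>. wave l t u \<omega> \<partial>W)"
    using assms by (simp add: integral_wave field_simps flip: of_real_mult exp_add)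
  moreover have "(\<integral>\<omega>. wave l s t \<omega> \<partial>W) \<noteq> 0" "(\<integral>\<omega>. wave l t u \<omega> \<partial>W) \<noteq> 0"
    using assms by (simp_all add: integral_wave)
  ultimately show ?thesis
    unfolding phi_def psi_add[OF less_imp_le[OF assms(1)] less_imp_le[OF assms(2)]] by (simp add: field_simps)
qed

lemma phi_sum:
  assumes d: "d > 0"
  shows "phi l s (s + real (Suc n) * d) = (\<Sum>i\<le>n. phi l (s + real i * d) (s + real (Suc i) * d))"
proof (induction n)
  case (Suc n)
  have "phi l s (s + real (Suc (Suc n)) * d) =
      phi l s (s + real (Suc n) * d) + phi l (s + real (Suc n) * d) (s + real (Suc (Suc n)) * d)"
    using d by (intro phi_add) (auto simp: field_simps intro!: add_pos_nonneg)
  then show ?case unfolding sum.atMost_Suc Suc.IH .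
qed simp

text \<open>On a fine partition every factor \<open>wave\<close> is close to \<open>1\<close> by continuity of paths; since \<open>A\<close> is
  nondecreasing, the weighted sums converge. A Poisson-like \<open>A\<close> could not be a functional of \<open>W\<close>.\<close>

lemma phi_eq:
  assumes st: "s < t"
  shows "phi l s t = of_real (\<integral>\<omega>. A t \<omega> - A s \<omega> \<partial>W)"
proof -
  define d where "d n = (t - s) / real (Suc n)" for n
  define x where "x n i = s + real i * d n" for n i
  have d: "d n > 0" for n using st by (simp add: d_def)
  have x0: "x n 0 = s" and xn: "x n (Suc n) = t" for n by (simp_all add: x_def d_def)
  have xs: "x n (Suc i) - x n i = d n" for n i by (simp add: x_def algebra_simps)
  have xlt: "x n i < x n (Suc i)" for n i using d[of n] xs[of n i] by simp
  define F where "F n \<omega> = (\<Sum>i\<le>n. complex_of_real (A (x n (Suc i)) \<omega> - A (x n i) \<omega>) * wave l (x n i) (x n (Suc i)) \<omega>)" for n \<omega>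
  have [measurable]: "F n \<in> borel_measurable W" for n unfolding F_def by measurable
  \<comment> \<open>All intervals have length \<open>d n\<close>, so undoing the normalisation costs
    one common factor, which tends to 1; the values of \<open>phi\<close> add up to
    \<open>phi l s t\<close>.\<close>
  have FE: "(\<integral>\<omega>. F n \<omega> \<partial>W) = phi l s t * of_real (exp (- (l\<^sup>2 * d n) / 2))" for n
  proof -
    have "(\<integral>\<omega>. F n \<omega> \<partial>W) = (\<Sum>i\<le>n. psi l (x n i) (x n (Suc i)))"
      unfolding F_def psi_def by (rule Bochner_Integration.integral_sum) (rule inc_wave_integrable)
    also have "\<dots> = (\<Sum>i\<le>n. phi l (x n i) (x n (Suc i)) * of_real (exp (- (l\<^sup>2 * d n) / 2)))"
      unfolding phi_def using xlt by (simp add: integral_wave xs)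
    also have "\<dots> = phi l s t * of_real (exp (- (l\<^sup>2 * d n) / 2))"
      unfolding sum_distrib_right[symmetric] using phi_sum[OF d[of n], of l s n] xn[of n] by (simp only: x_def)
    finally show ?thesis .
  qed
  have "d \<longlonglongrightarrow> 0" unfolding d_def by real_asymp
  then have "(\<lambda>n. phi l s t * of_real (exp (- (l\<^sup>2 * d n) / 2))) \<longlonglongrightarrow> phi l s t * of_real (exp (- (l\<^sup>2 * 0) / 2))"
    by (intro tendsto_intros) simp_all
  then have lim1: "(\<lambda>n. \<integral>\<omega>. F n \<omega> \<partial>W) \<longlonglongrightarrow> phi l s t" unfolding FE by simp
  have mono: "AE \<omega> in W. \<forall>n i. A (x n i) \<omega> \<le> A (x n (Suc i)) \<omega>"
    unfolding AE_all_countable using A_mono[OF less_imp_le[OF xlt]] by blast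
  have tele: "(\<Sum>i\<le>n. A (x n (Suc i)) \<omega> - A (x n i) \<omega>) = A t \<omega> - A s \<omega>" for n \<omega>
    using sum_lessThan_telescope[of "\<lambda>i. A (x n i) \<omega>" "Suc n"] by (simp add: lessThan_Suc_atMost x0 xn)
  have lim2: "(\<lambda>n. \<integral>\<omega>. F n \<omega> \<partial>W) \<longlonglongrightarrow> (\<integral>\<omega>. complex_of_real (A t \<omega> - A s \<omega>) \<partial>W)"
  proof (rule integral_dominated_convergence[where w="\<lambda>\<omega>. A t \<omega> - A s \<omega>"])
    show "integrable W (\<lambda>\<omega>. A t \<omega> - A s \<omega>)" using A_integrable by simp
    show "AE \<omega> in W. norm (F n \<omega>) \<le> A t \<omega> - A s \<omega>" for n
      using mono
    proof (rule eventually_mono)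
      fix \<omega> assume m: "\<forall>n i. A (x n i) \<omega> \<le> A (x n (Suc i)) \<omega>"
      have "norm (F n \<omega>) \<le> (\<Sum>i\<le>n. A (x n (Suc i)) \<omega> - A (x n i) \<omega>)"
        unfolding F_def by (rule sum_norm_le) (use m in \<open>simp add: norm_mult del: of_real_diff\<close>)
      then show "norm (F n \<omega>) \<le> A t \<omega> - A s \<omega>" by (simp add: tele)
    qed
    show "AE \<omega> in W. (\<lambda>n. F n \<omega>) \<longlonglongrightarrow> complex_of_real (A t \<omega> - A s \<omega>)"
      using mono AE_space
    proof eventually_elim
      fix \<omega> assume m: "\<forall>n i. A (x n i) \<omega> \<le> A (x n (Suc i)) \<omega>" and "\<omega> \<in> space W"
      then have "continuous_on UNIV \<omega>" by (simp add: space_W Omega0_def)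
      then have uc: "uniformly_continuous_on {s..t} \<omega>"
        by (rule compact_uniformly_continuous[OF continuous_on_subset[of UNIV \<omega>]]) auto
      have st_nn: "0 \<le> A t \<omega> - A s \<omega>"
        unfolding tele[of 0, symmetric] using m by (intro sum_nonneg) simp
      show "(\<lambda>n. F n \<omega>) \<longlonglongrightarrow> complex_of_real (A t \<omega> - A s \<omega>)"
      proof (rule LIMSEQ_I)
        fix e :: real assume e: "e > 0"
        \<comment> \<open>Chosen such that \<open>(A t \<omega> - A s \<omega> + 1) *
          ((\<bar>l\<bar> + 1) * e') = e\<close>; the added ones keep the divisor positive and the
          final inequality strict.\<close>
        define e' where "e' = e / ((\<bar>l\<bar> + 1) * (A t \<omega> - A s \<omega> + 1))"
        have e': "e' > 0" using e st_nn by (simp add: e'_def)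
        have "\<exists>\<delta>>0. \<forall>u\<in>{s..t}. \<forall>v\<in>{s..t}. dist v u < \<delta> \<longrightarrow> dist (\<omega> v) (\<omega> u) < e'"
          using uc e' unfolding uniformly_continuous_on_def by blast
        then obtain \<delta> where \<delta>: "\<delta> > 0"
          "\<And>u v. u \<in> {s..t} \<Longrightarrow> v \<in> {s..t} \<Longrightarrow> dist v u < \<delta> \<Longrightarrow> dist (\<omega> v) (\<omega> u) < e'"
          by blast
        obtain N where "\<forall>n\<ge>N. norm (d n - 0) < \<delta>"
          using LIMSEQ_D[OF \<open>d \<longlonglongrightarrow> 0\<close> \<delta>(1)] by blast
        then have N: "\<And>n. n \<ge> N \<Longrightarrow> d n < \<delta>" using d by (simp add: abs_of_pos)
        show "\<exists>N. \<forall>n\<ge>N. norm (F n \<omega> - complex_of_real (A t \<omega> - A s \<omega>)) < e"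
        proof (intro exI allI impI)
          fix n assume n: "n \<ge> N"
          have small: "cmod (wave l (x n i) (x n (Suc i)) \<omega> - 1) \<le> \<bar>l\<bar> * e'" if "i \<le> n" for i
          proof -
            have "real (Suc i) * d n \<le> real (Suc n) * d n"
              using that d[of n] by (intro mult_right_mono) auto
            also have "real (Suc n) * d n = t - s" by (simp add: d_def)
            finally have "x n (Suc i) \<le> t" unfolding x_def by linarith
            moreover have "s \<le> x n i" using d[of n] by (simp add: x_def)
            ultimately have "x n i \<in> {s..t}" "x n (Suc i) \<in> {s..t}" using xlt[of n i] by auto
            then have "dist (\<omega> (x n (Suc i))) (\<omega> (x n i)) < e'"
              using N[OF n] xs[of n i] d[of n] by (intro \<delta>(2)) (simp_all add: dist_real_def)
            then have "\<bar>l * (\<omega> (x n (Suc i)) - \<omega> (x n i))\<bar> \<le> \<bar>l\<bar> * e'"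
              by (simp add: abs_mult dist_real_def mult_left_mono)
            then show ?thesis unfolding wave_def by (rule order_trans[OF norm_iexp_minus_1])
          qed
          have "F n \<omega> - complex_of_real (A t \<omega> - A s \<omega>) =
              (\<Sum>i\<le>n. complex_of_real (A (x n (Suc i)) \<omega> - A (x n i) \<omega>) * (wave l (x n i) (x n (Suc i)) \<omega> - 1))"
            unfolding tele[of n, symmetric] F_def of_real_sum sum_subtractf[symmetric] right_diff_distrib mult_1_right ..
          also have "norm \<dots> \<le> (\<Sum>i\<le>n. (A (x n (Suc i)) \<omega> - A (x n i) \<omega>) * (\<bar>l\<bar> * e'))"
            by (rule sum_norm_le) (use m small in \<open>auto simp: norm_mult simp del: of_real_diff intro!: mult_left_mono\<close>)
          also have "\<dots> = (A t \<omega> - A s \<omega>) * (\<bar>l\<bar> * e')" unfolding sum_distrib_right[symmetric] tele ..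
          also have "\<dots> < (A t \<omega> - A s \<omega> + 1) * ((\<bar>l\<bar> + 1) * e')"
          proof -
            have "(A t \<omega> - A s \<omega>) * (\<bar>l\<bar> * e') \<le> (A t \<omega> - A s \<omega> + 1) * (\<bar>l\<bar> * e')"
              using e' by (intro mult_right_mono) auto
            also have "\<dots> < (A t \<omega> - A s \<omega> + 1) * ((\<bar>l\<bar> + 1) * e')"
              using st_nn e' by (intro mult_strict_left_mono mult_strict_right_mono) auto
            finally show ?thesis .
          qed
          also have "\<dots> = e"
          proof -
            have "A t \<omega> - A s \<omega> + 1 \<noteq> 0" "\<bar>l\<bar> + 1 \<noteq> 0" using st_nn by linarith+
            then show ?thesis by (simp add: e'_def)
          qed
          finally show "norm (F n \<omega> - complex_of_real (A t \<omega> - A s \<omega>)) < e" .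
        qed
      qed
    qed
  qed measurable
  from LIMSEQ_unique[OF lim1 lim2] show ?thesis by (simp only: integral_complex_of_real)
qed

text \<open>Weighting W with the normalised increment of \<open>A\<close> gives a probability under
  which, by \<open>phi_eq\<close>, \<open>\<omega> t - \<omega> s\<close> has the same
  characteristic function as under W. By Levy's theorem it has the same law, so the increment of
  \<open>A\<close> is uncorrelated with every event of
  \<open>\<omega> t - \<omega> s\<close>.\<close>

lemma inc_interval:
  assumes st: "s < t" and U: "U \<in> sets borel"
  shows "(\<integral>\<omega>. (A t \<omega> - A s \<omega>) * indicator U (\<omega> t - \<omega> s) \<partial>W) =
    (\<integral>\<omega>. A t \<omega> - A s \<omega> \<partial>W) * (\<integral>\<omega>. indicator U (\<omega> t - \<omega> s) \<partial>W)"
proof -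
  define a where "a = (\<integral>\<omega>. A t \<omega> - A s \<omega> \<partial>W)"
  define D where "D \<omega> = A t \<omega> - A s \<omega>" for \<omega>
  have D [measurable]: "D \<in> borel_measurable W" and Di: "integrable W D" unfolding D_def using A_integrable by auto
  have Dnn: "AE \<omega> in W. 0 \<le> D \<omega>" unfolding D_def using A_mono[OF less_imp_le[OF st]] by simp
  have B [measurable]: "(\<lambda>\<omega>. \<omega> t - \<omega> s) \<in> borel_measurable W" by (rule increment_measurable_W)
  note [measurable] = U
  have aD: "a = (\<integral>\<omega>. D \<omega> \<partial>W)" by (simp add: a_def D_def)
  have a: "a \<ge> 0" unfolding aD by (rule integral_nonneg_AE[OF Dnn])
  have "(\<integral>\<omega>. D \<omega> * indicator U (\<omega> t - \<omega> s) \<partial>W) = a * (\<integral>\<omega>. indicator U (\<omega> t - \<omega> s) \<partial>W)"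
  proof (cases "a = 0")
    case True
    then have "AE \<omega> in W. D \<omega> = 0" using integral_nonneg_eq_0_iff_AE[OF Di Dnn] aD by simp
    then have "(\<integral>\<omega>. D \<omega> * indicator U (\<omega> t - \<omega> s) \<partial>W) = (\<integral>\<omega>. 0 \<partial>W)"
      by (intro integral_cong_AE) (auto elim: eventually_mono)
    then show ?thesis using True by simp
  next
    case False
    with a have a: "a > 0" by simp
    \<comment> \<open>Division by the mean \<open>a\<close> is what makes this a probability; a
      vanishing mean was treated before, the increment then being zero almost surely.\<close>
    define Q where "Q = density W (\<lambda>\<omega>. ennreal (D \<omega> / a))"
    have gnn: "AE \<omega> in W. 0 \<le> D \<omega> / a" using Dnn a by (auto elim: eventually_mono)
    have "emeasure Q (space Q) = (\<integral>\<^sup>+\<omega>. ennreal (D \<omega> / a) \<partial>W)"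
      unfolding Q_def by (auto simp: emeasure_density intro!: nn_integral_cong)
    also have "\<dots> = ennreal (\<integral>\<omega>. D \<omega> / a \<partial>W)"
      by (rule nn_integral_eq_integral) (use Di gnn in auto)
    also have "\<dots> = 1" using a aD by simp
    finally have Q: "prob_space Q" by (rule prob_spaceI)
    have BQ [measurable]: "(\<lambda>\<omega>. \<omega> t - \<omega> s) \<in> borel_measurable Q" unfolding Q_def by simp
    let ?M1 = "distr Q borel (\<lambda>\<omega>. \<omega> t - \<omega> s)" and ?M2 = "distr W borel (\<lambda>\<omega>. \<omega> t - \<omega> s)"
    have "?M1 = ?M2"
    proof (rule Levy_uniqueness)
      show "real_distribution ?M1" by (rule prob_space.real_distribution_distr[OF Q BQ])
      show "real_distribution ?M2" by (rule W.real_distribution_distr[OF B])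
      show "char ?M1 = char ?M2"
      proof
        fix l
        have "char ?M1 l = (\<integral>\<omega>. wave l s t \<omega> \<partial>Q)"
          unfolding char_def wave_def by (rule integral_distr) auto
        also have "\<dots> = (\<integral>\<omega>. (D \<omega> / a) *\<^sub>R wave l s t \<omega> \<partial>W)"
          unfolding Q_def by (rule integral_density) (use gnn in auto)
        also have "\<dots> = (\<integral>\<omega>. (1 / complex_of_real a) * (complex_of_real (A t \<omega> - A s \<omega>) * wave l s t \<omega>) \<partial>W)"
          by (simp add: D_def scaleR_conv_of_real)
        also have "\<dots> = psi l s t / of_real a"
          unfolding psi_def by (subst integral_mult_right_zero) simp
        also have "\<dots> = (\<integral>\<omega>. wave l s t \<omega> \<partial>W)"
          using phi_eq[OF st, of l] a st unfolding phi_def a_def[symmetric] by (simp add: field_simps integral_wave)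
        also have "\<dots> = char ?M2 l"
          unfolding char_def wave_def by (rule integral_distr[symmetric]) auto
        finally show "char ?M1 l = char ?M2 l" .
      qed
    qed
    then have "measure ?M1 U = measure ?M2 U" by simp
    moreover have "measure ?M2 U = (\<integral>\<omega>. indicator U (\<omega> t - \<omega> s) \<partial>W)"
    proof -
      have "measure ?M2 U = (\<integral>x. indicator U x \<partial>?M2)" by simp
      then show ?thesis by (subst (asm) integral_distr) auto
    qed
    moreover have "measure ?M1 U = (\<integral>\<omega>. (D \<omega> / a) * indicator U (\<omega> t - \<omega> s) \<partial>W)"
    proof -
      have "measure ?M1 U = (\<integral>x. indicator U x \<partial>?M1)" by simp
      also have "\<dots> = (\<integral>\<omega>. indicator U (\<omega> t - \<omega> s) \<partial>Q)" by (rule integral_distr) auto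
      also have "\<dots> = (\<integral>\<omega>. (D \<omega> / a) *\<^sub>R indicator U (\<omega> t - \<omega> s) \<partial>W)"
        unfolding Q_def by (rule integral_density) (use gnn in auto)
      finally show ?thesis by simp
    qed
    ultimately show ?thesis using a by (simp add: field_simps)
  qed
  then show ?thesis by (simp add: D_def a_def)
qed

definition box :: "(nat \<Rightarrow> real) \<Rightarrow> (nat \<Rightarrow> real set) \<Rightarrow> nat \<Rightarrow> path set" where
  "box \<tau> U n = {\<omega> \<in> Omega0. \<forall>i<n. incs \<tau> i \<omega> \<in> U i}"

lemma box_Suc_indicator:
  "(indicator (box \<tau> U (Suc n)) \<omega> :: real) = indicator (box \<tau> U n) \<omega> * indicator (U n) (\<omega> (\<tau> (Suc n)) - \<omega> (\<tau> n))"
  by (auto simp: box_def indicator_def less_Suc_eq incs_def)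

lemma box_Fld:
  assumes \<tau>: "strict_mono \<tau>" and U: "\<And>i. U i \<in> sets borel"
  shows "box \<tau> U n \<in> sets (Fld W (ereal (\<tau> 0)) (ereal (\<tau> n)))"
proof -
  have "{\<omega> \<in> space (Fld W (ereal (\<tau> 0)) (ereal (\<tau> n))). \<forall>i\<in>{..<n}. incs \<tau> i \<omega> \<in> U i} \<in> sets (Fld W (ereal (\<tau> 0)) (ereal (\<tau> n)))"
  proof (rule sets.sets_Collect_finite_All)
    fix i assume "i \<in> {..<n}"
    then have "incs \<tau> i \<in> borel_measurable (Fld W (ereal (\<tau> 0)) (ereal (\<tau> n)))"
      unfolding incs_def[abs_def] using strict_mono_less_eq[OF \<tau>] by (intro Fld_increment) auto
    from measurable_sets[OF this U[of i]]
    show "{\<omega> \<in> space (Fld W (ereal (\<tau> 0)) (ereal (\<tau> n))). incs \<tau> i \<omega> \<in> U i} \<in> sets (Fld W (ereal (\<tau> 0)) (ereal (\<tau> n)))"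
      by (simp add: vimage_def Int_def conj_commute)
  qed (rule finite_lessThan)
  then show ?thesis unfolding space_Fld Ball_def lessThan_iff box_def .
qed

lemma box_indicator_Fld:
  assumes \<tau>: "strict_mono \<tau>" and U: "\<And>i. U i \<in> sets borel" and "s \<le> ereal (\<tau> 0)" "ereal (\<tau> n) \<le> t"
  shows "(indicator (box \<tau> U n) :: path \<Rightarrow> real) \<in> borel_measurable (Fld W s t)"
  by (rule Fld_measurable_mono[OF borel_measurable_indicator[OF box_Fld[OF \<tau> U]] assms(3,4)])

lemma box_W:
  assumes \<tau>: "strict_mono \<tau>" and U: "\<And>i. U i \<in> sets borel" shows "box \<tau> U n \<in> sets W"
  using box_Fld[where \<tau>=\<tau> and U=U and n=n, OF \<tau> U] subalgebra_Fld[of "ereal (\<tau> 0)" "ereal (\<tau> n)"] unfolding subalgebra_def by blast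

lemma indicator_integrable: "D \<in> sets W \<Longrightarrow> integrable W (indicator D :: path \<Rightarrow> real)"
  by (simp add: W.emeasure_eq_measure)

lemma mult_indicator_integrable: "integrable W f \<Longrightarrow> D \<in> sets W \<Longrightarrow> integrable W (\<lambda>\<omega>. f \<omega> * indicator D \<omega>)"
  for f :: "path \<Rightarrow> real"
  using integrable_mult_indicator[of D W f] by (simp add: mult.commute)

text \<open>Induction over the partition: the increment of \<open>A\<close> is split at
  \<open>\<tau> n\<close>, the box factorises there, independence separates the two sides, and
  \<open>inc_interval\<close> treats the last interval.\<close>

lemma integral_inc_box:
  assumes \<tau>: "strict_mono \<tau>" and U: "\<And>i. U i \<in> sets borel"
  shows "(\<integral>\<omega>. (A (\<tau> n) \<omega> - A (\<tau> 0) \<omega>) * indicator (box \<tau> U n) \<omega> \<partial>W) =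
    (\<integral>\<omega>. A (\<tau> n) \<omega> - A (\<tau> 0) \<omega> \<partial>W) * (\<integral>\<omega>. indicator (box \<tau> U n) \<omega> \<partial>W)"
proof (induction n)
  case 0
  show ?case by simp
next
  case (Suc n)
  define a where "a \<omega> = A (\<tau> n) \<omega> - A (\<tau> 0) \<omega>" for \<omega>
  define b where "b \<omega> = A (\<tau> (Suc n)) \<omega> - A (\<tau> n) \<omega>" for \<omega>
  define D :: "path \<Rightarrow> real" where "D = indicator (box \<tau> U n)"
  define J :: "path \<Rightarrow> real" where "J \<omega> = indicator (U n) (\<omega> (\<tau> (Suc n)) - \<omega> (\<tau> n))" for \<omega>
  have le: "\<tau> 0 \<le> \<tau> n" "\<tau> n < \<tau> (Suc n)" "\<tau> n \<le> \<tau> (Suc n)" using \<tau> by (simp_all add: strict_mono_less_eq strict_mono_less)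
  let ?P = "Fld W (-\<infinity>) (ereal (\<tau> n))" and ?F = "Fld W (ereal (\<tau> n)) \<infinity>"
  have ai: "integrable W a" and bi: "integrable W b" unfolding a_def b_def using A_integrable by auto
  have DW: "box \<tau> U n \<in> sets W" by (rule box_W[OF \<tau> U])
  have Jset: "(\<lambda>\<omega>. \<omega> (\<tau> (Suc n)) - \<omega> (\<tau> n)) -` U n \<inter> space W \<in> sets W"
    by (rule measurable_sets[OF increment_measurable_W U])
  have Jeq: "J \<omega> = indicator ((\<lambda>\<omega>. \<omega> (\<tau> (Suc n)) - \<omega> (\<tau> n)) -` U n \<inter> space W) \<omega>" if "\<omega> \<in> space W" for \<omega>
    using that by (auto simp: J_def indicator_def)
  have Di: "integrable W D" unfolding D_def by (rule indicator_integrable[OF DW])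
  have Jm: "J \<in> borel_measurable ?F"
    unfolding J_def[abs_def]
    by (rule measurable_compose[OF Fld_increment borel_measurable_indicator[OF U]]) (use le in auto)
  have JW: "J \<in> borel_measurable W" by (rule measurable_from_subalg[OF subalgebra_Fld Jm])
  have Ji: "integrable W J"
    by (rule W.integrable_const_bound[of _ 1]) (auto simp: J_def[abs_def] indicator_def JW[unfolded J_def[abs_def] indicator_def])
  have Dm: "D \<in> borel_measurable ?P" unfolding D_def by (rule box_indicator_Fld[OF \<tau> U]) auto
  have aDm: "(\<lambda>\<omega>. a \<omega> * D \<omega>) \<in> borel_measurable ?P"
    unfolding a_def by (rule borel_measurable_times[OF past_inc[OF le(1)] Dm])
  have bJm: "(\<lambda>\<omega>. b \<omega> * J \<omega>) \<in> borel_measurable ?F"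
    unfolding b_def by (rule borel_measurable_times[OF future_inc[OF le(3)] Jm])
  have aDi: "integrable W (\<lambda>\<omega>. a \<omega> * D \<omega>)" unfolding D_def by (rule mult_indicator_integrable[OF ai DW])
  have bJi: "integrable W (\<lambda>\<omega>. b \<omega> * J \<omega>)"
  proof (rule Bochner_Integration.integrable_bound[OF bi])
    show "(\<lambda>\<omega>. b \<omega> * J \<omega>) \<in> borel_measurable W"
      by (rule borel_measurable_times[OF borel_measurable_integrable[OF bi] JW])
    show "AE \<omega> in W. norm (b \<omega> * J \<omega>) \<le> norm (b \<omega>)"
      by (rule AE_I2) (simp add: abs_mult J_def indicator_def)
  qed
  have "(\<integral>\<omega>. (A (\<tau> (Suc n)) \<omega> - A (\<tau> 0) \<omega>) * indicator (box \<tau> U (Suc n)) \<omega> \<partial>W) =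
      (\<integral>\<omega>. (a \<omega> * D \<omega>) * J \<omega> + D \<omega> * (b \<omega> * J \<omega>) \<partial>W)"
    by (rule Bochner_Integration.integral_cong[OF refl])
      (simp add: box_Suc_indicator a_def b_def D_def J_def algebra_simps)
  also have "\<dots> = (\<integral>\<omega>. (a \<omega> * D \<omega>) * J \<omega> \<partial>W) + (\<integral>\<omega>. D \<omega> * (b \<omega> * J \<omega>) \<partial>W)"
    by (rule Bochner_Integration.integral_add[OF integrable_past_future[OF aDm aDi Jm Ji] integrable_past_future[OF Dm Di bJm bJi]])
  also have "\<dots> = (\<integral>\<omega>. a \<omega> * D \<omega> \<partial>W) * (\<integral>\<omega>. J \<omega> \<partial>W) + (\<integral>\<omega>. D \<omega> \<partial>W) * (\<integral>\<omega>. b \<omega> * J \<omega> \<partial>W)"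
    by (simp only: integral_past_future[OF aDm aDi Jm Ji] integral_past_future[OF Dm Di bJm bJi])
  also have "(\<integral>\<omega>. a \<omega> * D \<omega> \<partial>W) = (\<integral>\<omega>. a \<omega> \<partial>W) * (\<integral>\<omega>. D \<omega> \<partial>W)"
    using Suc.IH unfolding a_def D_def .
  also have "(\<integral>\<omega>. b \<omega> * J \<omega> \<partial>W) = (\<integral>\<omega>. b \<omega> \<partial>W) * (\<integral>\<omega>. J \<omega> \<partial>W)"
    using inc_interval[OF le(2) U[of n]] unfolding b_def J_def .
  also have "(\<integral>\<omega>. a \<omega> \<partial>W) * (\<integral>\<omega>. D \<omega> \<partial>W) * (\<integral>\<omega>. J \<omega> \<partial>W) + (\<integral>\<omega>. D \<omega> \<partial>W) * ((\<integral>\<omega>. b \<omega> \<partial>W) * (\<integral>\<omega>. J \<omega> \<partial>W)) =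
     ((\<integral>\<omega>. a \<omega> \<partial>W) + (\<integral>\<omega>. b \<omega> \<partial>W)) * ((\<integral>\<omega>. D \<omega> \<partial>W) * (\<integral>\<omega>. J \<omega> \<partial>W))"
    by (simp add: algebra_simps)
  also have "(\<integral>\<omega>. D \<omega> \<partial>W) * (\<integral>\<omega>. J \<omega> \<partial>W) = (\<integral>\<omega>. D \<omega> * J \<omega> \<partial>W)"
    by (rule integral_past_future[OF Dm Di Jm Ji, symmetric])
  also have "(\<integral>\<omega>. a \<omega> \<partial>W) + (\<integral>\<omega>. b \<omega> \<partial>W) = (\<integral>\<omega>. A (\<tau> (Suc n)) \<omega> - A (\<tau> 0) \<omega> \<partial>W)"
    unfolding Bochner_Integration.integral_add[OF ai bi, symmetric] by (simp add: a_def b_def)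
  finally show ?case by (simp add: box_Suc_indicator D_def J_def)
qed

text \<open>What \<open>A\<close> collects before \<open>\<tau> 0\<close> and after
  \<open>\<tau> n\<close> is independent of the box; the part in between is
  \<open>integral_inc_box\<close>.\<close>

lemma integral_Ainf_box:
  assumes \<tau>: "strict_mono \<tau>" and U: "\<And>i. U i \<in> sets borel"
  shows "(\<integral>\<omega>. Ainf \<omega> * indicator (box \<tau> U n) \<omega> \<partial>W) = (\<integral>\<omega>. Ainf \<omega> \<partial>W) * W.prob (box \<tau> U n)"
proof -
  define D :: "path \<Rightarrow> real" where "D = indicator (box \<tau> U n)"
  have DW: "box \<tau> U n \<in> sets W" by (rule box_W[OF \<tau> U])
  have Di: "integrable W D" unfolding D_def by (rule indicator_integrable[OF DW])
  have le: "\<tau> 0 \<le> \<tau> n" using \<tau> by (simp add: strict_mono_less_eq)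
  have D1: "D \<in> borel_measurable (Fld W (ereal (\<tau> 0)) \<infinity>)" unfolding D_def by (rule box_indicator_Fld[OF \<tau> U]) auto
  have D2: "D \<in> borel_measurable (Fld W (-\<infinity>) (ereal (\<tau> n)))" unfolding D_def by (rule box_indicator_Fld[OF \<tau> U]) auto
  define R where "R \<omega> = Ainf \<omega> - A (\<tau> n) \<omega>" for \<omega>
  define I where "I \<omega> = A (\<tau> n) \<omega> - A (\<tau> 0) \<omega>" for \<omega>
  have Ri: "integrable W R" and Ii: "integrable W I" unfolding R_def I_def using A_integrable Ainf_integrable by auto
  have Rm: "R \<in> borel_measurable (Fld W (ereal (\<tau> n)) \<infinity>)" unfolding R_def by (rule future)
  have 1: "(\<integral>\<omega>. A (\<tau> 0) \<omega> * D \<omega> \<partial>W) = (\<integral>\<omega>. A (\<tau> 0) \<omega> \<partial>W) * (\<integral>\<omega>. D \<omega> \<partial>W)"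
    by (rule integral_past_future[OF past A_integrable D1 Di])
  have 2: "(\<integral>\<omega>. I \<omega> * D \<omega> \<partial>W) = (\<integral>\<omega>. I \<omega> \<partial>W) * (\<integral>\<omega>. D \<omega> \<partial>W)"
    using integral_inc_box[OF \<tau> U, of n] unfolding I_def D_def .
  have 3: "(\<integral>\<omega>. D \<omega> * R \<omega> \<partial>W) = (\<integral>\<omega>. D \<omega> \<partial>W) * (\<integral>\<omega>. R \<omega> \<partial>W)"
    by (rule integral_past_future[OF D2 Di Rm Ri])
  have i: "integrable W (\<lambda>\<omega>. A (\<tau> 0) \<omega> * D \<omega>)" "integrable W (\<lambda>\<omega>. I \<omega> * D \<omega>)" "integrable W (\<lambda>\<omega>. D \<omega> * R \<omega>)"
    using mult_indicator_integrable[OF _ DW] A_integrable Ii Ri unfolding D_def by (auto simp: mult.commute[of "indicator _ _"])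
  have "(\<integral>\<omega>. Ainf \<omega> * D \<omega> \<partial>W) = (\<integral>\<omega>. A (\<tau> 0) \<omega> * D \<omega> + I \<omega> * D \<omega> + D \<omega> * R \<omega> \<partial>W)"
    by (rule Bochner_Integration.integral_cong[OF refl]) (simp add: I_def R_def algebra_simps)
  also have "\<dots> = ((\<integral>\<omega>. A (\<tau> 0) \<omega> \<partial>W) + (\<integral>\<omega>. I \<omega> \<partial>W) + (\<integral>\<omega>. R \<omega> \<partial>W)) * (\<integral>\<omega>. D \<omega> \<partial>W)"
  proof -
    have "(\<integral>\<omega>. A (\<tau> 0) \<omega> * D \<omega> + I \<omega> * D \<omega> + D \<omega> * R \<omega> \<partial>W) =
        (\<integral>\<omega>. A (\<tau> 0) \<omega> * D \<omega> \<partial>W) + (\<integral>\<omega>. I \<omega> * D \<omega> \<partial>W) + (\<integral>\<omega>. D \<omega> * R \<omega> \<partial>W)"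
      using i by simp
    then show ?thesis unfolding 1 2 3 by (simp add: distrib_left mult.commute)
  qed
  also have "(\<integral>\<omega>. A (\<tau> 0) \<omega> \<partial>W) + (\<integral>\<omega>. I \<omega> \<partial>W) + (\<integral>\<omega>. R \<omega> \<partial>W) = (\<integral>\<omega>. Ainf \<omega> \<partial>W)"
    unfolding I_def R_def using A_integrable Ainf_integrable by simp
  also have "(\<integral>\<omega>. D \<omega> \<partial>W) = W.prob (box \<tau> U n)"
    unfolding D_def using DW sets.sets_into_space[OF DW] by (simp add: Int_absorb2)
  finally show ?thesis unfolding D_def .
qed

text \<open>The measures with densities \<open>Ainf\<close> and its mean agree on all boxes of
  increments, hence everywhere, and so do their densities.\<close>

theorem Ainf_constant: "AE \<omega> in W. Ainf \<omega> = (\<integral>\<omega>. Ainf \<omega> \<partial>W)"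
proof -
  define c where "c = (\<integral>\<omega>. Ainf \<omega> \<partial>W)"
  have Ann: "AE \<omega> in W. 0 \<le> Ainf \<omega>" using A_nonneg[of 0] A_le[of 0] by eventually_elim simp
  have c: "c \<ge> 0" unfolding c_def by (rule integral_nonneg_AE[OF Ann])
  have "Ainf \<in> borel_measurable (completion W0)" using Ainf_integrable by (auto simp: W_def)
  \<comment> \<open>\<open>W0_measure_eqI\<close> compares measures on the uncompleted field, so
    \<open>Ainf\<close> is replaced by a version measurable for \<open>W0\<close>.\<close>
  then obtain g where g [measurable]: "g \<in> borel_measurable W0" and ae0: "AE \<omega> in W0. Ainf \<omega> = g \<omega>"
    using completion_ex_borel_measurable_real by blast
  have ae: "AE \<omega> in W. Ainf \<omega> = g \<omega>" unfolding W_def using ae0 by (rule AE_completion)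
  have gW: "g \<in> borel_measurable W" by (rule measurable_W0_W[OF g])
  have gi: "integrable W g"
    by (rule integrable_cong_AE_imp[OF Ainf_integrable gW ae])
  have gnn: "AE \<omega> in W. 0 \<le> g \<omega>" using Ann ae by eventually_elim simp
  have "density W0 (\<lambda>\<omega>. ennreal (g \<omega>)) = density W0 (\<lambda>\<omega>. ennreal c)"
  proof (rule W0_measure_eqI)
    have transfer: "emeasure (density W0 (\<lambda>\<omega>. ennreal (h \<omega>))) B = ennreal (\<integral>\<omega>. h \<omega> * indicator B \<omega> \<partial>W)"
      if h: "h \<in> borel_measurable W0" "integrable W h" "AE \<omega> in W. 0 \<le> h \<omega>" and B: "B \<in> sets W0" for h and B
    proof -
      have "emeasure (density W0 (\<lambda>\<omega>. ennreal (h \<omega>))) B = (\<integral>\<^sup>+\<omega>. ennreal (h \<omega>) * indicator B \<omega> \<partial>W0)"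
        using h B by (simp add: emeasure_density)
      also have "\<dots> = (\<integral>\<^sup>+\<omega>. ennreal (h \<omega>) * indicator B \<omega> \<partial>W)"
        unfolding W_def by (rule nn_integral_completion[symmetric])
      also have "\<dots> = (\<integral>\<^sup>+\<omega>. ennreal (h \<omega> * indicator B \<omega>) \<partial>W)"
        by (intro nn_integral_cong) (auto simp: indicator_def)
      also have "\<dots> = ennreal (\<integral>\<omega>. h \<omega> * indicator B \<omega> \<partial>W)"
        by (rule nn_integral_eq_integral[OF mult_indicator_integrable[OF h(2) sets_W0_W[OF B]]])
          (use h(3) in \<open>auto elim!: eventually_mono simp: indicator_def\<close>)
      finally show ?thesis .
    qed
    have sp: "space W0 \<in> sets W0" by simp
    have "emeasure (density W0 (\<lambda>\<omega>. ennreal (g \<omega>))) (space (density W0 (\<lambda>\<omega>. ennreal (g \<omega>)))) \<noteq> \<infinity>"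
      using transfer[OF g gi gnn sp] by simp
    then show "finite_measure (density W0 (\<lambda>\<omega>. ennreal (g \<omega>)))" by (rule finite_measureI)
    fix \<tau> :: "nat \<Rightarrow> real" and n and U :: "nat \<Rightarrow> real set"
    assume \<tau>: "strict_mono \<tau>" and U: "\<And>i. U i \<in> sets borel"
    have "{\<omega> \<in> space W0. \<forall>i\<in>{..<n}. incs \<tau> i \<omega> \<in> U i} \<in> sets W0"
    proof (rule sets.sets_Collect_finite_All)
      fix i
      have "incs \<tau> i -` U i \<inter> space W0 \<in> sets W0" by (rule measurable_sets[OF incs_measurable U])
      then show "{\<omega> \<in> space W0. incs \<tau> i \<omega> \<in> U i} \<in> sets W0" by (simp add: vimage_def Int_def conj_commute)
    qed (rule finite_lessThan)
    then have B: "box \<tau> U n \<in> sets W0" unfolding space_W0 Ball_def lessThan_iff box_def .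
    have "(\<integral>\<omega>. g \<omega> * indicator (box \<tau> U n) \<omega> \<partial>W) = (\<integral>\<omega>. Ainf \<omega> * indicator (box \<tau> U n) \<omega> \<partial>W)"
      by (rule integral_cong_AE) (use ae gW Ainf_integrable sets_W0_W[OF B] in \<open>auto elim!: eventually_mono\<close>)
    also have "\<dots> = c * W.prob (box \<tau> U n)" unfolding c_def by (rule integral_Ainf_box[OF \<tau> U])
    also have "\<dots> = (\<integral>\<omega>. c * indicator (box \<tau> U n) \<omega> \<partial>W)"
      using sets_W0_W[OF B] sets.sets_into_space[OF sets_W0_W[OF B]] by (simp add: Int_absorb2)
    finally have eq: "(\<integral>\<omega>. g \<omega> * indicator (box \<tau> U n) \<omega> \<partial>W) = (\<integral>\<omega>. c * indicator (box \<tau> U n) \<omega> \<partial>W)" .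
    show "emeasure (density W0 (\<lambda>\<omega>. ennreal (g \<omega>))) {\<omega> \<in> Omega0. \<forall>i<n. incs \<tau> i \<omega> \<in> U i} =
        emeasure (density W0 (\<lambda>\<omega>. ennreal c)) {\<omega> \<in> Omega0. \<forall>i<n. incs \<tau> i \<omega> \<in> U i}"
      unfolding box_def[symmetric] transfer[OF g gi gnn B] eq
      by (rule transfer[symmetric, OF _ _ _ B]) (simp_all add: c)
  qed simp_all
  then have "AE \<omega> in W0. ennreal (g \<omega>) = ennreal c"
    by (rule W0.density_unique[rotated 2]) simp_all
  then have "AE \<omega> in W. ennreal (g \<omega>) = ennreal c" unfolding W_def by (rule AE_completion)
  then show ?thesis
    using ae gnn unfolding c_def[symmetric] by eventually_elim (use c in simp)
qed

text \<open>Stopping at \<open>t\<close> makes \<open>A t\<close> the total value of another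
  additive functional, which brings every single time under \<open>Ainf_constant\<close>.\<close>

lemma stopped: "additive_functional W0 W (\<lambda>s. A (min s t)) (A t)"
proof
  fix s u :: real
  show "A (min s t) \<in> borel_measurable (Fld W (-\<infinity>) (ereal s))"
    by (rule Fld_measurable_mono[OF past]) auto
  show "(\<lambda>\<omega>. A t \<omega> - A (min s t) \<omega>) \<in> borel_measurable (Fld W (ereal s) \<infinity>)"
    using future_inc[of s t] by (cases "s \<le> t") (auto simp: min_def)
  show "s \<le> u \<Longrightarrow> AE \<omega> in W. A (min s t) \<omega> \<le> A (min u t) \<omega>" by (rule A_mono) auto
  show "AE \<omega> in W. A (min s t) \<omega> \<le> A t \<omega>" by (rule A_mono) simp
qed (use A_integrable A_nonneg in auto)

theorem A_constant: "AE \<omega> in W. A t \<omega> = (\<integral>\<omega>. A t \<omega> \<partial>W)"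
  by (rule additive_functional.Ainf_constant[OF stopped])

end

subsection \<open>The probability space of a triplet\<close>

lemma space_dagger_borel [simp]: "space dagger_borel = UNIV"
  unfolding dagger_borel_def by (simp add: space_measure_of_conv)

lemma dagger_borel_sets: "Some -` A \<in> sets borel \<Longrightarrow> A \<in> sets dagger_borel"
  unfolding dagger_borel_def by (simp add: sets_measure_of_conv sigma_sets.Basic)

lemma the_measurable [measurable]: "the \<in> dagger_borel \<rightarrow>\<^sub>M borel"
proof (rule measurableI)
  fix B :: "real set" assume "B \<in> sets borel"
  then show "the -` B \<inter> space dagger_borel \<in> sets dagger_borel"
    by (intro dagger_borel_sets) (simp add: vimage_def)
qed simp

lemma None_sets: "{None} \<in> sets dagger_borel"
  by (intro dagger_borel_sets) (simp add: vimage_def)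

locale triplet = wiener +
  fixes M :: "path \<Rightarrow> real set" and \<Omega>1 :: "path set" and S :: "nat \<Rightarrow> path \<Rightarrow> real option"
  assumes adm: "admissible_triplet W M \<Omega>1 S"
begin

lemma \<Omega>1: "\<Omega>1 \<subseteq> Omega0" "\<Omega>1 \<in> sets W" "emeasure W \<Omega>1 = 1"
  using adm unfolding admissible_triplet_def by blast+

lemma AE_\<Omega>1: "AE \<omega> in W. \<omega> \<in> \<Omega>1"
  using \<Omega>1 W.prob_eq_1[of \<Omega>1] by (simp add: W.emeasure_eq_measure)

lemma Delta_\<Omega>1: "\<omega> \<in> Omega0 \<Longrightarrow> Delta v \<omega> \<in> \<Omega>1 \<longleftrightarrow> \<omega> \<in> \<Omega>1"
  using adm unfolding admissible_triplet_def by blast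

lemma M_dense: "\<omega> \<in> \<Omega>1 \<Longrightarrow> closure (M \<omega>) = UNIV"
  using adm unfolding admissible_triplet_def by blast

lemma M_countable: "\<omega> \<in> Omega0 \<Longrightarrow> countable (M \<omega>)"
  using adm unfolding admissible_triplet_def by blast

lemma M_stationary: "\<omega> \<in> Omega0 \<Longrightarrow> M \<omega> = (\<lambda>x. u + x) ` M (Delta u \<omega>)"
  using adm unfolding admissible_triplet_def perfectly_stationary_def by blast

lemma S_measurable [measurable]: "S k \<in> W \<rightarrow>\<^sub>M dagger_borel"
  using adm unfolding admissible_triplet_def proper_enumeration_def measurable_enumeration_def by blast

lemma S_proper: "\<omega> \<in> \<Omega>1 \<Longrightarrow> inj (\<lambda>k. S k \<omega>)" "\<omega> \<in> \<Omega>1 \<Longrightarrow> S k \<omega> \<noteq> None"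
  "\<omega> \<in> \<Omega>1 \<Longrightarrow> M \<omega> = values_of (\<lambda>k. S k \<omega>)"
  using adm unfolding admissible_triplet_def proper_enumeration_def by blast+

definition pt :: "nat \<Rightarrow> path \<Rightarrow> real" where
  "pt k \<omega> = the (S k \<omega>)"

lemma pt_measurable [measurable]: "pt k \<in> borel_measurable W"
  unfolding pt_def[abs_def] by measurable

lemma pt_inj: "\<omega> \<in> \<Omega>1 \<Longrightarrow> inj (\<lambda>k. pt k \<omega>)"
  using S_proper(1,2)[of \<omega>] unfolding pt_def inj_def by (metis option.expand)

lemma pt_range: "\<omega> \<in> \<Omega>1 \<Longrightarrow> range (\<lambda>k. pt k \<omega>) = M \<omega>"
proof -
  assume \<omega>: "\<omega> \<in> \<Omega>1"
  have S: "S k \<omega> = Some (pt k \<omega>)" for k using S_proper(2)[OF \<omega>, of k] by (auto simp: pt_def)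
  show ?thesis unfolding S_proper(3)[OF \<omega>] values_of_def S by auto
qed

text \<open>A path has countably many points, so by Fubini almost every time is almost surely
  avoided. Stationarity turns hitting \<open>t\<close> into hitting 0 by the shifted path, so the
  probability does not depend on \<open>t\<close> and is zero throughout.\<close>

lemma pt_avoids: "AE \<omega> in W. \<forall>k. pt k \<omega> \<noteq> t"
proof -
  define E where "E t = {\<omega> \<in> space W. \<omega> \<in> \<Omega>1 \<and> (\<exists>k. pt k \<omega> = t)}" for t
  note [measurable] = \<Omega>1(2)
  have E [measurable]: "E t \<in> sets W" for t unfolding E_def by measurable
  have iff: "(\<exists>k. pt k \<omega> = t) \<longleftrightarrow> t \<in> M \<omega>" if "\<omega> \<in> \<Omega>1" for \<omega> t
    unfolding pt_range[OF that, symmetric] by auto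
  have eqE: "E t = Delta t -` E 0 \<inter> Omega0" for t
  proof (intro set_eqI)
    fix \<omega>
    have "t \<in> M \<omega> \<longleftrightarrow> 0 \<in> M (Delta t \<omega>)" if "\<omega> \<in> Omega0"
      using M_stationary[OF that, of t] by auto
    then show "\<omega> \<in> E t \<longleftrightarrow> \<omega> \<in> Delta t -` E 0 \<inter> Omega0"
      using Delta_\<Omega>1[of \<omega> t] Delta_Omega0[of \<omega> t] iff[of \<omega> t] iff[of "Delta t \<omega>" 0]
      by (auto simp: E_def space_W)
  qed
  have const: "emeasure W (E t) = emeasure W (E 0)" for t
    by (rule trans[OF arg_cong[OF eqE[of t], of "emeasure W"] Delta_invariant(2)[OF E[of 0], of t]])
  interpret L: pair_sigma_finite W "lborel :: real measure" by standard
  have "AE \<omega> in W. AE t in lborel. \<not> (\<omega> \<in> \<Omega>1 \<and> (\<exists>k. pt k \<omega> = t))"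
  proof (rule AE_I2)
    fix \<omega>
    have "AE t in lborel. t \<notin> range (\<lambda>k. pt k \<omega>)"
      by (rule AE_not_in) (simp add: null_sets_def emeasure_lborel_countable sets.countable)
    then show "AE t in lborel. \<not> (\<omega> \<in> \<Omega>1 \<and> (\<exists>k. pt k \<omega> = t))" by (rule eventually_mono) blast
  qed
  then have "AE t in lborel. AE \<omega> in W. \<not> (\<omega> \<in> \<Omega>1 \<and> (\<exists>k. pt k \<omega> = t))"
    by (subst (asm) L.AE_commute) measurable
  then have "AE t in lborel. emeasure W (E t) = 0"
  proof (rule eventually_mono)
    fix t :: real assume "AE \<omega> in W. \<not> (\<omega> \<in> \<Omega>1 \<and> (\<exists>k. pt k \<omega> = t))"
    then have "AE \<omega> in W. \<omega> \<notin> E t" by (rule eventually_mono) (simp add: E_def)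
    then show "emeasure W (E t) = 0" using E by (simp add: AE_iff_null_sets[symmetric] null_sets_def)
  qed
  then have "AE t in (lborel :: real measure). emeasure W (E 0) = 0"
  proof (rule eventually_mono)
    fix t :: real assume "emeasure W (E t) = 0"
    then show "emeasure W (E 0) = 0" using const[of t] by simp
  qed
  \<comment> \<open>A statement free of \<open>t\<close> that holds for Lebesgue-almost every
    \<open>t\<close> is true, the Lebesgue measure being nonzero.\<close>
  then have "emeasure W (E 0) = 0"
    by (subst (asm) eventually_const) (simp_all add: ae_filter_eq_bot_iff)
  then have "emeasure W (E t) = 0" using const[of t] by simp
  then have "AE \<omega> in W. \<omega> \<notin> E t" by (intro AE_not_in) (simp add: null_sets_def)
  then show ?thesis using AE_\<Omega>1 AE_space by eventually_elim (auto simp: E_def)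
qed

section \<open>The signed paths as a coin space\<close>

abbreviation "P \<equiv> PPM W M \<Omega>1 S"
abbreviation "Q \<equiv> QQ W \<Omega>1"
abbreviation "coins \<equiv> (\<Pi>\<^sub>M k\<in>(UNIV :: nat set). uniform_count_measure {-1, 1 :: real})"

definition X :: "signed_path \<Rightarrow> path" where "X x = fst (ThetaM S x)"
definition p :: "nat \<Rightarrow> signed_path \<Rightarrow> real" where "p k x = snd (ThetaM S x) k"

lemma X_eq: "X x = fst x"
  by (simp add: X_def ThetaM_def split_beta)

lemma p_eq: "p k x = snd x (pt k (fst x))"
  by (simp add: p_def ThetaM_def pt_def split_beta)

lemma space_coins: "space coins = {f. \<forall>k. f k \<in> {-1, 1}}"
  by (auto simp: space_PiM PiE_iff space_uniform_count_measure)

lemma space_restrict: "space (restrict_space W \<Omega>1) = \<Omega>1"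
  using \<Omega>1 by (auto simp: space_restrict_space space_W)

lemma space_Q: "space Q = \<Omega>1 \<times> {f. \<forall>k. f k \<in> {-1, 1}}"
  unfolding QQ_def space_pair_measure space_coins space_restrict ..

text \<open>On \<open>\<Omega>1\<close> the enumeration is a bijection onto the points, and
  extensionality of \<open>\<eta>\<close> leaves no freedom outside of them.\<close>

lemma Theta_bij: "bij_betw (ThetaM S) (OmegaM M \<Omega>1) (space Q)"
proof (rule bij_betw_imageI)
  show "inj_on (ThetaM S) (OmegaM M \<Omega>1)"
  proof (rule inj_onI)
    fix x y assume x: "x \<in> OmegaM M \<Omega>1" and y: "y \<in> OmegaM M \<Omega>1" and eq: "ThetaM S x = ThetaM S y"
    obtain \<omega> \<eta> where xe: "x = (\<omega>, \<eta>)" by (cases x)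
    obtain \<eta>' where ye: "y = (\<omega>, \<eta>')" using eq by (cases y) (simp add: xe ThetaM_def)
    have \<omega>: "\<omega> \<in> \<Omega>1" and h: "\<eta> \<in> M \<omega> \<rightarrow>\<^sub>E {-1, 1}" "\<eta>' \<in> M \<omega> \<rightarrow>\<^sub>E {-1, 1}"
      using x y by (auto simp: xe ye OmegaM_def)
    have "\<eta> (pt k \<omega>) = \<eta>' (pt k \<omega>)" for k
      using eq by (simp add: xe ye ThetaM_def pt_def fun_eq_iff)
    then have "\<eta> z = \<eta>' z" if "z \<in> M \<omega>" for z
      using that unfolding pt_range[OF \<omega>, symmetric] by auto
    then have "\<eta> = \<eta>'" by (rule PiE_ext[OF h])
    then show "x = y" by (simp add: xe ye)
  qed
  show "ThetaM S ` OmegaM M \<Omega>1 = space Q"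
  proof (intro equalityI subsetI)
    fix y assume "y \<in> ThetaM S ` OmegaM M \<Omega>1"
    then obtain \<omega> \<eta> where y: "y = ThetaM S (\<omega>, \<eta>)" and \<omega>: "\<omega> \<in> \<Omega>1" and h: "\<eta> \<in> M \<omega> \<rightarrow>\<^sub>E {-1, 1}"
      by (auto simp: OmegaM_def)
    have "pt k \<omega> \<in> M \<omega>" for k unfolding pt_range[OF \<omega>, symmetric] by simp
    then have "\<eta> (pt k \<omega>) \<in> {-1, 1}" for k using h by (blast dest: PiE_mem)
    then show "y \<in> space Q" using \<omega> by (simp add: y space_Q ThetaM_def pt_def)
  next
    fix y assume "y \<in> space Q"
    then obtain \<omega> f where y: "y = (\<omega>, f)" and \<omega>: "\<omega> \<in> \<Omega>1" and f: "\<And>k. f k \<in> {-1, 1}" by (auto simp: space_Q)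
    \<comment> \<open>The sign of a point is looked up at its index; the restriction keeps the
      function extensional.\<close>
    define \<eta> where "\<eta> = (\<lambda>z\<in>M \<omega>. f (inv (\<lambda>k. pt k \<omega>) z))"
    have "\<eta> \<in> M \<omega> \<rightarrow>\<^sub>E {-1, 1}" unfolding \<eta>_def using f by auto
    moreover have "\<eta> (pt k \<omega>) = f k" for k
    proof -
      have "pt k \<omega> \<in> M \<omega>" unfolding pt_range[OF \<omega>, symmetric] by simp
      then show ?thesis using inv_f_f[OF pt_inj[OF \<omega>], of k] by (simp add: \<eta>_def)
    qed
    ultimately have "(\<omega>, \<eta>) \<in> OmegaM M \<Omega>1" "ThetaM S (\<omega>, \<eta>) = y"
      using \<omega> by (auto simp: OmegaM_def ThetaM_def y pt_def)
    then show "y \<in> ThetaM S ` OmegaM M \<Omega>1" by blast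
  qed
qed

definition P0 :: "signed_path measure" where
  "P0 = distr Q (vimage_algebra (OmegaM M \<Omega>1) (ThetaM S) Q) (inv_into (OmegaM M \<Omega>1) (ThetaM S))"

lemma P_completion: "P = completion P0"
  by (simp add: PPM_def P0_def)

lemma Theta_space: "ThetaM S \<in> OmegaM M \<Omega>1 \<rightarrow> space Q"
  using Theta_bij unfolding bij_betw_def by auto

lemma space_P0: "space P0 = OmegaM M \<Omega>1"
  by (simp add: P0_def)

lemma space_P: "space P = OmegaM M \<Omega>1"
  by (simp add: P_completion space_P0)

lemma sets_P0: "sets P0 = {ThetaM S -` E \<inter> OmegaM M \<Omega>1 |E. E \<in> sets Q}"
  by (simp add: P0_def sets_vimage_algebra2[OF Theta_space])

lemma inv_measurable:
  "inv_into (OmegaM M \<Omega>1) (ThetaM S) \<in> Q \<rightarrow>\<^sub>M vimage_algebra (OmegaM M \<Omega>1) (ThetaM S) Q"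
proof (rule measurable_vimage_algebra2)
  show "inv_into (OmegaM M \<Omega>1) (ThetaM S) \<in> space Q \<rightarrow> OmegaM M \<Omega>1"
    using Theta_bij unfolding bij_betw_def by (auto intro: inv_into_into)
  show "(\<lambda>y. ThetaM S (inv_into (OmegaM M \<Omega>1) (ThetaM S) y)) \<in> Q \<rightarrow>\<^sub>M Q"
    by (rule measurable_cong[THEN iffD2, OF _ measurable_ident])
      (use Theta_bij in \<open>auto simp: bij_betw_def f_inv_into_f\<close>)
qed

lemma emeasure_P0:
  assumes "E \<in> sets Q" shows "emeasure P0 (ThetaM S -` E \<inter> OmegaM M \<Omega>1) = emeasure Q E"
proof -
  have "ThetaM S -` E \<inter> OmegaM M \<Omega>1 \<in> sets (vimage_algebra (OmegaM M \<Omega>1) (ThetaM S) Q)"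
    using assms by (auto simp: sets_vimage_algebra2[OF Theta_space])
  then have "emeasure P0 (ThetaM S -` E \<inter> OmegaM M \<Omega>1) =
     emeasure Q (inv_into (OmegaM M \<Omega>1) (ThetaM S) -` (ThetaM S -` E \<inter> OmegaM M \<Omega>1) \<inter> space Q)"
    unfolding P0_def by (rule emeasure_distr[OF inv_measurable])
  also have "inv_into (OmegaM M \<Omega>1) (ThetaM S) -` (ThetaM S -` E \<inter> OmegaM M \<Omega>1) \<inter> space Q = E"
  proof -
    have "ThetaM S (inv_into (OmegaM M \<Omega>1) (ThetaM S) y) = y" "inv_into (OmegaM M \<Omega>1) (ThetaM S) y \<in> OmegaM M \<Omega>1"
      if "y \<in> space Q" for y
      using Theta_bij that unfolding bij_betw_def by (auto simp: f_inv_into_f intro: inv_into_into)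
    note inv = this
    show ?thesis
    proof (intro set_eqI iffI)
      fix y assume y: "y \<in> inv_into (OmegaM M \<Omega>1) (ThetaM S) -` (ThetaM S -` E \<inter> OmegaM M \<Omega>1) \<inter> space Q"
      then have "ThetaM S (inv_into (OmegaM M \<Omega>1) (ThetaM S) y) \<in> E" by (simp only: vimage_eq Int_iff)
      then show "y \<in> E" using inv(1) y by (simp only: Int_iff)
    next
      fix y assume "y \<in> E"
      then show "y \<in> inv_into (OmegaM M \<Omega>1) (ThetaM S) -` (ThetaM S -` E \<inter> OmegaM M \<Omega>1) \<inter> space Q"
        using inv sets.sets_into_space[OF assms] by (simp only: vimage_eq Int_iff subset_eq)
    qed
  qed
  finally show ?thesis .
qed

lemma prob_space_coins: "prob_space coins"
  by (intro prob_space_PiM prob_space_uniform_count_measure) auto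

lemma emeasure_Q:
  assumes A: "A \<in> sets (restrict_space W \<Omega>1)" and B: "B \<in> sets coins"
  shows "emeasure Q (A \<times> B) = emeasure (restrict_space W \<Omega>1) A * emeasure coins B"
proof -
  interpret C: prob_space coins by (rule prob_space_coins)
  show ?thesis unfolding QQ_def by (rule C.emeasure_pair_measure_Times[OF A B])
qed

lemma coins_cyl:
  assumes J: "finite J"
  shows "{f \<in> space coins. \<forall>j\<in>J. f j \<in> {1}} \<in> sets coins"
    and "emeasure coins {f \<in> space coins. \<forall>j\<in>J. f j \<in> {1}} = ennreal (1 / 2 ^ card J)"
proof -
  interpret C: product_prob_space "\<lambda>_::nat. uniform_count_measure {-1, 1 :: real}" UNIV
    unfolding product_prob_space_def product_prob_space_axioms_def product_sigma_finite_def
    by (auto intro!: prob_space_uniform_count_measure prob_space_imp_sigma_finite)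
  have 1: "{1} \<in> sets (uniform_count_measure {-1, 1 :: real})" by (simp add: sets_uniform_count_measure)
  show "{f \<in> space coins. \<forall>j\<in>J. f j \<in> {1}} \<in> sets coins"
  proof (rule sets.sets_Collect_finite_All[OF _ J])
    fix j
    have "(\<lambda>f. f j) \<in> coins \<rightarrow>\<^sub>M uniform_count_measure {-1, 1}"
      by (rule measurable_component_singleton) simp
    from measurable_sets[OF this 1] have "(\<lambda>f. f j) -` {1} \<inter> space coins \<in> sets coins" .
    then show "{f \<in> space coins. f j \<in> {1}} \<in> sets coins" by (simp add: vimage_def Int_def conj_commute)
  qed
  have "emeasure coins {f \<in> space coins. \<forall>j\<in>J. f j \<in> {1}} = (\<Prod>j\<in>J. emeasure (uniform_count_measure {-1, 1 :: real}) {1})"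
    by (rule C.emeasure_PiM_Collect) (use J 1 in auto)
  also have "emeasure (uniform_count_measure {-1, 1 :: real}) {1} = ennreal (1 / 2)"
    by (subst emeasure_uniform_count_measure) auto
  finally have "emeasure coins {f \<in> space coins. \<forall>j\<in>J. f j \<in> {1}} = ennreal (1 / 2) ^ card J"
    by (simp only: prod_constant)
  also have "\<dots> = ennreal (1 / 2 ^ card J)"
  proof -
    have "(0::real) \<le> 1 / 2" by simp
    from ennreal_power[OF this, of "card J"] show ?thesis unfolding power_one_over .
  qed
  finally show "emeasure coins {f \<in> space coins. \<forall>j\<in>J. f j \<in> {1}} = ennreal (1 / 2 ^ card J)" .
qed

lemma cyl_as_Theta:
  "{x \<in> space P. X x \<in> A \<and> (\<forall>j\<in>J. p j x = 1)} =
    ThetaM S -` ((A \<inter> \<Omega>1) \<times> {f \<in> space coins. \<forall>j\<in>J. f j \<in> {1}}) \<inter> OmegaM M \<Omega>1"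
proof -
  have "fst (ThetaM S x) \<in> \<Omega>1" "snd (ThetaM S x) \<in> space coins" if "x \<in> OmegaM M \<Omega>1" for x
    using Theta_space that by (force simp: space_Q space_coins)+
  then show ?thesis by (auto simp: X_def p_def space_P mem_Times_iff)
qed

lemma cyl_sets_P:
  assumes A: "A \<in> sets W" and J: "finite J"
  shows "{x \<in> space P. X x \<in> A \<and> (\<forall>j\<in>J. p j x = 1)} \<in> sets P0"
    and "emeasure P0 {x \<in> space P. X x \<in> A \<and> (\<forall>j\<in>J. p j x = 1)} = ennreal (W.prob A / 2 ^ card J)"
proof -
  have A1: "A \<inter> \<Omega>1 \<in> sets (restrict_space W \<Omega>1)" using A \<Omega>1 by (auto simp: sets_restrict_space_iff)
  have E: "(A \<inter> \<Omega>1) \<times> {f \<in> space coins. \<forall>j\<in>J. f j \<in> {1}} \<in> sets Q"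
    unfolding QQ_def by (rule pair_measureI[OF A1 coins_cyl(1)[OF J]])
  then show "{x \<in> space P. X x \<in> A \<and> (\<forall>j\<in>J. p j x = 1)} \<in> sets P0"
    unfolding cyl_as_Theta sets_P0 by blast
  have "emeasure (restrict_space W \<Omega>1) (A \<inter> \<Omega>1) = emeasure W (A \<inter> \<Omega>1)"
    using \<Omega>1 A by (intro emeasure_restrict_space) (auto simp: space_W Int_absorb1 Int_absorb2)
  also have "\<dots> = emeasure W A"
    by (rule emeasure_eq_AE) (use AE_\<Omega>1 A \<Omega>1 in \<open>auto elim: eventually_mono\<close>)
  finally have "emeasure P0 {x \<in> space P. X x \<in> A \<and> (\<forall>j\<in>J. p j x = 1)} = emeasure W A * ennreal (1 / 2 ^ card J)"
    unfolding cyl_as_Theta emeasure_P0[OF E] emeasure_Q[OF A1 coins_cyl(1)[OF J]] coins_cyl(2)[OF J] by simp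
  then show "emeasure P0 {x \<in> space P. X x \<in> A \<and> (\<forall>j\<in>J. p j x = 1)} = ennreal (W.prob A / 2 ^ card J)"
    by (simp add: W.emeasure_eq_measure flip: ennreal_mult)
qed

lemma prob_space_P0: "prob_space P0"
proof (rule prob_spaceI)
  have "{x \<in> space P. X x \<in> space W \<and> (\<forall>j\<in>{}. p j x = 1)} = space P0"
  proof -
    have "X x \<in> space W" if "x \<in> OmegaM M \<Omega>1" for x
      using that \<Omega>1(1) by (auto simp: X_eq OmegaM_def space_W)
    then show ?thesis by (auto simp: space_P space_P0)
  qed
  then show "emeasure P0 (space P0) = 1"
    using cyl_sets_P(2)[of "space W" "{}"] W.prob_space by simp
qed

lemma prob_space_P: "prob_space P"
  unfolding P_completion by (rule prob_spaceI) (use prob_space.emeasure_space_1[OF prob_space_P0] in simp)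

definition cyls :: "signed_path set set" where
  "cyls = {{x \<in> space P. X x \<in> A \<and> (\<forall>j\<in>J. p j x = 1)} |A J. A \<in> sets W \<and> finite J}"

lemma p_values: "x \<in> space P \<Longrightarrow> p k x \<in> {-1, 1}"
  using Theta_space by (force simp: space_Q space_P p_def)

text \<open>The cylinders already generate the whole pull-back field. This is what
  \<open>coin_space\<close> demands under the name \<open>generated\<close>.\<close>

lemma Theta_measurable_cyls: "ThetaM S \<in> sigma (space P) cyls \<rightarrow>\<^sub>M Q"
proof -
  define V where "V = sigma (space P) cyls"
  have sub: "cyls \<subseteq> Pow (space P)" by (auto simp: cyls_def)
  have V: "space V = space P" "sets V = sigma_sets (space P) cyls" unfolding V_def using sub by auto
  have Xsp: "X x \<in> \<Omega>1" if "x \<in> space P" for x using that by (auto simp: X_eq OmegaM_def space_P)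
  have "(\<lambda>x. fst (ThetaM S x)) \<in> V \<rightarrow>\<^sub>M restrict_space W \<Omega>1"
  proof (rule measurableI)
    fix A assume "A \<in> sets (restrict_space W \<Omega>1)"
    then have A: "A \<in> sets W" using \<Omega>1 by (auto simp: sets_restrict_space_iff)
    have "{x \<in> space P. X x \<in> A \<and> (\<forall>j\<in>{}. p j x = 1)} \<in> sets V"
      unfolding V cyls_def using A by (intro sigma_sets.Basic) blast
    then show "(\<lambda>x. fst (ThetaM S x)) -` A \<inter> space V \<in> sets V"
      by (simp add: V vimage_def Int_def conj_commute X_def)
  qed (use Xsp in \<open>simp add: V X_def space_restrict\<close>)
  moreover have "(\<lambda>x. snd (ThetaM S x)) \<in> V \<rightarrow>\<^sub>M coins"
  proof (rule measurable_PiM_single')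
    fix k :: nat
    show "(\<lambda>x. snd (ThetaM S x) k) \<in> V \<rightarrow>\<^sub>M uniform_count_measure {-1, 1}"
    proof (rule measurableI)
      show "x \<in> space V \<Longrightarrow> snd (ThetaM S x) k \<in> space (uniform_count_measure {-1, 1})" for x
        using p_values[of x k] by (simp add: V p_def space_uniform_count_measure)
      fix B assume B: "B \<in> sets (uniform_count_measure {-1, 1 :: real})"
      have one: "{x \<in> space P. p k x = 1} \<in> sets V"
      proof -
        have "{x \<in> space P. X x \<in> space W \<and> (\<forall>j\<in>{k}. p j x = 1)} \<in> sets V"
          unfolding V cyls_def by (intro sigma_sets.Basic) blast
        moreover have "X x \<in> space W" if "x \<in> space P" for x using Xsp[OF that] \<Omega>1(1) by (auto simp: space_W)
        ultimately show ?thesis by (simp cong: conj_cong)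
      qed
      have "(\<lambda>x. snd (ThetaM S x) k) -` B \<inter> space V =
        (if 1 \<in> B then {x \<in> space P. p k x = 1} else {}) \<union> (if -1 \<in> B then space P - {x \<in> space P. p k x = 1} else {})"
      proof (rule set_eqI)
        fix x
        show "x \<in> (\<lambda>x. snd (ThetaM S x) k) -` B \<inter> space V \<longleftrightarrow>
          x \<in> (if 1 \<in> B then {x \<in> space P. p k x = 1} else {}) \<union> (if -1 \<in> B then space P - {x \<in> space P. p k x = 1} else {})"
          using p_values[of x k] by (cases "x \<in> space P") (auto simp: V(1) p_def)
      qed
      also have "\<dots> \<in> sets V" using one V(1) sets.top[of V] by (auto intro!: sets.Un sets.Diff)
      finally show "(\<lambda>x. snd (ThetaM S x) k) -` B \<inter> space V \<in> sets V" .
    qed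
  qed (use p_values in \<open>auto simp: V p_def PiE_iff space_uniform_count_measure\<close>)
  ultimately show ?thesis unfolding QQ_def V_def[symmetric] measurable_pair_iff comp_def by blast
qed

sublocale C: coin_space P W X p
proof (intro coin_space.intro prob_space_P W.prob_space_axioms coin_space_axioms.intro)
  have sub: "cyls \<subseteq> Pow (space P)" by (auto simp: cyls_def)
  have cyls_P: "sigma_sets (space P) cyls \<subseteq> sets P"
    by (rule sets.sigma_sets_subset) (use cyl_sets_P(1) in \<open>auto simp: cyls_def P_completion\<close>)
  have Xsp: "X x \<in> space W" if "x \<in> space P" for x using that \<Omega>1(1) by (auto simp: X_eq OmegaM_def space_P space_W)
  show "X \<in> P \<rightarrow>\<^sub>M W"
  proof (rule measurableI)
    fix A assume A: "A \<in> sets W"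
    have "{x \<in> space P. X x \<in> A \<and> (\<forall>j\<in>{}. p j x = 1)} \<in> sets P"
      using cyl_sets_P(1)[OF A finite.emptyI] unfolding P_completion by (rule sets_completionI_sets)
    then show "X -` A \<inter> space P \<in> sets P" by (simp add: vimage_def Int_def conj_commute)
  qed (rule Xsp)
  show "p k \<in> borel_measurable P" for k
  proof -
    have "{x \<in> space P. X x \<in> space W \<and> (\<forall>j\<in>{k}. p j x = 1)} \<in> sets P"
      using cyl_sets_P(1)[of "space W" "{k}"] unfolding P_completion by (intro sets_completionI_sets) simp
    then have "{x \<in> space P. p k x = 1} \<in> sets P" using Xsp by (simp cong: conj_cong)
    then have m: "(\<lambda>x. 2 * indicator {x \<in> space P. p k x = 1} x - 1 :: real) \<in> borel_measurable P" by measurable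
    show ?thesis
    proof (rule measurable_cong[THEN iffD1, OF _ m])
      fix x assume "x \<in> space P"
      then show "2 * indicator {x \<in> space P. p k x = 1} x - 1 = p k x"
        using p_values[of x k] by (cases "p k x = 1") auto
    qed
  qed
  show "x \<in> space P \<Longrightarrow> p k x \<in> {-1, 1}" for x k by (rule p_values)
  show "measure P {x \<in> space P. X x \<in> A \<and> (\<forall>j\<in>J. p j x = 1)} = W.prob A / 2 ^ card J"
    if "A \<in> sets W" "finite J" for A J
  proof -
    have "emeasure P {x \<in> space P. X x \<in> A \<and> (\<forall>j\<in>J. p j x = 1)} = ennreal (W.prob A / 2 ^ card J)"
      using cyl_sets_P[OF that] by (simp add: P_completion)
    then show ?thesis by (simp add: measure_def)
  qed
  \<comment> \<open>An event of the completion differs by a null set from one of \<open>P0\<close>,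
    and the latter is generated by the cylinders.\<close>
  fix C assume "C \<in> sets P"
  then obtain S' N N' where C: "C = S' \<union> N" "N \<subseteq> N'" "N' \<in> null_sets P0" "S' \<in> sets P0"
    unfolding P_completion by (rule sets_completionE)
  obtain E where E: "E \<in> sets Q" "S' = ThetaM S -` E \<inter> OmegaM M \<Omega>1" using C(4) by (auto simp: sets_P0)
  have sp: "space (sigma (space P) cyls) = space P" using sub by simp
  have "S' \<in> sigma_sets (space P) cyls"
    using measurable_sets[OF Theta_measurable_cyls E(1)] unfolding E(2) space_P[symmetric] sp sets_measure_of[OF sub] .
  moreover have "AE x in P. x \<notin> N'"
    unfolding P_completion by (rule AE_not_in[OF null_sets_completionI[OF C(3)]])
  then have "AE x in P. x \<in> C \<longleftrightarrow> x \<in> S'"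
    by (rule eventually_mono) (use C in auto)
  ultimately show "\<exists>D\<in>sigma_sets (space P) {{x \<in> space P. X x \<in> A \<and> (\<forall>j\<in>J. p j x = 1)} |A J. A \<in> sets W \<and> finite J}.
      AE x in P. x \<in> C \<longleftrightarrow> x \<in> D"
    unfolding cyls_def by blast
qed

section \<open>Enumerating the points of an interval\<close>

lemma Fld_complete:
  assumes D: "D \<in> sets (Fld W s t)" and ae: "AE \<omega> in W. \<omega> \<in> D \<longleftrightarrow> \<omega> \<in> E" and E: "E \<subseteq> Omega0"
  shows "E \<in> sets (Fld W s t)"
  unfolding Fld_def
proof (rule completed_sigma_AE_cong[OF increment_events_W D[unfolded Fld_def] _ ae])
  obtain N where N: "N \<in> null_sets W" "{\<omega> \<in> space W. \<not> (\<omega> \<in> D \<longleftrightarrow> \<omega> \<in> E)} \<subseteq> N"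
    using ae unfolding eventually_ae_filter by blast
  have D': "D \<in> sets W" using D subalgebra_Fld[of s t] unfolding subalgebra_def by blast
  have "E = (D - N) \<union> (E \<inter> N)"
    using N(2) E sets.sets_into_space[OF D'] by (auto simp: space_W)
  moreover have "E \<inter> N \<in> sets W" by (rule complete_W[OF N(1)]) simp
  ultimately show "E \<in> sets W" using D' N(1) by (metis null_setsD2 sets.Diff sets.Un)
qed

text \<open>Removing finitely many points from an open interval leaves a nonempty open set, and by
  density that set cannot miss \<open>M \<omega>\<close>.\<close>

lemma infinite_local:
  assumes \<omega>: "\<omega> \<in> \<Omega>1" and st: "s < t"
  shows "infinite (M \<omega> \<inter> einterval s t)"
proof
  assume fin: "finite (M \<omega> \<inter> einterval s t)"
  obtain a where a: "s < ereal a" "ereal a < t" using ereal_dense2[OF st] by auto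
  obtain b where b: "ereal a < ereal b" "ereal b < t" using ereal_dense2[OF a(2)] by auto
  have ab: "{a<..<b} \<subseteq> einterval s t"
  proof
    fix x assume "x \<in> {a<..<b}"
    then have "ereal a < ereal x" "ereal x < ereal b" by auto
    then show "x \<in> einterval s t"
      using less_trans[OF a(1), of "ereal x"] less_trans[OF _ b(2), of "ereal x"] by (simp add: einterval_def)
  qed
  define U where "U = {a<..<b} - (M \<omega> \<inter> einterval s t)"
  have "open U" unfolding U_def using fin by (intro open_Diff finite_imp_closed) auto
  moreover have "U \<noteq> {}"
  proof
    assume "U = {}"
    then have "{a<..<b} \<subseteq> M \<omega> \<inter> einterval s t" by (auto simp: U_def)
    then have "finite {a<..<b}" using fin finite_subset by blast
    then show False using b(1) by (simp add: infinite_Ioo)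
  qed
  moreover have "U \<inter> M \<omega> = {}" using ab by (auto simp: U_def)
  ultimately show False using M_dense[OF \<omega>] open_Int_closure_eq_empty[of U "M \<omega>"] by auto
qed

text \<open>Needed to give meaning to the choice in \<open>local_enumeration\<close>. Locality
  provides an enumeration that is valid almost surely and may contain repetitions and
  \<open>None\<close>. Keeping the first occurrences makes it injective, there are infinitely many
  of them by \<open>infinite_local\<close>, and exceptional paths are repaired at the cost of
  completeness only.\<close>

lemma local_enumeration_exists:
  assumes st: "s < t"
  shows "\<exists>R. proper_enumeration W (Fld W s t) (\<lambda>\<omega>. M \<omega> \<inter> einterval s t) \<Omega>1 R"
proof -
  have "local_random_set W M" using adm unfolding admissible_triplet_def by blast
  then obtain S' where S': "measurable_enumeration W (Fld W s t) (\<lambda>\<omega>. M \<omega> \<inter> einterval s t) S'"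
    using st unfolding local_random_set_def by blast
  let ?F = "Fld W s t"
  have S'm [measurable]: "S' i \<in> ?F \<rightarrow>\<^sub>M dagger_borel" for i
    using S' unfolding measurable_enumeration_def by blast
  have S'ae: "AE \<omega> in W. M \<omega> \<inter> einterval s t = values_of (\<lambda>i. S' i \<omega>)"
    using S' unfolding measurable_enumeration_def by blast
  define nn where "nn i \<omega> \<longleftrightarrow> S' i \<omega> = None" for i \<omega>
  define vv where "vv i \<omega> = the (S' i \<omega>)" for i \<omega>
  define ee where "ee j i \<omega> \<longleftrightarrow> S' j \<omega> = S' i \<omega>" for i j \<omega>
  have [measurable]: "Measurable.pred ?F (nn i)" for i
  proof -
    have "S' i -` {None} \<inter> space ?F \<in> sets ?F" by (rule measurable_sets[OF S'm None_sets])
    then show ?thesis by (simp add: pred_def nn_def vimage_def Int_def conj_commute)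
  qed
  have [measurable]: "vv i \<in> borel_measurable ?F" for i
    unfolding vv_def[abs_def] by (rule measurable_compose[OF S'm the_measurable])
  then have [measurable]: "Measurable.pred ?F (\<lambda>\<omega>. vv j \<omega> = vv i \<omega>)" for i j
    unfolding pred_def by (intro borel_measurable_eq)
  have [measurable]: "Measurable.pred ?F (ee j i)" for i j
  proof -
    have "ee j i = (\<lambda>\<omega>. (nn j \<omega> \<and> nn i \<omega>) \<or> (\<not> nn j \<omega> \<and> \<not> nn i \<omega> \<and> vv j \<omega> = vv i \<omega>))"
    proof (rule ext)
      fix \<omega>
      show "ee j i \<omega> = ((nn j \<omega> \<and> nn i \<omega>) \<or> (\<not> nn j \<omega> \<and> \<not> nn i \<omega> \<and> vv j \<omega> = vv i \<omega>))"
        unfolding ee_def nn_def vv_def by (cases "S' j \<omega>"; cases "S' i \<omega>") auto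
    qed
    moreover have "Measurable.pred ?F (\<lambda>\<omega>. (nn j \<omega> \<and> nn i \<omega>) \<or> (\<not> nn j \<omega> \<and> \<not> nn i \<omega> \<and> vv j \<omega> = vv i \<omega>))"
      by measurable
    ultimately show ?thesis by (simp only:)
  qed
  define D where "D \<omega> i \<longleftrightarrow> \<not> nn i \<omega> \<and> (\<forall>j\<in>{..<i}. \<not> ee j i \<omega>)" for \<omega> i
  have Dm [measurable]: "Measurable.pred ?F (\<lambda>\<omega>. D \<omega> i)" for i unfolding D_def by measurable
  \<comment> \<open>This is \<open>enumerate\<close> of the set of first occurrences, spelled out
    through \<open>LEAST\<close> so that measurability follows by induction, including paths where
    that set is finite.\<close>
  define ix where "ix = rec_nat (\<lambda>\<omega>. LEAST i. D \<omega> i) (\<lambda>_ f \<omega>. LEAST i. D \<omega> i \<and> f \<omega> < i)"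
  have ixm: "ix n \<in> ?F \<rightarrow>\<^sub>M count_space UNIV" for n
  proof (induction n)
    case 0
    show ?case unfolding ix_def by simp measurable
  next
    case (Suc n)
    note [measurable] = Suc
    have "ix (Suc n) = (\<lambda>\<omega>. LEAST i. D \<omega> i \<and> ix n \<omega> < i)" by (simp add: ix_def)
    then show ?case by simp measurable
  qed
  have ixeq: "ix n \<omega> = enumerate {i. D \<omega> i} n" if "infinite {i. D \<omega> i}" for n \<omega>
  proof (induction n)
    case 0
    show ?case by (simp add: ix_def enumerate_0)
  next
    case (Suc n)
    have "ix (Suc n) \<omega> = (LEAST i. D \<omega> i \<and> ix n \<omega> < i)" by (simp add: ix_def)
    then show ?case by (simp add: Suc enumerate_Suc''[OF that])
  qed
  define R where "R n \<omega> = S' (ix n \<omega>) \<omega>" for n \<omega>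
  have Rm: "R n \<in> ?F \<rightarrow>\<^sub>M dagger_borel" for n
    unfolding R_def[abs_def] by (rule measurable_compose_countable[where f="\<lambda>i \<omega>. S' i \<omega>" and g="ix n"]) (use ixm in measurable)
  define good where "good \<omega> \<longleftrightarrow> \<omega> \<in> \<Omega>1 \<and> M \<omega> \<inter> einterval s t = values_of (\<lambda>i. S' i \<omega>)" for \<omega>
  have good_ae: "AE \<omega> in W. good \<omega>" using AE_\<Omega>1 S'ae by eventually_elim (simp add: good_def)
  have good: "inj (\<lambda>k. R k \<omega>) \<and> (\<forall>k. R k \<omega> \<noteq> None) \<and> M \<omega> \<inter> einterval s t = values_of (\<lambda>k. R k \<omega>)"
    if g: "good \<omega>" for \<omega>
  proof -
    let ?D = "{i. D \<omega> i}"
    have M: "M \<omega> \<inter> einterval s t = values_of (\<lambda>i. S' i \<omega>)" and \<omega>: "\<omega> \<in> \<Omega>1" using g by (auto simp: good_def)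
    have first: "\<exists>i\<in>?D. S' i \<omega> = Some v" if "v \<in> values_of (\<lambda>i. S' i \<omega>)" for v
    proof -
      have "Some v \<in> range (\<lambda>i. S' i \<omega>)" using that by (simp add: values_of_def)
      then obtain i0 where "Some v = S' i0 \<omega>" by (rule rangeE)
      then have "S' i0 \<omega> = Some v" by simp
      then have L: "S' (LEAST i. S' i \<omega> = Some v) \<omega> = Some v" by (rule LeastI)
      moreover have "D \<omega> (LEAST i. S' i \<omega> = Some v)"
        unfolding D_def nn_def ee_def L using not_less_Least by auto
      ultimately show ?thesis by blast
    qed
    have inf: "infinite ?D"
    proof
      assume "finite ?D"
      then have "finite ((\<lambda>i. the (S' i \<omega>)) ` ?D)" by simp
      moreover have "values_of (\<lambda>i. S' i \<omega>) \<subseteq> (\<lambda>i. the (S' i \<omega>)) ` ?D"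
      proof
        fix v assume "v \<in> values_of (\<lambda>i. S' i \<omega>)"
        then obtain i where "i \<in> ?D" "S' i \<omega> = Some v" using first by blast
        then show "v \<in> (\<lambda>i. the (S' i \<omega>)) ` ?D" by (intro image_eqI[of _ _ i]) simp_all
      qed
      ultimately have "finite (values_of (\<lambda>i. S' i \<omega>))" by (rule finite_subset[rotated])
      then show False using infinite_local[OF \<omega> st] unfolding M by simp
    qed
    have ixD: "D \<omega> (ix k \<omega>)" for k using enumerate_in_set[OF inf, of k] by (simp add: ixeq[OF inf])
    have "inj (\<lambda>k. R k \<omega>)"
    proof (rule linorder_injI)
      fix k l :: nat assume "k < l"
      then have "ix k \<omega> < ix l \<omega>" by (simp add: ixeq[OF inf] enumerate_mono[OF _ inf])
      then show "R k \<omega> \<noteq> R l \<omega>" using ixD[of l] unfolding D_def nn_def ee_def R_def by auto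
    qed
    moreover have "R k \<omega> \<noteq> None" for k using ixD[of k] unfolding D_def nn_def ee_def R_def by auto
    moreover have "values_of (\<lambda>i. S' i \<omega>) = values_of (\<lambda>k. R k \<omega>)"
    proof (intro equalityI subsetI)
      fix v assume "v \<in> values_of (\<lambda>i. S' i \<omega>)"
      then obtain i where i: "i \<in> ?D" "S' i \<omega> = Some v" using first by blast
      have "i \<in> range (enumerate ?D)" using i(1) unfolding range_enumerate[OF inf] .
      then obtain k where "i = enumerate ?D k" by (rule rangeE)
      then have "R k \<omega> = Some v" using i by (simp add: R_def ixeq[OF inf])
      then show "v \<in> values_of (\<lambda>k. R k \<omega>)" using rangeI[of "\<lambda>k. R k \<omega>" k] by (simp add: values_of_def)
    next
      fix v assume "v \<in> values_of (\<lambda>k. R k \<omega>)"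
      then show "v \<in> values_of (\<lambda>i. S' i \<omega>)" unfolding values_of_def R_def by auto
    qed
    ultimately show ?thesis using M by simp
  qed
  \<comment> \<open>The bad paths form a null set that may still meet \<open>\<Omega>1\<close>.
    There any enumeration of the countable infinite set will do, and \<open>Fld_complete\<close>
    keeps measurability.\<close>
  define R' where "R' n \<omega> = (if good \<omega> then R n \<omega> else Some (from_nat_into (M \<omega> \<inter> einterval s t) n))" for n \<omega>
  have proper: "inj (\<lambda>k. R' k \<omega>) \<and> (\<forall>k. R' k \<omega> \<noteq> None) \<and> M \<omega> \<inter> einterval s t = values_of (\<lambda>k. R' k \<omega>)"
    if \<omega>: "\<omega> \<in> \<Omega>1" for \<omega>
  proof (cases "good \<omega>")
    case True
    then show ?thesis using good[OF True] by (simp add: R'_def)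
  next
    case False
    have "countable (M \<omega> \<inter> einterval s t)" using M_countable[of \<omega>] \<omega> \<Omega>1(1) by auto
    then have b: "bij_betw (from_nat_into (M \<omega> \<inter> einterval s t)) UNIV (M \<omega> \<inter> einterval s t)"
      using infinite_local[OF \<omega> st] by (rule bij_betw_from_nat_into)
    then show ?thesis using False
      unfolding R'_def values_of_def bij_betw_def inj_def by auto
  qed
  have R'm: "R' n \<in> ?F \<rightarrow>\<^sub>M dagger_borel" for n
  proof (rule measurableI)
    fix B assume "B \<in> sets dagger_borel"
    then have "R n -` B \<inter> space ?F \<in> sets ?F" by (rule measurable_sets[OF Rm])
    then show "R' n -` B \<inter> space ?F \<in> sets ?F"
    proof (rule Fld_complete)
      show "AE \<omega> in W. \<omega> \<in> R n -` B \<inter> space ?F \<longleftrightarrow> \<omega> \<in> R' n -` B \<inter> space ?F"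
        using good_ae by eventually_elim (simp add: R'_def)
    qed (simp add: space_Fld)
  qed simp
  have "proper_enumeration W ?F (\<lambda>\<omega>. M \<omega> \<inter> einterval s t) \<Omega>1 R'"
    unfolding proper_enumeration_def measurable_enumeration_def
    using R'm proper AE_\<Omega>1 by (auto elim!: eventually_mono)
  then show ?thesis by blast
qed

definition loc :: "ereal \<Rightarrow> ereal \<Rightarrow> nat \<Rightarrow> path \<Rightarrow> real" where
  "loc s t j \<omega> = the (local_enumeration W M \<Omega>1 s t j \<omega>)"

lemma local_enumeration_proper:
  "s < t \<Longrightarrow> proper_enumeration W (Fld W s t) (\<lambda>\<omega>. M \<omega> \<inter> einterval s t) \<Omega>1 (local_enumeration W M \<Omega>1 s t)"
  unfolding local_enumeration_def by (rule someI_ex[OF local_enumeration_exists])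

lemma loc_inj: "s < t \<Longrightarrow> \<omega> \<in> \<Omega>1 \<Longrightarrow> inj (\<lambda>j. loc s t j \<omega>)"
  using local_enumeration_proper[of s t] unfolding proper_enumeration_def loc_def inj_def
  by (metis option.expand)

lemma loc_range:
  assumes "s < t" "\<omega> \<in> \<Omega>1" shows "range (\<lambda>j. loc s t j \<omega>) = M \<omega> \<inter> einterval s t"
proof -
  have p: "\<forall>k. local_enumeration W M \<Omega>1 s t k \<omega> \<noteq> None"
    "M \<omega> \<inter> einterval s t = values_of (\<lambda>k. local_enumeration W M \<Omega>1 s t k \<omega>)"
    using local_enumeration_proper[OF assms(1)] assms(2) unfolding proper_enumeration_def by blast+
  have "local_enumeration W M \<Omega>1 s t k \<omega> = Some (loc s t k \<omega>)" for k using p(1) by (simp add: loc_def)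
  then show ?thesis unfolding p(2) values_of_def by auto
qed

lemma loc_measurable: assumes "s < t" shows "loc s t j \<in> borel_measurable W"
proof -
  have "local_enumeration W M \<Omega>1 s t j \<in> Fld W s t \<rightarrow>\<^sub>M dagger_borel"
    using local_enumeration_proper[OF assms] unfolding proper_enumeration_def measurable_enumeration_def by blast
  from measurable_from_subalg[OF subalgebra_Fld measurable_compose[OF this the_measurable]]
  show ?thesis unfolding loc_def[abs_def] .
qed

text \<open>The global index of the \<open>j\<close>-th point in the local order. The default
  \<open>j\<close> outside \<open>\<Omega>1\<close> keeps the selection injective on the whole
  space, as \<open>coin_selection\<close> requires.\<close>

definition sel :: "ereal \<Rightarrow> ereal \<Rightarrow> nat \<Rightarrow> path \<Rightarrow> nat" where
  "sel s t j \<omega> = (if \<omega> \<in> \<Omega>1 then LEAST k. pt k \<omega> = loc s t j \<omega> else j)"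

lemma pt_sel: assumes "s < t" "\<omega> \<in> \<Omega>1" shows "pt (sel s t j \<omega>) \<omega> = loc s t j \<omega>"
proof -
  have "loc s t j \<omega> \<in> range (\<lambda>k. pt k \<omega>)" using loc_range[OF assms] pt_range[OF assms(2)] by blast
  then have "\<exists>k. pt k \<omega> = loc s t j \<omega>" by force
  then have "pt (LEAST k. pt k \<omega> = loc s t j \<omega>) \<omega> = loc s t j \<omega>" by (rule LeastI_ex)
  then show ?thesis using assms(2) by (simp add: sel_def)
qed

lemma coin_selection_sel: assumes st: "s < t" shows "coin_selection P W X p (sel s t)"
proof (intro coin_selection.intro C.coin_space_axioms coin_selection_axioms.intro)
  note [measurable] = loc_measurable[OF st] \<Omega>1(2)
  have [measurable]: "Measurable.pred W (\<lambda>\<omega>. pt k \<omega> = loc s t j \<omega>)" for k j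
    unfolding pred_def by (intro borel_measurable_eq pt_measurable loc_measurable[OF st])
  show "sel s t j \<in> W \<rightarrow>\<^sub>M count_space UNIV" for j unfolding sel_def[abs_def] by measurable
  fix \<omega> show "inj (\<lambda>j. sel s t j \<omega>)"
  proof (cases "\<omega> \<in> \<Omega>1")
    case True
    show ?thesis
    proof (rule injI)
      fix i j assume "sel s t i \<omega> = sel s t j \<omega>"
      then have "loc s t i \<omega> = loc s t j \<omega>" using pt_sel[OF st True] by metis
      then show "i = j" by (rule injD[OF loc_inj[OF st True]])
    qed
  next
    case False
    then show ?thesis by (simp add: sel_def inj_def)
  qed
qed

lemma sel_avoids:
  assumes "s < t" "\<omega> \<in> \<Omega>1" "pt k \<omega> \<notin> einterval s t" shows "sel s t j \<omega> \<noteq> k"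
  using pt_sel[OF assms(1,2), of j] loc_range[OF assms(1,2)] assms(3) by blast

lemma sel_hits:
  assumes "s < t" "\<omega> \<in> \<Omega>1" "pt k \<omega> \<in> einterval s t" shows "\<exists>j. sel s t j \<omega> = k"
proof -
  have "pt k \<omega> \<in> range (\<lambda>j. loc s t j \<omega>)" using loc_range[OF assms(1,2)] pt_range[OF assms(2)] assms(3) by auto
  then obtain j where "pt k \<omega> = loc s t j \<omega>" by auto
  then have "pt (sel s t j \<omega>) \<omega> = pt k \<omega>" using pt_sel[OF assms(1,2)] by simp
  then show ?thesis using pt_inj[OF assms(2)] by (auto dest: injD)
qed

section \<open>The local sigma-fields as fields of selected coins\<close>

abbreviation "NN \<equiv> NNM W M \<Omega>1 S"

definition sign :: "ereal \<Rightarrow> ereal \<Rightarrow> nat \<Rightarrow> signed_path \<Rightarrow> real" where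
  "sign s t j x = p (sel s t j (X x)) x"

lemma X_\<Omega>1: "x \<in> space P \<Longrightarrow> X x \<in> \<Omega>1"
  by (auto simp: X_eq OmegaM_def space_P)

lemma sign_eq: "s < t \<Longrightarrow> x \<in> space P \<Longrightarrow> (case x of (\<omega>, \<eta>) \<Rightarrow> \<eta> (the (local_enumeration W M \<Omega>1 s t j \<omega>))) = sign s t j x"
  using pt_sel[OF _ X_\<Omega>1, of s t x j] by (simp add: sign_def p_eq X_eq loc_def split_beta)

lemma sign_measurable: assumes st: "s < t" shows "sign s t j \<in> borel_measurable P"
proof -
  interpret K: coin_selection P W X p "sel s t" by (rule coin_selection_sel[OF st])
  show ?thesis using K.q_measurable[of j] unfolding sign_def[abs_def] K.q_def[abs_def] .
qed

definition gens :: "ereal \<Rightarrow> ereal \<Rightarrow> signed_path set set" where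
  "gens s t = {X -` A \<inter> space P |A. A \<in> increment_events W (\<lambda>\<omega>. \<omega>) s t} \<union>
    (\<Union>j. {sign s t j -` B \<inter> space P |B. B \<in> sets borel})"

lemma NN_eq: assumes st: "s < t" shows "NN s t = completed_sigma P (gens s t)"
proof -
  have 1: "increment_events P (\<lambda>x. fst (ThetaM S x)) s t = {X -` A \<inter> space P |A. A \<in> increment_events W (\<lambda>\<omega>. \<omega>) s t}"
  proof -
    have "(\<lambda>x. fst (ThetaM S x) v - fst (ThetaM S x) u) -` B \<inter> space P = X -` ((\<lambda>\<omega>. \<omega> v - \<omega> u) -` B \<inter> space W) \<inter> space P" for u v and B :: "real set"
      using measurable_space[OF C.X_measurable] by (auto simp: X_def[symmetric])
    note eq = this
    show ?thesis
    proof (intro set_eqI iffI)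
      fix C assume "C \<in> increment_events P (\<lambda>x. fst (ThetaM S x)) s t"
      then obtain u v B where uv: "s \<le> ereal u" "u \<le> v" "ereal v \<le> t" "B \<in> sets borel"
        and C: "C = (\<lambda>x. fst (ThetaM S x) v - fst (ThetaM S x) u) -` B \<inter> space P"
        unfolding increment_events_def events_of_def by auto
      have "(\<lambda>\<omega>. \<omega> v - \<omega> u) -` B \<inter> space W \<in> increment_events W (\<lambda>\<omega>. \<omega>) s t"
        unfolding increment_events_def events_of_def using uv by auto
      then show "C \<in> {X -` A \<inter> space P |A. A \<in> increment_events W (\<lambda>\<omega>. \<omega>) s t}"
        unfolding C eq by blast
    next
      fix C assume "C \<in> {X -` A \<inter> space P |A. A \<in> increment_events W (\<lambda>\<omega>. \<omega>) s t}"
      then obtain A where A: "A \<in> increment_events W (\<lambda>\<omega>. \<omega>) s t" "C = X -` A \<inter> space P" by auto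
      then obtain u v B where uv: "s \<le> ereal u" "u \<le> v" "ereal v \<le> t" "B \<in> sets borel"
        and B: "A = (\<lambda>\<omega>. \<omega> v - \<omega> u) -` B \<inter> space W"
        unfolding increment_events_def events_of_def by auto
      show "C \<in> increment_events P (\<lambda>x. fst (ThetaM S x)) s t"
        unfolding A(2) B eq[symmetric] increment_events_def events_of_def using uv by auto
    qed
  qed
  have 2: "events_of P (\<lambda>(\<omega>, \<eta>). \<eta> (the (local_enumeration W M \<Omega>1 s t j \<omega>))) = {sign s t j -` B \<inter> space P |B. B \<in> sets borel}" for j
  proof -
    have "(\<lambda>(\<omega>, \<eta>). \<eta> (the (local_enumeration W M \<Omega>1 s t j \<omega>))) -` B \<inter> space P = sign s t j -` B \<inter> space P" for B
    proof (rule set_eqI)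
      fix x
      show "x \<in> (\<lambda>(\<omega>, \<eta>). \<eta> (the (local_enumeration W M \<Omega>1 s t j \<omega>))) -` B \<inter> space P \<longleftrightarrow> x \<in> sign s t j -` B \<inter> space P"
        using sign_eq[OF st, of x j] by (cases "x \<in> space P") (simp_all only: vimage_eq Int_iff simp_thms)
    qed
    then show ?thesis unfolding events_of_def by simp
  qed
  show ?thesis unfolding NNM_def gens_def 1 2 ..
qed

lemma gens_cases:
  assumes "A \<in> gens s t"
  obtains (path) B where "A = X -` B \<inter> space P" "B \<in> increment_events W (\<lambda>\<omega>. \<omega>) s t"
    | (sign) j B where "A = sign s t j -` B \<inter> space P" "B \<in> sets borel"
proof -
  have "(\<exists>B. A = X -` B \<inter> space P \<and> B \<in> increment_events W (\<lambda>\<omega>. \<omega>) s t) \<or>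
      (\<exists>j B. A = sign s t j -` B \<inter> space P \<and> B \<in> sets borel)"
    using assms unfolding gens_def by (simp only: Un_iff UN_iff mem_Collect_eq UNIV_I simp_thms bex_UNIV)
  then show ?thesis using that by (elim disjE exE conjE) simp_all
qed

lemma gens_P: assumes st: "s < t" shows "gens s t \<subseteq> sets P"
proof
  fix A assume "A \<in> gens s t"
  then show "A \<in> sets P"
  proof (cases rule: gens_cases)
    case (path B)
    have "B \<in> sets W" using path(2) by (rule subsetD[OF increment_events_W])
    then show ?thesis unfolding path(1) by (rule measurable_sets[OF C.X_measurable])
  next
    case (sign j B)
    show ?thesis unfolding sign(1) by (rule measurable_sets[OF sign_measurable[OF st] sign(2)])
  qed
qed

lemma subalgebra_NN: "s < t \<Longrightarrow> subalgebra P (NN s t)"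
  unfolding NN_eq by (rule subalgebra_completed_sigma[OF gens_P])

lemma space_NN: "s < t \<Longrightarrow> space (NN s t) = space P"
  using subalgebra_NN unfolding subalgebra_def by blast

text \<open>Increment events are generators on both sides, and trivial events of W pull back to
  trivial events because \<open>X\<close> has law W.\<close>

lemma X_NN: assumes st: "s < t" shows "X \<in> NN s t \<rightarrow>\<^sub>M Fld W s t"
  unfolding Fld_def completed_sigma_def
proof (rule measurable_measure_of)
  show "increment_events W (\<lambda>\<omega>. \<omega>) s t \<union> {A \<in> W.events. W.prob A = 0 \<or> W.prob A = 1} \<subseteq> Pow (space W)"
    using increment_events_W sets.sets_into_space by blast
  show "X \<in> space (NN s t) \<rightarrow> space W" using measurable_space[OF C.X_measurable] by (auto simp: space_NN[OF st])
  fix A assume "A \<in> increment_events W (\<lambda>\<omega>. \<omega>) s t \<union> {A \<in> W.events. W.prob A = 0 \<or> W.prob A = 1}"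
  then consider "A \<in> increment_events W (\<lambda>\<omega>. \<omega>) s t" | "A \<in> sets W" "W.prob A = 0 \<or> W.prob A = 1" by blast
  then show "X -` A \<inter> space (NN s t) \<in> sets (NN s t)"
  proof cases
    case 1
    then have "X -` A \<inter> space P \<in> gens s t" unfolding gens_def by blast
    then show ?thesis unfolding space_NN[OF st] unfolding NN_eq[OF st] by (rule completed_sigma_basic[OF gens_P[OF st]])
  next
    case 2
    have "measure P (X -` A \<inter> space P) = W.prob A"
      using measure_distr[OF C.X_measurable 2(1)] by (simp add: C.distr_X)
    then show ?thesis unfolding space_NN[OF st] unfolding NN_eq[OF st] sets_completed_sigma[OF gens_P[OF st]]
      using 2 measurable_sets[OF C.X_measurable 2(1)] by (intro sigma_sets.Basic) auto
  qed
qed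

text \<open>Supplies the generators in the form that \<open>cond_exp_X\<close> and
  \<open>local_projection\<close> require: an event of one sign is, apart from the trivial cases, a
  cylinder of a single selected coin or its complement.\<close>

lemma NN_approx:
  assumes st: "s < t" and C: "C \<in> sets (NN s t)"
  shows "\<exists>D\<in>sigma_sets (space P) {coin_selection.qcyl P X p (sel s t) A J |A J. A \<in> sets (Fld W s t) \<and> finite J}.
    AE x in P. x \<in> C \<longleftrightarrow> x \<in> D"
proof -
  interpret K: coin_selection P W X p "sel s t" by (rule coin_selection_sel[OF st])
  have qs: "K.q j = sign s t j" for j by (rule ext) (simp add: K.q_def sign_def)
  let ?G = "{K.qcyl A J |A J. A \<in> sets (Fld W s t) \<and> finite J}"
  define V where "V = sigma (space P) ?G"
  have sub: "?G \<subseteq> Pow (space P)" using K.qcyl_subset by blast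
  have V: "sets V = sigma_sets (space P) ?G" "space V = space P" unfolding V_def using sub by auto
  have top: "Omega0 \<in> sets (Fld W s t)" using sets.top[of "Fld W s t"] by (simp add: space_Fld)
  have "\<exists>D\<in>sets V. AE x in P. True \<longrightarrow> (x \<in> C \<longleftrightarrow> x \<in> D)"
  proof (rule completed_sigma_AE_class[OF prob_space_P gens_P[OF st] V(2) C[unfolded NN_eq[OF st]]])
    fix A assume "A \<in> gens s t"
    then have "A \<in> sets V"
    proof (cases rule: gens_cases)
      case (path B)
      then have "B \<in> sets (Fld W s t)" unfolding Fld_def by (intro completed_sigma_basic[OF increment_events_W])
      then have "K.qcyl B {} \<in> sets V" unfolding V by (intro sigma_sets.Basic) blast
      then show ?thesis by (simp add: K.qcyl_def path vimage_def Int_def conj_commute)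
    next
      case (sign j B)
      have one: "{x \<in> space P. sign s t j x = 1} \<in> sets V"
      proof -
        have "K.qcyl Omega0 {j} \<in> sets V" unfolding V using top by (intro sigma_sets.Basic) blast
        moreover have "K.qcyl Omega0 {j} = {x \<in> space P. sign s t j x = 1}"
          using measurable_space[OF C.X_measurable] by (auto simp: K.qcyl_def qs space_W)
        ultimately show ?thesis by simp
      qed
      have "A = (if 1 \<in> B then {x \<in> space P. sign s t j x = 1} else {}) \<union>
          (if -1 \<in> B then space P - {x \<in> space P. sign s t j x = 1} else {})"
      proof (rule set_eqI)
        fix x
        show "x \<in> A \<longleftrightarrow> x \<in> (if 1 \<in> B then {x \<in> space P. sign s t j x = 1} else {}) \<union>
          (if -1 \<in> B then space P - {x \<in> space P. sign s t j x = 1} else {})"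
          using K.q_values[of x j] unfolding qs by (cases "x \<in> space P") (auto simp: sign)
      qed
      also have "\<dots> \<in> sets V" using one V(2) sets.top[of V] by (auto intro!: sets.Un sets.Diff)
      finally show ?thesis .
    qed
    then show "\<exists>D\<in>sets V. AE x in P. True \<longrightarrow> (x \<in> A \<longleftrightarrow> x \<in> D)" by blast
  qed
  then show ?thesis unfolding V by simp
qed

lemma NN_projection:
  fixes Y :: "signed_path \<Rightarrow> real"
  assumes st: "s < t" and Y: "integrable P Y" "Y \<in> borel_measurable (NN s t)"
  shows "\<exists>y. integrable W y \<and> y \<in> borel_measurable (Fld W s t) \<and>
    (\<forall>A\<in>sets W. (\<integral>x. Y x * indicator A (X x) \<partial>P) = (\<integral>\<omega>. y \<omega> * indicator A \<omega> \<partial>W))"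
  by (rule coin_selection.local_projection[OF coin_selection_sel[OF st] subalgebra_Fld subalgebra_NN[OF st] X_NN[OF st]
        NN_approx[OF st] Y])

lemma NN_cond_exp_X:
  assumes st: "s < t" and g: "integrable W g"
  shows "AE x in P. real_cond_exp P (NN s t) (\<lambda>x. g (X x)) x = real_cond_exp W (Fld W s t) g (X x)"
  by (rule coin_selection.cond_exp_X[OF coin_selection_sel[OF st] subalgebra_Fld subalgebra_NN[OF st] X_NN[OF st]
        NN_approx[OF st] g])

subsection \<open>Superchaos\<close>

abbreviation "SW \<equiv> sigma_W W M \<Omega>1 S"

definition wgens :: "signed_path set set" where
  "wgens = {X -` A \<inter> space P |A. A \<in> sets W \<and> A \<subseteq> \<Omega>1}"

lemma SW_eq: "SW = completed_sigma P wgens"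
proof -
  have "A \<in> sets (restrict_space W \<Omega>1) \<longleftrightarrow> A \<subseteq> \<Omega>1 \<and> A \<in> sets W" for A
    by (rule sets_restrict_space_iff) (use \<Omega>1 in \<open>auto simp: space_W Int_absorb2\<close>)
  then have "{(\<lambda>x. fst (ThetaM S x)) -` A \<inter> OmegaM M \<Omega>1 |A. A \<in> sets (restrict_space W \<Omega>1)} = wgens"
    unfolding wgens_def space_P X_def[abs_def] by (simp add: conj_commute)
  then show ?thesis unfolding sigma_W_def by simp
qed

lemma wgens_P: "wgens \<subseteq> sets P"
proof
  fix A assume "A \<in> wgens"
  then obtain B where "A = X -` B \<inter> space P" "B \<in> sets W" unfolding wgens_def by blast
  then show "A \<in> sets P" using measurable_sets[OF C.X_measurable] by simp
qed

lemma subalgebra_SW: "subalgebra P SW"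
  unfolding SW_eq by (rule subalgebra_completed_sigma[OF wgens_P])

lemma space_SW: "space SW = space P"
  using subalgebra_SW unfolding subalgebra_def by blast

lemma X_restrict: "X -` A \<inter> space P = X -` (A \<inter> \<Omega>1) \<inter> space P"
  using X_\<Omega>1 by auto

lemma X_SW: "X \<in> SW \<rightarrow>\<^sub>M W"
proof (rule measurableI)
  fix A assume A: "A \<in> sets W"
  have "X -` (A \<inter> \<Omega>1) \<inter> space P \<in> wgens" unfolding wgens_def using A \<Omega>1(2) by blast
  then show "X -` A \<inter> space SW \<in> sets SW"
    unfolding space_SW X_restrict[of A] unfolding SW_eq by (rule completed_sigma_basic[OF wgens_P])
qed (use measurable_space[OF C.X_measurable] in \<open>simp add: space_SW\<close>)

text \<open>Since \<open>sigma_stb\<close> will turn out to have the same events as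
  \<open>SW\<close> (see \<open>sets_ST\<close>), this is the field occurring in the definition of
  the first superchaos. It can be studied before that identification.\<close>

definition JJ :: "ereal \<Rightarrow> ereal \<Rightarrow> signed_path measure" where
  "JJ s t = join_sigma (NN s t) SW"

lemma SW_sets_P: "sets SW \<subseteq> sets P"
  using subalgebra_SW unfolding subalgebra_def by blast

lemma X_event_others: "A \<in> sets W \<Longrightarrow> X -` A \<inter> space P \<in> sets (C.others k)"
  using measurable_sets[OF C.X_others] by simp

context
  fixes s t :: ereal assumes st: "s < t"
begin

lemma NN_sets_P: "sets (NN s t) \<subseteq> sets P"
  using subalgebra_NN[OF st] unfolding subalgebra_def by blast

lemma JJ_Pow: "sets (NN s t) \<union> sets SW \<subseteq> Pow (space P)"
  using NN_sets_P SW_sets_P sets.sets_into_space by blast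

lemma space_JJ: "space (JJ s t) = space P"
  unfolding JJ_def join_sigma_def space_NN[OF st] by (rule space_measure_of[OF JJ_Pow])

lemma sets_JJ: "sets (JJ s t) = sigma_sets (space P) (sets (NN s t) \<union> sets SW)"
  unfolding JJ_def join_sigma_def space_NN[OF st] by (rule sets_measure_of[OF JJ_Pow])

lemma subalgebra_JJ: "subalgebra P (JJ s t)"
  unfolding subalgebra_def space_JJ sets_JJ
  by (intro conjI refl sets.sigma_sets_subset Un_least NN_sets_P SW_sets_P)

lemma NN_JJ: "f \<in> NN s t \<rightarrow>\<^sub>M L \<Longrightarrow> f \<in> JJ s t \<rightarrow>\<^sub>M L"
  by (rule measurable_from_subalg[rotated])
    (auto simp: subalgebra_def space_JJ sets_JJ space_NN[OF st] intro: sigma_sets.Basic)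

lemma SW_JJ: "f \<in> SW \<rightarrow>\<^sub>M L \<Longrightarrow> f \<in> JJ s t \<rightarrow>\<^sub>M L"
  by (rule measurable_from_subalg[rotated])
    (auto simp: subalgebra_def space_JJ sets_JJ space_SW intro: sigma_sets.Basic)

lemma sign_JJ: "sign s t j \<in> borel_measurable (JJ s t)"
proof (rule NN_JJ, rule measurableI)
  fix B :: "real set" assume B: "B \<in> sets borel"
  have "sign s t j -` B \<inter> space P \<in> gens s t" unfolding gens_def using B by blast
  then show "sign s t j -` B \<inter> space (NN s t) \<in> sets (NN s t)"
    unfolding space_NN[OF st] unfolding NN_eq[OF st] by (rule completed_sigma_basic[OF gens_P[OF st]])
qed simp

text \<open>On the event that \<open>pt k\<close> lies outside the interval, the sign at \<open>pt k\<close> is independent of \<open>JJ s t\<close>.\<close>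

lemma vanishes_outside:
  assumes A: "A \<in> sets W" "A \<subseteq> \<Omega>1" and out: "\<And>\<omega>. \<omega> \<in> A \<Longrightarrow> pt k \<omega> \<notin> einterval s t"
    and K: "finite K" "k \<in> K" and Y: "Y \<in> rL2 P" "Y \<in> borel_measurable (JJ s t)"
  shows "C.vanishes Y K A"
proof (rule C.orthogonal_on[OF subalgebra_JJ sets_JJ A(1) K _ Y])
  interpret K: coin_selection P W X p "sel s t" by (rule coin_selection_sel[OF st])
  have qs: "K.q j = sign s t j" for j by (rule ext) (simp add: K.q_def sign_def)
  fix C assume "C \<in> sets (NN s t) \<union> sets SW"
  then consider "C \<in> sets (completed_sigma P (gens s t))" | "C \<in> sets (completed_sigma P wgens)"
    unfolding NN_eq[OF st] SW_eq by blast
  then show "\<exists>D\<in>sets (C.others k). AE x in P. X x \<in> A \<longrightarrow> (x \<in> C \<longleftrightarrow> x \<in> D)"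
  proof cases
    case 1
    show ?thesis
    proof (rule completed_sigma_AE_class[OF prob_space_P gens_P[OF st] C.space_others 1])
      fix G assume "G \<in> gens s t"
      then show "\<exists>D\<in>sets (C.others k). AE x in P. X x \<in> A \<longrightarrow> (x \<in> G \<longleftrightarrow> x \<in> D)"
      proof (cases rule: gens_cases)
        case (path B)
        have "B \<in> sets W" using path(2) by (rule subsetD[OF increment_events_W])
        then have "G \<in> sets (C.others k)" unfolding path(1) by (rule X_event_others)
        then show ?thesis by (intro bexI[of _ G]) auto
      next
        case (sign j B)
        \<comment> \<open>On the event in question the \<open>j\<close>-th local point is not
          \<open>pt k\<close>, so its sign can be expressed without the coin
          \<open>k\<close>.\<close>
        define D where "D = (if 1 \<in> B then K.q_avoiding k j else {}) \<union> (if -1 \<in> B then space P - K.q_avoiding k j else {})"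
        have "space P \<in> sets (C.others k)" using sets.top[of "C.others k"] by simp
        then have D: "D \<in> sets (C.others k)"
          unfolding D_def using K.q_avoiding_sets[of k j] by (auto intro!: sets.Un sets.Diff)
        have "x \<in> G \<longleftrightarrow> x \<in> D" if x: "x \<in> space P" and XA: "X x \<in> A" for x
        proof -
          have "sel s t j (X x) \<noteq> k" by (rule sel_avoids[OF st X_\<Omega>1[OF x] out[OF XA]])
          then have "x \<in> K.q_avoiding k j \<longleftrightarrow> sign s t j x = 1" using K.q_avoiding_iff[OF x] unfolding qs by blast
          then show ?thesis using K.q_values[OF x, of j] x unfolding qs D_def sign(1) by auto
        qed
        then show ?thesis using D by (intro bexI[of _ D] AE_I2) auto
      qed
    qed
  next
    case 2
    show ?thesis
    proof (rule completed_sigma_AE_class[OF prob_space_P wgens_P C.space_others 2])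
      fix G assume "G \<in> wgens"
      then obtain B where "G = X -` B \<inter> space P" "B \<in> sets W" unfolding wgens_def by blast
      then have "G \<in> sets (C.others k)" using X_event_others by simp
      then show "\<exists>D\<in>sets (C.others k). AE x in P. X x \<in> A \<longrightarrow> (x \<in> G \<longleftrightarrow> x \<in> D)"
        by (intro bexI[of _ G]) auto
    qed
  qed
qed

text \<open>If \<open>pt k\<close> lies in the interval, some local place \<open>j\<close> carries
  it. The path component in \<open>JJ s t\<close> reveals which one, and the local sign is then the
  coin \<open>k\<close>.\<close>

lemma sign_inside_measurable:
  assumes B [measurable]: "B \<in> sets W" and BO: "B \<subseteq> \<Omega>1" and inn: "\<And>\<omega>. \<omega> \<in> B \<Longrightarrow> pt k \<omega> \<in> einterval s t"
  shows "(\<lambda>x. p k x * indicator B (X x)) \<in> borel_measurable (JJ s t)"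
proof -
  note [measurable] = SW_JJ[OF X_SW] sign_JJ coin_selection.\<kappa>_measurable[OF coin_selection_sel[OF st]]
  define D where "D = (\<Union>j. {x \<in> space (JJ s t). X x \<in> B \<and> sel s t j (X x) = k \<and> sign s t j x = 1})"
  have [measurable]: "D \<in> sets (JJ s t)" unfolding D_def by (intro sets.countable_UN') auto
  have eq: "p k x * indicator B (X x) = 2 * indicator D x - indicator B (X x)" if x: "x \<in> space P" for x
  proof -
    have "x \<in> D \<longleftrightarrow> X x \<in> B \<and> p k x = 1"
    proof (cases "X x \<in> B")
      case True
      obtain j where j: "sel s t j (X x) = k" using sel_hits[OF st X_\<Omega>1[OF x] inn[OF True]] by blast
      have "sign s t i x = p k x" if "sel s t i (X x) = k" for i by (simp add: sign_def that)
      then show ?thesis using j True x unfolding D_def space_JJ by auto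
    next
      case False
      then show ?thesis unfolding D_def by auto
    qed
    then show ?thesis using p_values[OF x, of k] by (auto simp: indicator_def)
  qed
  have "(\<lambda>x. 2 * indicator D x - indicator B (X x) :: real) \<in> borel_measurable (JJ s t)" by measurable
  then show ?thesis
    by (rule measurable_cong[THEN iffD2, rotated]) (rule eq, simp add: space_JJ)
qed

text \<open>On \<open>A\<close> all coins of \<open>K\<close> are known to \<open>JJ s t\<close>, so
  the test function \<open>wal K x * indicator B (X x)\<close> passes through the conditional
  expectation.\<close>

lemma cond_exp_vanishes_inside_iff:
  assumes A: "A \<in> sets W" "A \<subseteq> \<Omega>1" and inn: "\<And>\<omega> k. \<omega> \<in> A \<Longrightarrow> k \<in> K \<Longrightarrow> pt k \<omega> \<in> einterval s t"
    and K: "finite K" and f: "f \<in> rL2 P"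
  shows "C.vanishes (real_cond_exp P (JJ s t) f) K A \<longleftrightarrow> C.vanishes f K A"
proof -
  interpret S: sigma_finite_subalgebra P "JJ s t"
    by (rule subalgebra_sigma_finite[OF prob_space_P subalgebra_JJ])
  have "(\<integral>x. real_cond_exp P (JJ s t) f x * C.wal K x * indicator B (X x) \<partial>P) =
      (\<integral>x. f x * C.wal K x * indicator B (X x) \<partial>P)" if B: "B \<in> sets W" "B \<subseteq> A" for B
  proof -
    note [measurable] = B(1) SW_JJ[OF X_SW]
    define u where "u x = C.wal K x * indicator B (X x)" for x
    \<comment> \<open>The extra indicator covers the case of empty \<open>K\<close>, where the
      product alone would be 1.\<close>
    have "(\<lambda>x. (\<Prod>k\<in>K. p k x * indicator B (X x)) * indicator B (X x)) \<in> borel_measurable (JJ s t)"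
      by (intro borel_measurable_times borel_measurable_prod sign_inside_measurable) (use A B inn in auto)
    moreover have "(\<Prod>k\<in>K. p k x * indicator B (X x)) * indicator B (X x) = u x" for x
      by (cases "X x \<in> B") (simp_all add: u_def C.wal_def)
    ultimately have u: "u \<in> borel_measurable (JJ s t)" by simp
    have um [measurable]: "u \<in> borel_measurable P" by (rule measurable_from_subalg[OF subalgebra_JJ u])
    have "(\<lambda>x. f x * u x) \<in> rL2 P"
      by (rule rL2_bounded_mult[OF f um]) (use C.wal_bounded[of _ K] in \<open>auto simp: u_def indicator_def\<close>)
    then have i: "integrable P (\<lambda>x. u x * f x)"
      using C.P.rL2_integrable by (simp add: mult.commute)
    show ?thesis
      using S.real_cond_exp_intg(2)[OF i u rL2_measurable[OF f]] by (simp add: u_def mult_ac)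
  qed
  then show ?thesis unfolding C.vanishes_def by auto
qed

end

text \<open>Glueing: the exceptional null sets of countably many pieces have a null union.\<close>

lemma vanishes_cover:
  assumes f: "f \<in> rL2 P" and I: "countable I" and B: "\<And>i. i \<in> I \<Longrightarrow> B i \<in> sets W"
    and v: "\<And>i. i \<in> I \<Longrightarrow> C.vanishes f K (B i)" and cover: "AE \<omega> in W. \<exists>i\<in>I. \<omega> \<in> B i"
  shows "C.vanishes f K (space W)"
  unfolding C.vanishes_space_iff[OF f]
proof -
  have "AE \<omega> in W. \<forall>i\<in>I. \<omega> \<in> B i \<longrightarrow> C.coef f K \<omega> = 0"
    unfolding AE_ball_countable[OF I] using v C.vanishes_iff[OF f B] by blast
  then show "AE \<omega> in W. C.coef f K \<omega> = 0" using cover by eventually_elim blast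
qed

lemma vanishes_cong_AE:
  assumes f: "f \<in> borel_measurable P" and g: "g \<in> borel_measurable P" and eq: "AE x in P. f x = g x" and v: "C.vanishes f K A"
  shows "C.vanishes g K A"
  unfolding C.vanishes_def
proof (intro ballI impI)
  fix B assume B: "B \<in> sets W" "B \<subseteq> A"
  note [measurable] = f g B(1)
  have "(\<integral>x. g x * C.wal K x * indicator B (X x) \<partial>P) = (\<integral>x. f x * C.wal K x * indicator B (X x) \<partial>P)"
    by (rule integral_cong_AE) (use eq in \<open>auto elim: eventually_mono\<close>)
  then show "(\<integral>x. g x * C.wal K x * indicator B (X x) \<partial>P) = 0" using v B unfolding C.vanishes_def by auto
qed

lemma vanishes_mono: "C.vanishes f K A \<Longrightarrow> B \<subseteq> A \<Longrightarrow> C.vanishes f K B"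
  unfolding C.vanishes_def by auto

lemma vanishes_sum:
  assumes "f \<in> rL2 P" "g1 \<in> rL2 P" "g2 \<in> rL2 P" "AE x in P. f x = g1 x + g2 x" "C.vanishes g1 K A" "C.vanishes g2 K A"
  shows "C.vanishes f K A"
proof (rule vanishes_cong_AE[OF _ _ _ C.vanishes_add(1)[OF assms(2,3,5,6)]])
  show "AE x in P. g1 x + g2 x = f x" using assms(4) by (rule eventually_mono) simp
qed (rule rL2_measurable[OF rL2_add[OF assms(2,3)]] rL2_measurable[OF assms(1)])+

lemma past_interval: "x \<in> einterval (-\<infinity>) (ereal t) \<longleftrightarrow> x < t"
  and future_interval: "x \<in> einterval (ereal t) \<infinity> \<longleftrightarrow> t < x"
  by (auto simp: einterval_def)

lemma past_lt: "-\<infinity> < ereal t" and future_lt: "ereal t < \<infinity>"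
  by simp_all

text \<open>Common shape of the decompositions defining the first chaos and the first superchaos; a
  function measurable for \<open>NN\<close> is also measurable for \<open>JJ\<close>, so facts about
  \<open>splits\<close> apply to both.\<close>

definition splits :: "(signed_path \<Rightarrow> real) \<Rightarrow> real \<Rightarrow> (signed_path \<Rightarrow> real) \<Rightarrow> (signed_path \<Rightarrow> real) \<Rightarrow> bool" where
  "splits f t g1 g2 \<longleftrightarrow> g1 \<in> rL2 P \<and> g1 \<in> borel_measurable (JJ (-\<infinity>) (ereal t)) \<and>
     g2 \<in> rL2 P \<and> g2 \<in> borel_measurable (JJ (ereal t) \<infinity>) \<and> (AE x in P. f x = g1 x + g2 x)"

text \<open>Where \<open>t\<close> separates two points of \<open>K\<close>, the later one lies
  outside the past interval and the earlier one outside the future interval, so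
  \<open>vanishes_outside\<close> applies to both summands.\<close>

lemma vanishes_straddle:
  assumes f: "f \<in> rL2 P" and K: "finite K" "j \<in> K" "k \<in> K" "j \<noteq> k"
    and split: "\<And>t. \<exists>g1 g2. splits f t g1 g2"
  shows "C.vanishes f K (space W)"
proof -
  define B where "B j k t = {\<omega> \<in> space W. \<omega> \<in> \<Omega>1 \<and> pt j \<omega> < t \<and> t < pt k \<omega>}" for j k t
  note [measurable] = \<Omega>1(2)
  have B [measurable]: "B j k t \<in> sets W" for j k t unfolding B_def by measurable
  have v: "C.vanishes f K (B j k t)" if jk: "j \<in> K" "k \<in> K" for j k t
  proof -
    obtain g1 g2 where g: "g1 \<in> rL2 P" "g1 \<in> borel_measurable (JJ (-\<infinity>) (ereal t))"
       "g2 \<in> rL2 P" "g2 \<in> borel_measurable (JJ (ereal t) \<infinity>)" "AE x in P. f x = g1 x + g2 x"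
      using split[of t] unfolding splits_def by blast
    have sub: "B j k t \<subseteq> \<Omega>1" by (auto simp: B_def)
    show ?thesis
    proof (rule vanishes_sum[OF f g(1,3,5)])
      show "C.vanishes g1 K (B j k t)"
        by (rule vanishes_outside[OF past_lt B sub _ K(1) jk(2) g(1,2)]) (auto simp: past_interval B_def)
      show "C.vanishes g2 K (B j k t)"
        by (rule vanishes_outside[OF future_lt B sub _ K(1) jk(1) g(3,4)]) (auto simp: future_interval B_def)
    qed
  qed
  \<comment> \<open>The boolean records which of the two points comes first, the real number a time
    between them.\<close>
  define BB where "BB = (\<lambda>(t, b). if b then B j k t else B k j t)"
  have "countable ((\<rat> :: real set) \<times> (UNIV :: bool set))" using countable_rat by auto
  then show ?thesis
  proof (rule vanishes_cover[OF f, where B=BB])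
    show "BB i \<in> sets W" for i unfolding BB_def by (cases i) auto
    show "C.vanishes f K (BB i)" for i unfolding BB_def using v[OF K(2,3)] v[OF K(3,2)] by (cases i) auto
    show "AE \<omega> in W. \<exists>i\<in>\<rat> \<times> UNIV. \<omega> \<in> BB i"
      using AE_\<Omega>1 AE_space
    proof eventually_elim
      fix \<omega> assume \<omega>: "\<omega> \<in> \<Omega>1" "\<omega> \<in> space W"
      have "pt j \<omega> \<noteq> pt k \<omega>" using pt_inj[OF \<omega>(1)] K(4) by (auto dest: injD)
      then consider "pt j \<omega> < pt k \<omega>" | "pt k \<omega> < pt j \<omega>" by linarith
      then show "\<exists>i\<in>\<rat> \<times> UNIV. \<omega> \<in> BB i"
      proof cases
        case 1
        obtain t where "t \<in> \<rat>" "pt j \<omega> < t" "t < pt k \<omega>" using Rats_dense_in_real[OF 1] by (elim bexE conjE)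
        then show ?thesis using \<omega> by (intro bexI[of _ "(t, True)"]) (simp_all add: BB_def B_def)
      next
        case 2
        obtain t where "t \<in> \<rat>" "pt k \<omega> < t" "t < pt j \<omega>" using Rats_dense_in_real[OF 2] by (elim bexE conjE)
        then show ?thesis using \<omega> by (intro bexI[of _ "(t, False)"]) (simp_all add: BB_def B_def)
      qed
    qed
  qed
qed

lemma two_elements: "finite K \<Longrightarrow> K \<noteq> {} \<Longrightarrow> card K \<noteq> 1 \<Longrightarrow> \<exists>j k. j \<in> K \<and> k \<in> K \<and> j \<noteq> k"
  using is_singletonI'[of K] is_singleton_altdef[of K] by blast

lemma cond_exp_JJ:
  assumes st: "s < t" and f: "f \<in> rL2 P"
  shows "real_cond_exp P (JJ s t) f \<in> rL2 P" "real_cond_exp P (JJ s t) f \<in> borel_measurable (JJ s t)"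
  using real_cond_exp_square[OF prob_space_P subalgebra_JJ[OF st] f] by auto

text \<open>Conditioning does not create Walsh terms: where all points of \<open>K\<close> are
  inside, the coefficient is the old one, and where some point is outside, the coefficient is zero
  anyway.\<close>

lemma cond_exp_vanishes:
  assumes st: "s < t" and f: "f \<in> rL2 P" and K: "finite K" and v: "C.vanishes f K (space W)"
  shows "C.vanishes (real_cond_exp P (JJ s t) f) K (space W)"
proof -
  note E = cond_exp_JJ[OF st f]
  define In where "In k = {\<omega> \<in> space W. pt k \<omega> \<in> einterval s t}" for k
  have In [measurable]: "In k \<in> sets W" for k
    using measurable_sets[OF pt_measurable, of "einterval s t" k] by (simp add: In_def vimage_def Int_def conj_commute)
  define A where "A = \<Omega>1 \<inter> {\<omega> \<in> space W. \<forall>k\<in>K. \<omega> \<in> In k}"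
  have A: "A \<in> sets W"
    unfolding A_def by (intro sets.Int \<Omega>1(2) sets.sets_Collect_finite_All[OF _ K]) measurable
  have AB: "\<Omega>1 - In k \<in> sets W" for k using \<Omega>1(2) by auto
  \<comment> \<open>\<open>None\<close> stands for all points of \<open>K\<close> inside the
    interval, \<open>Some k\<close> for \<open>pt k\<close> outside.\<close>
  define B where "B = (\<lambda>i. case i of None \<Rightarrow> A | Some k \<Rightarrow> \<Omega>1 - In k)"
  show ?thesis
  proof (rule vanishes_cover[OF E(1), where B=B and I="insert None (Some ` K)"])
    show "countable (insert None (Some ` K))" using K by (intro countable_finite) auto
    show "B i \<in> sets W" for i unfolding B_def using A AB by (cases i) auto
    show "C.vanishes (real_cond_exp P (JJ s t) f) K (B i)" if i: "i \<in> insert None (Some ` K)" for i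
    proof (cases i)
      case None
      have "C.vanishes f K A" by (rule vanishes_mono[OF v]) (use sets.sets_into_space[OF A] in blast)
      then have "C.vanishes (real_cond_exp P (JJ s t) f) K A"
        by (subst cond_exp_vanishes_inside_iff[OF st A _ _ K f]) (auto simp: A_def In_def)
      then show ?thesis by (simp add: B_def None)
    next
      case (Some k)
      have "C.vanishes (real_cond_exp P (JJ s t) f) K (\<Omega>1 - In k)"
        by (rule vanishes_outside[OF st AB _ _ K _ E, of k]) (use i Some \<Omega>1(1) in \<open>auto simp: In_def space_W\<close>)
      then show ?thesis by (simp add: B_def Some)
    qed
    show "AE \<omega> in W. \<exists>i\<in>insert None (Some ` K). \<omega> \<in> B i"
      using AE_\<Omega>1 AE_space by eventually_elim (auto simp: B_def A_def)
  qed
qed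

definition real_superchaos :: "(signed_path \<Rightarrow> real) \<Rightarrow> bool" where
  "real_superchaos f \<longleftrightarrow> (\<forall>t::real. AE x in P. f x = real_cond_exp P (JJ (-\<infinity>) (ereal t)) f x + real_cond_exp P (JJ (ereal t) \<infinity>) f x)"

lemma splits_cond_exp:
  assumes f: "f \<in> rL2 P" and "real_superchaos f"
  shows "splits f t (real_cond_exp P (JJ (-\<infinity>) (ereal t)) f) (real_cond_exp P (JJ (ereal t) \<infinity>) f)"
  using assms cond_exp_JJ[OF past_lt f] cond_exp_JJ[OF future_lt f] unfolding splits_def real_superchaos_def by blast

theorem real_superchaos_iff:
  assumes f: "f \<in> rL2 P"
  shows "real_superchaos f \<longleftrightarrow> (\<forall>K. finite K \<and> card K \<noteq> 1 \<longrightarrow> C.vanishes f K (space W))"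
proof (intro iffI allI impI)
  fix K :: "nat set" assume sc: "real_superchaos f" and "finite K \<and> card K \<noteq> 1"
  then have K: "finite K" "card K \<noteq> 1" by auto
  show "C.vanishes f K (space W)"
  proof (cases "K = {}")
    case False
    then obtain j k where "j \<in> K" "k \<in> K" "j \<noteq> k" using two_elements K by blast
    then show ?thesis using vanishes_straddle[OF f K(1)] splits_cond_exp[OF f sc] by blast
  next
    case True
    \<comment> \<open>Both fields contain \<open>SW\<close>, so over an event of W each conditional
      expectation has the same integral as \<open>f\<close>. The integral of \<open>f\<close> thus
      equals twice itself and is zero.\<close>
    have v1: "C.vanishes f {} \<Omega>1"
    proof -
      let ?g = "real_cond_exp P (JJ (-\<infinity>) (ereal 0)) f" and ?h = "real_cond_exp P (JJ (ereal 0) \<infinity>) f"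
      have gh: "?g \<in> rL2 P" "?h \<in> rL2 P" "AE x in P. f x = ?g x + ?h x"
        using splits_cond_exp[OF f sc, of 0] unfolding splits_def by blast+

      interpret S1: sigma_finite_subalgebra P "JJ (-\<infinity>) (ereal 0)"
        by (rule subalgebra_sigma_finite[OF prob_space_P subalgebra_JJ[OF past_lt]])
      interpret S2: sigma_finite_subalgebra P "JJ (ereal 0) \<infinity>"
        by (rule subalgebra_sigma_finite[OF prob_space_P subalgebra_JJ[OF future_lt]])
      show ?thesis unfolding C.vanishes_def
      proof (intro ballI impI)
        fix A assume A: "A \<in> sets W" "A \<subseteq> \<Omega>1"
        note [measurable] = A(1)
        define u where "u x = (indicator A (X x) :: real)" for x
        have u1: "u \<in> borel_measurable (JJ (-\<infinity>) (ereal 0))" "u \<in> borel_measurable (JJ (ereal 0) \<infinity>)" "u \<in> borel_measurable P"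
          using measurable_compose[OF SW_JJ[OF past_lt X_SW] borel_measurable_indicator[OF A(1)]]
            measurable_compose[OF SW_JJ[OF future_lt X_SW] borel_measurable_indicator[OF A(1)]]
            measurable_compose[OF C.X_measurable borel_measurable_indicator[OF A(1)]]
          unfolding u_def[abs_def] by blast+
        have ui: "integrable P (\<lambda>x. u x * h x)" if "h \<in> rL2 P" for h
          using C.P.rL2_integrable[OF rL2_bounded_mult[OF that u1(3)]] by (simp add: u_def indicator_def mult.commute)
        note [measurable] = u1(3) rL2_measurable[OF f] rL2_measurable[OF gh(1)] rL2_measurable[OF gh(2)]
        have "(\<integral>x. u x * f x \<partial>P) = (\<integral>x. u x * ?g x + u x * ?h x \<partial>P)"
        proof (rule integral_cong_AE)
          show "AE x in P. u x * f x = u x * ?g x + u x * ?h x"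
            using gh(3) by (rule eventually_mono) (simp add: distrib_left)
        qed measurable
        also have "\<dots> = (\<integral>x. u x * ?g x \<partial>P) + (\<integral>x. u x * ?h x \<partial>P)"
          by (rule Bochner_Integration.integral_add[OF ui[OF gh(1)] ui[OF gh(2)]])
        also have "\<dots> = (\<integral>x. u x * f x \<partial>P) + (\<integral>x. u x * f x \<partial>P)"
          using S1.real_cond_exp_intg(2)[OF ui[OF f] u1(1) rL2_measurable[OF f]]
            S2.real_cond_exp_intg(2)[OF ui[OF f] u1(2) rL2_measurable[OF f]] by simp
        finally have "(\<integral>x. u x * f x \<partial>P) = 0" by simp
        then show "(\<integral>x. f x * C.wal {} x * indicator A (X x) \<partial>P) = 0" by (simp add: u_def mult.commute)
      qed
    qed
    show ?thesis unfolding True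
      by (rule vanishes_cover[OF f, where I="{()}" and B="\<lambda>_. \<Omega>1"]) (use v1 \<Omega>1(2) AE_\<Omega>1 in auto)
  qed
next
  assume v: "\<forall>K. finite K \<and> card K \<noteq> 1 \<longrightarrow> C.vanishes f K (space W)"
  show "real_superchaos f" unfolding real_superchaos_def
  proof
    fix t :: real
    let ?g = "real_cond_exp P (JJ (-\<infinity>) (ereal t)) f" and ?h = "real_cond_exp P (JJ (ereal t) \<infinity>) f"
    note g = cond_exp_JJ[OF past_lt[of t] f] and h = cond_exp_JJ[OF future_lt[of t] f]
    have gh: "(\<lambda>x. ?g x + ?h x) \<in> rL2 P" by (rule rL2_add[OF g(1) h(1)])
    show "AE x in P. f x = ?g x + ?h x"
    proof (rule C.eq_if_differences_vanish[OF f gh])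
      fix K :: "nat set" assume K: "finite K"
      show "C.vanishes (\<lambda>x. f x - (?g x + ?h x)) K (space W)"
      proof (cases "card K = 1")
        case False
        then have vf: "C.vanishes f K (space W)" using v K by blast
        show ?thesis
          by (rule C.vanishes_add(2)[OF f gh vf C.vanishes_add(1)[OF g(1) h(1)
              cond_exp_vanishes[OF past_lt f K vf] cond_exp_vanishes[OF future_lt f K vf]]])
      next
        case True
        then obtain k where Kk: "K = {k}" by (auto simp: card_1_singleton_iff)
        define B where "B b = {\<omega> \<in> space W. \<omega> \<in> \<Omega>1 \<and> (if b then pt k \<omega> < t else t < pt k \<omega>)}" for b
        note [measurable] = \<Omega>1(2)
        have B: "B b \<in> sets W" for b unfolding B_def by (cases b) simp_all
        have sub: "B b \<subseteq> \<Omega>1" for b by (auto simp: B_def)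
        let ?d = "\<lambda>x. f x - (?g x + ?h x)"
        have d: "?d \<in> rL2 P" by (rule rL2_diff[OF f gh])
        show ?thesis
        proof (rule vanishes_cover[OF d, where I=UNIV and B=B])
          fix b
          show "B b \<in> sets W" by (rule B)

          \<comment> \<open>\<open>f\<close> minus its conditional expectation has conditional
            expectation zero, and where the points of \<open>K\<close> are inside, conditioning
            leaves the coefficient unchanged.\<close>
          have key: "C.vanishes (\<lambda>x. f x - real_cond_exp P (JJ s u) f x) K A"
            if su: "s < u" and A: "A \<in> sets W" "A \<subseteq> \<Omega>1" and inn: "\<And>\<omega> k. \<omega> \<in> A \<Longrightarrow> k \<in> K \<Longrightarrow> pt k \<omega> \<in> einterval s u" for s u A
          proof -
            let ?e = "real_cond_exp P (JJ s u) f" and ?r = "\<lambda>x. f x - real_cond_exp P (JJ s u) f x"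
            interpret S: sigma_finite_subalgebra P "JJ s u"
              by (rule subalgebra_sigma_finite[OF prob_space_P subalgebra_JJ[OF su]])
            have e: "?e \<in> rL2 P" "?e \<in> borel_measurable (JJ s u)" by (rule cond_exp_JJ[OF su f])+
            have fi: "integrable P f" "integrable P ?e" using C.P.rL2_integrable f e by blast+
            have r: "?r \<in> rL2 P" by (rule rL2_diff[OF f e(1)])
            have "AE x in P. real_cond_exp P (JJ s u) ?r x = 0"
              using S.real_cond_exp_diff[OF fi] S.real_cond_exp_F_meas[OF fi(2) e(2)] by eventually_elim simp
            then have ae: "AE x in P. (0::real) = real_cond_exp P (JJ s u) ?r x" by (rule eventually_mono) simp
            have "C.vanishes (\<lambda>x. 0) K A" unfolding C.vanishes_def by simp
            from vanishes_cong_AE[OF _ _ ae this] have "C.vanishes (real_cond_exp P (JJ s u) ?r) K A" by simp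
            then show ?thesis using cond_exp_vanishes_inside_iff[OF su A inn K r] by blast
          qed
          show "C.vanishes ?d K (B b)"
          proof (cases b)
            case True
            have 1: "C.vanishes (\<lambda>x. f x - ?g x) K (B b)"
              by (rule key[OF past_lt B sub]) (simp add: B_def True Kk past_interval)
            have 2: "C.vanishes ?h K (B b)"
              by (rule vanishes_outside[OF future_lt B sub _ K _ h, where k=k]) (auto simp: B_def True Kk future_interval)
            show ?thesis using C.vanishes_add(2)[OF rL2_diff[OF f g(1)] h(1) 1 2] by (simp add: diff_diff_eq)
          next
            case False
            have 1: "C.vanishes (\<lambda>x. f x - ?h x) K (B b)"
              by (rule key[OF future_lt B sub]) (simp add: B_def False Kk future_interval)
            have 2: "C.vanishes ?g K (B b)"
              by (rule vanishes_outside[OF past_lt B sub _ K _ g, where k=k]) (auto simp: B_def False Kk past_interval)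
            show ?thesis using C.vanishes_add(2)[OF rL2_diff[OF f h(1)] g(1) 1 2] by (simp add: diff_diff_eq add.commute)
          qed
        next
          \<comment> \<open>\<open>pt k\<close> lies before or after \<open>t\<close>; equality is
            excluded by \<open>pt_avoids\<close>.\<close>
          show "AE \<omega> in W. \<exists>b\<in>UNIV. \<omega> \<in> B b"
            using pt_avoids[of t] AE_\<Omega>1 AE_space
          proof eventually_elim
            fix \<omega> assume \<omega>: "\<forall>k. pt k \<omega> \<noteq> t" "\<omega> \<in> \<Omega>1" "\<omega> \<in> space W"
            then have "pt k \<omega> < t \<or> t < pt k \<omega>" by (meson linorder_neqE)
            then show "\<exists>b\<in>UNIV. \<omega> \<in> B b" using \<omega> by (auto simp: B_def intro: exI[of _ True] exI[of _ False])
          qed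
        qed simp
      qed
    qed
  qed
qed

end

subsection \<open>First chaos\<close>

lemma AE_le_if_integrals_le:
  fixes f g :: "'a \<Rightarrow> real"
  assumes f: "integrable M f" and g: "integrable M g"
    and le: "\<And>B. B \<in> sets M \<Longrightarrow> (\<integral>x. f x * indicator B x \<partial>M) \<le> (\<integral>x. g x * indicator B x \<partial>M)"
  shows "AE x in M. f x \<le> g x"
proof -
  note [measurable] = borel_measurable_integrable[OF f] borel_measurable_integrable[OF g]
  define B where "B = {x \<in> space M. g x < f x}"
  have B: "B \<in> sets M" unfolding B_def by measurable
  have fB: "integrable M (\<lambda>x. f x * indicator B x)" and gB: "integrable M (\<lambda>x. g x * indicator B x)"
    by (rule integrable_real_mult_indicator[OF B f] integrable_real_mult_indicator[OF B g])+
  define h where "h x = f x * indicator B x - g x * indicator B x" for x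
  have h: "integrable M h" unfolding h_def[abs_def] by (rule Bochner_Integration.integrable_diff[OF fB gB])
  have h0: "0 \<le> h x" for x by (simp add: h_def B_def indicator_def)
  have "(\<integral>x. h x \<partial>M) \<le> 0" unfolding h_def Bochner_Integration.integral_diff[OF fB gB] using le[OF B] by simp
  moreover have "0 \<le> (\<integral>x. h x \<partial>M)" by (rule integral_nonneg_AE) (simp add: h0)
  ultimately have "(\<integral>x. h x \<partial>M) = 0" by simp
  then have "AE x in M. h x = 0" by (subst (asm) integral_nonneg_eq_0_iff_AE[OF h]) (simp_all add: h0)
  then show ?thesis using AE_space
  proof eventually_elim
    fix x assume "h x = 0" "x \<in> space M"
    then show "f x \<le> g x" by (cases "g x < f x") (simp_all add: h_def B_def)
  qed
qed

lemma AE_eq_if_integrals_eq: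
  fixes f g :: "'a \<Rightarrow> real"
  assumes f: "integrable M f" and g: "integrable M g"
    and eq: "\<And>B. B \<in> sets M \<Longrightarrow> (\<integral>x. f x * indicator B x \<partial>M) = (\<integral>x. g x * indicator B x \<partial>M)"
  shows "AE x in M. f x = g x"
proof -
  have "AE x in M. f x \<le> g x" by (rule AE_le_if_integrals_le[OF f g]) (simp add: eq)
  moreover have "AE x in M. g x \<le> f x" by (rule AE_le_if_integrals_le[OF g f]) (simp add: eq)
  ultimately show ?thesis by eventually_elim simp
qed

context coin_space
begin

lemma integrable_wal:
  assumes f: "f \<in> rL2 P" and B: "B \<in> sets W"
  shows "integrable P (\<lambda>x. f x * wal K x * indicator B (X x))"
proof -
  note [measurable] = B
  have "(\<lambda>x. f x * (wal K x * indicator B (X x))) \<in> rL2 P"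
    by (rule rL2_bounded_mult[OF f]) (use wal_bounded[of _ K] in \<open>auto simp: indicator_def\<close>)
  from P.rL2_integrable[OF this] show ?thesis by (simp add: mult.assoc)
qed

lemma integral_coef_indicator:
  assumes f: "f \<in> rL2 P" and B: "B \<in> sets W"
  shows "(\<integral>\<omega>. coef f K \<omega> * indicator B \<omega> \<partial>W) = (\<integral>x. f x * wal K x * indicator B (X x) \<partial>P)"
  using integral_coef[OF f W.rL2_indicator[OF B], of K] by simp

lemma coef_split:
  assumes f: "f \<in> rL2 P" and g: "g1 \<in> rL2 P" "g2 \<in> rL2 P" and eq: "AE x in P. f x = g1 x + g2 x"
  shows "AE \<omega> in W. coef f K \<omega> = coef g1 K \<omega> + coef g2 K \<omega>"
proof (rule AE_eq_if_integrals_eq)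
  note i = W.rL2_integrable[OF coef_rL2[OF g(1)], of K] W.rL2_integrable[OF coef_rL2[OF g(2)], of K]
  show "integrable W (coef f K)" by (rule W.rL2_integrable[OF coef_rL2[OF f]])
  show "integrable W (\<lambda>\<omega>. coef g1 K \<omega> + coef g2 K \<omega>)" by (rule Bochner_Integration.integrable_add[OF i])
  fix B assume B: "B \<in> sets W"
  note [measurable] = B rL2_measurable[OF f] rL2_measurable[OF g(1)] rL2_measurable[OF g(2)]
  have "(\<integral>\<omega>. coef f K \<omega> * indicator B \<omega> \<partial>W) = (\<integral>x. g1 x * wal K x * indicator B (X x) + g2 x * wal K x * indicator B (X x) \<partial>P)"
    unfolding integral_coef_indicator[OF f B]
  proof (rule integral_cong_AE)
    show "AE x in P. f x * wal K x * indicator B (X x) = g1 x * wal K x * indicator B (X x) + g2 x * wal K x * indicator B (X x)"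
      using eq by (rule eventually_mono) (simp add: distrib_right)
  qed measurable
  also have "\<dots> = (\<integral>\<omega>. coef g1 K \<omega> * indicator B \<omega> \<partial>W) + (\<integral>\<omega>. coef g2 K \<omega> * indicator B \<omega> \<partial>W)"
    unfolding integral_coef_indicator[OF g(1) B] integral_coef_indicator[OF g(2) B]
    by (rule Bochner_Integration.integral_add[OF integrable_wal[OF g(1) B] integrable_wal[OF g(2) B]])
  also have "\<dots> = (\<integral>\<omega>. coef g1 K \<omega> * indicator B \<omega> + coef g2 K \<omega> * indicator B \<omega> \<partial>W)"
    by (rule Bochner_Integration.integral_add[symmetric]) (rule integrable_real_mult_indicator[OF B] i)+
  finally show "(\<integral>\<omega>. coef f K \<omega> * indicator B \<omega> \<partial>W) = (\<integral>\<omega>. (coef g1 K \<omega> + coef g2 K \<omega>) * indicator B \<omega> \<partial>W)"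
    by (simp add: distrib_right)
qed

end

context triplet
begin

text \<open>Each part has coefficient zero where \<open>pt k\<close> is on the wrong side of
  \<open>t\<close>, or equal to \<open>t\<close>, so the other part has to carry the whole
  coefficient of \<open>f\<close> there.\<close>

lemma coef_splits:
  assumes f: "f \<in> rL2 P" and K: "finite K" "k \<in> K" and g: "splits f t g1 g2"
  shows "AE \<omega> in W. C.coef g1 K \<omega> = C.coef f K \<omega> * indicator {..<t} (pt k \<omega>)"
    and "AE \<omega> in W. C.coef g2 K \<omega> = C.coef f K \<omega> * indicator {t<..} (pt k \<omega>)"
proof -
  have g: "g1 \<in> rL2 P" "g1 \<in> borel_measurable (JJ (-\<infinity>) (ereal t))"
    "g2 \<in> rL2 P" "g2 \<in> borel_measurable (JJ (ereal t) \<infinity>)" "AE x in P. f x = g1 x + g2 x"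
    using g unfolding splits_def by blast+
  define L where "L = {\<omega> \<in> space W. \<omega> \<in> \<Omega>1 \<and> t \<le> pt k \<omega>}"
  define R where "R = {\<omega> \<in> space W. \<omega> \<in> \<Omega>1 \<and> pt k \<omega> \<le> t}"
  note [measurable] = \<Omega>1(2)
  have L: "L \<in> sets W" "L \<subseteq> \<Omega>1" unfolding L_def by measurable auto
  have R: "R \<in> sets W" "R \<subseteq> \<Omega>1" unfolding R_def by measurable auto
  have "C.vanishes g1 K L"
    by (rule vanishes_outside[OF past_lt L _ K g(1,2)]) (auto simp: past_interval L_def)
  then have 1: "AE \<omega> in W. \<omega> \<in> L \<longrightarrow> C.coef g1 K \<omega> = 0" unfolding C.vanishes_iff[OF g(1) L(1)] .
  have "C.vanishes g2 K R"
    by (rule vanishes_outside[OF future_lt R _ K g(3,4)]) (auto simp: future_interval R_def)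
  then have 2: "AE \<omega> in W. \<omega> \<in> R \<longrightarrow> C.coef g2 K \<omega> = 0" unfolding C.vanishes_iff[OF g(3) R(1)] .
  note s = C.coef_split[OF f g(1,3,5), of K]
  show "AE \<omega> in W. C.coef g1 K \<omega> = C.coef f K \<omega> * indicator {..<t} (pt k \<omega>)"
    using 1 2 s AE_\<Omega>1 AE_space
  proof eventually_elim
    fix \<omega> assume "\<omega> \<in> L \<longrightarrow> C.coef g1 K \<omega> = 0" "\<omega> \<in> R \<longrightarrow> C.coef g2 K \<omega> = 0"
      "C.coef f K \<omega> = C.coef g1 K \<omega> + C.coef g2 K \<omega>" "\<omega> \<in> \<Omega>1" "\<omega> \<in> space W"
    then show "C.coef g1 K \<omega> = C.coef f K \<omega> * indicator {..<t} (pt k \<omega>)"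
      by (cases "pt k \<omega> < t") (simp_all add: L_def R_def)
  qed
  show "AE \<omega> in W. C.coef g2 K \<omega> = C.coef f K \<omega> * indicator {t<..} (pt k \<omega>)"
    using 1 2 s AE_\<Omega>1 AE_space
  proof eventually_elim
    fix \<omega> assume "\<omega> \<in> L \<longrightarrow> C.coef g1 K \<omega> = 0" "\<omega> \<in> R \<longrightarrow> C.coef g2 K \<omega> = 0"
      "C.coef f K \<omega> = C.coef g1 K \<omega> + C.coef g2 K \<omega>" "\<omega> \<in> \<Omega>1" "\<omega> \<in> space W"
    then show "C.coef g2 K \<omega> = C.coef f K \<omega> * indicator {t<..} (pt k \<omega>)"
      by (cases "t < pt k \<omega>") (simp_all add: L_def R_def)
  qed
qed

text \<open>\<open>g\<close> is the sum of the \<open>e k\<close> in the weak sense of integrals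
  over events. This determines \<open>g\<close> up to null sets and avoids a pointwise sum.\<close>

definition has_energy :: "(nat \<Rightarrow> path \<Rightarrow> real) \<Rightarrow> (path \<Rightarrow> real) \<Rightarrow> bool" where
  "has_energy e g \<longleftrightarrow> integrable W g \<and>
    (\<forall>B\<in>sets W. ((\<lambda>k. \<integral>\<omega>. e k \<omega> * indicator B \<omega> \<partial>W) has_sum (\<integral>\<omega>. g \<omega> * indicator B \<omega> \<partial>W)) UNIV)"

lemma has_energy_integrable: "has_energy e g \<Longrightarrow> integrable W g"
  by (simp add: has_energy_def)

lemma has_energy_sum:
  "has_energy e g \<Longrightarrow> B \<in> sets W \<Longrightarrow>
    ((\<lambda>k. \<integral>\<omega>. e k \<omega> * indicator B \<omega> \<partial>W) has_sum (\<integral>\<omega>. g \<omega> * indicator B \<omega> \<partial>W)) UNIV"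
  by (simp add: has_energy_def)

lemma has_energy_cong_AE:
  assumes e: "has_energy e g" and [measurable]: "\<And>k. e k \<in> borel_measurable W" "\<And>k. e' k \<in> borel_measurable W"
    and eq: "\<And>k. AE \<omega> in W. e k \<omega> = e' k \<omega>"
  shows "has_energy e' g"
proof -
  have "(\<integral>\<omega>. e k \<omega> * indicator B \<omega> \<partial>W) = (\<integral>\<omega>. e' k \<omega> * indicator B \<omega> \<partial>W)" if [measurable]: "B \<in> sets W" for k B
  proof (rule integral_cong_AE)
    show "AE \<omega> in W. e k \<omega> * indicator B \<omega> = e' k \<omega> * indicator B \<omega>"
      using eq[of k] by (rule eventually_mono) simp
  qed measurable
  then show ?thesis using e unfolding has_energy_def by simp
qed

text \<open>\<open>g\<close> is the conditional variance of \<open>Y\<close> given the path, a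
  second moment minus a squared mean. Both are measurable for \<open>Fld W s t\<close> by
  \<open>NN_projection\<close>, whereas the single summands need not be. Conditional Parseval
  identifies \<open>g\<close> with the sum of the squared coefficients over nonempty
  \<open>K\<close>, of which by \<open>v\<close> only the singletons remain.\<close>

lemma energy_density_exists:
  assumes st: "s < t" and Y: "Y \<in> rL2 P" "Y \<in> borel_measurable (NN s t)"
    and v: "\<forall>K. finite K \<and> K \<noteq> {} \<and> card K \<noteq> 1 \<longrightarrow> (AE \<omega> in W. C.coef Y K \<omega> = 0)"
  shows "\<exists>g\<in>borel_measurable (Fld W s t). has_energy (\<lambda>k \<omega>. (C.coef Y {k} \<omega>)\<^sup>2) g"
proof -
  note [measurable] = Y(2)
  have "(\<lambda>x. (Y x)\<^sup>2) \<in> borel_measurable (NN s t)" by measurable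
  from NN_projection[OF st rL2_square[OF Y(1)] this]
  obtain y2 where y2: "integrable W y2" "y2 \<in> borel_measurable (Fld W s t)"
    "\<And>A. A \<in> sets W \<Longrightarrow> (\<integral>x. (Y x)\<^sup>2 * indicator A (X x) \<partial>P) = (\<integral>\<omega>. y2 \<omega> * indicator A \<omega> \<partial>W)"
    by blast
  from NN_projection[OF st C.P.rL2_integrable[OF Y(1)] Y(2)]
  obtain y1 where y1: "integrable W y1" "y1 \<in> borel_measurable (Fld W s t)"
    "\<And>A. A \<in> sets W \<Longrightarrow> (\<integral>x. Y x * indicator A (X x) \<partial>P) = (\<integral>\<omega>. y1 \<omega> * indicator A \<omega> \<partial>W)"
    by blast
  have c: "AE \<omega> in W. C.coef Y {} \<omega> = y1 \<omega>"
  proof (rule AE_eq_if_integrals_eq)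
    show "integrable W (C.coef Y {})" by (rule W.rL2_integrable[OF C.coef_rL2[OF Y(1)]])
    show "integrable W y1" by (rule y1(1))
    fix B assume B: "B \<in> sets W"
    show "(\<integral>\<omega>. C.coef Y {} \<omega> * indicator B \<omega> \<partial>W) = (\<integral>\<omega>. y1 \<omega> * indicator B \<omega> \<partial>W)"
      unfolding C.integral_coef_indicator[OF Y(1) B] y1(3)[OF B, symmetric] by simp
  qed
  have c0: "integrable W (\<lambda>\<omega>. (C.coef Y {} \<omega>)\<^sup>2)" by (rule rL2_square[OF C.coef_rL2[OF Y(1)]])
  note [measurable] = C.coef_measurable[OF Y(1)] borel_measurable_integrable[OF y1(1)] borel_measurable_integrable[OF y2(1)]
  have y1sq: "integrable W (\<lambda>\<omega>. (y1 \<omega>)\<^sup>2)"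
    by (rule integrable_cong_AE_imp[OF c0]) (use c in \<open>auto elim: eventually_mono\<close>)
  define g where "g \<omega> = y2 \<omega> - (y1 \<omega>)\<^sup>2" for \<omega>
  have "integrable W g" unfolding g_def[abs_def] by (rule Bochner_Integration.integrable_diff[OF y2(1) y1sq])
  moreover have "g \<in> borel_measurable (Fld W s t)"
    unfolding g_def[abs_def] by (intro borel_measurable_diff borel_measurable_power y2(2) y1(2))
  moreover have "((\<lambda>k. \<integral>\<omega>. (C.coef Y {k} \<omega>)\<^sup>2 * indicator B \<omega> \<partial>W) has_sum (\<integral>\<omega>. g \<omega> * indicator B \<omega> \<partial>W)) UNIV"
    if B: "B \<in> sets W" for B
  proof -
    note [measurable] = B
    define \<phi> where "\<phi> K = (\<integral>\<omega>. (C.coef Y K \<omega>)\<^sup>2 * indicator B \<omega> \<partial>W)" for K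
    have "(\<phi> has_sum (\<integral>\<omega>. y2 \<omega> * indicator B \<omega> \<partial>W)) {K. finite K}"
      using C.Parseval_on[OF Y(1) B] unfolding y2(3)[OF B] \<phi>_def[abs_def] .
    from has_sum_Diff[OF this has_sum_finite[of "{{}}"]]
    have 1: "(\<phi> has_sum (\<integral>\<omega>. y2 \<omega> * indicator B \<omega> \<partial>W) - \<phi> {}) ({K. finite K} - {{}})" by simp
    have "\<phi> {} = (\<integral>\<omega>. (y1 \<omega>)\<^sup>2 * indicator B \<omega> \<partial>W)"
      unfolding \<phi>_def by (rule integral_cong_AE) (use c in \<open>auto elim: eventually_mono\<close>)
    moreover have "(\<integral>\<omega>. g \<omega> * indicator B \<omega> \<partial>W) = (\<integral>\<omega>. y2 \<omega> * indicator B \<omega> \<partial>W) - (\<integral>\<omega>. (y1 \<omega>)\<^sup>2 * indicator B \<omega> \<partial>W)"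
      unfolding g_def left_diff_distrib
      by (rule Bochner_Integration.integral_diff) (rule integrable_real_mult_indicator[OF B] y2(1) y1sq)+
    ultimately have 2: "(\<phi> has_sum (\<integral>\<omega>. g \<omega> * indicator B \<omega> \<partial>W)) ({K. finite K} - {{}})" using 1 by simp
    have 3: "\<phi> K = 0" if K: "finite K" "K \<noteq> {}" "card K \<noteq> 1" for K
    proof -
      have v': "AE \<omega> in W. C.coef Y K \<omega> = 0" using v K by blast
      have "\<phi> K = (\<integral>\<omega>. 0 \<partial>W)"
        unfolding \<phi>_def by (rule integral_cong_AE) (use v' in \<open>auto elim: eventually_mono\<close>)
      then show ?thesis by simp
    qed
    have "(\<phi> has_sum (\<integral>\<omega>. g \<omega> * indicator B \<omega> \<partial>W)) (range (\<lambda>k. {k})) \<longleftrightarrow>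
        (\<phi> has_sum (\<integral>\<omega>. g \<omega> * indicator B \<omega> \<partial>W)) ({K. finite K} - {{}})"
    proof (rule has_sum_cong_neutral)
      fix K :: "nat set" assume K: "K \<in> {K. finite K} - {{}} - range (\<lambda>k. {k})"
      then have "card K \<noteq> 1" by (auto simp: card_1_singleton_iff)
      then show "\<phi> K = 0" using K by (intro 3) auto
    qed auto
    with 2 have "(\<phi> has_sum (\<integral>\<omega>. g \<omega> * indicator B \<omega> \<partial>W)) (range (\<lambda>k. {k}))" by simp
    then have "(\<phi> \<circ> (\<lambda>k. {k}) has_sum (\<integral>\<omega>. g \<omega> * indicator B \<omega> \<partial>W)) UNIV"
      by (subst (asm) has_sum_reindex) simp_all
    then show ?thesis unfolding o_def \<phi>_def .
  qed
  ultimately show ?thesis unfolding has_energy_def by blast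
qed

definition real_first_chaos :: "(signed_path \<Rightarrow> real) \<Rightarrow> bool" where
  "real_first_chaos f \<longleftrightarrow> (\<forall>t::real. AE x in P. f x = real_cond_exp P (NN (-\<infinity>) (ereal t)) f x + real_cond_exp P (NN (ereal t) \<infinity>) f x)"

context
  fixes f assumes f: "f \<in> rL2 P" and fc: "real_first_chaos f"
begin

lemma splits_first_chaos:
  "splits f t (real_cond_exp P (NN (-\<infinity>) (ereal t)) f) (real_cond_exp P (NN (ereal t) \<infinity>) f)"
  unfolding splits_def
proof (intro conjI)
  show "real_cond_exp P (NN (-\<infinity>) (ereal t)) f \<in> rL2 P"
    by (rule real_cond_exp_square[OF prob_space_P subalgebra_NN[OF past_lt] f])
  show "real_cond_exp P (NN (ereal t) \<infinity>) f \<in> rL2 P"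
    by (rule real_cond_exp_square[OF prob_space_P subalgebra_NN[OF future_lt] f])
  show "real_cond_exp P (NN (-\<infinity>) (ereal t)) f \<in> borel_measurable (JJ (-\<infinity>) (ereal t))"
    by (rule NN_JJ[OF past_lt borel_measurable_cond_exp])
  show "real_cond_exp P (NN (ereal t) \<infinity>) f \<in> borel_measurable (JJ (ereal t) \<infinity>)"
    by (rule NN_JJ[OF future_lt borel_measurable_cond_exp])
  show "AE x in P. f x = real_cond_exp P (NN (-\<infinity>) (ereal t)) f x + real_cond_exp P (NN (ereal t) \<infinity>) f x"
    using fc unfolding real_first_chaos_def by blast
qed

lemma first_chaos_higher:
  assumes K: "finite K" "K \<noteq> {}" "card K \<noteq> 1"
  shows "AE \<omega> in W. C.coef f K \<omega> = 0"
proof -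
  obtain j k where "j \<in> K" "k \<in> K" "j \<noteq> k" using two_elements[OF K] by blast
  then show ?thesis
    unfolding C.vanishes_space_iff[OF f, symmetric] using vanishes_straddle[OF f K(1)] splits_first_chaos by blast
qed

text \<open>Applied to the past part of \<open>f\<close>, whose coefficients by
  \<open>coef_splits\<close> are those of \<open>f\<close> cut off at \<open>t\<close>.\<close>

lemma past_energy: "\<exists>g\<in>borel_measurable (Fld W (-\<infinity>) (ereal t)). has_energy (\<lambda>k \<omega>. (C.coef f {k} \<omega>)\<^sup>2 * indicator {..<t} (pt k \<omega>)) g"
proof -
  let ?g = "real_cond_exp P (NN (-\<infinity>) (ereal t)) f"
  have g: "?g \<in> rL2 P" using splits_first_chaos[of t] unfolding splits_def by blast
  note [measurable] = C.coef_measurable[OF f] C.coef_measurable[OF g]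
  note co = coef_splits(1)[OF f _ _ splits_first_chaos[of t]]
  have "AE \<omega> in W. C.coef ?g K \<omega> = 0" if K: "finite K" "K \<noteq> {}" "card K \<noteq> 1" for K
  proof -
    obtain k where "k \<in> K" using K(2) by blast
    from co[OF K(1) this] first_chaos_higher[OF K] show ?thesis by eventually_elim simp
  qed
  then have "\<forall>K. finite K \<and> K \<noteq> {} \<and> card K \<noteq> 1 \<longrightarrow> (AE \<omega> in W. C.coef ?g K \<omega> = 0)" by blast
  from energy_density_exists[OF past_lt g borel_measurable_cond_exp this]
  obtain h where h: "h \<in> borel_measurable (Fld W (-\<infinity>) (ereal t))" "has_energy (\<lambda>k \<omega>. (C.coef ?g {k} \<omega>)\<^sup>2) h"
    by blast
  have "has_energy (\<lambda>k \<omega>. (C.coef f {k} \<omega>)\<^sup>2 * indicator {..<t} (pt k \<omega>)) h"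
  proof (rule has_energy_cong_AE[OF h(2)])
    fix k
    show "AE \<omega> in W. (C.coef ?g {k} \<omega>)\<^sup>2 = (C.coef f {k} \<omega>)\<^sup>2 * indicator {..<t} (pt k \<omega>)"
      using co[of "{k}" k, OF finite.intros(2)[OF finite.intros(1)] insertI1]
      by (rule eventually_mono) (simp add: indicator_def)
  qed measurable
  then show ?thesis using h(1) by blast
qed

lemma future_energy: "\<exists>g\<in>borel_measurable (Fld W (ereal t) \<infinity>). has_energy (\<lambda>k \<omega>. (C.coef f {k} \<omega>)\<^sup>2 * indicator {t<..} (pt k \<omega>)) g"
proof -
  let ?g = "real_cond_exp P (NN (ereal t) \<infinity>) f"
  have g: "?g \<in> rL2 P" using splits_first_chaos[of t] unfolding splits_def by blast
  note [measurable] = C.coef_measurable[OF f] C.coef_measurable[OF g]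
  note co = coef_splits(2)[OF f _ _ splits_first_chaos[of t]]
  have "AE \<omega> in W. C.coef ?g K \<omega> = 0" if K: "finite K" "K \<noteq> {}" "card K \<noteq> 1" for K
  proof -
    obtain k where "k \<in> K" using K(2) by blast
    from co[OF K(1) this] first_chaos_higher[OF K] show ?thesis by eventually_elim simp
  qed
  then have "\<forall>K. finite K \<and> K \<noteq> {} \<and> card K \<noteq> 1 \<longrightarrow> (AE \<omega> in W. C.coef ?g K \<omega> = 0)" by blast
  from energy_density_exists[OF future_lt g borel_measurable_cond_exp this]
  obtain h where h: "h \<in> borel_measurable (Fld W (ereal t) \<infinity>)" "has_energy (\<lambda>k \<omega>. (C.coef ?g {k} \<omega>)\<^sup>2) h"
    by blast
  have "has_energy (\<lambda>k \<omega>. (C.coef f {k} \<omega>)\<^sup>2 * indicator {t<..} (pt k \<omega>)) h"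
  proof (rule has_energy_cong_AE[OF h(2)])
    fix k
    show "AE \<omega> in W. (C.coef ?g {k} \<omega>)\<^sup>2 = (C.coef f {k} \<omega>)\<^sup>2 * indicator {t<..} (pt k \<omega>)"
      using co[of "{k}" k, OF finite.intros(2)[OF finite.intros(1)] insertI1]
      by (rule eventually_mono) (simp add: indicator_def)
  qed measurable
  then show ?thesis using h(1) by blast
qed

text \<open>Once the energy \<open>G t\<close> before \<open>t\<close> is a constant
  \<open>F t\<close>, the energy of a point in \<open>[q,q')\<close> is at most
  \<open>F q' - F q\<close>. Rational intervals shrinking to the point bound it by the oscillation
  of \<open>F\<close> there, which is zero because almost surely no point is a discontinuity of
  \<open>F\<close>.\<close>

lemma first_chaos_single: "AE \<omega> in W. C.coef f {k} \<omega> = 0"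
proof -
  define e where "e k \<omega> = (C.coef f {k} \<omega>)\<^sup>2" for k \<omega>
  have e0: "0 \<le> e k \<omega>" for k \<omega> by (simp add: e_def)
  have ei: "integrable W (e k)" for k unfolding e_def[abs_def] by (rule rL2_square[OF C.coef_rL2[OF f]])
  note [measurable] = borel_measurable_integrable[OF ei]
  have "\<forall>t. \<exists>g. g \<in> borel_measurable (Fld W (-\<infinity>) (ereal t)) \<and> has_energy (\<lambda>k \<omega>. e k \<omega> * indicator {..<t} (pt k \<omega>)) g"
    unfolding e_def using past_energy by blast
  from choice[OF this] obtain G where G: "\<And>t. G t \<in> borel_measurable (Fld W (-\<infinity>) (ereal t))"
    "\<And>t. has_energy (\<lambda>k \<omega>. e k \<omega> * indicator {..<t} (pt k \<omega>)) (G t)" by blast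
  note G = has_energy_integrable[OF G(2)] G(1) has_energy_sum[OF G(2)]
  have "\<forall>t. \<exists>g. g \<in> borel_measurable (Fld W (ereal t) \<infinity>) \<and> has_energy (\<lambda>k \<omega>. e k \<omega> * indicator {t<..} (pt k \<omega>)) g"
    unfolding e_def using future_energy by blast
  from choice[OF this] obtain H where H: "\<And>t. H t \<in> borel_measurable (Fld W (ereal t) \<infinity>)"
    "\<And>t. has_energy (\<lambda>k \<omega>. e k \<omega> * indicator {t<..} (pt k \<omega>)) (H t)" by blast
  note H = has_energy_integrable[OF H(2)] H(1) has_energy_sum[OF H(2)]
  have part: "integrable W (\<lambda>\<omega>. e k \<omega> * indicator T (pt k \<omega>) * indicator B \<omega>)" if "B \<in> sets W" "T \<in> sets borel" for k B T
  proof (rule Bochner_Integration.integrable_bound[OF ei[of k]])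
    note [measurable] = that
    show "(\<lambda>\<omega>. e k \<omega> * indicator T (pt k \<omega>) * indicator B \<omega>) \<in> borel_measurable W" by measurable
    show "AE \<omega> in W. norm (e k \<omega> * indicator T (pt k \<omega>) * indicator B \<omega>) \<le> norm (e k \<omega>)"
      by (intro AE_I2) (simp add: indicator_def)
  qed
  have Gle: "AE \<omega> in W. G s \<omega> \<le> G t \<omega>" if "s \<le> t" for s t
  proof (rule AE_le_if_integrals_le[OF G(1) G(1)])
    fix B assume B: "B \<in> sets W"
    show "(\<integral>\<omega>. G s \<omega> * indicator B \<omega> \<partial>W) \<le> (\<integral>\<omega>. G t \<omega> * indicator B \<omega> \<partial>W)"
      by (rule has_sum_mono[OF G(3)[OF B] G(3)[OF B]], rule integral_mono[OF part[OF B] part[OF B]])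
        (use \<open>s \<le> t\<close> e0 in \<open>auto simp: indicator_def\<close>)
  qed
  have G0: "AE \<omega> in W. 0 \<le> G t \<omega>" for t
  proof (rule AE_le_if_integrals_le[OF _ G(1)])
    fix B assume B: "B \<in> sets W"
    show "(\<integral>\<omega>. 0 * indicator B \<omega> \<partial>W) \<le> (\<integral>\<omega>. G t \<omega> * indicator B \<omega> \<partial>W)"
      using has_sum_nonneg[OF G(3)[OF B]] e0 by simp
  qed simp
  have H0: "AE \<omega> in W. 0 \<le> H t \<omega>" for t
  proof (rule AE_le_if_integrals_le[OF _ H(1)])
    fix B assume B: "B \<in> sets W"
    show "(\<integral>\<omega>. 0 * indicator B \<omega> \<partial>W) \<le> (\<integral>\<omega>. H t \<omega> * indicator B \<omega> \<partial>W)"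
      using has_sum_nonneg[OF H(3)[OF B]] e0 by simp
  qed simp
  \<comment> \<open>The total energy, split at time 0; by \<open>TH\<close> any other time gives the
    same value almost surely.\<close>
  define T where "T \<omega> = G 0 \<omega> + H 0 \<omega>" for \<omega>
  have Ti: "integrable W T" unfolding T_def[abs_def] by (rule Bochner_Integration.integrable_add[OF G(1) H(1)])
  have all: "((\<lambda>k. \<integral>\<omega>. e k \<omega> * indicator B \<omega> \<partial>W) has_sum (\<integral>\<omega>. (G t \<omega> + H t \<omega>) * indicator B \<omega> \<partial>W)) UNIV"
    if B: "B \<in> sets W" for B t
  proof -
    have "(\<integral>\<omega>. e k \<omega> * indicator {..<t} (pt k \<omega>) * indicator B \<omega> \<partial>W) + (\<integral>\<omega>. e k \<omega> * indicator {t<..} (pt k \<omega>) * indicator B \<omega> \<partial>W) =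
        (\<integral>\<omega>. e k \<omega> * indicator B \<omega> \<partial>W)" for k
    proof -
      have "(\<integral>\<omega>. e k \<omega> * indicator {..<t} (pt k \<omega>) * indicator B \<omega> \<partial>W) + (\<integral>\<omega>. e k \<omega> * indicator {t<..} (pt k \<omega>) * indicator B \<omega> \<partial>W) =
          (\<integral>\<omega>. e k \<omega> * indicator {..<t} (pt k \<omega>) * indicator B \<omega> + e k \<omega> * indicator {t<..} (pt k \<omega>) * indicator B \<omega> \<partial>W)"
        by (rule Bochner_Integration.integral_add[symmetric]) (rule part[OF B]; simp)+
      also have "\<dots> = (\<integral>\<omega>. e k \<omega> * indicator B \<omega> \<partial>W)"
      proof (rule integral_cong_AE)
        note [measurable] = B
        show "AE \<omega> in W. e k \<omega> * indicator {..<t} (pt k \<omega>) * indicator B \<omega> + e k \<omega> * indicator {t<..} (pt k \<omega>) * indicator B \<omega> =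
          e k \<omega> * indicator B \<omega>" using pt_avoids[of t]
        proof eventually_elim
          fix \<omega> assume "\<forall>k. pt k \<omega> \<noteq> t"
          then have "pt k \<omega> \<noteq> t" by blast
          then show "e k \<omega> * indicator {..<t} (pt k \<omega>) * indicator B \<omega> + e k \<omega> * indicator {t<..} (pt k \<omega>) * indicator B \<omega> =
            e k \<omega> * indicator B \<omega>" by (simp add: indicator_def)
        qed
        show "(\<lambda>\<omega>. e k \<omega> * indicator {..<t} (pt k \<omega>) * indicator B \<omega> + e k \<omega> * indicator {t<..} (pt k \<omega>) * indicator B \<omega>) \<in> borel_measurable W"
          "(\<lambda>\<omega>. e k \<omega> * indicator B \<omega>) \<in> borel_measurable W" by measurable
      qed
      finally show ?thesis .
    qed
    moreover have "(\<integral>\<omega>. G t \<omega> * indicator B \<omega> \<partial>W) + (\<integral>\<omega>. H t \<omega> * indicator B \<omega> \<partial>W) = (\<integral>\<omega>. (G t \<omega> + H t \<omega>) * indicator B \<omega> \<partial>W)"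
      unfolding distrib_right
      by (rule Bochner_Integration.integral_add[symmetric]) (rule integrable_real_mult_indicator[OF B] G(1) H(1))+
    ultimately show ?thesis using has_sum_add[OF G(3)[OF B, of t] H(3)[OF B, of t]] by simp
  qed
  have TH: "AE \<omega> in W. T \<omega> = G t \<omega> + H t \<omega>" for t
  proof (rule AE_eq_if_integrals_eq[OF Ti Bochner_Integration.integrable_add[OF G(1) H(1)]])
    fix B assume B: "B \<in> sets W"
    show "(\<integral>\<omega>. T \<omega> * indicator B \<omega> \<partial>W) = (\<integral>\<omega>. (G t \<omega> + H t \<omega>) * indicator B \<omega> \<partial>W)"
      unfolding T_def by (rule has_sum_unique[OF all[OF B] all[OF B]])
  qed
  interpret A: additive_functional W0 W G T
  proof (intro additive_functional.intro wiener_axioms additive_functional_axioms.intro)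
    fix s t :: real
    show "(\<lambda>\<omega>. T \<omega> - G t \<omega>) \<in> borel_measurable (Fld W (ereal t) \<infinity>)"
    \<comment> \<open>The difference equals \<open>H t\<close> only almost surely; completeness of
      the field makes up for that.\<close>
    proof (rule Fld_AE_cong[OF H(2)])
      show "(\<lambda>\<omega>. T \<omega> - G t \<omega>) \<in> borel_measurable W" using Ti G(1) by simp
      show "AE \<omega> in W. H t \<omega> = T \<omega> - G t \<omega>" using TH[of t] by eventually_elim simp
    qed
    show "AE \<omega> in W. G t \<omega> \<le> T \<omega>" using TH[of t] H0[of t] by eventually_elim simp
  qed (fact G Ti G0 Gle)+
  define F where "F t = (\<integral>\<omega>. G t \<omega> \<partial>W)" for t
  have F: "AE \<omega> in W. G t \<omega> = F t" for t unfolding F_def by (rule A.A_constant)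
  have "mono F" unfolding F_def mono_def by (intro allI impI integral_mono_AE G(1) Gle)
  \<comment> \<open>The increment of \<open>G\<close> contains the energy of all points in
    \<open>[q,q')\<close>, and one nonnegative summand is at most the sum.\<close>
  have jump: "AE \<omega> in W. e k \<omega> * indicator {q..<q'} (pt k \<omega>) \<le> F q' - F q" if "q \<le> q'" for q q'
  proof -
    have "AE \<omega> in W. e k \<omega> * indicator {q..<q'} (pt k \<omega>) \<le> G q' \<omega> - G q \<omega>"
    proof (rule AE_le_if_integrals_le)
      show "integrable W (\<lambda>\<omega>. e k \<omega> * indicator {q..<q'} (pt k \<omega>))"
        using part[of UNIV "{q..<q'}" k] sets.top[of W] part[of "space W" "{q..<q'}" k]
        by (simp cong: Bochner_Integration.integrable_cong)
      show "integrable W (\<lambda>\<omega>. G q' \<omega> - G q \<omega>)" by (rule Bochner_Integration.integrable_diff[OF G(1) G(1)])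
      fix B assume B: "B \<in> sets W"
      have d: "(\<integral>\<omega>. e k \<omega> * indicator {..<q'} (pt k \<omega>) * indicator B \<omega> \<partial>W) - (\<integral>\<omega>. e k \<omega> * indicator {..<q} (pt k \<omega>) * indicator B \<omega> \<partial>W) =
        (\<integral>\<omega>. e k \<omega> * indicator {q..<q'} (pt k \<omega>) * indicator B \<omega> \<partial>W)" for k
      proof -
        have "(\<integral>\<omega>. e k \<omega> * indicator {..<q'} (pt k \<omega>) * indicator B \<omega> \<partial>W) - (\<integral>\<omega>. e k \<omega> * indicator {..<q} (pt k \<omega>) * indicator B \<omega> \<partial>W) =
          (\<integral>\<omega>. e k \<omega> * indicator {..<q'} (pt k \<omega>) * indicator B \<omega> - e k \<omega> * indicator {..<q} (pt k \<omega>) * indicator B \<omega> \<partial>W)"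
          by (rule Bochner_Integration.integral_diff[symmetric]) (rule part[OF B]; simp)+
        also have "\<dots> = (\<integral>\<omega>. e k \<omega> * indicator {q..<q'} (pt k \<omega>) * indicator B \<omega> \<partial>W)"
          by (rule Bochner_Integration.integral_cong) (use \<open>q \<le> q'\<close> in \<open>auto simp: indicator_def\<close>)
        finally show ?thesis .
      qed
      have "((\<lambda>k. \<integral>\<omega>. e k \<omega> * indicator {q..<q'} (pt k \<omega>) * indicator B \<omega> \<partial>W) has_sum
          ((\<integral>\<omega>. G q' \<omega> * indicator B \<omega> \<partial>W) - (\<integral>\<omega>. G q \<omega> * indicator B \<omega> \<partial>W))) UNIV"
        using has_sum_add[OF G(3)[OF B, of q'] has_sum_uminusI[OF G(3)[OF B, of q]]] by (simp add: d flip: diff_conv_add_uminus)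
      from finite_sum_le_has_sum[OF this, of "{k}"]
      have "(\<integral>\<omega>. e k \<omega> * indicator {q..<q'} (pt k \<omega>) * indicator B \<omega> \<partial>W) \<le>
        (\<integral>\<omega>. G q' \<omega> * indicator B \<omega> \<partial>W) - (\<integral>\<omega>. G q \<omega> * indicator B \<omega> \<partial>W)"
        using e0 by simp
      also have "\<dots> = (\<integral>\<omega>. (G q' \<omega> - G q \<omega>) * indicator B \<omega> \<partial>W)"
        unfolding left_diff_distrib
        by (rule Bochner_Integration.integral_diff[symmetric]) (rule integrable_real_mult_indicator[OF B] G(1))+
      finally show "(\<integral>\<omega>. e k \<omega> * indicator {q..<q'} (pt k \<omega>) * indicator B \<omega> \<partial>W) \<le> (\<integral>\<omega>. (G q' \<omega> - G q \<omega>) * indicator B \<omega> \<partial>W)" .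
    qed
    with F[of q] F[of q'] show ?thesis by eventually_elim simp
  qed
  \<comment> \<open>A monotone function has countably many discontinuities, so
    \<open>pt_avoids\<close> can be applied to all of them at once.\<close>
  define D where "D = {x. \<not> isCont F x}"
  have "countable D" unfolding D_def by (rule mono_ctble_discont[OF \<open>mono F\<close>])
  then have cont: "AE \<omega> in W. \<forall>x\<in>D. \<forall>k. pt k \<omega> \<noteq> x" unfolding AE_ball_countable[OF \<open>countable D\<close>] using pt_avoids by blast
  have "AE \<omega> in W. \<forall>q\<in>\<rat>. \<forall>q'\<in>\<rat>. q \<le> q' \<longrightarrow> e k \<omega> * indicator {q..<q'} (pt k \<omega>) \<le> F q' - F q"
    unfolding AE_ball_countable[OF countable_rat] using jump by (auto intro!: AE_impI)
  with cont show ?thesis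
  proof eventually_elim
    fix \<omega> assume c: "\<forall>x\<in>D. \<forall>k. pt k \<omega> \<noteq> x" and j: "\<forall>q\<in>\<rat>. \<forall>q'\<in>\<rat>. q \<le> q' \<longrightarrow> e k \<omega> * indicator {q..<q'} (pt k \<omega>) \<le> F q' - F q"
    have "isCont F (pt k \<omega>)" using c unfolding D_def by blast
    have "e k \<omega> \<le> 0"
    proof (rule field_le_epsilon)
      fix \<epsilon> :: real assume "\<epsilon> > 0"
      then obtain \<delta> where \<delta>: "\<delta> > 0" "\<And>y. \<bar>y - pt k \<omega>\<bar> < \<delta> \<Longrightarrow> \<bar>F y - F (pt k \<omega>)\<bar> < \<epsilon> / 2"
        using \<open>isCont F (pt k \<omega>)\<close> unfolding continuous_at_eps_delta dist_real_def by (meson half_gt_zero)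
      obtain q where q: "q \<in> \<rat>" "pt k \<omega> - \<delta> < q" "q < pt k \<omega>" using Rats_dense_in_real[of "pt k \<omega> - \<delta>" "pt k \<omega>"] \<delta>(1) by auto
      obtain q' where q': "q' \<in> \<rat>" "pt k \<omega> < q'" "q' < pt k \<omega> + \<delta>" using Rats_dense_in_real[of "pt k \<omega>" "pt k \<omega> + \<delta>"] \<delta>(1) by auto
      have "q \<le> q'" "pt k \<omega> \<in> {q..<q'}" using q q' by auto
      then have "e k \<omega> \<le> F q' - F q" using j[rule_format, OF q(1) q'(1)] by (simp only: indicator_simps mult_1_right)
      also have "\<dots> \<le> 0 + \<epsilon>" using \<delta>(2)[of q] \<delta>(2)[of q'] q q' by linarith
      finally show "e k \<omega> \<le> 0 + \<epsilon>" .
    qed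
    then show "C.coef f {k} \<omega> = 0" by (simp add: e_def)
  qed
qed

theorem first_chaos_vanishes:
  assumes K: "finite K" "K \<noteq> {}"
  shows "C.vanishes f K (space W)"
proof (cases "card K = 1")
  case True
  then obtain k where "K = {k}" by (rule card_1_singletonE)
  then show ?thesis unfolding C.vanishes_space_iff[OF f] by (simp only: first_chaos_single)
next
  case False
  then show ?thesis unfolding C.vanishes_space_iff[OF f] using first_chaos_higher[OF K False] by blast
qed

end

end

section \<open>Increments of the path lie in the first chaos\<close>

context wiener
begin

lemma
  assumes uv: "u \<le> v"
  shows increment_rL2: "(\<lambda>\<omega>. \<omega> v - \<omega> u) \<in> rL2 W" and increment_mean: "(\<integral>\<omega>. \<omega> v - \<omega> u \<partial>W) = 0"
proof -
  have "(\<lambda>\<omega>. \<omega> v - \<omega> u) \<in> rL2 W \<and> (\<integral>\<omega>. \<omega> v - \<omega> u \<partial>W) = 0"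
  proof (cases "u = v")
    case True
    then show ?thesis by (simp add: W.rL2_const)
  next
    case False
    then have pos: "0 < sqrt (v - u)" and D: "distributed W0 lborel (\<lambda>\<omega>. \<omega> v - \<omega> u) (normal_density 0 (sqrt (v - u)))"
      using uv increment_distributed[of u v] by auto
    have "integrable lborel (\<lambda>x. normal_density 0 (sqrt (v - u)) x * x\<^sup>2)"
      using integrable_normal_moment[OF pos, of 0 2] by simp
    then have "integrable W0 (\<lambda>\<omega>. (\<omega> v - \<omega> u)\<^sup>2)"
      by (subst (asm) distributed_integrable[OF D]) auto
    moreover have "(\<integral>\<omega>. \<omega> v - \<omega> u \<partial>W0) = 0" by (rule W0.normal_distributed_expectation[OF pos D])
    ultimately show ?thesis
      unfolding rL2_def W_def
      by (simp add: integrable_completion integral_completion measurable_completion)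
  qed
  then show "(\<lambda>\<omega>. \<omega> v - \<omega> u) \<in> rL2 W" "(\<integral>\<omega>. \<omega> v - \<omega> u \<partial>W) = 0" by blast+
qed

lemma cond_exp_future_past:
  assumes g: "g \<in> borel_measurable (Fld W (ereal t) \<infinity>)" "integrable W g" "(\<integral>\<omega>. g \<omega> \<partial>W) = 0"
  shows "AE \<omega> in W. real_cond_exp W (Fld W (-\<infinity>) (ereal t)) g \<omega> = 0"
proof -
  interpret S: sigma_finite_subalgebra W "Fld W (-\<infinity>) (ereal t)"
    by (rule subalgebra_sigma_finite[OF prob_space_W subalgebra_Fld])
  show ?thesis
  proof (rule S.real_cond_exp_charact)
    fix A assume A: "A \<in> sets (Fld W (-\<infinity>) (ereal t))"
    then have AW: "A \<in> sets W" using subalgebra_Fld unfolding subalgebra_def by blast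
    have "(\<integral>\<omega>. indicator A \<omega> * g \<omega> \<partial>W) = (\<integral>\<omega>. indicator A \<omega> \<partial>W) * (\<integral>\<omega>. g \<omega> \<partial>W)"
      by (rule integral_past_future[OF borel_measurable_indicator[OF A] _ g(1,2)])
        (rule W.rL2_integrable[OF W.rL2_indicator[OF AW]])
    then show "(\<integral>\<omega>\<in>A. g \<omega> \<partial>W) = (\<integral>\<omega>\<in>A. 0 \<partial>W)" by (simp add: set_lebesgue_integral_def g(3))
  qed (use g in auto)
qed

lemma cond_exp_past_future:
  assumes g: "g \<in> borel_measurable (Fld W (-\<infinity>) (ereal t))" "integrable W g" "(\<integral>\<omega>. g \<omega> \<partial>W) = 0"
  shows "AE \<omega> in W. real_cond_exp W (Fld W (ereal t) \<infinity>) g \<omega> = 0"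
proof -
  interpret S: sigma_finite_subalgebra W "Fld W (ereal t) \<infinity>"
    by (rule subalgebra_sigma_finite[OF prob_space_W subalgebra_Fld])
  show ?thesis
  proof (rule S.real_cond_exp_charact)
    fix A assume A: "A \<in> sets (Fld W (ereal t) \<infinity>)"
    then have AW: "A \<in> sets W" using subalgebra_Fld unfolding subalgebra_def by blast
    have "(\<integral>\<omega>. g \<omega> * indicator A \<omega> \<partial>W) = (\<integral>\<omega>. g \<omega> \<partial>W) * (\<integral>\<omega>. indicator A \<omega> \<partial>W)"
      by (rule integral_past_future[OF g(1,2) borel_measurable_indicator[OF A]])
        (rule W.rL2_integrable[OF W.rL2_indicator[OF AW]])
    then show "(\<integral>\<omega>\<in>A. g \<omega> \<partial>W) = (\<integral>\<omega>\<in>A. 0 \<partial>W)"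
      by (simp add: set_lebesgue_integral_def g(3) mult.commute)
  qed (use g in auto)
qed

text \<open>The interval is cut at \<open>t\<close> by \<open>min\<close> and \<open>max\<close>.
  Each piece is known on its own side and, being independent of the other side with mean zero, is
  predicted there by zero; a piece may be empty.\<close>

lemma increment_first_chaos:
  assumes uv: "u \<le> v"
  shows "AE \<omega> in W. \<omega> v - \<omega> u = real_cond_exp W (Fld W (-\<infinity>) (ereal t)) (\<lambda>\<omega>. \<omega> v - \<omega> u) \<omega> +
    real_cond_exp W (Fld W (ereal t) \<infinity>) (\<lambda>\<omega>. \<omega> v - \<omega> u) \<omega>"
proof -
  define a where "a \<omega> = \<omega> (min v t) - \<omega> (min u t)" for \<omega> :: path
  define b where "b \<omega> = \<omega> (max v t) - \<omega> (max u t)" for \<omega> :: path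
  have ab: "\<omega> v - \<omega> u = a \<omega> + b \<omega>" for \<omega>
    using uv unfolding a_def b_def min_def max_def by simp
  have le: "min u t \<le> min v t" "max u t \<le> max v t" using uv by auto
  have a: "a \<in> borel_measurable (Fld W (-\<infinity>) (ereal t))" "integrable W a" "(\<integral>\<omega>. a \<omega> \<partial>W) = 0"
    unfolding a_def[abs_def] using Fld_increment[of "-\<infinity>" "min u t" "min v t" "ereal t"] le
      W.rL2_integrable[OF increment_rL2[OF le(1)]] increment_mean[OF le(1)] by auto
  have b: "b \<in> borel_measurable (Fld W (ereal t) \<infinity>)" "integrable W b" "(\<integral>\<omega>. b \<omega> \<partial>W) = 0"
    unfolding b_def[abs_def] using Fld_increment[of "ereal t" "max u t" "max v t" "\<infinity>"] le
      W.rL2_integrable[OF increment_rL2[OF le(2)]] increment_mean[OF le(2)] by auto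
  interpret S: sigma_finite_subalgebra W "Fld W (-\<infinity>) (ereal t)"
    by (rule subalgebra_sigma_finite[OF prob_space_W subalgebra_Fld])
  interpret T: sigma_finite_subalgebra W "Fld W (ereal t) \<infinity>"
    by (rule subalgebra_sigma_finite[OF prob_space_W subalgebra_Fld])
  show ?thesis unfolding ab
    using S.real_cond_exp_add[OF a(2) b(2)] T.real_cond_exp_add[OF a(2) b(2)] S.real_cond_exp_F_meas[OF a(2,1)]
      T.real_cond_exp_F_meas[OF b(2,1)] cond_exp_future_past[OF b] cond_exp_past_future[OF a]
    by eventually_elim simp
qed

end

context triplet
begin

subsection \<open>Stable part\<close>

abbreviation "NOISE \<equiv> noise_of_triplet W M \<Omega>1 S"

lemma noise_simps: "law_of NOISE = P" "field_of NOISE = NN"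
  by (simp_all add: noise_of_triplet_def)

lemma AE_complex_iff:
  "(AE x in P. f x = complex_cond_exp P F f x + complex_cond_exp P G f x) \<longleftrightarrow>
    (AE x in P. Re (f x) = real_cond_exp P F (\<lambda>x. Re (f x)) x + real_cond_exp P G (\<lambda>x. Re (f x)) x) \<and>
    (AE x in P. Im (f x) = real_cond_exp P F (\<lambda>x. Im (f x)) x + real_cond_exp P G (\<lambda>x. Im (f x)) x)"
  unfolding complex_cond_exp_def complex_eq_iff by (simp add: AE_conj_iff)

lemma first_chaos_iff:
  "f \<in> first_chaos NOISE \<longleftrightarrow> f \<in> L2 P \<and> real_first_chaos (\<lambda>x. Re (f x)) \<and> real_first_chaos (\<lambda>x. Im (f x))"
  unfolding first_chaos_def noise_simps AE_complex_iff real_first_chaos_def by blast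

lemma increment_real_first_chaos:
  assumes uv: "u \<le> v" shows "real_first_chaos (\<lambda>x. X x v - X x u)"
  unfolding real_first_chaos_def
proof
  fix t :: real
  note i = W.rL2_integrable[OF increment_rL2[OF uv]]
  show "AE x in P. X x v - X x u = real_cond_exp P (NN (-\<infinity>) (ereal t)) (\<lambda>x. X x v - X x u) x +
      real_cond_exp P (NN (ereal t) \<infinity>) (\<lambda>x. X x v - X x u) x"
    using NN_cond_exp_X[OF past_lt[of t] i] NN_cond_exp_X[OF future_lt[of t] i] C.AE_X[OF increment_first_chaos[OF uv, of t]]
    by eventually_elim simp
qed

text \<open>Takes care of the imaginary part of a real increment.\<close>

lemma zero_real_first_chaos: "real_first_chaos (\<lambda>x. 0)"
  unfolding real_first_chaos_def
proof
  fix t :: real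
  interpret S1: sigma_finite_subalgebra P "NN (-\<infinity>) (ereal t)"
    by (rule subalgebra_sigma_finite[OF prob_space_P subalgebra_NN[OF past_lt]])
  interpret S2: sigma_finite_subalgebra P "NN (ereal t) \<infinity>"
    by (rule subalgebra_sigma_finite[OF prob_space_P subalgebra_NN[OF future_lt]])
  have "AE x in P. real_cond_exp P (NN (-\<infinity>) (ereal t)) (\<lambda>x. 0) x = 0" by (rule S1.real_cond_exp_F_meas) simp_all
  moreover have "AE x in P. real_cond_exp P (NN (ereal t) \<infinity>) (\<lambda>x. 0) x = 0" by (rule S2.real_cond_exp_F_meas) simp_all
  ultimately show "AE x in P. 0 = real_cond_exp P (NN (-\<infinity>) (ereal t)) (\<lambda>x. 0) x + real_cond_exp P (NN (ereal t) \<infinity>) (\<lambda>x. 0) x"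
    by eventually_elim simp
qed

lemma increment_in_first_chaos:
  assumes uv: "u \<le> v" shows "(\<lambda>x. complex_of_real (X x v - X x u)) \<in> first_chaos NOISE"
  unfolding first_chaos_iff L2_iff
  using C.rL2_X[OF increment_rL2[OF uv]] C.P.rL2_const[of 0] increment_real_first_chaos[OF uv] zero_real_first_chaos by simp

lemma vanishes_SW:
  assumes f: "f \<in> rL2 P" and v: "\<And>K. finite K \<Longrightarrow> K \<noteq> {} \<Longrightarrow> C.vanishes f K (space W)"
  shows "f \<in> borel_measurable SW"
proof -
  have ae: "AE x in P. C.coef f {} (X x) = f x" using C.eq_coef_empty[OF f v] by (rule eventually_mono) simp_all
  have "(\<lambda>x. C.coef f {} (X x)) \<in> borel_measurable SW" by (rule measurable_compose[OF X_SW C.coef_measurable[OF f]])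
  then show ?thesis
    unfolding SW_eq by (rule completed_sigma_measurable_AE_cong[OF wgens_P _ rL2_measurable[OF f] ae])
qed

lemma SW_vanishes:
  assumes f: "f \<in> rL2 P" "f \<in> borel_measurable SW" and K: "finite K" "K \<noteq> {}"
  shows "C.vanishes f K (space W)"
proof -
  obtain k where k: "k \<in> K" using K(2) by blast
  \<comment> \<open>\<open>orthogonal_on\<close> works with generators and an event: the field
    serves as its own generator, and the event is the whole space because \<open>SW\<close> sees no
    coin anywhere.\<close>
  have s: "sets SW = sigma_sets (space P) (sets SW)" using sets.sigma_sets_eq[of SW] by (simp add: space_SW)
  show ?thesis
  proof (rule C.orthogonal_on[OF subalgebra_SW s sets.top K(1) k _ f])
    fix C assume "C \<in> sets SW"
    then have "C \<in> sets (completed_sigma P wgens)" unfolding SW_eq .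
    then show "\<exists>D\<in>sets (C.others k). AE x in P. X x \<in> space W \<longrightarrow> (x \<in> C \<longleftrightarrow> x \<in> D)"
    proof (rule completed_sigma_AE_class[OF prob_space_P wgens_P C.space_others])
      fix G assume "G \<in> wgens"
      then obtain B where "G = X -` B \<inter> space P" "B \<in> sets W" unfolding wgens_def by blast
      then have "G \<in> sets (C.others k)" using X_event_others by simp
      then show "\<exists>D\<in>sets (C.others k). AE x in P. X x \<in> space W \<longrightarrow> (x \<in> G \<longleftrightarrow> x \<in> D)"
        by (intro bexI[of _ G]) auto
    qed
  qed
qed

abbreviation "ST \<equiv> sigma_stb NOISE"

definition chaos_events :: "signed_path set set" where
  "chaos_events = (\<Union>f\<in>first_chaos NOISE. events_of P f)"

lemma ST_eq: "ST = completed_sigma P chaos_events"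
  unfolding sigma_stb_def noise_simps chaos_events_def ..

lemma chaos_events_cases:
  assumes "A \<in> chaos_events"
  obtains f B where "f \<in> first_chaos NOISE" "A = f -` B \<inter> space P" "B \<in> sets borel"
proof -
  obtain f where f: "f \<in> first_chaos NOISE" "A \<in> events_of P f"
    using assms unfolding chaos_events_def by (rule UN_E)
  then have "\<exists>B. A = f -` B \<inter> space P \<and> B \<in> sets borel" unfolding events_of_def by (simp only: mem_Collect_eq)
  then show thesis using that[OF f(1)] by (elim exE conjE)
qed

lemma chaos_eventsI: "f \<in> first_chaos NOISE \<Longrightarrow> B \<in> sets borel \<Longrightarrow> f -` B \<inter> space P \<in> chaos_events"
  unfolding chaos_events_def events_of_def by (rule UN_I[of f]) auto

lemma first_chaos_measurable: "f \<in> first_chaos NOISE \<Longrightarrow> f \<in> borel_measurable P"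
  unfolding first_chaos_iff by (simp add: L2_def)

lemma chaos_events_P: "chaos_events \<subseteq> sets P"
proof
  fix A assume "A \<in> chaos_events"
  then show "A \<in> sets P" by (rule chaos_events_cases) (simp add: measurable_sets[OF first_chaos_measurable])
qed

lemma first_chaos_SW:
  assumes "f \<in> first_chaos NOISE" shows "f \<in> borel_measurable SW"
proof -
  have f: "(\<lambda>x. Re (f x)) \<in> rL2 P" "(\<lambda>x. Im (f x)) \<in> rL2 P" "real_first_chaos (\<lambda>x. Re (f x))" "real_first_chaos (\<lambda>x. Im (f x))"
    using assms unfolding first_chaos_iff L2_iff by blast+
  have "(\<lambda>x. Re (f x)) \<in> borel_measurable SW" by (rule vanishes_SW[OF f(1) first_chaos_vanishes[OF f(1,3)]])
  moreover have "(\<lambda>x. Im (f x)) \<in> borel_measurable SW" by (rule vanishes_SW[OF f(2) first_chaos_vanishes[OF f(2,4)]])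
  ultimately show ?thesis by (rule borel_measurable_complex_iff[THEN iffD2, OF conjI])
qed

lemma space_ST: "space ST = space P"
  unfolding ST_eq by (rule space_completed_sigma[OF chaos_events_P])

text \<open>Paths vanish at 0, so the value at \<open>t\<close> is up to sign an increment, and
  increments belong to the first chaos.\<close>

lemma X_ST_W0: "X \<in> ST \<rightarrow>\<^sub>M W0"
proof (rule measurable_into_W0)
  fix x assume "x \<in> space ST"
  then show "X x \<in> Omega0" unfolding space_ST by (rule subsetD[OF \<Omega>1(1) X_\<Omega>1])
next
  fix t
  have inc: "(\<lambda>x. X x v - X x u) \<in> borel_measurable ST" if "u \<le> v" for u v
  proof -
    have "(\<lambda>x. complex_of_real (X x v - X x u)) \<in> borel_measurable ST"
    proof (rule measurableI)
      fix B :: "complex set" assume "B \<in> sets borel"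
      then show "(\<lambda>x. complex_of_real (X x v - X x u)) -` B \<inter> space ST \<in> sets ST"
        unfolding space_ST unfolding ST_eq
        by (intro completed_sigma_basic[OF chaos_events_P] chaos_eventsI increment_in_first_chaos that)
    qed simp
    from measurable_compose[OF this borel_measurable_Re] show ?thesis by simp
  qed
  have z: "X x 0 = 0" if "x \<in> space ST" for x
    using subsetD[OF \<Omega>1(1) X_\<Omega>1[of x]] that unfolding space_ST Omega0_def by simp
  show "(\<lambda>x. X x t) \<in> borel_measurable ST"
  proof (cases "0 \<le> t")
    case True
    then show ?thesis using inc[OF True] by (simp add: z cong: measurable_cong)
  next
    case False
    then have "t \<le> 0" by simp
    then have "(\<lambda>x. - (X x 0 - X x t)) \<in> borel_measurable ST" by (intro borel_measurable_uminus inc)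
    then show ?thesis by (simp add: z cong: measurable_cong)
  qed
qed

lemma X_ST: assumes A: "A \<in> sets W" shows "X -` A \<inter> space P \<in> sets ST"
proof -
  obtain E N N' where E: "A = E \<union> N" "N \<subseteq> N'" "N' \<in> null_sets W0" "E \<in> sets W0"
    using A unfolding W_def by (rule sets_completionE)
  have ED: "X -` E \<inter> space P \<in> sets ST" by (rule measurable_sets[OF X_ST_W0 E(4), unfolded space_ST])
  have "AE \<omega> in W. \<omega> \<notin> N'"
    unfolding W_def by (rule AE_not_in[OF null_sets_completionI[OF E(3)]])
  from C.AE_X[OF this] have ae: "AE x in P. x \<in> X -` E \<inter> space P \<longleftrightarrow> x \<in> X -` A \<inter> space P"
    by (rule eventually_mono) (use E(1,2) in auto)
  show ?thesis
    unfolding ST_eq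
    by (rule completed_sigma_AE_cong[OF chaos_events_P ED[unfolded ST_eq] measurable_sets[OF C.X_measurable A] ae])
qed

text \<open>One inclusion holds because elements of the first chaos have no coin terms, the other
  because the increments in the first chaos recover the path; both fields contain the trivial
  events.\<close>

lemma sets_ST: "sets ST = sets SW"
proof (rule antisym)
  show "sets ST \<subseteq> sets SW"
    unfolding ST_eq sets_completed_sigma[OF chaos_events_P] space_SW[symmetric]
  proof (rule sets.sigma_sets_subset, rule Un_least)
    show "chaos_events \<subseteq> sets SW"
    proof
      fix A assume "A \<in> chaos_events"
      then show "A \<in> sets SW"
        by (rule chaos_events_cases) (simp add: space_SW[symmetric] measurable_sets[OF first_chaos_SW])
    qed
    show "{A \<in> sets P. measure P A = 0 \<or> measure P A = 1} \<subseteq> sets SW"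
      unfolding SW_eq sets_completed_sigma[OF wgens_P] by (intro subsetI sigma_sets.Basic UnI2)
  qed
  show "sets SW \<subseteq> sets ST"
    unfolding SW_eq sets_completed_sigma[OF wgens_P] space_ST[symmetric]
  proof (rule sets.sigma_sets_subset, rule Un_least)
    show "wgens \<subseteq> sets ST"
    proof
      fix A assume "A \<in> wgens"
      then obtain B where B: "A = X -` B \<inter> space P" "B \<in> sets W" unfolding wgens_def by blast
      show "A \<in> sets ST" unfolding B(1) by (rule X_ST[OF B(2)])
    qed
    show "{A \<in> sets P. measure P A = 0 \<or> measure P A = 1} \<subseteq> sets ST"
      unfolding ST_eq sets_completed_sigma[OF chaos_events_P] by (intro subsetI sigma_sets.Basic UnI2)
  qed
qed

lemma L2_SW_iff:
  "f \<in> L2 (restr_to_subalg P SW) \<longleftrightarrow> f \<in> L2 P \<and>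
    (\<forall>K. finite K \<and> K \<noteq> {} \<longrightarrow> C.vanishes (\<lambda>x. Re (f x)) K (space W) \<and> C.vanishes (\<lambda>x. Im (f x)) K (space W))"
proof
  assume "f \<in> L2 (restr_to_subalg P SW)"
  then have m: "f \<in> borel_measurable (restr_to_subalg P SW)"
    and i: "integrable (restr_to_subalg P SW) (\<lambda>x. (cmod (f x))\<^sup>2)"
    unfolding L2_def by blast+
  have fS: "f \<in> borel_measurable SW" using m measurable_in_subalg'[OF subalgebra_SW] by blast
  have f: "f \<in> L2 P"
    unfolding L2_def using measurable_from_subalg[OF subalgebra_SW fS] integrable_from_subalg[OF subalgebra_SW i] by blast
  have r: "(\<lambda>x. Re (f x)) \<in> rL2 P" "(\<lambda>x. Im (f x)) \<in> rL2 P" using f unfolding L2_iff by blast+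
  show "f \<in> L2 P \<and>
    (\<forall>K. finite K \<and> K \<noteq> {} \<longrightarrow> C.vanishes (\<lambda>x. Re (f x)) K (space W) \<and> C.vanishes (\<lambda>x. Im (f x)) K (space W))"
  proof (intro conjI allI impI f)
    fix K :: "nat set" assume "finite K \<and> K \<noteq> {}"
    then have K: "finite K" "K \<noteq> {}" by blast+
    show "C.vanishes (\<lambda>x. Re (f x)) K (space W)" "C.vanishes (\<lambda>x. Im (f x)) K (space W)"
      by (rule SW_vanishes[OF r(1) measurable_compose[OF fS borel_measurable_Re] K]
          SW_vanishes[OF r(2) measurable_compose[OF fS borel_measurable_Im] K])+
  qed
next
  assume v: "f \<in> L2 P \<and>
    (\<forall>K. finite K \<and> K \<noteq> {} \<longrightarrow> C.vanishes (\<lambda>x. Re (f x)) K (space W) \<and> C.vanishes (\<lambda>x. Im (f x)) K (space W))"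
  then have r: "(\<lambda>x. Re (f x)) \<in> rL2 P" "(\<lambda>x. Im (f x)) \<in> rL2 P" unfolding L2_iff by blast+
  have "(\<lambda>x. Re (f x)) \<in> borel_measurable SW" by (rule vanishes_SW[OF r(1)]) (use v in blast)
  moreover have "(\<lambda>x. Im (f x)) \<in> borel_measurable SW" by (rule vanishes_SW[OF r(2)]) (use v in blast)
  ultimately have fS: "f \<in> borel_measurable SW" by (rule borel_measurable_complex_iff[THEN iffD2, OF conjI])
  have i: "integrable P (\<lambda>x. (cmod (f x))\<^sup>2)" using v unfolding L2_def by blast
  have "(\<lambda>x. (cmod (f x))\<^sup>2) \<in> borel_measurable SW" using fS by measurable
  from integrable_in_subalg[OF subalgebra_SW this i] measurable_in_subalg[OF subalgebra_SW fS]
  show "f \<in> L2 (restr_to_subalg P SW)" unfolding L2_def by blast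
qed

lemma H_stb_eq: "H_stb NOISE = L2 (restr_to_subalg P SW)"
  unfolding H_stb_def noise_simps restr_to_subalg_def sets_ST ..

lemma join_ST: "join_sigma (NN s t) ST = JJ s t"
  unfolding JJ_def join_sigma_def sets_ST ..

lemma first_superchaos_iff:
  "f \<in> first_superchaos NOISE \<longleftrightarrow> f \<in> L2 P \<and>
    (\<forall>K. finite K \<and> card K \<noteq> 1 \<longrightarrow> C.vanishes (\<lambda>x. Re (f x)) K (space W) \<and> C.vanishes (\<lambda>x. Im (f x)) K (space W))"
proof -
  have "f \<in> first_superchaos NOISE \<longleftrightarrow> f \<in> L2 P \<and> real_superchaos (\<lambda>x. Re (f x)) \<and> real_superchaos (\<lambda>x. Im (f x))"
    unfolding first_superchaos_def noise_simps join_ST AE_complex_iff real_superchaos_def by blast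
  then show ?thesis unfolding L2_iff using real_superchaos_iff by blast
qed

text \<open>\<open>coefficient\<close> is a choice among expansions. By
  \<open>expansion_zero_iff\<close> all of them have the same vanishing coefficients, so the choice
  does not matter here.\<close>

lemma coefficient_zero_iff:
  assumes f: "f \<in> L2 P" and K: "finite K"
  shows "(AE \<omega> in W. coefficient W M \<Omega>1 S f K \<omega> = 0) \<longleftrightarrow>
    C.vanishes (\<lambda>x. Re (f x)) K (space W) \<and> C.vanishes (\<lambda>x. Im (f x)) K (space W)"
proof -
  have e: "orthogonal_expansion W M \<Omega>1 S f = C.expansion f"
    unfolding fun_eq_iff orthogonal_expansion_def C.expansion_def X_def p_def by blast
  have "C.expansion f (coefficient W M \<Omega>1 S f)"
    unfolding coefficient_def e by (rule someI_ex[OF C.expansion_exists[OF f]])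
  then show ?thesis by (rule C.expansion_zero_iff[OF f _ K])
qed

theorem stable_part_and_first_superchaos:
  "H_stb NOISE = {f \<in> L2 P. \<forall>K. finite K \<and> K \<noteq> {} \<longrightarrow> (AE \<omega> in W. coefficient W M \<Omega>1 S f K \<omega> = 0)} \<and>
   {f \<in> L2 P. \<forall>K. finite K \<and> K \<noteq> {} \<longrightarrow> (AE \<omega> in W. coefficient W M \<Omega>1 S f K \<omega> = 0)} = L2 (restr_to_subalg P SW) \<and>
   first_superchaos NOISE = {f \<in> L2 P. \<forall>K. finite K \<and> card K \<noteq> 1 \<longrightarrow> (AE \<omega> in W. coefficient W M \<Omega>1 S f K \<omega> = 0)}"
proof -
  have 1: "{f \<in> L2 P. \<forall>K. finite K \<and> K \<noteq> {} \<longrightarrow> (AE \<omega> in W. coefficient W M \<Omega>1 S f K \<omega> = 0)} = L2 (restr_to_subalg P SW)"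
    by (rule set_eqI) (use coefficient_zero_iff in \<open>auto simp only: L2_SW_iff mem_Collect_eq\<close>)
  have 2: "first_superchaos NOISE = {f \<in> L2 P. \<forall>K. finite K \<and> card K \<noteq> 1 \<longrightarrow> (AE \<omega> in W. coefficient W M \<Omega>1 S f K \<omega> = 0)}"
    by (rule set_eqI) (use coefficient_zero_iff in \<open>auto simp only: first_superchaos_iff mem_Collect_eq\<close>)
  show ?thesis unfolding 1 H_stb_eq 2 by blast
qed

end

theorem proposition7p9:
  fixes W :: "path measure"
    and M :: "path \<Rightarrow> real set"
    and \<Omega>1 :: "path set"
    and S :: "nat \<Rightarrow> path \<Rightarrow> real option"
  assumes "wiener_measure W"
    and "admissible_triplet W M \<Omega>1 S"
  shows "H_stb (noise_of_triplet W M \<Omega>1 S) =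
           {f \<in> L2 (PPM W M \<Omega>1 S).
              \<forall>K. finite K \<and> K \<noteq> {} \<longrightarrow> (AE \<omega> in W. coefficient W M \<Omega>1 S f K \<omega> = 0)} \<and>
         {f \<in> L2 (PPM W M \<Omega>1 S).
              \<forall>K. finite K \<and> K \<noteq> {} \<longrightarrow> (AE \<omega> in W. coefficient W M \<Omega>1 S f K \<omega> = 0)} =
           L2 (restr_to_subalg (PPM W M \<Omega>1 S) (sigma_W W M \<Omega>1 S)) \<and>
         first_superchaos (noise_of_triplet W M \<Omega>1 S) =
           {f \<in> L2 (PPM W M \<Omega>1 S).
              \<forall>K. finite K \<and> card K \<noteq> 1 \<longrightarrow> (AE \<omega> in W. coefficient W M \<Omega>1 S f K \<omega> = 0)}"
proof -
  obtain W0 where "raw_wiener_measure W0" "W = completion W0"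
    using assms(1) unfolding wiener_measure_def by (elim exE conjE) (rule that)
  then interpret triplet W0 W M \<Omega>1 S
    by (intro triplet.intro wiener.intro triplet_axioms.intro assms(2))
  show ?thesis by (rule stable_part_and_first_superchaos)
qed

end
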